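(* Let $\bar t>0$, $I=(0,\bar t)$, let $\gamma_1,\gamma_2\in\mathrm{Lip}(I)$ with $\gamma_1<0<\gamma_2$ on $I$, $\gamma_1(0)=\gamma_1(\bar t)=\gamma_2(0)=\gamma_2(\bar t)=0$, $\gamma_1$ convex, $\gamma_2$ concave, and $D=\{(y,t)\in\mathbb W:t\in I,\ \gamma_1(t)<y<\gamma_2(t)\}$. Let $\phi\in C(\partial D)$ with $\phi_1,\phi_2\in\mathrm{Lip}(I)$ satisfy $\zeta<(\sqrt{721}-25)/48$, and let $u\in\mathrm{Lip}(D)$ be the function with $u=\phi$ on $\partial D$ and $S_u=R_\phi$. Let $v\in C(\bar D)$ be such that $v=\phi$ on $\partial D$ and $\mathcal Bv\in L^\infty_{loc}(D)$, and assume that for every $y\in Y_D$ the function $D_y\ni t\mapsto\beta^v_y(t):=t+4yv(y,t)$ is increasing. Then $\mathcal A_H(u)\le\mathcal A_H(v)$, with equality if and only if $u=v$.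
   Context: $\mathbb H$ is $\mathbb R^3$ with product $(x,y,t)\cdot(\xi,\eta,\tau)=(x+\xi,y+\eta,t+\tau+2(y\xi-x\eta))$; $X=\partial_x+2y\partial_t$, $Y=\partial_y-2x\partial_t$, $H_p=\mathrm{span}\{X(p),Y(p)\}$. $\mathbb W=\{x=0\}$ with coordinates $(y,t)$; $S_u=\{(u(y,t),y,t+2yu(y,t)):(y,t)\in D\}$. $\mathcal Bu=\partial_yu-2\partial_t(u^2)$ (distributionally) and $\mathcal A_H(u)=\int_D\sqrt{1+(\mathcal Bu)^2}\,dy\,dt$. For $y\in\mathbb R$, $D_y=\{t\in I:(y,t)\in D\}$ and $Y_D=\{y\in\mathbb R: D_y\neq\emptyset\}$. Set $\phi_i(s)=\phi(\gamma_i(s),s)$, $\|\gamma\|_\infty=\max_i\|\gamma_i\|_\infty$, $\mathrm{Lip}(\gamma)=\max_i\mathrm{Lip}(\gamma_i)$, $\|\phi\|_\infty=\max_i\|\phi_i\|_\infty$, $\mathrm{Lip}(\phi)=\max_i\mathrm{Lip}(\phi_i)$, $\zeta=4(\|\gamma\|_\infty+\mathrm{Lip}(\gamma))(\|\phi\|_\infty+\mathrm{Lip}(\phi))$, $p_i(s)=(\phi_i(s),\gamma_i(s),s+2\gamma_i(s)\phi_i(s))$; $\lambda(s)$ is the unique point of $\bar I$ with $p_2(\lambda(s))-p_1(s)\in H_{p_1(s)}$; $\rho(h,s)=(1-h)p_1(s)+h\,p_2(\lambda(s))$ on $Q=(0,1)\times I$; $R_\phi=\rho(Q)$. Under the stated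 smallness of $\zeta$, a Lipschitz $u$ with $u=\phi$ on $\partial D$ and $S_u=R_\phi$ exists (and is unique, since $S_u$ determines $u$). *)

theory Defs
  imports "HOL-Analysis.Analysis"
begin

text \<open>Points of W are pairs (y,t); points of the Heisenberg group H are triples (x,y,t).\<close>

definition dY :: "(real \<times> real \<Rightarrow> real) \<Rightarrow> real \<times> real \<Rightarrow> real" where
  "dY f p = frechet_derivative f (at p) (1, 0)"

definition dT :: "(real \<times> real \<Rightarrow> real) \<Rightarrow> real \<times> real \<Rightarrow> real" where
  "dT f p = frechet_derivative f (at p) (0, 1)"

text \<open>C-infinity functions on the plane: all partial derivatives of all orders exist
  (greatest fixed point), hence are differentiable and in particular continuous.\<close>
coinductive smooth2 :: "(real \<times> real \<Rightarrow> real) \<Rightarrow> bool" where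
  "(\<forall>p. f differentiable (at p)) \<Longrightarrow> smooth2 (dY f) \<Longrightarrow> smooth2 (dT f) \<Longrightarrow> smooth2 f"

definition test_fun :: "(real \<times> real) set \<Rightarrow> (real \<times> real \<Rightarrow> real) \<Rightarrow> bool" where
  "test_fun D \<psi> \<longleftrightarrow> smooth2 \<psi> \<and> compact (closure {p. \<psi> p \<noteq> 0}) \<and> closure {p. \<psi> p \<noteq> 0} \<subseteq> D"

text \<open>w is a (locally integrable) representative of the distribution
  B v = \<partial>_y v - 2 \<partial>_t (v^2) on the open set D.\<close>
definition B_rep :: "(real \<times> real) set \<Rightarrow> (real \<times> real \<Rightarrow> real) \<Rightarrow> (real \<times> real \<Rightarrow> real) \<Rightarrow> bool" where
  "B_rep D v w \<longleftrightarrow> w \<in> borel_measurable lborel \<and>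
     (\<forall>K. compact K \<and> K \<subseteq> D \<longrightarrow> set_integrable lborel K w) \<and>
     (\<forall>\<psi>. test_fun D \<psi> \<longrightarrow>
        (\<integral>p. w p * \<psi> p \<partial>lborel) =
        (\<integral>p. - v p * dY \<psi> p + 2 * (v p)\<^sup>2 * dT \<psi> p \<partial>lborel))"

definition B_Linfty_loc :: "(real \<times> real) set \<Rightarrow> (real \<times> real \<Rightarrow> real) \<Rightarrow> bool" where
  "B_Linfty_loc D v \<longleftrightarrow> (\<exists>w. B_rep D v w \<and>
     (\<forall>K. compact K \<and> K \<subseteq> D \<longrightarrow> (\<exists>C. AE p in lborel. p \<in> K \<longrightarrow> \<bar>w p\<bar> \<le> C)))"

definition area_H :: "(real \<times> real) set \<Rightarrow> (real \<times> real \<Rightarrow> real) \<Rightarrow> ennreal" where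
  "area_H D u = (let w = (SOME w. B_rep D u w) in
     (\<integral>\<^sup>+ p. indicator D p * ennreal (sqrt (1 + (w p)\<^sup>2)) \<partial>lborel))"

definition sup_norm :: "real set \<Rightarrow> (real \<Rightarrow> real) \<Rightarrow> real" where
  "sup_norm I f = (SUP s\<in>I. \<bar>f s\<bar>)"

definition lip_const :: "real set \<Rightarrow> (real \<Rightarrow> real) \<Rightarrow> real" where
  "lip_const I f = Inf {L. L-lipschitz_on I f}"

definition hX :: "real \<times> real \<times> real \<Rightarrow> real \<times> real \<times> real" where
  "hX p = (case p of (x, y, t) \<Rightarrow> (1, 0, 2 * y))"

definition hY :: "real \<times> real \<times> real \<Rightarrow> real \<times> real \<times> real" where
  "hY p = (case p of (x, y, t) \<Rightarrow> (0, 1, - 2 * x))"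

definition horiz :: "real \<times> real \<times> real \<Rightarrow> (real \<times> real \<times> real) set" where
  "horiz p = span {hX p, hY p}"

definition pcurve :: "(real \<Rightarrow> real) \<Rightarrow> (real \<times> real \<Rightarrow> real) \<Rightarrow> real \<Rightarrow> real \<times> real \<times> real" where
  "pcurve g \<phi> s = (\<phi> (g s, s), g s, s + 2 * g s * \<phi> (g s, s))"

definition lam :: "real \<Rightarrow> (real \<Rightarrow> real) \<Rightarrow> (real \<Rightarrow> real) \<Rightarrow> (real \<times> real \<Rightarrow> real) \<Rightarrow> real \<Rightarrow> real" where
  "lam tb g1 g2 \<phi> s = (THE r. r \<in> {0..tb} \<and> pcurve g2 \<phi> r - pcurve g1 \<phi> s \<in> horiz (pcurve g1 \<phi> s))"

definition R_phi :: "real \<Rightarrow> (real \<Rightarrow> real) \<Rightarrow> (real \<Rightarrow> real) \<Rightarrow> (real \<times> real \<Rightarrow> real) \<Rightarrow> (real \<times> real \<times> real) set" where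
  "R_phi tb g1 g2 \<phi> = (\<lambda>(h, s). (1 - h) *\<^sub>R pcurve g1 \<phi> s + h *\<^sub>R pcurve g2 \<phi> (lam tb g1 g2 \<phi> s))
      ` ({0<..<1} \<times> {0<..<tb})"

definition graph_S :: "(real \<times> real) set \<Rightarrow> (real \<times> real \<Rightarrow> real) \<Rightarrow> (real \<times> real \<times> real) set" where
  "graph_S D u = (\<lambda>(y, t). (u (y, t), y, t + 2 * y * u (y, t))) ` D"

definition zeta :: "real \<Rightarrow> (real \<Rightarrow> real) \<Rightarrow> (real \<Rightarrow> real) \<Rightarrow> (real \<times> real \<Rightarrow> real) \<Rightarrow> real" where
  "zeta tb g1 g2 \<phi> = (let I = {0<..<tb}; p1 = (\<lambda>s. \<phi> (g1 s, s)); p2 = (\<lambda>s. \<phi> (g2 s, s)) in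
     4 * (max (sup_norm I g1) (sup_norm I g2) + max (lip_const I g1) (lip_const I g2))
       * (max (sup_norm I p1) (sup_norm I p2) + max (lip_const I p1) (lip_const I p2)))"

definition domD :: "real \<Rightarrow> (real \<Rightarrow> real) \<Rightarrow> (real \<Rightarrow> real) \<Rightarrow> (real \<times> real) set" where
  "domD tb g1 g2 = {(y, t). t \<in> {0<..<tb} \<and> g1 t < y \<and> y < g2 t}"

end

theory Submission
  imports Defs "HOL-Computational_Algebra.Polynomial"
begin

text \<open>A calibration argument whose calibrating field depends on the competitor. The surface
  \<open>S\<^sub>u\<close> is ruled by horizontal segments; along the ruling with label \<open>s\<close> the function \<open>u\<close> is affine in \<open>y\<close>
  with slope \<open>m(s) = \<B>u\<close>, and \<open>t + 4yu = \<alpha>(s) + 2m(s)y\<^sup>2\<close>. Since \<open>t \<mapsto> t + 4yv\<close> increases and \<open>v = u\<close> on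
  the boundary, the same equation with \<open>v\<close> in place of \<open>u\<close> defines a label of every point of \<open>D\<close> with respect
  to \<open>v\<close>, and its level curves join the same boundary points. Green's formula along these curves, on which
  the flux of \<open>\<B>v\<close> integrates exactly, gives
  \<open>\<integral>(\<B>v - m(s))\<close> over \<open>{label\<^sub>v < s}\<close> \<open>=\<close> \<open>\<integral>(\<B>u - m(s))\<close> over \<open>{label\<^sub>u < s}\<close> for every \<open>s\<close>.
  Summing over \<open>s\<close> with the weights \<open>d(1/\<surd>(1+m\<^sup>2))\<close> and \<open>d(m/\<surd>(1+m\<^sup>2))\<close> yields
  \<open>\<A>(u) = \<integral>(1 + m(label\<^sub>v) \<B>v)/\<surd>(1 + m(label\<^sub>v)\<^sup>2)\<close>, which is at most \<open>\<A>(v)\<close> by Cauchy-Schwarz. Equality forces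
  \<open>\<B>v = m(label\<^sub>v)\<close>; differentiating the partial Green formulas in \<open>s\<close> then shows that the two
  families of level curves coincide.\<close>

text \<open>Green's formula belongs to the form v dt + 2 v^2 dy. On a curve t + 4 y v = \<alpha> + 2
  m y^2 it equals 4 m y v dy - d(2 y v^2), and 4 y v is the parabola minus the height of the curve;
  subtracting m times the area below the curve leaves only \<alpha>, m and the two ends. The
  obstacle is regularity. The competitor and its level curves are only continuous and Bv is known
  only through integrals over boxes, so nothing can be differentiated along a curve. Monotonicity of
  t + 4 y v supplies two-sided estimates on thin cells instead, and the flux formulas are reached by
  subdivision with errors that are additive over the cells. The second obstacle is that the rulings
  shrink to points at both ends of I. Estimates there hold after multiplication with the length of
  the ruling, and Lipschitz bounds for the slope are confined to compact label intervals. The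
  smallness of \<open>zeta\<close> is used as 1/25: it keeps \<open>lam\<close>, and along each line
  y = const also t and t + 4 y u, close to the identity in the label.\<close>

section \<open>Smooth functions on the line and a smooth step\<close>

definition smooth1 :: "(real \<Rightarrow> real) \<Rightarrow> bool" where
  "smooth1 f \<longleftrightarrow> (\<exists>F. F 0 = f \<and> (\<forall>n x. (F n has_real_derivative F (Suc n) x) (at x)))"

lemma smooth1_deriv:
  assumes "smooth1 f"
  shows "(f has_real_derivative deriv f x) (at x)" "smooth1 (deriv f)"
proof -
  obtain F where F: "F 0 = f" "\<And>n x. (F n has_real_derivative F (Suc n) x) (at x)"
    using assms unfolding smooth1_def by metis
  have d: "deriv f = F 1"
    using F(2)[of 0] F(1) by (auto intro!: ext DERIV_imp_deriv)
  show "(f has_real_derivative deriv f x) (at x)"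
    using F(2)[of 0] F(1) d by auto
  show "smooth1 (deriv f)"
    unfolding smooth1_def d by (rule exI[of _ "\<lambda>n. F (Suc n)"]) (simp add: F)
qed

lemma has_derivative_tensor:
  fixes f g :: "real \<Rightarrow> real"
  assumes "(f has_real_derivative f') (at (fst p))" "(g has_real_derivative g') (at (snd p))"
  shows "((\<lambda>p. f (fst p) * g (snd p)) has_derivative
          (\<lambda>h. f' * fst h * g (snd p) + f (fst p) * (g' * snd h))) (at p)"
proof -
  have 1: "((\<lambda>p. f (fst p)) has_derivative (\<lambda>h. f' * fst h)) (at p)"
    by (rule has_derivative_compose[OF has_derivative_fst[OF has_derivative_ident]
          assms(1)[unfolded has_field_derivative_def], simplified])
  have 2: "((\<lambda>p. g (snd p)) has_derivative (\<lambda>h. g' * snd h)) (at p)"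
    by (rule has_derivative_compose[OF has_derivative_snd[OF has_derivative_ident]
          assms(2)[unfolded has_field_derivative_def], simplified])
  show ?thesis using has_derivative_mult[OF 1 2] by (simp add: algebra_simps)
qed

lemma partial_tensor:
  fixes f g :: "real \<Rightarrow> real"
  assumes "smooth1 f" "smooth1 g"
  shows "dY (\<lambda>p. f (fst p) * g (snd p)) = (\<lambda>p. deriv f (fst p) * g (snd p))"
    and "dT (\<lambda>p. f (fst p) * g (snd p)) = (\<lambda>p. f (fst p) * deriv g (snd p))"
proof -
  have "frechet_derivative (\<lambda>p. f (fst p) * g (snd p)) (at p)
       = (\<lambda>h. deriv f (fst p) * fst h * g (snd p) + f (fst p) * (deriv g (snd p) * snd h))" for p
    by (rule frechet_derivative_at[symmetric, OF has_derivative_tensor])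
       (use smooth1_deriv assms in auto)
  then show "dY (\<lambda>p. f (fst p) * g (snd p)) = (\<lambda>p. deriv f (fst p) * g (snd p))"
    "dT (\<lambda>p. f (fst p) * g (snd p)) = (\<lambda>p. f (fst p) * deriv g (snd p))"
    by (auto simp: dY_def dT_def)
qed

text \<open>Coinduction on the class of all products of two smooth one-variable functions:
  differentiating one factor leaves such a product. These are the test functions used for
  rectangles.\<close>

lemma smooth2_tensor:
  fixes f g :: "real \<Rightarrow> real"
  assumes "smooth1 f" "smooth1 g"
  shows "smooth2 (\<lambda>p. f (fst p) * g (snd p))"
proof -
  let ?X = "\<lambda>h. \<exists>f g. smooth1 f \<and> smooth1 g \<and> h = (\<lambda>p. f (fst p) * g (snd p) :: real)"
  have "?X (\<lambda>p. f (fst p) * g (snd p))" using assms by blast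
  then show ?thesis
  proof (coinduct rule: smooth2.coinduct)
    case (smooth2 h)
    then obtain f g where fg: "smooth1 f" "smooth1 g" and h: "h = (\<lambda>p. f (fst p) * g (snd p))"
      by blast
    have "h differentiable at p" for p
      unfolding h differentiable_def
      using has_derivative_tensor smooth1_deriv(1) fg by blast
    moreover have "?X (dY h)" "?X (dT h)"
      unfolding h partial_tensor[OF fg] using fg smooth1_deriv(2) by blast+
    ultimately show ?case by auto
  qed
qed

lemma smooth1_diff:
  assumes "smooth1 f" "smooth1 g" shows "smooth1 (\<lambda>x. f x - g x)"
proof -
  obtain F G where F: "F 0 = f" "\<And>n x. (F n has_real_derivative F (Suc n) x) (at x)"
    "G 0 = g" "\<And>n x. (G n has_real_derivative G (Suc n) x) (at x)"
    using assms unfolding smooth1_def by metis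
  show ?thesis unfolding smooth1_def
    by (rule exI[of _ "\<lambda>n x. F n x - G n x"]) (auto simp: F intro!: derivative_intros)
qed

lemma smooth1_affine:
  assumes "smooth1 f" shows "smooth1 (\<lambda>x. f (a * x + b))"
proof -
  obtain F where F: "F 0 = f" "\<And>n x. (F n has_real_derivative F (Suc n) x) (at x)"
    using assms unfolding smooth1_def by metis
  have "((\<lambda>x. a ^ n * F n (a * x + b)) has_real_derivative a ^ Suc n * F (Suc n) (a * x + b)) (at x)" for n x
  proof -
    have "((\<lambda>x. F n (a * x + b)) has_real_derivative F (Suc n) (a * x + b) * a) (at x)"
      by (rule DERIV_chain2[OF F(2)]) (auto intro!: derivative_eq_intros)
    from DERIV_cmult[OF this, of "a^n"] show ?thesis by (simp add: mult_ac)
  qed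
  then show ?thesis unfolding smooth1_def
    by (intro exI[of _ "\<lambda>n x. a ^ n * F n (a * x + b)"]) (auto simp: F)
qed

text \<open>The classical bump exp(-1/(x(1-x))) on (0,1), enlarged by a polynomial factor and
  negative powers of x(1-x) to a family that differentiation does not leave.\<close>

definition bump :: "real poly \<Rightarrow> nat \<Rightarrow> real \<Rightarrow> real" where
  "bump p k x = (if 0 < x \<and> x < 1
     then poly p x * (1 / (x * (1 - x))) ^ k * exp (- (1 / (x * (1 - x)))) else 0)"

text \<open>With r = 1/(x(1-x)), the single term r^(k+2)/(k+2)! of the exponential series already
  dominates r^k and leaves two spare factors x(1-x). They force a zero derivative at both ends of
  the interval.\<close>

lemma bump_quadratic_bound: "\<exists>C. \<forall>x. \<bar>bump p k x\<bar> \<le> C * (x * (1 - x))\<^sup>2"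
proof -
  have "bounded (poly p ` {0..1})"
    by (intro compact_imp_bounded compact_continuous_image continuous_intros) auto
  then obtain B where B: "\<And>x. x \<in> {0..1} \<Longrightarrow> \<bar>poly p x\<bar> \<le> B"
    unfolding bounded_iff by (auto simp del: atLeastAtMost_iff)
  have B0: "B \<ge> 0" using B[of 0] by auto
  have "\<bar>bump p k x\<bar> \<le> (B * fact (k + 2)) * (x * (1 - x))\<^sup>2" for x
  proof (cases "0 < x \<and> x < 1")
    case True
    define r where "r = 1 / (x * (1 - x))"
    have q: "x * (1 - x) > 0" using True by simp
    have r: "r > 0" and xr: "x * (1 - x) = 1 / r" using q by (auto simp: r_def)
    have "(\<Sum>n\<in>{k+2}. r ^ n /\<^sub>R fact n) \<le> (\<Sum>n. r ^ n /\<^sub>R fact n)"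
      using r by (intro sum_le_suminf summable_exp_generic) auto
    then have "r ^ (k + 2) / fact (k + 2) \<le> exp r"
      by (simp add: exp_def divide_inverse mult.commute)
    then have "r ^ (k + 2) \<le> fact (k + 2) * exp r"
      unfolding pos_divide_le_eq[OF fact_gt_zero] by (simp only: mult.commute)
    then have z: "r ^ k * exp (- r) \<le> fact (k + 2) * (1 / r)\<^sup>2"
      using r by (simp add: exp_minus field_simps power_add power2_eq_square)
    have "\<bar>poly p x\<bar> * (r ^ k * exp (- r)) \<le> B * (fact (k + 2) * (1 / r)\<^sup>2)"
      by (rule mult_mono[OF B z]) (use True B0 r in auto)
    then show ?thesis using True r
      by (simp add: bump_def abs_mult flip: r_def) (simp add: xr mult_ac)
  next
    case False then show ?thesis using B0 by (auto simp: bump_def)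
  qed
  then show ?thesis by blast
qed

lemma DERIV_zero_quadratic:
  fixes f :: "real \<Rightarrow> real"
  assumes "f x = 0" "\<And>y. \<bar>y - x\<bar> < 1 \<Longrightarrow> \<bar>f y\<bar> \<le> C * (y - x)\<^sup>2"
  shows "(f has_real_derivative 0) (at x)"
proof -
  have "((\<lambda>h. f (x + h) / h) \<longlongrightarrow> 0) (at 0)"
  proof (rule Lim_null_comparison)
    show "\<forall>\<^sub>F h in at 0. norm (f (x + h) / h) \<le> C * \<bar>h\<bar>"
      unfolding eventually_at
    proof (intro exI[of _ 1] conjI ballI impI)
      fix h :: real assume h: "h \<noteq> 0 \<and> dist h 0 < 1"
      then have "\<bar>f (x + h)\<bar> \<le> C * h\<^sup>2" using assms(2)[of "x+h"] by (simp add: dist_real_def)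
      then show "norm (f (x + h) / h) \<le> C * \<bar>h\<bar>" using h
        by (simp add: divide_simps power2_eq_square mult.assoc)
    qed simp
    show "((\<lambda>h. C * \<bar>h\<bar>) \<longlongrightarrow> 0) (at 0)" by (auto intro!: tendsto_eq_intros)
  qed
  then show ?thesis using assms(1) by (simp add: DERIV_def)
qed

lemma bump_DERIV:
  "\<exists>q. \<forall>x. (bump p k has_real_derivative bump q (k + 2) x) (at x)"
proof -
  define e :: "real poly" where "e = [:0, 1, -1:]"
  define d :: "real poly" where "d = [:1, -2:]"
  \<comment> \<open>Here e = x(1-x) and d = e'. The product rule gives terms with r^k, k d r^(k+1)
    and d r^(k+2) for r = 1/e; factoring out r^(k+2) leaves this polynomial.\<close>
  define q where "q = pderiv p * e\<^sup>2 - of_nat k * p * d * e + p * d"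
  have e: "poly e x = x * (1 - x)" and d: "poly d x = 1 - 2 * x" for x
    by (simp_all add: e_def d_def algebra_simps)
  obtain C where C: "\<And>x. \<bar>bump p k x\<bar> \<le> C * (x * (1 - x))\<^sup>2"
    using bump_quadratic_bound by blast
  have C0: "C \<ge> 0" using C[of 2] by (simp add: bump_def)
  have "(bump p k has_real_derivative bump q (k + 2) x) (at x)" for x
  proof -
    consider "0 < x \<and> x < 1" | "x = 0" | "x = 1" | "x < 0" | "x > 1" by linarith
    then show ?thesis
    proof cases
      case 1
      define r where "r = 1 / (x * (1 - x))"
      have q0: "x * (1 - x) \<noteq> 0" using 1 by simp
      have D1: "((\<lambda>x. 1 / (x * (1 - x))) has_real_derivative - (1 - 2 * x) * r\<^sup>2) (at x)"
        using q0 by (auto intro!: derivative_eq_intros simp: r_def divide_simps power2_eq_square)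
      have D2: "((\<lambda>x. (1 / (x * (1 - x))) ^ k) has_real_derivative
             of_nat k * (- (1 - 2 * x) * r\<^sup>2) * r ^ (k - 1)) (at x)"
        using DERIV_power[OF D1, of k] by (simp add: r_def mult_ac)
      have D3: "((\<lambda>x. exp (- (1 / (x * (1 - x))))) has_real_derivative
             exp (- r) * ((1 - 2 * x) * r\<^sup>2)) (at x)"
        by (rule DERIV_cong[OF DERIV_chain2[OF DERIV_exp DERIV_minus[OF D1]]]) (simp only: r_def mult_minus_left minus_minus)
      have D4: "((\<lambda>x. poly p x * (1 / (x * (1 - x))) ^ k * exp (- (1 / (x * (1 - x)))))
         has_real_derivative
           (poly (pderiv p) x * r ^ k + of_nat k * (- (1 - 2 * x) * r\<^sup>2) * r ^ (k - 1) * poly p x)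
             * exp (- r) + exp (- r) * ((1 - 2 * x) * r\<^sup>2) * (poly p x * r ^ k)) (at x)"
        using DERIV_mult[OF DERIV_mult[OF poly_DERIV D2] D3] by (simp add: r_def)
      have re: "poly e x * r = 1" using q0 by (simp add: e r_def)
      have k1: "of_nat k * r\<^sup>2 * r ^ (k - 1) = of_nat k * r ^ (k + 1)"
        by (cases k) (auto simp: power2_eq_square)
      have "bump q (k + 2) x = poly q x * r ^ (k + 2) * exp (- r)"
        using 1 by (simp add: bump_def r_def)
      also have "poly q x * r ^ (k + 2) = poly (pderiv p) x * (poly e x * r)\<^sup>2 * r ^ k
           - of_nat k * poly p x * (1 - 2 * x) * (poly e x * r) * r ^ (k + 1)
           + poly p x * (1 - 2 * x) * r\<^sup>2 * r ^ k"
        by (simp add: q_def d algebra_simps power2_eq_square)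
      also have "\<dots> = poly (pderiv p) x * r ^ k
           - (1 - 2 * x) * poly p x * (of_nat k * r\<^sup>2 * r ^ (k - 1))
           + poly p x * (1 - 2 * x) * r\<^sup>2 * r ^ k"
        unfolding re k1 by simp
      finally have eq: "(poly (pderiv p) x * r ^ k + of_nat k * (- (1 - 2 * x) * r\<^sup>2) * r ^ (k - 1) * poly p x)
             * exp (- r) + exp (- r) * ((1 - 2 * x) * r\<^sup>2) * (poly p x * r ^ k) = bump q (k + 2) x"
        by (simp add: algebra_simps)
      have "\<forall>\<^sub>F y in nhds x. bump p k y = poly p y * (1 / (y * (1 - y))) ^ k * exp (- (1 / (y * (1 - y))))"
        using eventually_nhds_in_open[of "{0<..<1}" x] 1
        by (auto elim!: eventually_mono simp: bump_def)
      then show ?thesis using D4 unfolding eq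
        by (subst DERIV_cong_ev[OF refl _ refl]) auto
    next
      case 2
      have "(bump p k has_real_derivative 0) (at x)"
      proof (rule DERIV_zero_quadratic[where C="C * 4"])
        show "\<bar>bump p k y\<bar> \<le> C * 4 * (y - x)\<^sup>2" if "\<bar>y - x\<bar> < 1" for y
        proof -
          have "(1 - y)\<^sup>2 \<le> 2\<^sup>2" using that 2 abs_le_square_iff[of "1 - y" 2] by auto
          then have "C * (y\<^sup>2 * (1 - y)\<^sup>2) \<le> C * (y\<^sup>2 * 4)"
            using C0 by (intro mult_left_mono) auto
          then show ?thesis using C[of y] 2 by (simp add: power_mult_distrib mult_ac)
        qed
      qed (simp add: 2 bump_def)
      then show ?thesis by (simp add: 2 bump_def)
    next
      case 3
      have "(bump p k has_real_derivative 0) (at x)"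
      proof (rule DERIV_zero_quadratic[where C="C * 4"])
        show "\<bar>bump p k y\<bar> \<le> C * 4 * (y - x)\<^sup>2" if "\<bar>y - x\<bar> < 1" for y
        proof -
          have "y\<^sup>2 \<le> 2\<^sup>2" using that 3 abs_le_square_iff[of y 2] by auto
          then have "C * (y\<^sup>2 * (1 - y)\<^sup>2) \<le> C * (4 * (1 - y)\<^sup>2)"
            using C0 by (intro mult_left_mono mult_right_mono) auto
          then show ?thesis using C[of y] 3
            by (simp add: power_mult_distrib mult_ac power2_commute[of 1])
        qed
      qed (simp add: 3 bump_def)
      then show ?thesis by (simp add: 3 bump_def)
    next
      case 4
      have "\<forall>\<^sub>F y in nhds x. bump p k y = 0"
        using eventually_nhds_in_open[of "{..<0}" x] 4
        by (auto elim!: eventually_mono simp: bump_def)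
      then show ?thesis using 4
        by (subst DERIV_cong_ev[OF refl _ refl]) (auto simp: bump_def)
    next
      case 5
      have "\<forall>\<^sub>F y in nhds x. bump p k y = 0"
        using eventually_nhds_in_open[of "{1<..}" x] 5
        by (auto elim!: eventually_mono simp: bump_def)
      then show ?thesis using 5
        by (subst DERIV_cong_ev[OF refl _ refl]) (auto simp: bump_def)
    qed
  qed
  then show ?thesis by blast
qed

lemma smooth1_bump: "smooth1 (bump p k)"
proof -
  have "\<exists>G. \<forall>p k x. (bump p k has_real_derivative bump (G p k) (k + 2) x) (at x)"
    using bump_DERIV by metis
  then obtain G where G: "\<And>p k x. (bump p k has_real_derivative bump (G p k) (k + 2) x) (at x)"
    by blast
  define P where "P = rec_nat (p, k) (\<lambda>_ (p, k). (G p k, k + 2))"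
  have P: "P 0 = (p, k)" "P (Suc n) = (G (fst (P n)) (snd (P n)), snd (P n) + 2)" for n
    by (simp_all add: P_def split_beta)
  show ?thesis unfolding smooth1_def
    by (rule exI[of _ "\<lambda>n. bump (fst (P n)) (snd (P n))"]) (use G in \<open>auto simp: P\<close>)
qed

definition smooth_step :: "(real \<Rightarrow> real) \<Rightarrow> bool" where
  "smooth_step S \<longleftrightarrow> smooth1 S \<and> (\<forall>x\<le>0. S x = 0) \<and> (\<forall>x\<ge>1. S x = 1)
     \<and> (\<forall>x. 0 \<le> S x \<and> S x \<le> 1) \<and> (\<forall>x. 0 \<le> deriv S x)"

lemma smooth_step_exists: "\<exists>S. smooth_step S"
proof -
  define b where "b = bump 1 0"
  obtain B where B: "B 0 = b" "\<And>n x. (B n has_real_derivative B (Suc n) x) (at x)"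
    using smooth1_bump[of 1 0] unfolding smooth1_def b_def by metis
  have b0: "b x \<ge> 0" for x by (simp add: b_def bump_def)
  have bz: "b x = 0" if "x \<le> 0 \<or> x \<ge> 1" for x using that by (auto simp: b_def bump_def)
  have cont: "continuous_on A b" for A
    using B(2)[of 0] B(1) by (metis DERIV_continuous_on has_field_derivative_at_within)
  have int: "b integrable_on {l..u}" for l u by (rule integrable_continuous_real[OF cont])
  define Z where "Z = integral {-1..1} b"
  \<comment> \<open>Starting at -1 keeps 0 in the interior of the range, so differentiability at 0
    needs no one-sided argument; for x < -1 the interval is empty and the integral is 0.\<close>
  define S where "S x = integral {-1..x} b / Z" for x
  have low: "integral {-1..x} b = 0" if "x \<le> 0" for x
  proof -
    have "integral {-1..x} b = integral {-1..x} (\<lambda>_. 0)"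
      by (rule integral_cong) (use that bz in auto)
    then show ?thesis by simp
  qed
  have high: "integral {-1..x} b = Z" if "x \<ge> 1" for x
  proof -
    have "integral {-1..1} b + integral {1..x} b = integral {-1..x} b"
      by (rule Henstock_Kurzweil_Integration.integral_combine) (use that int in auto)
    moreover have "integral {1..x} b = integral {1..x} (\<lambda>_. 0)"
      by (rule integral_cong) (use bz in auto)
    ultimately show ?thesis by (simp add: Z_def)
  qed
  have mono: "integral {-1..x} b \<le> integral {-1..y} b" if "x \<le> y" for x y
    by (rule integral_subset_le) (use that int b0 in auto)
  have Z0: "Z \<noteq> 0"
  proof
    assume "Z = 0"
    then have "\<forall>x\<in>{-1..1}. b x = 0"
      using integral_eq_0_iff[of "-1" 1 b] cont b0 by (simp add: Z_def)
    moreover have "b (1/2) > 0" by (simp add: b_def bump_def)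
    ultimately show False by force
  qed
  have Z1: "Z > 0" using mono[of 0 1] low[of 0] Z0 by (simp add: Z_def)
  have D: "((\<lambda>x. integral {-1..x} b) has_real_derivative b x) (at x)" for x
  proof (cases "x < 0")
    case True
    have "\<forall>\<^sub>F y in nhds x. integral {-1..y} b = 0"
      using eventually_nhds_in_open[of "{..<0}" x] True by (auto elim!: eventually_mono simp: low)
    then show ?thesis using True bz by (subst DERIV_cong_ev[OF refl _ refl]) auto
  next
    case False
    have "((\<lambda>x. integral {-1..x} b) has_real_derivative b x) (at x within {-1..x+1})"
      by (rule integral_has_real_derivative[OF cont]) (use False in auto)
    then show ?thesis using False by (simp add: at_within_Icc_at)
  qed
  have DS: "(S has_real_derivative b x / Z) (at x)" for x
    unfolding S_def by (rule DERIV_cdivide[OF D])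
  have "smooth1 S" unfolding smooth1_def
  proof (intro exI[of _ "\<lambda>n. case n of 0 \<Rightarrow> S | Suc k \<Rightarrow> (\<lambda>x. B k x / Z)"] conjI allI)
    fix n x
    show "((case n of 0 \<Rightarrow> S | Suc k \<Rightarrow> (\<lambda>x. B k x / Z)) has_real_derivative
        (case Suc n of 0 \<Rightarrow> S | Suc k \<Rightarrow> (\<lambda>x. B k x / Z)) x) (at x)"
      using DS B DERIV_cdivide[OF B(2)] by (cases n) auto
  qed auto
  moreover have "deriv S x = b x / Z" for x using DS by (rule DERIV_imp_deriv)
  moreover have "0 \<le> S x \<and> S x \<le> 1" for x
  proof -
    have "integral {-1..min x 0} b \<le> integral {-1..x} b" "integral {-1..x} b \<le> integral {-1..max x 1} b"
      by (auto intro!: mono)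
    then show ?thesis using Z1 low[of "min x 0"] high[of "max x 1"] by (simp add: S_def)
  qed
  ultimately show ?thesis using Z1 b0 Z0 low high
    by (intro exI[of _ S]) (auto simp: S_def smooth_step_def)
qed

lemma tensor_integral:
  fixes f g :: "real \<Rightarrow> real"
  assumes f: "integrable lborel f" and g: "integrable lborel g"
  shows "integrable lborel (\<lambda>p. f (fst p) * g (snd p))"
    and "(\<integral>p. f (fst p) * g (snd p) \<partial>lborel) = (\<integral>x. f x \<partial>lborel) * (\<integral>x. g x \<partial>lborel)"
proof -
  have [measurable]: "f \<in> borel_measurable borel" "g \<in> borel_measurable borel"
    using f g by auto
  have i: "integrable (lborel \<Otimes>\<^sub>M lborel) (\<lambda>p. f (fst p) * g (snd p))"
  proof (rule lborel_pair.Fubini_integrable)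
    show "(\<lambda>p. f (fst p) * g (snd p)) \<in> borel_measurable (lborel \<Otimes>\<^sub>M lborel)" by measurable
    show "AE x in lborel. integrable lborel (\<lambda>y. f (fst (x, y)) * g (snd (x, y)))" using g by simp
    show "integrable lborel (\<lambda>x. \<integral>y. norm (f (fst (x, y)) * g (snd (x, y))) \<partial>lborel)"
      using f by (simp add: abs_mult)
  qed
  then show "integrable lborel (\<lambda>p. f (fst p) * g (snd p))" by (simp add: lborel_prod)
  show "(\<integral>p. f (fst p) * g (snd p) \<partial>lborel) = (\<integral>x. f x \<partial>lborel) * (\<integral>x. g x \<partial>lborel)"
    using lborel_pair.integral_fst'[OF i] by (simp add: lborel_prod)
qed

lemma lborel_integral_swap:
  fixes f :: "real \<times> real \<Rightarrow> real"
  assumes [measurable]: "f \<in> borel_measurable borel"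
  shows "(\<integral>p. f (snd p, fst p) \<partial>lborel) = (\<integral>p. f p \<partial>lborel)"
  using lborel_pair.integral_product_swap[of f] by (simp add: lborel_prod case_prod_unfold borel_prod)

lemma integrable_bounded_box:
  fixes f :: "real \<times> real \<Rightarrow> real"
  assumes [measurable]: "f \<in> borel_measurable borel" and "bounded A" and "\<And>p. \<bar>f p\<bar> \<le> C"
    and z: "\<And>p. p \<notin> A \<Longrightarrow> f p = 0"
  shows "integrable lborel f"
proof -
  obtain a where a: "A \<subseteq> cbox (- a) a" using bounded_subset_cbox_symmetric[OF assms(2)] by blast
  show ?thesis
  proof (rule Bochner_Integration.integrable_bound)
    show "integrable lborel (\<lambda>p. indicator (cbox (-a) a) p * C)"
      by (simp add: emeasure_lborel_cbox_eq)
    show "AE p in lborel. norm (f p) \<le> norm (indicator (cbox (-a) a) p * C)"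
    proof (rule AE_I2)
      fix p show "norm (f p) \<le> norm (indicator (cbox (-a) a) p * C)"
        using a z[of p] assms(3)[of p] by (auto simp: indicator_def)
    qed
  qed simp
qed

section \<open>Smooth approximation of indicators and of point masses\<close>

context
  fixes S :: "real \<Rightarrow> real"
  assumes step: "smooth_step S"
begin

lemma S: "smooth1 S" "\<And>x. x \<le> 0 \<Longrightarrow> S x = 0" "\<And>x. x \<ge> 1 \<Longrightarrow> S x = 1"
    "\<And>x. 0 \<le> S x" "\<And>x. S x \<le> 1" "\<And>x. 0 \<le> deriv S x"
  using step by (auto simp: smooth_step_def)

text \<open>The derivative of a step of width d: an approximate point mass at c, carried by
  [c, c + d].\<close>

definition ker :: "real \<Rightarrow> real \<Rightarrow> real \<Rightarrow> real" where
  "ker d c y = deriv S ((y - c) / d) / d"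

text \<open>An approximate indicator whose derivative is one approximate point mass minus another;
  testing with it turns a derivative into traces on two sides of a box.\<close>

definition plateau :: "real \<Rightarrow> real \<Rightarrow> real \<Rightarrow> real \<Rightarrow> real" where
  "plateau d a b y = S ((y - a) / d) - S ((y - b) / d)"

lemma S_mono: "x \<le> y \<Longrightarrow> S x \<le> S y"
  by (rule DERIV_nonneg_imp_nondecreasing) (use S(6) smooth1_deriv[OF S(1)] in auto)

lemma S_cont: "continuous_on A S"
  using smooth1_deriv(1)[OF S(1)] by (metis DERIV_continuous_on has_field_derivative_at_within)

lemma dS_cont: "continuous_on A (deriv S)"
  using smooth1_deriv(1)[OF smooth1_deriv(2)[OF S(1)]]
  by (metis DERIV_continuous_on has_field_derivative_at_within)

lemma dS_zero: assumes "x \<le> 0 \<or> x \<ge> 1" shows "deriv S x = 0"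
proof -
  have 1: "deriv S x = 0" if "x < 0 \<or> x > 1" for x
  proof -
    have "\<forall>\<^sub>F y in nhds x. S y = (if x < 0 then 0 else 1)"
      using eventually_nhds_in_open[of "if x < 0 then {..<0} else {1<..}" x] that
      by (auto elim!: eventually_mono simp: S split: if_splits)
    then have "deriv S x = deriv (\<lambda>_. if x < 0 then 0 else 1) x" by (rule deriv_cong_ev) simp
    then show ?thesis by simp
  qed
  have c: "isCont (deriv S) x" using dS_cont[of UNIV] by (simp add: continuous_on_eq_continuous_at)
  consider "x < 0 \<or> x > 1" | "x = 0" | "x = 1" using assms by linarith
  then show ?thesis
  proof cases
    case 2
    have "((\<lambda>x. deriv S x) \<longlongrightarrow> deriv S 0) (at_left 0)"
      using c 2 by (auto simp: isCont_def intro: tendsto_mono at_le)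
    moreover have "((\<lambda>x. deriv S x) \<longlongrightarrow> 0) (at_left 0)"
      by (rule tendsto_eventually) (auto simp: eventually_at_filter 1)
    ultimately show ?thesis using 2 tendsto_unique[of "at_left (0::real)"] by auto
  next
    case 3
    have "((\<lambda>x. deriv S x) \<longlongrightarrow> deriv S 1) (at_right 1)"
      using c 3 by (auto simp: isCont_def intro: tendsto_mono at_le)
    moreover have "((\<lambda>x. deriv S x) \<longlongrightarrow> 0) (at_right 1)"
      by (rule tendsto_eventually) (auto simp: eventually_at_filter 1)
    ultimately show ?thesis using 3 tendsto_unique[of "at_right (1::real)"] by auto
  qed (use 1 in auto)
qed

lemma smooth1_plateau: "smooth1 (plateau d a b)"
proof -
  have "smooth1 (\<lambda>x. S (inverse d * x + (- a / d)) - S (inverse d * x + (- b / d)))"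
    by (intro smooth1_diff smooth1_affine S(1))
  moreover have "(\<lambda>x. S (inverse d * x + (- a / d)) - S (inverse d * x + (- b / d))) = plateau d a b"
    by (auto simp: plateau_def fun_eq_iff divide_inverse algebra_simps)
  ultimately show ?thesis by simp
qed

lemma S_scaled_DERIV: "((\<lambda>z. S ((z - a) / d)) has_real_derivative deriv S ((y - a) / d) / d) (at y)"
proof -
  have "((\<lambda>z. (z - a) / d) has_real_derivative 1 / d) (at y)"
    by (cases "d = 0") (auto intro!: derivative_eq_intros)
  from DERIV_chain2[OF smooth1_deriv(1)[OF S(1)] this] show ?thesis by simp
qed

lemma deriv_plateau: "deriv (plateau d a b) y = ker d a y - ker d b y"
  unfolding plateau_def[abs_def] ker_def
  by (intro DERIV_imp_deriv DERIV_diff S_scaled_DERIV)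

lemma plateau_bounds:
  assumes "a \<le> b" "d > 0"
  shows "0 \<le> plateau d a b y" "plateau d a b y \<le> 1"
  using S_mono[of "(y - b)/d" "(y - a)/d"] S(4)[of "(y - b)/d"] S(5)[of "(y - a)/d"] assms
  by (auto simp: plateau_def divide_right_mono)

lemma plateau_supp:
  assumes "a \<le> b" "d > 0" "y \<notin> {a..b + d}" shows "plateau d a b y = 0"
proof -
  consider "y < a" | "y > b + d" using assms by force
  then show ?thesis
  proof cases
    case 1 then show ?thesis using assms by (simp add: plateau_def S divide_le_0_iff)
  next
    case 2
    then have "(y - a)/d \<ge> 1" "(y - b)/d \<ge> 1" using assms by (auto simp: field_simps)
    then show ?thesis by (simp add: plateau_def S)
  qed
qed

text \<open>The step vanishes at 0 and rises to the right of it, which selects the half-open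
  interval. Half-open boxes later tile without overlap.\<close>

lemma plateau_lim:
  assumes "a \<le> b" "d \<longlonglongrightarrow> 0" "\<And>n. d n > 0"
  shows "(\<lambda>n. plateau (d n) a b y) \<longlonglongrightarrow> indicator {a<..b} y"
proof -
  have one: "(\<lambda>n. S ((y - c) / d n)) \<longlonglongrightarrow> (if y > c then 1 else 0)" for c
  proof (cases "y > c")
    case True
    have "\<forall>\<^sub>F n in sequentially. d n < y - c"
      using assms(2) True by (intro order_tendstoD) auto
    then have "\<forall>\<^sub>F n in sequentially. S ((y - c) / d n) = 1"
    proof eventually_elim
      case (elim n)
      then have "(y - c) / d n \<ge> 1" using assms(3)[of n] by (simp add: field_simps)
      then show ?case by (rule S(3))
    qed
    then show ?thesis using True by (simp add: tendsto_eventually)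
  next
    case False
    then have "S ((y - c) / d n) = 0" for n using assms(3)[of n] by (intro S(2)) (simp add: divide_le_0_iff)
    then show ?thesis using False by simp
  qed
  have "(\<lambda>n. plateau (d n) a b y) \<longlonglongrightarrow> (if y > a then 1 else 0) - (if y > b then 1 else 0)"
    unfolding plateau_def by (intro tendsto_diff one)
  moreover have "(if y > a then 1 else 0) - (if y > b then 1 else 0) = (indicator {a<..b} y :: real)"
    using assms(1) by auto
  ultimately show ?thesis by simp
qed

lemma ker_cont: "d \<noteq> 0 \<Longrightarrow> continuous_on A (ker d c)"
  unfolding ker_def by (intro continuous_intros continuous_on_compose2[OF dS_cont[of UNIV]]) auto

lemma ker_zero: "d > 0 \<Longrightarrow> y \<notin> {c..c + d} \<Longrightarrow> ker d c y = 0"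
  unfolding ker_def by (subst dS_zero) (auto simp: field_simps)

lemma ker_nonneg: "d > 0 \<Longrightarrow> 0 \<le> ker d c y" by (simp add: ker_def S)

lemma ker_integral: assumes "d > 0"
  shows "integrable lborel (ker d c)" "(\<integral>y. ker d c y \<partial>lborel) = 1"
proof -
  have h: "has_bochner_integral lborel (\<lambda>y. ker d c y * indicator {c..c + d} y) (S ((c + d - c) / d) - S ((c - c) / d))"
  proof (rule has_bochner_integral_FTC_Icc_real[where F="\<lambda>y. S ((y - c) / d)"])
    show "((\<lambda>y. S ((y - c) / d)) has_real_derivative ker d c y) (at y)" for y
      unfolding ker_def by (rule S_scaled_DERIV)
    show "isCont (ker d c) y" for y
      using ker_cont[of d UNIV c] assms by (simp add: continuous_on_eq_continuous_at)
  qed (use assms in auto)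
  have e: "(\<lambda>y. ker d c y * indicator {c..c + d} y) = ker d c"
    using ker_zero[OF assms] by (auto simp: fun_eq_iff indicator_def)
  show "integrable lborel (ker d c)" "(\<integral>y. ker d c y \<partial>lborel) = 1"
    using h assms S(2)[of 0] S(3)[of 1] unfolding e by (auto simp: has_bochner_integral_iff)
qed

text \<open>The kernel concentrates in the first coordinate only, so the limit is a trace. Uniform
  continuity on a fixed compact box replaces h by its values on the line through c; the kernel then
  integrates out and a one-dimensional limit remains.\<close>

lemma ker_limit:
  fixes h :: "real \<times> real \<Rightarrow> real" and g :: "nat \<Rightarrow> real \<Rightarrow> real"
  assumes h: "continuous_on UNIV h" and d: "d \<longlonglongrightarrow> 0" "\<And>n. 0 < d n" "\<And>n. d n \<le> 1"
    and g: "\<And>n. continuous_on UNIV (g n)" "\<And>n t. \<bar>g n t\<bar> \<le> 1" "\<And>n t. t \<notin> {a..b} \<Longrightarrow> g n t = 0"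
    and gl: "\<And>t. (\<lambda>n. g n t) \<longlonglongrightarrow> g' t" and ab: "a \<le> b"
  shows "(\<lambda>n. \<integral>p. h p * (ker (d n) c (fst p) * g n (snd p)) \<partial>lborel) \<longlonglongrightarrow> (\<integral>t. h (c, t) * g' t \<partial>lborel)"
    and "integrable lborel (\<lambda>p. h p * (ker (d n) c (fst p) * g n (snd p)))"
proof -
  let ?k = "\<lambda>n. ker (d n) c"
  have hc: "continuous_on UNIV (\<lambda>t. h (c, t))"
    by (intro continuous_on_compose2[OF h] continuous_intros) auto
  have [measurable]: "h \<in> borel_measurable borel" "(\<lambda>t. h (c, t)) \<in> borel_measurable borel"
    "g n \<in> borel_measurable borel" "?k n \<in> borel_measurable borel" for n
    using borel_measurable_continuous_onI[OF h] borel_measurable_continuous_onI[OF hc] borel_measurable_continuous_onI[OF g(1)]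
      borel_measurable_continuous_onI[OF ker_cont[of "d n" UNIV c]] d(2)[of n] by auto
  have tm[measurable]: "(\<lambda>p. ?k n (fst p) * g n (snd p)) \<in> borel_measurable borel" for n
    using d(2)[of n] by (intro borel_measurable_continuous_onI continuous_intros
      continuous_on_compose2[OF g(1)] continuous_on_compose2[OF ker_cont[of "d n" UNIV c]]) auto
  let ?K = "{c..c+1} \<times> {a..b}"
  have K: "compact ?K" by (intro compact_Times) auto
  obtain H where H: "\<And>p. p \<in> ?K \<Longrightarrow> \<bar>h p\<bar> \<le> H"
    using compact_imp_bounded[OF compact_continuous_image[OF continuous_on_subset[OF h subset_UNIV] K]]
    unfolding bounded_iff by auto
  have inK: "p \<in> ?K" if "?k n (fst p) * g n (snd p) \<noteq> 0" for n p
    using that ker_zero[OF d(2)[of n], of "fst p" c] g(3)[of "snd p" n] d(3)[of n]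
    by (cases p) fastforce
  have H0: "H \<ge> 0" using H[of "(c,a)"] ab by (auto intro: order_trans[OF abs_ge_zero])
  have ig: "integrable lborel (\<lambda>t. indicator {a..b} t :: real)"
    by (intro integrable_real_indicator) (auto simp: emeasure_lborel_Icc_eq)
  have ic: "integrable lborel (\<lambda>p. ?k n (fst p) * indicator {a..b} (snd p))" for n
    by (rule tensor_integral(1)[OF ker_integral(1)[OF d(2)] ig])
  have dom: "integrable lborel (\<lambda>p. f p * (?k n (fst p) * g n (snd p)))"
    if [measurable]: "f \<in> borel_measurable borel" and f: "\<And>p. p \<in> ?K \<Longrightarrow> \<bar>f p\<bar> \<le> C" for f n C
  proof (rule Bochner_Integration.integrable_bound)
    show "integrable lborel (\<lambda>p. C * (?k n (fst p) * indicator {a..b} (snd p)))" using ic by simp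
    show "AE p in lborel. norm (f p * (?k n (fst p) * g n (snd p))) \<le> norm (C * (?k n (fst p) * indicator {a..b} (snd p)))"
    proof (rule AE_I2)
      fix p
      show "norm (f p * (?k n (fst p) * g n (snd p))) \<le> norm (C * (?k n (fst p) * indicator {a..b} (snd p)))"
      proof (cases "?k n (fst p) * g n (snd p) = 0")
        case False
        then have p: "p \<in> ?K" by (rule inK)
        have "\<bar>f p\<bar> * \<bar>g n (snd p)\<bar> \<le> C * 1" 
          by (rule mult_mono) (use f[OF p] g(2) in auto)
        then have "\<bar>f p\<bar> * \<bar>g n (snd p)\<bar> * ?k n (fst p) \<le> C * 1 * ?k n (fst p)"
          by (rule mult_right_mono) (rule ker_nonneg[OF d(2)])
        then show ?thesis using p ker_nonneg[OF d(2)[of n], of c "fst p"] f[OF p]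
          by (auto simp: abs_mult mult_ac)
      qed auto
    qed
  qed (use tm in \<open>auto intro!: borel_measurable_times\<close>)
  have ihi: "integrable lborel (\<lambda>p. h p * (?k n (fst p) * g n (snd p)))" for n
    by (rule dom[of h H]) (use H in auto)
  then show "integrable lborel (\<lambda>p. h p * (?k n (fst p) * g n (snd p)))" .
  have hcb: "\<And>p. p \<in> ?K \<Longrightarrow> \<bar>h (c, snd p)\<bar> \<le> H" using H by auto
  have ihc: "integrable lborel (\<lambda>p. h (c, snd p) * (?k n (fst p) * g n (snd p)))" for n
  proof (rule dom[of _ H])
    show "(\<lambda>p. h (c, snd p)) \<in> borel_measurable borel"
      by (intro borel_measurable_continuous_onI continuous_on_compose2[OF h] continuous_intros) auto
  qed (rule hcb)
  have hg: "integrable lborel (\<lambda>t. h (c, t) * g n t)" for n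
  proof (rule Bochner_Integration.integrable_bound)
    show "integrable lborel (\<lambda>t. H * indicator {a..b} t)" by (intro integrable_mult_right ig)
    show "AE t in lborel. norm (h (c, t) * g n t) \<le> norm (H * indicator {a..b} t)"
    proof (rule AE_I2)
      fix t show "norm (h (c, t) * g n t) \<le> norm (H * indicator {a..b} t)"
        using H[of "(c,t)"] g(2)[of n t] g(3)[of t n] mult_mono[of "\<bar>h (c,t)\<bar>" H "\<bar>g n t\<bar>" 1] H0
        by (cases "t \<in> {a..b}") (auto simp: abs_mult)
    qed
  qed simp
  have e2: "(\<integral>p. h (c, snd p) * (?k n (fst p) * g n (snd p)) \<partial>lborel) = (\<integral>t. h (c, t) * g n t \<partial>lborel)" for n
    using tensor_integral(2)[OF ker_integral(1)[OF d(2)[of n], of c] hg[of n]] ker_integral(2)[OF d(2)]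
    by (simp add: mult_ac)
  have l2: "(\<lambda>n. \<integral>t. h (c, t) * g n t \<partial>lborel) \<longlonglongrightarrow> (\<integral>t. h (c, t) * g' t \<partial>lborel)"
  proof (rule integral_dominated_convergence[where w="\<lambda>t. H * indicator {a..b} t"])
    have [measurable]: "g' \<in> borel_measurable borel"
      by (rule borel_measurable_LIMSEQ_real[where u=g]) (use gl in auto)
    show "(\<lambda>t. h (c, t) * g' t) \<in> borel_measurable lborel" by measurable
    show "AE t in lborel. (\<lambda>n. h (c, t) * g n t) \<longlonglongrightarrow> h (c, t) * g' t"
      using gl by (intro AE_I2 tendsto_mult_left)
    show "AE t in lborel. norm (h (c, t) * g n t) \<le> H * indicator {a..b} t" for n
    proof (rule AE_I2)
      fix t show "norm (h (c, t) * g n t) \<le> H * indicator {a..b} t"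
        using H[of "(c,t)"] g(2)[of n t] g(3)[of t n] mult_mono[of "\<bar>h (c,t)\<bar>" H "\<bar>g n t\<bar>" 1] H0
        by (cases "t \<in> {a..b}") (auto simp: abs_mult)
    qed
    show "integrable lborel (\<lambda>t. H * indicator {a..b} t)" by (intro integrable_mult_right ig)
  qed auto
  have l1: "(\<lambda>n. (\<integral>p. h p * (?k n (fst p) * g n (snd p)) \<partial>lborel)
       - (\<integral>p. h (c, snd p) * (?k n (fst p) * g n (snd p)) \<partial>lborel)) \<longlonglongrightarrow> 0"
  proof (rule LIMSEQ_I)
    fix r :: real assume r: "r > 0"
    \<comment> \<open>The added 1 covers a = b and makes the final inequality strict.\<close>
    define e where "e = r / (b - a + 1)"
    have e: "e > 0" using r ab by (simp add: e_def)
    have "uniformly_continuous_on ?K h"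
      by (rule compact_uniformly_continuous[OF continuous_on_subset[OF h subset_UNIV] K])
    then obtain dd where dd: "dd > 0"
      "\<And>x x'. x \<in> ?K \<Longrightarrow> x' \<in> ?K \<Longrightarrow> dist x' x < dd \<Longrightarrow> dist (h x') (h x) < e"
      unfolding uniformly_continuous_on_def using e by metis
    have "\<forall>\<^sub>F n in sequentially. d n < dd" using d(1) dd(1) by (rule order_tendstoD)
    then obtain N where N: "\<And>n. n \<ge> N \<Longrightarrow> d n < dd" unfolding eventually_sequentially by blast
    show "\<exists>no. \<forall>n\<ge>no. norm ((\<integral>p. h p * (?k n (fst p) * g n (snd p)) \<partial>lborel)
       - (\<integral>p. h (c, snd p) * (?k n (fst p) * g n (snd p)) \<partial>lborel) - 0) < r"
    proof (intro exI[of _ N] allI impI)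
      fix n assume n: "n \<ge> N"
      have bd: "norm (h p * (?k n (fst p) * g n (snd p)) - h (c, snd p) * (?k n (fst p) * g n (snd p)))
            \<le> e * (?k n (fst p) * indicator {a..b} (snd p))" for p
      proof (cases "?k n (fst p) * g n (snd p) = 0")
        case True
        show ?thesis using e ker_nonneg[OF d(2)[of n], of c "fst p"]
          by (simp only: True mult_zero_right diff_self norm_zero) simp
      next
        case False
        then have p: "p \<in> ?K" by (rule inK)
        have "fst p \<in> {c..c + d n}" using ker_zero[OF d(2)[of n], of "fst p" c] False by auto
        then have "dist p (c, snd p) < dd" using N[OF n] by (cases p) (simp add: dist_prod_def dist_real_def)
        then have "\<bar>h p - h (c, snd p)\<bar> \<le> e"
          using dd(2)[of "(c, snd p)" p] p by (auto simp: dist_real_def)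
        then have "\<bar>h p - h (c, snd p)\<bar> * \<bar>g n (snd p)\<bar> \<le> e * 1"
          by (rule mult_mono) (use g(2) e in auto)
        then have "\<bar>h p - h (c, snd p)\<bar> * \<bar>g n (snd p)\<bar> * ?k n (fst p) \<le> e * 1 * ?k n (fst p)"
          by (rule mult_right_mono) (rule ker_nonneg[OF d(2)])
        then show ?thesis using p ker_nonneg[OF d(2)[of n], of c "fst p"]
          unfolding left_diff_distrib[symmetric] by (auto simp: abs_mult mult_ac)
      qed
      have i1: "(\<integral>p. h p * (?k n (fst p) * g n (snd p)) \<partial>lborel)
         - (\<integral>p. h (c, snd p) * (?k n (fst p) * g n (snd p)) \<partial>lborel)
         = (\<integral>p. h p * (?k n (fst p) * g n (snd p)) - h (c, snd p) * (?k n (fst p) * g n (snd p)) \<partial>lborel)"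
        by (rule Bochner_Integration.integral_diff[symmetric, OF ihi ihc])
      have i2: "norm (\<integral>p. h p * (?k n (fst p) * g n (snd p)) - h (c, snd p) * (?k n (fst p) * g n (snd p)) \<partial>lborel) \<le> (\<integral>p. e * (?k n (fst p) * indicator {a..b} (snd p)) \<partial>lborel)"
      proof (rule order_trans[OF integral_norm_bound], rule Bochner_Integration.integral_mono)
        show "integrable lborel (\<lambda>p. norm (h p * (?k n (fst p) * g n (snd p)) - h (c, snd p) * (?k n (fst p) * g n (snd p))))"
          by (intro integrable_norm Bochner_Integration.integrable_diff ihi ihc)
        show "integrable lborel (\<lambda>p. e * (?k n (fst p) * indicator {a..b} (snd p)))"
          by (intro integrable_mult_right ic)
      qed (rule bd)
      have i3: "(\<integral>p. e * (?k n (fst p) * indicator {a..b} (snd p)) \<partial>lborel) = e * (\<integral>p. ?k n (fst p) * indicator {a..b} (snd p) \<partial>lborel)"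
        by (rule integral_mult_right_zero)
      have i4: "(\<integral>p. ?k n (fst p) * indicator {a..b} (snd p) \<partial>lborel) = b - a"
        unfolding tensor_integral(2)[OF ker_integral(1)[OF d(2)[of n], of c] ig] ker_integral(2)[OF d(2)]
        using ab by simp
      have i5: "e * (b - a) < e * (b - a + 1)" using e by simp
      have i6: "e * (b - a + 1) = r" using ab by (simp add: e_def)
      show "norm ((\<integral>p. h p * (?k n (fst p) * g n (snd p)) \<partial>lborel)
       - (\<integral>p. h (c, snd p) * (?k n (fst p) * g n (snd p)) \<partial>lborel) - 0) < r"
        unfolding i1 diff_zero using i2 i3 i4 i5 i6 by simp
    qed
  qed
  show "(\<lambda>n. \<integral>p. h p * (?k n (fst p) * g n (snd p)) \<partial>lborel) \<longlonglongrightarrow> (\<integral>t. h (c, t) * g' t \<partial>lborel)"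
    using tendsto_add[OF l1 l2] by (simp add: e2)
qed

end

lemma integral_Ioc_eq:
  fixes f :: "real \<Rightarrow> real"
  assumes "continuous_on UNIV f"
  shows "(\<integral>t. f t * indicator {a<..b} t \<partial>lborel) = integral {a..b} f"
proof -
  have "set_integrable lborel {a..b} f"
    by (rule borel_integrable_atLeastAtMost'[OF continuous_on_subset[OF assms subset_UNIV]])
  then have i: "set_integrable lborel {a<..b} f"
    by (rule set_integrable_subset) auto
  have "(\<integral>t. f t * indicator {a<..b} t \<partial>lborel) = (LINT t:{a<..b}|lborel. f t)"
    by (simp add: set_lebesgue_integral_def mult.commute)
  also have "\<dots> = integral {a<..b} f" by (rule set_borel_integral_eq_integral[OF i])
  also have "\<dots> = integral {a..b} f"
    by (rule integral_subset_negligible) (auto intro: negligible_subset[OF negligible_sing[of a]])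
  finally show ?thesis .
qed

text \<open>The divergence theorem for Bv = w on a rectangle: v on the sides y = const, 2 v^2 on the
  sides t = const. It makes sense for merely continuous v and is the form in which the
  distributional equation enters all later arguments.\<close>

definition box_law :: "(real \<times> real \<Rightarrow> real) \<Rightarrow> (real \<times> real \<Rightarrow> real) \<Rightarrow> real \<Rightarrow> real \<Rightarrow> real \<Rightarrow> real \<Rightarrow> bool" where
  "box_law v w y1 y2 t1 t2 \<longleftrightarrow> (LINT p:{y1<..y2} \<times> {t1<..t2}|lborel. w p)
     = integral {t1..t2} (\<lambda>t. v (y2, t)) - integral {t1..t2} (\<lambda>t. v (y1, t))
       - 2 * (integral {y1..y2} (\<lambda>y. (v (y, t2))\<^sup>2) - integral {y1..y2} (\<lambda>y. (v (y, t1))\<^sup>2))"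

lemma closed_box_enlarge:
  fixes y1 :: real
  assumes "open D" "{y1..y2} \<times> {t1..t2} \<subseteq> D" "y1 \<le> y2" "t1 \<le> t2"
  obtains d where "d > 0" "{y1 - d..y2 + d} \<times> {t1 - d..t2 + d} \<subseteq> D"
proof -
  obtain e where e: "e > 0" "(\<Union>x\<in>{y1..y2} \<times> {t1..t2}. ball x e) \<subseteq> D"
    using compact_subset_open_imp_ball_epsilon_subset[OF compact_Times[OF compact_Icc compact_Icc] assms(1,2)]
    by blast
  have "{y1 - e/3..y2 + e/3} \<times> {t1 - e/3..t2 + e/3} \<subseteq> D"
  proof
    fix p assume p: "p \<in> {y1 - e/3..y2 + e/3} \<times> {t1 - e/3..t2 + e/3}"
    obtain y t where pe: "p = (y, t)" by force
    define q where "q = (max y1 (min y y2), max t1 (min t t2))"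
    have q: "q \<in> {y1..y2} \<times> {t1..t2}" using assms by (auto simp: q_def)
    have "dist q p \<le> dist (fst q) (fst p) + dist (snd q) (snd p)"
      by (simp add: dist_prod_def sqrt_sum_squares_le_sum)
    also have "\<dots> \<le> e/3 + e/3"
      using p assms e(1) unfolding pe q_def by (intro add_mono) (auto simp: dist_real_def max_def min_def)
    finally have "p \<in> ball q e" using e by auto
    then show "p \<in> D" using q e(2) by blast
  qed
  then show ?thesis using e(1) by (intro that[of "e/3"]) auto
qed

text \<open>Test with a product of two plateaus. Its support exceeds the box by the transition
  width, hence the enlarged box inside D. One side converges by domination, the other by
  \<open>ker_limit\<close>.\<close>

lemma box_law_of_B_rep:
  assumes D: "open D" and v: "continuous_on UNIV v" and B: "B_rep D v w"
    and box: "{y1..y2} \<times> {t1..t2} \<subseteq> D" "y1 \<le> y2" "t1 \<le> t2"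
  shows "box_law v w y1 y2 t1 t2"
proof -
  obtain S where S: "smooth_step S" using smooth_step_exists by auto
  note pl_b = plateau_bounds[OF S] and pl_s = plateau_supp[OF S] and pl_l = plateau_lim[OF S]
    and pl_sm = smooth1_plateau[OF S] and pl_d = deriv_plateau[OF S]
    and kl = ker_limit[OF S]
  obtain d0 where d0: "d0 > 0" "{y1 - d0..y2 + d0} \<times> {t1 - d0..t2 + d0} \<subseteq> D"
    using closed_box_enlarge[OF D box] .
  define K where "K = {y1..y2 + d0} \<times> {t1..t2 + d0}"
  have K: "compact K" "K \<subseteq> D" using d0 by (auto simp: K_def intro!: compact_Times)
  define d where "d n = min d0 1 / real (Suc n)" for n
  have d: "d \<longlonglongrightarrow> 0" unfolding d_def
    using LIMSEQ_Suc[OF lim_const_over_n[of "min d0 1"]] by simp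
  have dp: "d n > 0" and dd: "d n \<le> d0" and d1: "d n \<le> 1" for n
  proof -
    show "d n > 0" using d0 by (simp add: d_def)
    have "d n \<le> min d0 1 / 1" unfolding d_def by (rule divide_left_mono) (use d0 in auto)
    then show "d n \<le> d0" "d n \<le> 1" by auto
  qed
  define f where "f n = plateau S (d n) y1 y2" for n
  define g where "g n = plateau S (d n) t1 t2" for n
  have sm: "smooth1 (f n)" "smooth1 (g n)" for n by (simp_all add: f_def g_def pl_sm)
  have f0: "0 \<le> f n y" "f n y \<le> 1" and g0: "0 \<le> g n y" "g n y \<le> 1" for n y
    using pl_b[OF box(2) dp] pl_b[OF box(3) dp] by (auto simp: f_def g_def)
  have fs: "f n y = 0" if "y \<notin> {y1..y2 + d0}" for n y
    using pl_s[OF box(2) dp, of y n] that dd[of n] by (auto simp: f_def)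
  have gs: "g n y = 0" if "y \<notin> {t1..t2 + d0}" for n y
    using pl_s[OF box(3) dp, of y n] that dd[of n] by (auto simp: g_def)
  have fc: "continuous_on UNIV (f n)" "continuous_on UNIV (g n)" for n
    using smooth1_deriv(1)[OF sm(1)] smooth1_deriv(1)[OF sm(2)]
    by (metis DERIV_continuous_on has_field_derivative_at_within)+
  have fl: "(\<lambda>n. f n y) \<longlonglongrightarrow> indicator {y1<..y2} y" and gl: "(\<lambda>n. g n y) \<longlonglongrightarrow> indicator {t1<..t2} y" for y
    unfolding f_def g_def using pl_l[OF box(2) d dp] pl_l[OF box(3) d dp] by auto
  define \<psi> where "\<psi> n p = f n (fst p) * g n (snd p)" for n p
  have wm[measurable]: "w \<in> borel_measurable borel" using B by (simp add: B_rep_def)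
  have psiK: "\<psi> n p = 0" if "p \<notin> K" for n p
    using that fs[of "fst p" n] gs[of "snd p" n] by (cases p) (auto simp: \<psi>_def K_def)
  have test: "test_fun D (\<psi> n)" for n
  proof -
    have "closure {p. \<psi> n p \<noteq> 0} \<subseteq> K"
      by (rule closure_minimal) (use psiK K(1) in \<open>auto intro: compact_imp_closed\<close>)
    moreover have "compact (closure {p. \<psi> n p \<noteq> 0})"
      using calculation K(1) by (metis closed_closure compact_Int_closed inf.absorb_iff2)
    ultimately show ?thesis using K(2) smooth2_tensor[OF sm(1)[of n] sm(2)[of n]]
      unfolding test_fun_def \<psi>_def[abs_def] by auto
  qed
  have eq: "(\<integral>p. w p * \<psi> n p \<partial>lborel) =
        (\<integral>p. - v p * dY (\<psi> n) p + 2 * (v p)\<^sup>2 * dT (\<psi> n) p \<partial>lborel)" for n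
    using B test unfolding B_rep_def by blast
  have lhs: "(\<lambda>n. \<integral>p. w p * \<psi> n p \<partial>lborel) \<longlonglongrightarrow> (\<integral>p. w p * indicator ({y1<..y2} \<times> {t1<..t2}) p \<partial>lborel)"
  proof (rule integral_dominated_convergence[where w="\<lambda>p. indicator K p * \<bar>w p\<bar>"])
    have "set_integrable lborel K w" using B K unfolding B_rep_def by blast
    then show "integrable lborel (\<lambda>p. indicator K p * \<bar>w p\<bar>)"
      using set_integrable_abs unfolding set_integrable_def by fastforce
    show "AE p in lborel. norm (w p * \<psi> n p) \<le> indicator K p * \<bar>w p\<bar>" for n
    proof (rule AE_I2)
      fix p
      show "norm (w p * \<psi> n p) \<le> indicator K p * \<bar>w p\<bar>"
      proof (cases "p \<in> K")
        case True
        have "f n (fst p) * g n (snd p) \<le> 1" using f0 g0 by (intro mult_le_one) auto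
        then have "\<bar>w p\<bar> * \<bar>\<psi> n p\<bar> \<le> \<bar>w p\<bar> * 1"
          using f0[of n "fst p"] g0[of n "snd p"] by (intro mult_left_mono) (auto simp: \<psi>_def)
        then show ?thesis using True by (simp add: abs_mult)
      qed (simp add: psiK)
    qed
    show "AE p in lborel. (\<lambda>n. w p * \<psi> n p) \<longlonglongrightarrow> w p * indicator ({y1<..y2} \<times> {t1<..t2}) p"
    proof (rule AE_I2)
      fix p :: "real \<times> real"
      have "indicator ({y1<..y2} \<times> {t1<..t2}) p = (indicator {y1<..y2} (fst p) * indicator {t1<..t2} (snd p) :: real)"
        by (cases p) (auto simp: indicator_def)
      then show "(\<lambda>n. w p * \<psi> n p) \<longlonglongrightarrow> w p * indicator ({y1<..y2} \<times> {t1<..t2}) p"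
        unfolding \<psi>_def by (auto intro!: tendsto_mult fl gl)
    qed
    have [measurable]: "\<psi> n \<in> borel_measurable borel" for n
      unfolding \<psi>_def
      by (intro borel_measurable_continuous_onI continuous_intros
          continuous_on_compose2[OF fc(1)] continuous_on_compose2[OF fc(2)]) auto
    show "(\<lambda>p. w p * indicator ({y1<..y2} \<times> {t1<..t2}) p) \<in> borel_measurable lborel"
      by (intro borel_measurable_times borel_measurable_indicator) (auto simp: borel_Times)
    show "(\<lambda>p. w p * \<psi> n p) \<in> borel_measurable lborel" for n by measurable
  qed
  \<comment> \<open>\<open>ker_limit\<close> concentrates in the first coordinate, so the term with
    the t-derivative is treated after exchanging the coordinates.\<close>
  define v2 where "v2 p = (v (snd p, fst p))\<^sup>2" for p
  have v2c: "continuous_on UNIV v2"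
    unfolding v2_def by (intro continuous_intros continuous_on_compose2[OF v]) auto
  define A where "A c n = (\<integral>p. v p * (ker S (d n) c (fst p) * g n (snd p)) \<partial>lborel)" for c n
  define C where "C c n = (\<integral>p. v2 p * (ker S (d n) c (fst p) * f n (snd p)) \<partial>lborel)" for c n
  have t12: "t1 \<le> t2 + d0" "y1 \<le> y2 + d0" using box d0 by auto
  have g1: "\<And>n t. \<bar>g n t\<bar> \<le> 1" "\<And>n t. \<bar>f n t\<bar> \<le> 1" using f0 g0 by (auto simp: abs_le_iff intro: order_trans)
  note klA = kl[OF v d dp d1 fc(2) g1(1) gs gl t12(1)]
  note klC = kl[OF v2c d dp d1 fc(1) g1(2) fs fl t12(2)]
  have Al: "A c \<longlonglongrightarrow> integral {t1..t2} (\<lambda>t. v (c, t))" for c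
  proof -
    have "continuous_on UNIV (\<lambda>t. v (c, t))" by (intro continuous_on_compose2[OF v] continuous_intros) auto
    then have e: "(\<integral>t. v (c, t) * indicator {t1<..t2} t \<partial>lborel) = integral {t1..t2} (\<lambda>t. v (c, t))"
      by (rule integral_Ioc_eq)
    show ?thesis unfolding A_def e[symmetric] by (rule klA(1))
  qed
  have Cl: "C c \<longlonglongrightarrow> integral {y1..y2} (\<lambda>y. (v (y, c))\<^sup>2)" for c
  proof -
    have "continuous_on UNIV (\<lambda>y. v2 (c, y))" by (intro continuous_on_compose2[OF v2c] continuous_intros) auto
    then have e: "(\<integral>t. v2 (c, t) * indicator {y1<..y2} t \<partial>lborel) = integral {y1..y2} (\<lambda>y. v2 (c, y))"
      by (rule integral_Ioc_eq)
    have "C c \<longlonglongrightarrow> integral {y1..y2} (\<lambda>y. v2 (c, y))"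
      unfolding C_def e[symmetric] by (rule klC(1))
    then show ?thesis by (simp add: v2_def)
  qed
  have Cm: "(\<lambda>p. v2 p * (ker S (d n) c (fst p) * f n (snd p))) \<in> borel_measurable borel" for c n
    using klC(2)[THEN borel_measurable_integrable] by simp
  have Csw: "C c n = (\<integral>p. (v p)\<^sup>2 * (f n (fst p) * ker S (d n) c (snd p)) \<partial>lborel)" for c n
    using lborel_integral_swap[OF Cm] unfolding C_def by (simp add: v2_def mult_ac)
  have Cint: "integrable lborel (\<lambda>p. (v p)\<^sup>2 * (f n (fst p) * ker S (d n) c (snd p)))" for c n
  proof -
    have "integrable lborel (\<lambda>(x,y). (\<lambda>p. v2 p * (ker S (d n) c (fst p) * f n (snd p))) (y, x))"
      using lborel_pair.integrable_product_swap[of "\<lambda>p. v2 p * (ker S (d n) c (fst p) * f n (snd p))"] klC(2)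
      by (simp add: lborel_prod)
    then show ?thesis by (simp add: case_prod_unfold v2_def mult_ac)
  qed
  have rhs: "(\<integral>p. - v p * dY (\<psi> n) p + 2 * (v p)\<^sup>2 * dT (\<psi> n) p \<partial>lborel)
     = - (A y1 n - A y2 n) + 2 * (C t1 n - C t2 n)" for n
  proof -
    have "- v p * dY (\<psi> n) p + 2 * (v p)\<^sup>2 * dT (\<psi> n) p
      = - (v p * (ker S (d n) y1 (fst p) * g n (snd p)) - v p * (ker S (d n) y2 (fst p) * g n (snd p)))
        + 2 * ((v p)\<^sup>2 * (f n (fst p) * ker S (d n) t1 (snd p)) - (v p)\<^sup>2 * (f n (fst p) * ker S (d n) t2 (snd p)))" for p
      unfolding \<psi>_def[abs_def] partial_tensor[OF sm(1)[of n] sm(2)[of n]]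
      unfolding f_def g_def pl_d by (simp add: algebra_simps)
    then show ?thesis unfolding A_def Csw using klA(2) Cint by simp
  qed
  have "(\<lambda>n. \<integral>p. w p * \<psi> n p \<partial>lborel) \<longlonglongrightarrow>
     - (integral {t1..t2} (\<lambda>t. v (y1, t)) - integral {t1..t2} (\<lambda>t. v (y2, t)))
      + 2 * (integral {y1..y2} (\<lambda>y. (v (y, t1))\<^sup>2) - integral {y1..y2} (\<lambda>y. (v (y, t2))\<^sup>2))"
    unfolding eq rhs by (intro tendsto_intros Al Cl)
  from LIMSEQ_unique[OF this lhs]
  have "(\<integral>p. w p * indicator ({y1<..y2} \<times> {t1<..t2}) p \<partial>lborel) = - (integral {t1..t2} (\<lambda>t. v (y1, t)) - integral {t1..t2} (\<lambda>t. v (y2, t)))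
      + 2 * (integral {y1..y2} (\<lambda>y. (v (y, t1))\<^sup>2) - integral {y1..y2} (\<lambda>y. (v (y, t2))\<^sup>2))" ..
  moreover have "(LINT p:{y1<..y2} \<times> {t1<..t2}|lborel. w p) = (\<integral>p. w p * indicator ({y1<..y2} \<times> {t1<..t2}) p \<partial>lborel)"
    unfolding set_lebesgue_integral_def real_scaleR_def by (simp only: mult.commute)
  ultimately show ?thesis unfolding box_law_def by (simp add: algebra_simps)
qed

section \<open>Densities determined by their integrals over boxes\<close>

lemma AE_lborel_fst_snd_neq:
  "AE p in (lborel :: (real \<times> real) measure). fst p \<noteq> a"
  "AE p in (lborel :: (real \<times> real) measure). snd p \<noteq> b"
proof -
  have "AE p in (lborel :: real measure) \<Otimes>\<^sub>M (lborel :: real measure). fst p \<noteq> a"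
  proof (rule lborel_pair.AE_pair_measure)
    show "{p \<in> space ((lborel :: real measure) \<Otimes>\<^sub>M (lborel :: real measure)). fst p \<noteq> a} \<in> sets (lborel \<Otimes>\<^sub>M lborel)" by measurable
    show "AE x in (lborel :: real measure). AE y in (lborel :: real measure). fst (x, y) \<noteq> a"
      using AE_lborel_singleton[of a] by eventually_elim simp
  qed
  then show "AE p in (lborel :: (real \<times> real) measure). fst p \<noteq> a" unfolding lborel_prod .
  have "AE p in (lborel :: real measure) \<Otimes>\<^sub>M (lborel :: real measure). snd p \<noteq> b"
  proof (rule lborel_pair.AE_pair_measure)
    show "{p \<in> space ((lborel :: real measure) \<Otimes>\<^sub>M (lborel :: real measure)). snd p \<noteq> b} \<in> sets (lborel \<Otimes>\<^sub>M lborel)" by measurable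
    show "AE x in (lborel :: real measure). AE y in (lborel :: real measure). snd (x, y) \<noteq> b"
      using AE_lborel_singleton[of b] by simp
  qed
  then show "AE p in (lborel :: (real \<times> real) measure). snd p \<noteq> b" unfolding lborel_prod .
qed

lemma box_prod_real: "box (a :: real \<times> real) b = {fst a<..<fst b} \<times> {snd a<..<snd b}"
  by (auto simp: box_prod box_real)

lemma set_integral_box_Ioc:
  fixes w :: "real \<times> real \<Rightarrow> real"
  assumes [measurable]: "w \<in> borel_measurable borel"
  shows "(LINT p:box (a, c) (b, d)|lborel. w p) = (LINT p:{a<..b} \<times> {c<..d}|lborel. w p)"
proof -
  have [measurable]: "{a<..b} \<times> {c<..d} \<in> sets borel" by (auto simp: borel_Times)
  show ?thesis unfolding set_lebesgue_integral_def
  proof (rule integral_cong_AE)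
    show "AE p in lborel. indicat_real (box (a, c) (b, d)) p *\<^sub>R w p = indicat_real ({a<..b} \<times> {c<..d}) p *\<^sub>R w p"
      using AE_lborel_fst_snd_neq(1)[of b] AE_lborel_fst_snd_neq(2)[of d]
    proof eventually_elim
      case (elim p) then show ?case by (cases p) (auto simp: box_prod_real indicator_def)
    qed
  qed measurable
qed

text \<open>Cut off to one box inside D, the difference integrates to zero over open boxes, an
  intersection-stable generator of the Borel sets, hence over all Borel sets. The purpose is to make
  the value of \<open>area_H\<close> independent of the representative that it chooses.\<close>

lemma AE_eq_of_box_laws:
  fixes w w' :: "real \<times> real \<Rightarrow> real"
  assumes "open D" and w: "w \<in> borel_measurable borel" "w' \<in> borel_measurable borel"
    and wi: "\<And>K. compact K \<Longrightarrow> K \<subseteq> D \<Longrightarrow> set_integrable lborel K w"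
      "\<And>K. compact K \<Longrightarrow> K \<subseteq> D \<Longrightarrow> set_integrable lborel K w'"
    and eq: "\<And>a b c d. {a..b} \<times> {c..d} \<subseteq> D \<Longrightarrow> a \<le> b \<Longrightarrow> c \<le> d \<Longrightarrow>
      (LINT p:{a<..b} \<times> {c<..d}|lborel. w p) = (LINT p:{a<..b} \<times> {c<..d}|lborel. w' p)"
  shows "AE p in lborel. p \<in> D \<longrightarrow> w p = w' p"
proof -
  note [measurable] = w
  define f where "f p = w p - w' p" for p
  have [measurable]: "f \<in> borel_measurable borel" unfolding f_def by measurable
  have fi: "set_integrable lborel K f" if "compact K" "K \<subseteq> D" for K
    unfolding f_def by (intro set_integral_diff(1) wi that)
  have f0: "(LINT p:box a b|lborel. f p) = 0" if "cbox a b \<subseteq> D" for a b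
  proof (cases "box a b = {}")
    case False
    then obtain p where "p \<in> box a b" by blast
    then have ab: "fst a \<le> fst b" "snd a \<le> snd b" unfolding box_prod_real mem_Times_iff by auto
    have c: "cbox a b = {fst a..fst b} \<times> {snd a..snd b}" by (cases a, cases b) (simp add: cbox_Pair_eq)
    have si: "set_integrable lborel ({fst a<..fst b} \<times> {snd a<..snd b}) w"
      "set_integrable lborel ({fst a<..fst b} \<times> {snd a<..snd b}) w'"
      by (rule set_integrable_subset[OF wi(1)[OF compact_cbox that]] set_integrable_subset[OF wi(2)[OF compact_cbox that]];
          auto simp: c borel_Times)+
    have "(LINT p:box a b|lborel. f p) = (LINT p:{fst a<..fst b} \<times> {snd a<..snd b}|lborel. f p)"
      using set_integral_box_Ioc[of f "fst a" "snd a" "fst b" "snd b"] by simp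
    also have "\<dots> = 0"
      unfolding f_def using eq[of "fst a" "fst b" "snd a" "snd b"] that ab si by (simp add: c set_integral_diff)
    finally show ?thesis .
  qed (simp add: set_lebesgue_integral_def)
  have main: "AE p in lborel. p \<in> box a b \<longrightarrow> f p = 0" if ab: "cbox a b \<subseteq> D" for a b
  proof -
    define g where "g p = indicator (box a b) p * f p" for p
    have gi: "integrable lborel g"
    proof -
      have "set_integrable lborel (box a b) f"
        by (rule set_integrable_subset[OF fi[OF compact_cbox ab]]) (auto intro: box_subset_cbox[THEN subsetD])
      then show ?thesis by (simp add: set_integrable_def g_def[abs_def])
    qed
    have gb: "(LINT p:box c d|lborel. g p) = 0" for c d
    proof -
      obtain e h where eh: "box a b \<inter> box c d = box e h" using box_Int_box by blast
      have "(LINT p:box c d|lborel. g p) = (LINT p:box e h|lborel. f p)"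
        unfolding set_lebesgue_integral_def g_def eh[symmetric] indicator_inter_arith by (simp add: mult_ac)
      also have "\<dots> = 0"
      proof (cases "box e h = {}")
        case False
        have "cbox e h = closure (box e h)" using closure_box[OF False] by simp
        also have "\<dots> \<subseteq> closure (box a b)" by (rule closure_mono) (use eh in auto)
        also have "\<dots> \<subseteq> cbox a b" by (rule closure_minimal) (auto intro: box_subset_cbox[THEN subsetD])
        finally show ?thesis using ab by (intro f0) auto
      qed (simp add: set_lebesgue_integral_def)
      finally show ?thesis .
    qed
    have IS: "Int_stable (range (\<lambda>(a, b). box a b :: (real \<times> real) set))"
    proof (rule Int_stableI)
      fix A B :: "(real \<times> real) set"
      assume "A \<in> range (\<lambda>(a, b). box a b)" "B \<in> range (\<lambda>(a, b). box a b)"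
      then obtain a b c d where "A = box a b" "B = box c d" by auto
      moreover obtain e h where "box a b \<inter> box c d = box e h" using box_Int_box by blast
      ultimately show "A \<inter> B \<in> range (\<lambda>(a, b). box a b)"
        by (auto intro!: image_eqI[of _ _ "(e, h)"])
    qed
    have "(LINT p:A|lborel. g p) = (LINT p:A|lborel. 0)" if "A \<in> sets lborel" for A
    proof -
      have A: "A \<in> sigma_sets UNIV (range (\<lambda>(a, b). box a b))"
        using that by (simp add: borel_eq_box)
      have "range (\<lambda>(a, b). box a b :: (real \<times> real) set) \<subseteq> Pow UNIV" by simp
      from IS this A have "(LINT p:A|lborel. g p) = 0"
      proof (induct rule: sigma_sets_induct_disjoint)
        case (compl A)
        then have [measurable]: "A \<in> sets borel" by (simp add: borel_eq_box)
        \<comment> \<open>The whole plane is not a box; since g vanishes off \<open>box a b\<close>,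
          a large box replaces it.\<close>
        obtain n where n: "box a b \<subseteq> box (-n) n"
          using bounded_subset_box_symmetric[OF bounded_box] by blast
        have "(LINT p:UNIV - A|lborel. g p) = (\<integral>p. indicator (box (-n) n) p *\<^sub>R g p - indicator A p *\<^sub>R g p \<partial>lborel)"
          unfolding set_lebesgue_integral_def
          by (rule Bochner_Integration.integral_cong) (use n in \<open>auto simp: g_def indicator_def\<close>)
        also have "\<dots> = (LINT p:box (-n) n|lborel. g p) - (LINT p:A|lborel. g p)"
          unfolding set_lebesgue_integral_def
          by (rule Bochner_Integration.integral_diff; intro integrable_mult_indicator gi) auto
        finally show ?case using compl gb by simp
      next
        case (union A)
        then have [measurable]: "A i \<in> sets borel" for i by (auto simp: borel_eq_box)
        have "(LINT p:\<Union> (range A)|lborel. g p) = (\<Sum>i. (LINT p:A i|lborel. g p))"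
        proof (rule lebesgue_integral_countable_add)
          have "\<Union> (range A) \<in> sets lborel" by measurable
          then show "set_integrable lborel (\<Union> (range A)) g"
            unfolding set_integrable_def by (intro integrable_mult_indicator gi) simp
        qed (use union in \<open>auto simp: disjoint_family_on_def\<close>)
        then show ?case using union by simp
      next
        case (basic A)
        then show ?case using gb by auto
      next
        case empty
        show ?case by (simp add: set_lebesgue_integral_def)
      qed
      then show ?thesis by (simp add: set_lebesgue_integral_def)
    qed
    then have "AE p in lborel. g p = 0"
      by (intro density_unique_real[OF gi]) auto
    then show ?thesis by eventually_elim (auto simp: g_def indicator_def)
  qed
  have main2: "AE p in lborel. p \<in> cbox a b \<longrightarrow> w p = w' p" if "cbox a b \<subseteq> D" for a b
    using main[OF that] AE_lborel_fst_snd_neq(1)[of "fst a"] AE_lborel_fst_snd_neq(1)[of "fst b"]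
      AE_lborel_fst_snd_neq(2)[of "snd a"] AE_lborel_fst_snd_neq(2)[of "snd b"]
  proof eventually_elim
    case (elim p)
    then show ?case by (cases a, cases b, cases p) (auto simp: box_prod_real cbox_Pair_eq f_def)
  qed
  obtain \<D> where \<D>: "countable \<D>" "\<D> \<subseteq> Pow D" "\<And>X. X \<in> \<D> \<Longrightarrow> \<exists>a b. X = cbox a b" "\<Union>\<D> = D"
    using open_countable_Union_open_cbox[OF assms(1)] by metis
  have "AE p in lborel. \<forall>X\<in>\<D>. p \<in> X \<longrightarrow> w p = w' p"
  proof (subst AE_ball_countable[OF \<D>(1)], rule ballI)
    fix X assume X: "X \<in> \<D>"
    then obtain a b where ab: "X = cbox a b" using \<D>(3) by blast
    show "AE p in lborel. p \<in> X \<longrightarrow> w p = w' p" unfolding ab by (rule main2) (use X \<D>(2) ab in blast)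
  qed
  then show ?thesis by eventually_elim (use \<D>(4) in blast)
qed

lemma borel_measurable_fst_snd [measurable]:
  "fst \<in> borel_measurable (borel :: (real \<times> real) measure)"
  "snd \<in> borel_measurable (borel :: (real \<times> real) measure)"
  by (intro borel_measurable_continuous_onI continuous_intros)+

lemma set_integral_symdiff_le:
  fixes w :: "'a \<Rightarrow> real"
  assumes i: "set_integrable M X w" and [measurable]: "A \<in> sets M" "B \<in> sets M" "S \<in> sets M"
    and sub: "A \<subseteq> X" "B \<subseteq> X" "S \<subseteq> X" and d: "A - B \<subseteq> S" "B - A \<subseteq> S"
  shows "\<bar>(LINT p:A|M. w p) - (LINT p:B|M. w p)\<bar> \<le> (LINT p:S|M. \<bar>w p\<bar>)"
proof -
  have iA: "set_integrable M A w" and iB: "set_integrable M B w" and iS: "set_integrable M S w"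
    by (rule set_integrable_subset[OF i]; use sub in auto)+
  note ii = iA[unfolded set_integrable_def] iB[unfolded set_integrable_def]
  have "(LINT p:A|M. w p) - (LINT p:B|M. w p) = (\<integral>p. indicator A p *\<^sub>R w p - indicator B p *\<^sub>R w p \<partial>M)"
    unfolding set_lebesgue_integral_def by (rule Bochner_Integration.integral_diff[symmetric, OF ii])
  then have "\<bar>(LINT p:A|M. w p) - (LINT p:B|M. w p)\<bar> \<le> (\<integral>p. \<bar>indicator A p *\<^sub>R w p - indicator B p *\<^sub>R w p\<bar> \<partial>M)"
    using integral_norm_bound[of M "\<lambda>p. indicator A p *\<^sub>R w p - indicator B p *\<^sub>R w p"] by simp
  also have "\<dots> \<le> (\<integral>p. indicator S p *\<^sub>R \<bar>w p\<bar> \<partial>M)"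
  proof (rule Bochner_Integration.integral_mono)
    show "integrable M (\<lambda>p. \<bar>indicator A p *\<^sub>R w p - indicator B p *\<^sub>R w p\<bar>)"
      by (intro integrable_abs Bochner_Integration.integrable_diff ii)
    show "integrable M (\<lambda>p. indicator S p *\<^sub>R \<bar>w p\<bar>)"
      using set_integrable_abs[OF iS] by (simp add: set_integrable_def)
    show "\<bar>indicator A p *\<^sub>R w p - indicator B p *\<^sub>R w p\<bar> \<le> indicator S p *\<^sub>R \<bar>w p\<bar>" for p
      using d by (auto simp: indicator_def)
  qed
  finally show ?thesis by (simp add: set_lebesgue_integral_def)
qed

lemma continuous_on_slice:
  assumes "continuous_on UNIV (v :: real \<times> real \<Rightarrow> real)"
  shows "continuous_on A (\<lambda>t. v (y, t))" "continuous_on A (\<lambda>y. v (y, t))"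
  by (intro continuous_on_compose2[OF assms] continuous_intros subset_UNIV)+

section \<open>Flux below a level curve\<close>

context
  fixes v w :: "real \<times> real \<Rightarrow> real" and c :: "real \<Rightarrow> real" and y1 y2 a d A m :: real
  assumes zero: "0 \<notin> {y1..y2}"
    and v: "continuous_on UNIV v" and c: "continuous_on UNIV c"
    and law: "\<And>y y' t1 t2. y1 \<le> y \<Longrightarrow> y \<le> y' \<Longrightarrow> y' \<le> y2 \<Longrightarrow> a \<le> t1 \<Longrightarrow> t1 \<le> t2 \<Longrightarrow> t2 \<le> d \<Longrightarrow> box_law v w y y' t1 t2"
    and w: "w \<in> borel_measurable borel" and wi: "set_integrable lborel ({y1..y2} \<times> {a..d}) w"
    and mono: "\<And>y t t'. y \<in> {y1..y2} \<Longrightarrow> a \<le> t \<Longrightarrow> t \<le> t' \<Longrightarrow> t' \<le> d \<Longrightarrow> t + 4 * y * v (y, t) \<le> t' + 4 * y * v (y, t')"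
    and cr: "\<And>y. y \<in> {y1..y2} \<Longrightarrow> a \<le> c y \<and> c y \<le> d"
    and lev: "\<And>y. y \<in> {y1..y2} \<Longrightarrow> c y + 4 * y * v (y, c y) = A + 2 * m * y\<^sup>2"
begin

private definition "T y = A + 2 * m * y\<^sup>2"
private definition "V y = v (y, c y)"
text \<open>The flux through a line y = const below the curve. Formally, raising the curve changes
  it by v times the change of t + 4 y v, so it is adapted to level curves.\<close>

private definition "\<Phi> y = integral {a..c y} (\<lambda>t. v (y, t)) + 2 * y * (V y)\<^sup>2"
private definition "R y y' = {p. y < fst p \<and> fst p \<le> y' \<and> a < snd p \<and> snd p \<le> c (fst p)}"
private definition "N \<omega> y y' = {p. y < fst p \<and> fst p \<le> y' \<and> a < snd p \<and> snd p \<le> d \<and> \<bar>snd p - c (fst p)\<bar> \<le> \<omega>}"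
text \<open>The derivative of (T - \<kappa>)^2 / (8 \<eta>) in \<eta>, corrected by the flux terms
  on the horizontal line t = \<kappa> and on the curve. It vanishes where that line meets the curve,
  which makes it small on thin columns.\<close>

private definition "K \<eta> \<kappa> = (T \<eta> - \<kappa>) * m - (T \<eta> - \<kappa>)\<^sup>2 / (8 * \<eta>\<^sup>2) + 2 * (v (\<eta>, \<kappa>))\<^sup>2 - 4 * m * (\<eta> * V \<eta>)"
text \<open>The value to be shown for the integral of w below the curve.\<close>

private definition "Q y y' = \<Phi> y' - \<Phi> y - 4 * m * integral {y..y'} (\<lambda>y. y * V y) + 2 * integral {y..y'} (\<lambda>y. (v (y, a))\<^sup>2)"

private lemma V_cont: "continuous_on B V"
  unfolding V_def by (intro continuous_on_compose2[OF v] continuous_intros continuous_on_subset[OF c] subset_UNIV)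

private lemma v_int: "(\<lambda>t. v (y, t)) integrable_on {s..t}"
  by (intro integrable_continuous_real continuous_on_slice v)

private lemma level: "y \<in> {y1..y2} \<Longrightarrow> 4 * y * V y = T y - c y"
  using lev[of y] by (simp add: V_def T_def)

private lemma level2: assumes "y \<in> {y1..y2}" shows "2 * y * (V y)\<^sup>2 = (T y - c y)\<^sup>2 / (8 * y)"
proof -
  have "y \<noteq> 0" using assms zero by auto
  then show ?thesis unfolding level[OF assms, symmetric] by (simp add: power2_eq_square)
qed

private lemma linear_integral: "integral {s..t} (\<lambda>t. (\<tau> - t) / 4) = ((\<tau> - s)\<^sup>2 - (\<tau> - t)\<^sup>2) / 8" if "s \<le> t" for s t \<tau> :: real
proof -
  have "((\<lambda>t. (\<tau> - t) / 4) has_integral (- (\<tau> - t)\<^sup>2 / 8) - (- (\<tau> - s)\<^sup>2 / 8)) {s..t}"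
    by (rule fundamental_theorem_of_calculus[OF that])
       (auto intro!: derivative_eq_intros simp: field_simps simp flip: has_real_derivative_iff_has_vector_derivative)
  then show ?thesis by (simp only: integral_unique) (simp add: diff_divide_distrib)
qed

text \<open>Monotonicity of \<open>t + 4 y v\<close> compares \<open>v(y, \<cdot>)\<close> with the affine function through the
  pivot \<open>(y, c y)\<close>, so both orders of \<open>c y\<close> and \<open>\<kappa>\<close> give the same inequality.\<close>
private lemma pivot:
  assumes y: "y \<in> {y1..y2}" and k: "a \<le> \<kappa>" "\<kappa> \<le> d"
  shows "y * (integral {a..c y} (\<lambda>t. v (y, t)) - integral {a..\<kappa>} (\<lambda>t. v (y, t)))
      \<le> ((T y - \<kappa>)\<^sup>2 - (T y - c y)\<^sup>2) / 8"
proof (cases "\<kappa> \<le> c y")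
  case True
  have "integral {a..\<kappa>} (\<lambda>t. v (y, t)) + integral {\<kappa>..c y} (\<lambda>t. v (y, t)) = integral {a..c y} (\<lambda>t. v (y, t))"
    by (rule Henstock_Kurzweil_Integration.integral_combine) (use k True v_int in auto)
  then have d: "integral {a..c y} (\<lambda>t. v (y, t)) - integral {a..\<kappa>} (\<lambda>t. v (y, t))
     = integral {\<kappa>..c y} (\<lambda>t. v (y, t))" by linarith
  have "y * (integral {a..c y} (\<lambda>t. v (y, t)) - integral {a..\<kappa>} (\<lambda>t. v (y, t)))
     = integral {\<kappa>..c y} (\<lambda>t. y * v (y, t))" unfolding d by simp
  also have "\<dots> \<le> integral {\<kappa>..c y} (\<lambda>t. (T y - t) / 4)"
  proof (rule integral_le)
    show "y * v (y, t) \<le> (T y - t) / 4" if "t \<in> {\<kappa>..c y}" for t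
      using mono[OF y, of t "c y"] that k cr[OF y] lev[OF y] by (auto simp: T_def)
  qed (auto intro!: integrable_continuous_real continuous_intros continuous_on_slice v)
  finally show ?thesis unfolding linear_integral[OF True] .
next
  case False
  then have F: "c y \<le> \<kappa>" by simp
  have "integral {a..c y} (\<lambda>t. v (y, t)) + integral {c y..\<kappa>} (\<lambda>t. v (y, t)) = integral {a..\<kappa>} (\<lambda>t. v (y, t))"
    by (rule Henstock_Kurzweil_Integration.integral_combine) (use F cr[OF y] v_int in auto)
  then have d: "integral {a..c y} (\<lambda>t. v (y, t)) - integral {a..\<kappa>} (\<lambda>t. v (y, t))
     = - integral {c y..\<kappa>} (\<lambda>t. v (y, t))" by linarith
  have e: "y * (integral {a..c y} (\<lambda>t. v (y, t)) - integral {a..\<kappa>} (\<lambda>t. v (y, t)))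
     = - integral {c y..\<kappa>} (\<lambda>t. y * v (y, t))" unfolding d by simp
  have "integral {c y..\<kappa>} (\<lambda>t. (T y - t) / 4) \<le> integral {c y..\<kappa>} (\<lambda>t. y * v (y, t))"
  proof (rule integral_le)
    show "(T y - t) / 4 \<le> y * v (y, t)" if "t \<in> {c y..\<kappa>}" for t
      using mono[OF y, of "c y" t] that k cr[OF y] lev[OF y] by (auto simp: T_def)
  qed (auto intro!: integrable_continuous_real continuous_intros continuous_on_slice v)
  then show ?thesis unfolding e linear_integral[OF F] by simp
qed

private lemma K_integral:
  assumes "y1 \<le> y" "y \<le> y'" "y' \<le> y2"
  shows "integral {y..y'} (\<lambda>\<eta>. K \<eta> \<kappa>) = (T y' - \<kappa>)\<^sup>2 / (8 * y') - (T y - \<kappa>)\<^sup>2 / (8 * y)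
     + 2 * integral {y..y'} (\<lambda>\<eta>. (v (\<eta>, \<kappa>))\<^sup>2) - 4 * m * integral {y..y'} (\<lambda>\<eta>. \<eta> * V \<eta>)"
proof -
  have nz: "x \<noteq> 0" if "x \<in> {y..y'}" for x using zero assms that by auto
  have h1: "((\<lambda>\<eta>. (T \<eta> - \<kappa>) * m - (T \<eta> - \<kappa>)\<^sup>2 / (8 * \<eta>\<^sup>2)) has_integral
      (T y' - \<kappa>)\<^sup>2 / (8 * y') - (T y - \<kappa>)\<^sup>2 / (8 * y)) {y..y'}"
  proof (rule fundamental_theorem_of_calculus[OF assms(2)])
    fix x assume x: "x \<in> {y..y'}"
    have "((\<lambda>\<eta>. (T \<eta> - \<kappa>)\<^sup>2 / (8 * \<eta>)) has_real_derivative (T x - \<kappa>) * m - (T x - \<kappa>)\<^sup>2 / (8 * x\<^sup>2)) (at x within {y..y'})"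
      unfolding T_def using nz[OF x]
      by (auto intro!: derivative_eq_intros simp: field_simps power2_eq_square)
    then show "((\<lambda>\<eta>. (T \<eta> - \<kappa>)\<^sup>2 / (8 * \<eta>)) has_vector_derivative (T x - \<kappa>) * m - (T x - \<kappa>)\<^sup>2 / (8 * x\<^sup>2)) (at x within {y..y'})"
      by (simp add: has_real_derivative_iff_has_vector_derivative)
  qed
  have h2: "((\<lambda>\<eta>. (v (\<eta>, \<kappa>))\<^sup>2) has_integral integral {y..y'} (\<lambda>\<eta>. (v (\<eta>, \<kappa>))\<^sup>2)) {y..y'}"
    by (intro integrable_integral integrable_continuous_real continuous_intros continuous_on_slice v)
  have h3: "((\<lambda>\<eta>. \<eta> * V \<eta>) has_integral integral {y..y'} (\<lambda>\<eta>. \<eta> * V \<eta>)) {y..y'}"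
    by (intro integrable_integral integrable_continuous_real continuous_intros V_cont)
  have "((\<lambda>\<eta>. K \<eta> \<kappa>) has_integral (T y' - \<kappa>)\<^sup>2 / (8 * y') - (T y - \<kappa>)\<^sup>2 / (8 * y)
     + 2 * integral {y..y'} (\<lambda>\<eta>. (v (\<eta>, \<kappa>))\<^sup>2) - 4 * m * integral {y..y'} (\<lambda>\<eta>. \<eta> * V \<eta>)) {y..y'}"
    unfolding K_def
    by (rule has_integral_diff[OF has_integral_add[OF h1 has_integral_mult_right[OF h2]] has_integral_mult_right[OF h3]])
  then show ?thesis by (rule integral_unique)
qed

private lemma K_zero: "y \<in> {y1..y2} \<Longrightarrow> K y (c y) = 0"
proof -
  assume y: "y \<in> {y1..y2}"
  then have "y \<noteq> 0" using zero by auto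
  then show "K y (c y) = 0" unfolding K_def level[OF y, symmetric] by (simp add: V_def power2_eq_square field_simps)
qed

private lemma K_cont: "continuous_on ({y1..y2} \<times> {a..d}) (\<lambda>p. K (fst p) (snd p))"
proof -
  have "continuous_on ({y1..y2} \<times> {a..d}) (\<lambda>p. v (fst p, snd p))"
    "continuous_on ({y1..y2} \<times> {a..d}) (\<lambda>p. V (fst p))"
    by (intro continuous_on_compose2[OF v] continuous_on_compose2[OF V_cont[of UNIV]] continuous_intros subset_UNIV)+
  then show ?thesis unfolding K_def T_def by (intro continuous_intros) (use zero in auto)
qed

private lemma RN_sets [measurable]: "R y y' \<in> sets borel" "N \<omega> y y' \<in> sets borel"
proof -
  have [measurable]: "c \<in> borel_measurable borel" by (rule borel_measurable_continuous_onI[OF c])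
  have "Measurable.pred borel (\<lambda>p. y < fst p \<and> fst p \<le> y' \<and> a < snd p \<and> snd p \<le> c (fst p))" by measurable
  then show "R y y' \<in> sets borel" unfolding R_def by (simp add: pred_def)
  have "Measurable.pred borel (\<lambda>p. y < fst p \<and> fst p \<le> y' \<and> a < snd p \<and> snd p \<le> d \<and> \<bar>snd p - c (fst p)\<bar> \<le> \<omega>)" by measurable
  then show "N \<omega> y y' \<in> sets borel" unfolding N_def by (simp add: pred_def)
qed

private lemma RN_sub:
  assumes "y1 \<le> y" "y' \<le> y2"
  shows "R y y' \<subseteq> {y1..y2} \<times> {a..d}" "N \<omega> y y' \<subseteq> {y1..y2} \<times> {a..d}"
proof -
  show "R y y' \<subseteq> {y1..y2} \<times> {a..d}"
  proof
    fix p assume p: "p \<in> R y y'"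
    then have "fst p \<in> {y1..y2}" using assms by (auto simp: R_def)
    then show "p \<in> {y1..y2} \<times> {a..d}" using p cr[of "fst p"] by (auto simp: R_def mem_Times_iff)
  qed
qed (use assms in \<open>auto simp: N_def\<close>)

text \<open>On a thin column the region below the curve is compared with the boxes of heights
  \<open>c y\<close> and \<open>c y'\<close>. In the box law for either height, the defect of the
  claimed value is an integral of K plus exactly the quantity whose sign is given by
  \<open>pivot\<close>; the two signs enclose the flux.\<close>

private lemma one_step:
  assumes y: "y1 \<le> y" "y \<le> y'" "y' \<le> y2"
    and om: "\<And>\<eta>. \<eta> \<in> {y..y'} \<Longrightarrow> \<bar>c \<eta> - c y\<bar> \<le> \<omega> \<and> \<bar>c \<eta> - c y'\<bar> \<le> \<omega>"
    and ep: "\<And>\<eta>. \<eta> \<in> {y..y'} \<Longrightarrow> \<bar>K \<eta> (c y)\<bar> \<le> \<epsilon> \<and> \<bar>K \<eta> (c y')\<bar> \<le> \<epsilon>"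
  shows "\<bar>(LINT p:R y y'|lborel. w p) - Q y y'\<bar> \<le> (LINT p:N \<omega> y y'|lborel. \<bar>w p\<bar>) + \<epsilon> * (y' - y)"
proof -
  let ?L = "(LINT p:R y y'|lborel. w p)" and ?E = "(LINT p:N \<omega> y y'|lborel. \<bar>w p\<bar>)"
  have yy: "y \<in> {y1..y2}" "y' \<in> {y1..y2}" using y by auto
  have nz: "y \<noteq> 0" "y' \<noteq> 0" using zero yy by auto
  have B: "\<bar>?L - (LINT p:{y<..y'} \<times> {a<..\<kappa>}|lborel. w p)\<bar> \<le> ?E" if "\<kappa> = c y \<or> \<kappa> = c y'" for \<kappa>
  proof (rule set_integral_symdiff_le[OF wi])
    have k: "a \<le> \<kappa>" "\<kappa> \<le> d" using that cr yy by auto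
    show "R y y' \<in> sets lborel" "N \<omega> y y' \<in> sets lborel" by auto
    show "{y<..y'} \<times> {a<..\<kappa>} \<in> sets lborel" by (simp add: borel_Times)
    show "R y y' \<subseteq> {y1..y2} \<times> {a..d}" "N \<omega> y y' \<subseteq> {y1..y2} \<times> {a..d}" using RN_sub y by auto
    show "{y<..y'} \<times> {a<..\<kappa>} \<subseteq> {y1..y2} \<times> {a..d}" using y k by auto
    have o: "\<bar>c \<eta> - \<kappa>\<bar> \<le> \<omega>" if "\<eta> \<in> {y..y'}" for \<eta> using om[OF that] \<open>\<kappa> = c y \<or> \<kappa> = c y'\<close> by auto
    have cd: "c \<eta> \<le> d" if "\<eta> \<in> {y..y'}" for \<eta> using cr[of \<eta>] that y by auto
    show "R y y' - {y<..y'} \<times> {a<..\<kappa>} \<subseteq> N \<omega> y y'"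
    proof
      fix p assume "p \<in> R y y' - {y<..y'} \<times> {a<..\<kappa>}"
      then show "p \<in> N \<omega> y y'" using o[of "fst p"] cd[of "fst p"] by (auto simp: R_def N_def mem_Times_iff)
    qed
    show "{y<..y'} \<times> {a<..\<kappa>} - R y y' \<subseteq> N \<omega> y y'"
    proof
      fix p assume "p \<in> {y<..y'} \<times> {a<..\<kappa>} - R y y'"
      then show "p \<in> N \<omega> y y'" using o[of "fst p"] k by (auto simp: R_def N_def mem_Times_iff)
    qed
  qed
  have Kb: "\<bar>integral {y..y'} (\<lambda>\<eta>. K \<eta> \<kappa>)\<bar> \<le> \<epsilon> * (y' - y)" if "\<kappa> = c y \<or> \<kappa> = c y'" for \<kappa>
  proof -
    have k: "a \<le> \<kappa>" "\<kappa> \<le> d" using that cr yy by auto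
    have "continuous_on {y..y'} (\<lambda>\<eta>. K (fst (\<eta>, \<kappa>)) (snd (\<eta>, \<kappa>)))"
      by (rule continuous_on_compose2[OF K_cont, of _ "\<lambda>\<eta>. (\<eta>, \<kappa>)"]) (use y k in \<open>auto intro!: continuous_intros\<close>)
    then show ?thesis
      using integral_bound[OF y(2), of "\<lambda>\<eta>. K \<eta> \<kappa>" \<epsilon>] ep that by auto
  qed
  \<comment> \<open>The height taken on the left is tested by \<open>pivot\<close> on the right side
    of the column, and in \<open>lo\<close> conversely; this crossing produces the opposite
    signs.\<close>
  have up: "y' * (Q y y' - (LINT p:{y<..y'} \<times> {a<..c y}|lborel. w p) - integral {y..y'} (\<lambda>\<eta>. K \<eta> (c y))) \<le> 0"
  proof -
    have l: "(LINT p:{y<..y'} \<times> {a<..c y}|lborel. w p)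
     = integral {a..c y} (\<lambda>t. v (y', t)) - integral {a..c y} (\<lambda>t. v (y, t))
       - 2 * (integral {y..y'} (\<lambda>y'. (v (y', c y))\<^sup>2) - integral {y..y'} (\<lambda>y. (v (y, a))\<^sup>2))"
      using law[of y y' a "c y"] y cr[OF yy(1)] by (simp add: box_law_def)
    have "Q y y' - (LINT p:{y<..y'} \<times> {a<..c y}|lborel. w p) - integral {y..y'} (\<lambda>\<eta>. K \<eta> (c y))
      = (integral {a..c y'} (\<lambda>t. v (y', t)) - integral {a..c y} (\<lambda>t. v (y', t)))
        - ((T y' - c y)\<^sup>2 - (T y' - c y')\<^sup>2) / (8 * y')"
      unfolding Q_def \<Phi>_def l K_integral[OF y] level2[OF yy(1)] level2[OF yy(2)]
      by (simp add: algebra_simps diff_divide_distrib)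
    also have "y' * \<dots> = y' * (integral {a..c y'} (\<lambda>t. v (y', t)) - integral {a..c y} (\<lambda>t. v (y', t)))
        - ((T y' - c y)\<^sup>2 - (T y' - c y')\<^sup>2) / 8"
      unfolding right_diff_distrib using nz by simp
    also have "\<dots> \<le> 0" using pivot[OF yy(2), of "c y"] cr[OF yy(1)] by simp
    finally show ?thesis .
  qed
  have lo: "y * (Q y y' - (LINT p:{y<..y'} \<times> {a<..c y'}|lborel. w p) - integral {y..y'} (\<lambda>\<eta>. K \<eta> (c y'))) \<ge> 0"
  proof -
    have l: "(LINT p:{y<..y'} \<times> {a<..c y'}|lborel. w p)
     = integral {a..c y'} (\<lambda>t. v (y', t)) - integral {a..c y'} (\<lambda>t. v (y, t))
       - 2 * (integral {y..y'} (\<lambda>y. (v (y, c y'))\<^sup>2) - integral {y..y'} (\<lambda>y. (v (y, a))\<^sup>2))"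
      using law[of y y' a "c y'"] y cr[OF yy(2)] by (simp add: box_law_def)
    have "Q y y' - (LINT p:{y<..y'} \<times> {a<..c y'}|lborel. w p) - integral {y..y'} (\<lambda>\<eta>. K \<eta> (c y'))
      = - (integral {a..c y} (\<lambda>t. v (y, t)) - integral {a..c y'} (\<lambda>t. v (y, t)))
        + ((T y - c y')\<^sup>2 - (T y - c y)\<^sup>2) / (8 * y)"
      unfolding Q_def \<Phi>_def l K_integral[OF y] level2[OF yy(1)] level2[OF yy(2)]
      by (simp add: algebra_simps diff_divide_distrib)
    also have "y * \<dots> = - (y * (integral {a..c y} (\<lambda>t. v (y, t)) - integral {a..c y'} (\<lambda>t. v (y, t))))
        + ((T y - c y')\<^sup>2 - (T y - c y)\<^sup>2) / 8"
    proof -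
      have "y * (- a + b / (8 * y)) = - (y * a) + b / 8" for a b
        using nz by (simp add: field_simps)
      then show ?thesis .
    qed
    also have "\<dots> \<ge> 0" using pivot[OF yy(1), of "c y'"] cr[OF yy(2)] by simp
    finally show ?thesis .
  qed
  \<comment> \<open>Dividing by y exchanges the upper and the lower bound when y is negative; the
    enclosure is the same.\<close>
  show ?thesis
  proof (cases "y > 0")
    case True
    then have "y' > 0" using y by simp
    then have "Q y y' \<le> (LINT p:{y<..y'} \<times> {a<..c y}|lborel. w p) + integral {y..y'} (\<lambda>\<eta>. K \<eta> (c y))"
      "Q y y' \<ge> (LINT p:{y<..y'} \<times> {a<..c y'}|lborel. w p) + integral {y..y'} (\<lambda>\<eta>. K \<eta> (c y'))"
      using up lo True by (auto simp: mult_le_0_iff zero_le_mult_iff)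
    then show ?thesis using B[of "c y"] B[of "c y'"] Kb[of "c y"] Kb[of "c y'"] by (simp add: abs_le_iff)
  next
    case False
    then have "y < 0" "y' < 0" using zero y nz by (auto simp: not_less)
    then have "Q y y' \<ge> (LINT p:{y<..y'} \<times> {a<..c y}|lborel. w p) + integral {y..y'} (\<lambda>\<eta>. K \<eta> (c y))"
      "Q y y' \<le> (LINT p:{y<..y'} \<times> {a<..c y'}|lborel. w p) + integral {y..y'} (\<lambda>\<eta>. K \<eta> (c y'))"
      using up lo by (auto simp: mult_le_0_iff zero_le_mult_iff)
    then show ?thesis using B[of "c y"] B[of "c y'"] Kb[of "c y"] Kb[of "c y'"] by (simp add: abs_le_iff)
  qed
qed

text \<open>Bisection: an estimate that holds on all short columns and whose error is additive over
  adjacent columns holds on the whole interval. Here both error terms are additive, so the number of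
  columns never enters.\<close>

private lemma all_steps:
  assumes y12: "y1 \<le> y2" and ep: "\<epsilon> > 0" and om: "\<omega> > 0"
  shows "\<bar>(LINT p:R y1 y2|lborel. w p) - Q y1 y2\<bar> \<le> (LINT p:N \<omega> y1 y2|lborel. \<bar>w p\<bar>) + \<epsilon> * (y2 - y1)"
proof -
  have "uniformly_continuous_on ({y1..y2} \<times> {a..d}) (\<lambda>p. K (fst p) (snd p))"
    by (rule compact_uniformly_continuous[OF K_cont]) (intro compact_Times compact_Icc)
  then obtain \<delta> where \<delta>: "\<delta> > 0" "\<And>p q. p \<in> {y1..y2} \<times> {a..d} \<Longrightarrow> q \<in> {y1..y2} \<times> {a..d} \<Longrightarrow> dist q p < \<delta>
     \<Longrightarrow> dist (K (fst q) (snd q)) (K (fst p) (snd p)) < \<epsilon>"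
    unfolding uniformly_continuous_on_def using ep by metis
  have "uniformly_continuous_on {y1..y2} c"
    by (rule compact_uniformly_continuous[OF continuous_on_subset[OF c]]) auto
  \<comment> \<open>Oscillation below \<omega> confines the difference between region and box to the
    neighbourhood N of the curve; oscillation below \<delta> keeps K, zero on the curve, below
    \<epsilon>.\<close>
  moreover have "min \<omega> \<delta> > 0" using om \<delta> by simp
  ultimately obtain \<theta> where \<theta>: "\<theta> > 0" "\<And>p q. p \<in> {y1..y2} \<Longrightarrow> q \<in> {y1..y2} \<Longrightarrow> dist q p < \<theta>
     \<Longrightarrow> dist (c q) (c p) < min \<omega> \<delta>"
    unfolding uniformly_continuous_on_def by metis
  define P where "P y y' \<longleftrightarrow> (y1 \<le> y \<and> y' \<le> y2 \<longrightarrow>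
     \<bar>(LINT p:R y y'|lborel. w p) - Q y y'\<bar> \<le> (LINT p:N \<omega> y y'|lborel. \<bar>w p\<bar>) + \<epsilon> * (y' - y))" for y y'
  have "P y1 y2"
  proof (rule Bolzano[OF y12])
    fix y y' y'' assume *: "P y y'" "P y' y''" "y \<le> y'" "y' \<le> y''"
    show "P y y''" unfolding P_def
    proof (intro impI)
      assume b: "y1 \<le> y \<and> y'' \<le> y2"
      have si: "set_integrable lborel (R s t) w" "set_integrable lborel (N \<omega> s t) (\<lambda>p. \<bar>w p\<bar>)"
        if "y1 \<le> s" "t \<le> y2" for s t
        using RN_sub[OF that] by (auto intro!: set_integrable_subset[OF wi] set_integrable_abs)
      have "R y y'' = R y y' \<union> R y' y''" "R y y' \<inter> R y' y'' = {}"
         "N \<omega> y y'' = N \<omega> y y' \<union> N \<omega> y' y''" "N \<omega> y y' \<inter> N \<omega> y' y'' = {}"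
        using * by (auto simp: R_def N_def)
      then have 1: "(LINT p:R y y''|lborel. w p) = (LINT p:R y y'|lborel. w p) + (LINT p:R y' y''|lborel. w p)"
        "(LINT p:N \<omega> y y''|lborel. \<bar>w p\<bar>) = (LINT p:N \<omega> y y'|lborel. \<bar>w p\<bar>) + (LINT p:N \<omega> y' y''|lborel. \<bar>w p\<bar>)"
        using si b * by (auto intro!: set_integral_Un)
      have ic: "integral {y..y'} f + integral {y'..y''} f = integral {y..y''} f" if "continuous_on UNIV f" for f :: "real \<Rightarrow> real"
        by (rule Henstock_Kurzweil_Integration.integral_combine)
           (use * in \<open>auto intro!: integrable_continuous_real continuous_on_subset[OF that]\<close>)
      have "Q y y'' = Q y y' + Q y' y''"
      proof -
        have "continuous_on UNIV (\<lambda>y. y * V y)" "continuous_on UNIV (\<lambda>y. (v (y, a))\<^sup>2)"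
          by (intro continuous_intros continuous_on_slice[OF v] V_cont)+
        from this[THEN ic] show ?thesis unfolding Q_def by (simp flip: distrib_left add: algebra_simps)
      qed
      then show "\<bar>(LINT p:R y y''|lborel. w p) - Q y y''\<bar> \<le> (LINT p:N \<omega> y y''|lborel. \<bar>w p\<bar>) + \<epsilon> * (y'' - y)"
        using *(1,2) b *(3,4) unfolding P_def 1 by (auto simp: algebra_simps abs_le_iff)
    qed
  next
    fix x assume "y1 \<le> x" "x \<le> y2"
    show "\<exists>r>0. \<forall>y y'. y \<le> x \<and> x \<le> y' \<and> y' - y < r \<longrightarrow> P y y'"
    proof (intro exI[of _ "\<theta>"] conjI allI impI \<theta>(1))
      fix y y' assume yy: "y \<le> x \<and> x \<le> y' \<and> y' - y < \<theta>"
      show "P y y'" unfolding P_def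
      proof (intro impI one_step)
        assume b: "y1 \<le> y \<and> y' \<le> y2"
        then show "y1 \<le> y" "y \<le> y'" "y' \<le> y2" using yy by auto
        fix \<eta> assume \<eta>: "\<eta> \<in> {y..y'}"
        have 1: "dist (c \<eta>) (c s) < min \<omega> \<delta>" if "s = y \<or> s = y'" for s
          by (rule \<theta>(2)) (use that \<eta> yy b in \<open>auto simp: dist_real_def\<close>)
        then show "\<bar>c \<eta> - c y\<bar> \<le> \<omega> \<and> \<bar>c \<eta> - c y'\<bar> \<le> \<omega>" by (fastforce simp: dist_real_def)
        have "\<bar>K \<eta> (c s)\<bar> \<le> \<epsilon>" if "s = y \<or> s = y'" for s
        proof -
          have "dist (K (fst (\<eta>, c s)) (snd (\<eta>, c s))) (K (fst (\<eta>, c \<eta>)) (snd (\<eta>, c \<eta>))) < \<epsilon>"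
            by (rule \<delta>(2)) (use 1[OF that] cr that \<eta> b yy in \<open>auto simp: dist_prod_def dist_commute\<close>)
          then show ?thesis using K_zero[of \<eta>] \<eta> b by (simp add: dist_real_def)
        qed
        then show "\<bar>K \<eta> (c y)\<bar> \<le> \<epsilon> \<and> \<bar>K \<eta> (c y')\<bar> \<le> \<epsilon>" by blast
      qed
    qed
  qed
  then show ?thesis by (simp add: P_def)
qed

text \<open>The neighbourhoods N shrink to the graph of c, a null set, so both errors of
  \<open>all_steps\<close> tend to zero. Neither v nor c is ever differentiated.\<close>

lemma level_curve_flux:
  assumes y12: "y1 \<le> y2"
  shows "(LINT p:{p. y1 < fst p \<and> fst p \<le> y2 \<and> a < snd p \<and> snd p \<le> c (fst p)}|lborel. w p)
    = (integral {a..c y2} (\<lambda>t. v (y2, t)) + 2 * y2 * (v (y2, c y2))\<^sup>2)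
      - (integral {a..c y1} (\<lambda>t. v (y1, t)) + 2 * y1 * (v (y1, c y1))\<^sup>2)
      - 4 * m * integral {y1..y2} (\<lambda>y. y * v (y, c y)) + 2 * integral {y1..y2} (\<lambda>y. (v (y, a))\<^sup>2)"
proof -
  note [measurable] = w
  have [measurable]: "c \<in> borel_measurable borel" by (rule borel_measurable_continuous_onI[OF c])
  have nul: "AE p in lborel. snd p \<noteq> c (fst p)"
  proof -
    have "AE p in (lborel :: real measure) \<Otimes>\<^sub>M (lborel :: real measure). snd p \<noteq> c (fst p)"
    proof (rule lborel_pair.AE_pair_measure)
      show "{p \<in> space ((lborel :: real measure) \<Otimes>\<^sub>M (lborel :: real measure)). snd p \<noteq> c (fst p)} \<in> sets (lborel \<Otimes>\<^sub>M lborel)"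
        by measurable
      show "AE x in (lborel :: real measure). AE y in (lborel :: real measure). snd (x, y) \<noteq> c (fst (x, y))"
        by (rule AE_I2) (simp add: AE_lborel_singleton)
    qed
    then show ?thesis unfolding lborel_prod .
  qed
  have "(\<lambda>n. LINT p:N (1 / real (Suc n)) y1 y2|lborel. \<bar>w p\<bar>) \<longlonglongrightarrow> (\<integral>p. 0 \<partial>(lborel :: (real \<times> real) measure))"
    unfolding set_lebesgue_integral_def
  proof (rule integral_dominated_convergence[where w="\<lambda>p. indicator ({y1..y2} \<times> {a..d}) p *\<^sub>R \<bar>w p\<bar>"])
    show "integrable lborel (\<lambda>p. indicator ({y1..y2} \<times> {a..d}) p *\<^sub>R \<bar>w p\<bar>)"
      using set_integrable_abs[OF wi] by (simp add: set_integrable_def)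
    show "AE p in lborel. norm (indicator (N (1 / real (Suc n)) y1 y2) p *\<^sub>R \<bar>w p\<bar>)
        \<le> indicator ({y1..y2} \<times> {a..d}) p *\<^sub>R \<bar>w p\<bar>" for n
    proof (rule AE_I2)
      fix p
      show "norm (indicator (N (1 / real (Suc n)) y1 y2) p *\<^sub>R \<bar>w p\<bar>)
        \<le> indicator ({y1..y2} \<times> {a..d}) p *\<^sub>R \<bar>w p\<bar>"
        using RN_sub(2)[of y1 y2 "1 / real (Suc n)"] by (auto simp: indicator_def)
    qed
    show "AE p in lborel. (\<lambda>n. indicator (N (1 / real (Suc n)) y1 y2) p *\<^sub>R \<bar>w p\<bar>) \<longlonglongrightarrow> 0"
      using nul
    proof eventually_elim
      case (elim p)
      have "(\<lambda>n. 1 / real (Suc n)) \<longlonglongrightarrow> 0" using LIMSEQ_Suc[OF lim_const_over_n[of 1]] by simp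
      then have "\<forall>\<^sub>F n in sequentially. 1 / real (Suc n) < \<bar>snd p - c (fst p)\<bar>"
        using elim by (intro order_tendstoD) auto
      then have "\<forall>\<^sub>F n in sequentially. indicator (N (1 / real (Suc n)) y1 y2) p *\<^sub>R \<bar>w p\<bar> = 0"
        by eventually_elim (auto simp: N_def indicator_def)
      then show ?case by (rule tendsto_eventually)
    qed
  qed (auto intro!: borel_measurable_times borel_measurable_indicator)
  then have E0: "(\<lambda>n. (LINT p:N (1 / real (Suc n)) y1 y2|lborel. \<bar>w p\<bar>) + 1 / real (Suc n) * (y2 - y1)) \<longlonglongrightarrow> 0 + 0 * (y2 - y1)"
    using LIMSEQ_Suc[OF lim_const_over_n[of 1]] by (intro tendsto_intros) auto
  have "\<bar>(LINT p:R y1 y2|lborel. w p) - Q y1 y2\<bar> \<le> 0 + 0 * (y2 - y1)"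
  proof (rule LIMSEQ_le_const[OF E0], intro exI allI impI)
    fix n show "\<bar>(LINT p:R y1 y2|lborel. w p) - Q y1 y2\<bar>
      \<le> (LINT p:N (1 / real (Suc n)) y1 y2|lborel. \<bar>w p\<bar>) + 1 / real (Suc n) * (y2 - y1)"
      by (rule all_steps[OF y12]) auto
  qed
  then show ?thesis by (simp add: Q_def \<Phi>_def R_def V_def)
qed

end

section \<open>Box laws across the boundary of the domain\<close>

context
  fixes tb L :: real and g1 g2 :: "real \<Rightarrow> real" and z z2 f :: "real \<times> real \<Rightarrow> real"
  assumes L: "L \<ge> 0"
    and lip: "\<And>s t. s \<in> {0..tb} \<Longrightarrow> t \<in> {0..tb} \<Longrightarrow> \<bar>g1 s - g1 t\<bar> \<le> L * \<bar>s - t\<bar>"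
      "\<And>s t. s \<in> {0..tb} \<Longrightarrow> t \<in> {0..tb} \<Longrightarrow> \<bar>g2 s - g2 t\<bar> \<le> L * \<bar>s - t\<bar>"
    and ends: "g1 0 = 0" "g1 tb = 0" "g2 0 = 0" "g2 tb = 0"
    and g12: "\<And>t. t \<in> {0..tb} \<Longrightarrow> g1 t \<le> g2 t"
    and z: "continuous_on UNIV z" and z2: "continuous_on UNIV z2"
    and z0: "\<And>p. p \<notin> domD tb g1 g2 \<Longrightarrow> z p = 0" and z20: "\<And>p. p \<notin> domD tb g1 g2 \<Longrightarrow> z2 p = 0"
    and f: "integrable lborel f" and f0: "\<And>p. p \<notin> domD tb g1 g2 \<Longrightarrow> f p = 0"
begin

text \<open>The defect of the box law; it is additive under cutting a box in either direction, and
  the aim is to show that it vanishes on boxes that leave the domain.\<close>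

private definition "Fl y y' t t' = (LINT p:{y<..y'} \<times> {t<..t'}|lborel. f p)
   - (integral {t..t'} (\<lambda>t. z (y', t)) - integral {t..t'} (\<lambda>t. z (y, t))
      - 2 * (integral {y..y'} (\<lambda>y. z2 (y, t')) - integral {y..y'} (\<lambda>y. z2 (y, t))))"

private lemma f_set: "A \<in> sets borel \<Longrightarrow> set_integrable lborel A f"
  unfolding set_integrable_def by (intro integrable_mult_indicator f) simp

private lemma Ioc_sets [measurable]: "{y<..y'} \<times> {t<..t'} \<in> sets (borel :: (real \<times> real) measure)"
  by (simp add: borel_Times)

private lemma integral_glue:
  fixes h :: "real \<Rightarrow> real"
  assumes "continuous_on UNIV h" "a \<le> b" "b \<le> c"
  shows "integral {a..c} h = integral {a..b} h + integral {b..c} h"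
  by (rule Henstock_Kurzweil_Integration.integral_combine[symmetric])
     (use assms in \<open>auto intro!: integrable_continuous_real continuous_on_subset[OF assms(1)]\<close>)

private lemma Fl_split_y:
  assumes "y \<le> x" "x \<le> y'" shows "Fl y y' t t' = Fl y x t t' + Fl x y' t t'"
proof -
  have "{y<..y'} \<times> {t<..t'} = {y<..x} \<times> {t<..t'} \<union> {x<..y'} \<times> {t<..t'}"
    "({y<..x} \<times> {t<..t'}) \<inter> ({x<..y'} \<times> {t<..t'}) = {}" using assms by auto
  then have "(LINT p:{y<..y'} \<times> {t<..t'}|lborel. f p) = (LINT p:{y<..x} \<times> {t<..t'}|lborel. f p) + (LINT p:{x<..y'} \<times> {t<..t'}|lborel. f p)"
    by (simp add: set_integral_Un f_set)
  then show ?thesis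
    unfolding Fl_def integral_glue[OF continuous_on_slice(2)[OF z2] assms] by (simp add: algebra_simps)
qed

private lemma Fl_split_t:
  assumes "t \<le> x" "x \<le> t'" shows "Fl y y' t t' = Fl y y' t x + Fl y y' x t'"
proof -
  have "{y<..y'} \<times> {t<..t'} = {y<..y'} \<times> {t<..x} \<union> {y<..y'} \<times> {x<..t'}"
    "({y<..y'} \<times> {t<..x}) \<inter> ({y<..y'} \<times> {x<..t'}) = {}" using assms by auto
  then have "(LINT p:{y<..y'} \<times> {t<..t'}|lborel. f p) = (LINT p:{y<..y'} \<times> {t<..x}|lborel. f p) + (LINT p:{y<..y'} \<times> {x<..t'}|lborel. f p)"
    by (simp add: set_integral_Un f_set)
  then show ?thesis
    unfolding Fl_def integral_glue[OF continuous_on_slice(1)[OF z] assms] by (simp add: algebra_simps)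
qed

private lemma Fl_bound:
  assumes "y \<le> y'" "t \<le> t'" and e: "\<And>x s. x \<in> {y..y'} \<Longrightarrow> s \<in> {t..t'} \<Longrightarrow> \<bar>z (x, s)\<bar> \<le> e \<and> \<bar>z2 (x, s)\<bar> \<le> e"
    and A: "A \<in> sets borel" "{y<..y'} \<times> {t<..t'} \<inter> domD tb g1 g2 \<subseteq> A"
  shows "\<bar>Fl y y' t t'\<bar> \<le> (LINT p:A|lborel. \<bar>f p\<bar>) + 2 * (t' - t) * e + 4 * (y' - y) * e"
proof -
  have iz: "\<bar>integral {t..t'} (\<lambda>t. z (x, t))\<bar> \<le> e * (t' - t)" if "x \<in> {y..y'}" for x
    using integral_bound[OF assms(2) continuous_on_slice(1)[OF z], of x e] e that by auto
  have iz2: "\<bar>integral {y..y'} (\<lambda>y. z2 (y, s))\<bar> \<le> e * (y' - y)" if "s \<in> {t..t'}" for s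
    using integral_bound[OF assms(1) continuous_on_slice(2)[OF z2], of s e] e that by auto
  have "\<bar>LINT p:{y<..y'} \<times> {t<..t'}|lborel. f p\<bar> \<le> (\<integral>p. norm (indicator ({y<..y'} \<times> {t<..t'}) p *\<^sub>R f p) \<partial>lborel)"
    using integral_norm_bound[of lborel "\<lambda>p. indicator ({y<..y'} \<times> {t<..t'}) p *\<^sub>R f p"]
    by (simp only: set_lebesgue_integral_def real_norm_def)
  also have "\<dots> \<le> (\<integral>p. indicator A p *\<^sub>R \<bar>f p\<bar> \<partial>lborel)"
  proof (rule Bochner_Integration.integral_mono)
    show "integrable lborel (\<lambda>p. norm (indicator ({y<..y'} \<times> {t<..t'}) p *\<^sub>R f p))"
      by (intro integrable_norm integrable_mult_indicator f) auto
    show "integrable lborel (\<lambda>p. indicator A p *\<^sub>R \<bar>f p\<bar>)"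
      by (intro integrable_mult_indicator integrable_abs f) (use A in auto)
    show "norm (indicator ({y<..y'} \<times> {t<..t'}) p *\<^sub>R f p) \<le> indicator A p *\<^sub>R \<bar>f p\<bar>" for p
      using A(2) f0[of p] by (auto simp: indicator_def)
  qed
  finally have "\<bar>LINT p:{y<..y'} \<times> {t<..t'}|lborel. f p\<bar> \<le> (LINT p:A|lborel. \<bar>f p\<bar>)"
    by (simp add: set_lebesgue_integral_def)
  then show ?thesis using iz[of y] iz[of y'] iz2[of t] iz2[of t'] assms(1,2) unfolding Fl_def
    by (auto simp: abs_le_iff algebra_simps)
qed

private definition "near r = {p \<in> domD tb g1 g2. \<bar>fst p - g1 (snd p)\<bar> \<le> r \<or> \<bar>fst p - g2 (snd p)\<bar> \<le> r}"

private lemma gc: "continuous_on {0..tb} g1" "continuous_on {0..tb} g2"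
proof -
  have "L-lipschitz_on {0..tb} g1" "L-lipschitz_on {0..tb} g2"
    using lip L by (auto simp: lipschitz_on_def dist_real_def)
  then show "continuous_on {0..tb} g1" "continuous_on {0..tb} g2" by (auto intro: lipschitz_on_continuous_on)
qed

private lemma near_sets [measurable]: "near r \<in> sets borel"
proof -
  have [measurable]: "(\<lambda>t. indicator {0..tb} t *\<^sub>R g1 t) \<in> borel_measurable borel"
    "(\<lambda>t. indicator {0..tb} t *\<^sub>R g2 t) \<in> borel_measurable borel"
    using borel_measurable_continuous_on_indicator[OF _ gc(1)] borel_measurable_continuous_on_indicator[OF _ gc(2)] by auto
  let ?g1 = "\<lambda>t. indicator {0..tb} t *\<^sub>R g1 t" and ?g2 = "\<lambda>t. indicator {0..tb} t *\<^sub>R g2 t"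
  have "Measurable.pred borel (\<lambda>p. 0 < snd p \<and> snd p < tb \<and> ?g1 (snd p) < fst p \<and> fst p < ?g2 (snd p) \<and>
     (\<bar>fst p - ?g1 (snd p)\<bar> \<le> r \<or> \<bar>fst p - ?g2 (snd p)\<bar> \<le> r))" (is "Measurable.pred borel ?P") by measurable
  moreover have "near r = {p. 0 < snd p \<and> snd p < tb \<and> ?g1 (snd p) < fst p \<and> fst p < ?g2 (snd p) \<and>
     (\<bar>fst p - ?g1 (snd p)\<bar> \<le> r \<or> \<bar>fst p - ?g2 (snd p)\<bar> \<le> r)}"
    by (auto simp: near_def domD_def indicator_def)
  ultimately show ?thesis by (simp only: pred_def space_borel UNIV_I simp_thms)
qed

private definition "strip t t' = {p :: real \<times> real. t < snd p \<and> snd p \<le> t'}"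

private lemma strip_sets [measurable]: "strip t t' \<in> sets borel"
proof -
  have "Measurable.pred borel (\<lambda>p :: real \<times> real. t < snd p \<and> snd p \<le> t')" by measurable
  then show ?thesis by (simp add: strip_def pred_def)
qed

text \<open>In a row of height h each boundary curve stays in a window of width (2 L + 1) h. Cells
  outside the windows lie off the domain or inside it and have no defect. In a window every point is
  within (4 L + 2) h of a point off the domain, so the boundary terms are at most e.\<close>

private lemma row:
  assumes zero: "\<And>a b c d. a \<le> b \<Longrightarrow> c \<le> d \<Longrightarrow> {a..b} \<times> {c..d} \<subseteq> domD tb g1 g2 \<Longrightarrow> Fl a b c d = 0"
    and y: "y \<le> y'" and t: "0 \<le> t" "t < t'" "t' \<le> tb" and e: "e \<ge> 0"
    and small: "\<And>p q. dist p q \<le> (4 * L + 2) * (t' - t) \<Longrightarrow> p \<notin> domD tb g1 g2 \<Longrightarrow> \<bar>z q\<bar> \<le> e \<and> \<bar>z2 q\<bar> \<le> e"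
    and r: "(4 * L + 2) * (t' - t) \<le> r"
  shows "\<bar>Fl y y' t t'\<bar> \<le> 2 * (LINT p:strip t t' \<inter> near r|lborel. \<bar>f p\<bar>) + (20 + 32 * L) * e * (t' - t)"
proof -
  define h where "h = t' - t"
  have h: "h > 0" using t by (simp add: h_def)
  \<comment> \<open>L h bounds the drift of a boundary curve over the row; the extra h on the inner
    sides puts the middle cell strictly inside the domain.\<close>
  define lm lp rm rp where "lm = g1 t - L * h" and "lp = g1 t + (L + 1) * h"
    and "rm = g2 t - (L + 1) * h" and "rp = g2 t + L * h"
  have Lh: "L * h \<ge> 0" using L h by simp
  let ?I = "(LINT p:strip t t' \<inter> near r|lborel. \<bar>f p\<bar>)"
  have I0: "?I \<ge> 0" unfolding set_lebesgue_integral_def by (rule Bochner_Integration.integral_nonneg) simp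
  have gs: "\<bar>g1 s - g1 t\<bar> \<le> L * h" "\<bar>g2 s - g2 t\<bar> \<le> L * h" if "s \<in> {t..t'}" for s
  proof -
    have "L * \<bar>s - t\<bar> \<le> L * h" using that L by (intro mult_left_mono) (auto simp: h_def)
    then show "\<bar>g1 s - g1 t\<bar> \<le> L * h" "\<bar>g2 s - g2 t\<bar> \<le> L * h"
      using lip[of s t] that t by auto
  qed
  have out: "Fl p q t t' = 0" if "p \<le> q" "q \<le> lm \<or> rp \<le> p" for p q
  proof -
    have o: "(x, s) \<notin> domD tb g1 g2" if "x \<in> {p..q}" "s \<in> {t..t'}" for x s
      using gs[OF that(2)] that(1) \<open>q \<le> lm \<or> rp \<le> p\<close> by (auto simp: domD_def lm_def rp_def)
    have "\<bar>Fl p q t t'\<bar> \<le> (LINT p:{}|lborel. \<bar>f p\<bar>) + 2 * (t' - t) * 0 + 4 * (q - p) * 0"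
      by (rule Fl_bound) (use that t z0[OF o] z20[OF o] o in auto)
    then show ?thesis by (simp add: set_lebesgue_integral_def)
  qed
  have trans: "\<bar>Fl p q t t'\<bar> \<le> ?I + (10 + 16 * L) * e * h"
    if pq: "p \<le> q" "(lm \<le> p \<and> q \<le> lp) \<or> (rm \<le> p \<and> q \<le> rp) \<or> (lm \<le> p \<and> q \<le> rp \<and> rm < lp)" for p q
  proof -
    have dst: "\<bar>x - g1 s\<bar> \<le> (4 * L + 2) * h \<or> \<bar>x - g2 s\<bar> \<le> (4 * L + 2) * h"
      if "x \<in> {p..q}" "s \<in> {t..t'}" for x s
      using pq(2)
    proof (elim disjE)
      assume "lm \<le> p \<and> q \<le> lp"
      then show ?thesis using that(1) gs[OF that(2)] Lh h by (auto simp: lm_def lp_def abs_le_iff algebra_simps)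
    next
      assume "rm \<le> p \<and> q \<le> rp"
      then show ?thesis using that(1) gs[OF that(2)] Lh h by (auto simp: rm_def rp_def abs_le_iff algebra_simps)
    next
      assume "lm \<le> p \<and> q \<le> rp \<and> rm < lp"
      then show ?thesis using that(1) gs[OF that(2)] Lh h g12[of t] t
        by (auto simp: lm_def lp_def rm_def rp_def abs_le_iff algebra_simps)
    qed
    have "\<bar>Fl p q t t'\<bar> \<le> ?I + 2 * (t' - t) * e + 4 * (q - p) * e"
    proof (rule Fl_bound)
      show "strip t t' \<inter> near r \<in> sets borel" by measurable
      show "{p<..q} \<times> {t<..t'} \<inter> domD tb g1 g2 \<subseteq> strip t t' \<inter> near r"
      proof
        fix x assume "x \<in> {p<..q} \<times> {t<..t'} \<inter> domD tb g1 g2"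
        then show "x \<in> strip t t' \<inter> near r" using dst[of "fst x" "snd x"] r
          by (auto simp: strip_def near_def h_def)
      qed
      fix x s assume xs: "x \<in> {p..q}" "s \<in> {t..t'}"
      have "(g1 s, s) \<notin> domD tb g1 g2" "(g2 s, s) \<notin> domD tb g1 g2" by (auto simp: domD_def)
      moreover have "dist (g1 s, s) (x, s) \<le> (4 * L + 2) * (t' - t) \<or> dist (g2 s, s) (x, s) \<le> (4 * L + 2) * (t' - t)"
        using dst[OF xs] by (simp add: dist_prod_def dist_real_def h_def abs_minus_commute)
      ultimately show "\<bar>z (x, s)\<bar> \<le> e \<and> \<bar>z2 (x, s)\<bar> \<le> e" using small by blast
    qed (use pq t in auto)
    moreover have "(q - p) * e \<le> ((4 * L + 2) * h) * e"
    proof (rule mult_right_mono[OF _ e])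
      show "q - p \<le> (4 * L + 2) * h" using pq(2) Lh h
        by (auto simp: lm_def lp_def rm_def rp_def algebra_simps)
    qed
    ultimately show ?thesis by (simp add: h_def algebra_simps)
  qed
  \<comment> \<open>Cutting points are clamped to [y, y'], so that cells beyond the given box become
    empty.\<close>
  define cl where "cl x = max y (min x y')" for x
  have cl: "y \<le> cl x" "cl x \<le> y'" for x using y by (auto simp: cl_def)
  have clm: "cl x \<le> cl x'" if "x \<le> x'" for x x' using that by (auto simp: cl_def)
  have F0: "Fl x x t t' = 0" for x by (simp add: Fl_def set_lebesgue_integral_def)
  have out1: "Fl y (cl lm) t t' = 0"
    by (cases "lm \<ge> y") (use out[of y "cl lm"] cl F0 in \<open>auto simp: cl_def\<close>)
  have out2: "Fl (cl rp) y' t t' = 0"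
    by (cases "rp \<le> y'") (use out[of "cl rp" y'] cl F0 in \<open>auto simp: cl_def\<close>)
  have tr: "\<bar>Fl (cl p) (cl q) t t'\<bar> \<le> ?I + (10 + 16 * L) * e * h"
    if "p \<le> q" "(lm \<le> p \<and> q \<le> lp) \<or> (rm \<le> p \<and> q \<le> rp) \<or> (lm \<le> p \<and> q \<le> rp \<and> rm < lp)" for p q
  proof (cases "cl p = cl q")
    case True
    then show ?thesis using I0 F0 e h L by simp
  next
    case False
    then have "p \<le> cl p" "cl q \<le> q" using y that(1) by (auto simp: cl_def max_def min_def split: if_splits)
    then show ?thesis using that clm[OF that(1)] by (intro trans) auto
  qed
  have lmrp: "lm \<le> rp" using g12[of t] t Lh by (auto simp: lm_def rp_def)
  show ?thesis
  proof (cases "rm < lp")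
    case True
    \<comment> \<open>If the windows overlap there is no interior cell, and a single window of width
      at most (4 L + 2) h replaces both.\<close>
    have "Fl y y' t t' = Fl y (cl lm) t t' + (Fl (cl lm) (cl rp) t t' + Fl (cl rp) y' t t')"
      using Fl_split_y[of y "cl lm" y'] Fl_split_y[of "cl lm" "cl rp" y'] cl clm lmrp by simp
    then have "\<bar>Fl y y' t t'\<bar> \<le> ?I + (10 + 16 * L) * e * h"
      using tr[of lm rp] lmrp True by (simp add: out1 out2)
    moreover have "(10 + 16 * L) * e * h \<ge> 0" using L e h by simp
    ultimately show ?thesis using I0 by (simp add: h_def algebra_simps)
  next
    case False
    have mid: "Fl (cl lp) (cl rm) t t' = 0"
    proof (cases "cl lp = cl rm")
      case True then show ?thesis by (simp add: F0)
    next
      case F: False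
      then have b: "lp \<le> cl lp" "cl rm \<le> rm" using y False by (auto simp: cl_def max_def min_def split: if_splits)
      \<comment> \<open>Both boundary curves start at 0, so at t = 0 the windows would overlap;
        likewise at the upper end.\<close>
      have t0: "0 < t"
      proof (rule ccontr)
        assume "\<not> 0 < t" then have "t = 0" using t by simp
        then show False using False Lh h ends by (simp add: lp_def rm_def algebra_simps)
      qed
      have t1: "t' < tb"
      proof (rule ccontr)
        assume "\<not> t' < tb" then have "t' = tb" using t by simp
        then show False using False Lh h ends gs[of t'] t by (auto simp: lp_def rm_def algebra_simps)
      qed
      show ?thesis
      proof (rule zero)
        show "{cl lp..cl rm} \<times> {t..t'} \<subseteq> domD tb g1 g2"
        proof
          fix p assume p: "p \<in> {cl lp..cl rm} \<times> {t..t'}"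
          then show "p \<in> domD tb g1 g2" using gs[of "snd p"] b t0 t1 h
            by (cases p) (auto simp: domD_def lp_def rm_def algebra_simps)
        qed
      qed (use clm False t in auto)
    qed
    have o: "lm \<le> lp" "lp \<le> rm" "rm \<le> rp" using False Lh h by (auto simp: lm_def lp_def rm_def rp_def algebra_simps)
    have "Fl y y' t t' = Fl y (cl lm) t t' + (Fl (cl lm) (cl lp) t t' + (Fl (cl lp) (cl rm) t t'
        + (Fl (cl rm) (cl rp) t t' + Fl (cl rp) y' t t')))"
      using Fl_split_y[of y "cl lm" y'] Fl_split_y[of "cl lm" "cl lp" y'] Fl_split_y[of "cl lp" "cl rm" y']
        Fl_split_y[of "cl rm" "cl rp" y'] cl clm o by simp
    then have "\<bar>Fl y y' t t'\<bar> \<le> 2 * (?I + (10 + 16 * L) * e * h)"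
      using tr[of lm lp] tr[of rm rp] o by (simp add: out1 out2 mid)
    then show ?thesis by (simp add: h_def algebra_simps)
  qed
qed

text \<open>The same subdivision argument, now in t: the mass near the boundary and the height are
  additive over rows. The vanishing of z and z2 off the domain becomes uniform smallness near it by
  uniform continuity.\<close>

private lemma all_rows:
  assumes zero: "\<And>a b c d. a \<le> b \<Longrightarrow> c \<le> d \<Longrightarrow> {a..b} \<times> {c..d} \<subseteq> domD tb g1 g2 \<Longrightarrow> Fl a b c d = 0"
    and y: "y \<le> y'" and t: "0 \<le> t" "t \<le> t'" "t' \<le> tb" and e: "e > 0" and r: "r > 0"
  shows "\<bar>Fl y y' t t'\<bar> \<le> 2 * (LINT p:strip t t' \<inter> near r|lborel. \<bar>f p\<bar>) + (20 + 32 * L) * e * (t' - t)"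
proof -
  have gb: "\<exists>M. \<forall>s\<in>{0..tb}. \<bar>g1 s\<bar> \<le> M \<and> \<bar>g2 s\<bar> \<le> M"
  proof -
    have "bounded (g1 ` {0..tb})" "bounded (g2 ` {0..tb})"
      by (intro compact_imp_bounded compact_continuous_image gc compact_Icc)+
    then obtain M1 M2 where M: "\<forall>x\<in>g1 ` {0..tb}. norm x \<le> M1" "\<forall>x\<in>g2 ` {0..tb}. norm x \<le> M2"
      unfolding bounded_iff by blast
    have "\<bar>g1 s\<bar> \<le> max M1 M2 \<and> \<bar>g2 s\<bar> \<le> max M1 M2" if "s \<in> {0..tb}" for s
      using M(1)[rule_format, OF imageI[OF that]] M(2)[rule_format, OF imageI[OF that]] by auto
    then show ?thesis by blast
  qed
  have uc: "\<exists>d>0. \<forall>p q. dist p q \<le> d \<longrightarrow> p \<notin> domD tb g1 g2 \<longrightarrow> \<bar>k q\<bar> \<le> e"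
    if k: "continuous_on UNIV k" and k0: "\<And>p. p \<notin> domD tb g1 g2 \<Longrightarrow> k p = 0" for k :: "real \<times> real \<Rightarrow> real"
  proof -
    obtain M where M: "\<forall>s\<in>{0..tb}. \<bar>g1 s\<bar> \<le> M \<and> \<bar>g2 s\<bar> \<le> M" using gb by blast
    define C where "C = {-M-1..M+1} \<times> {-1..tb+1}"
    have "uniformly_continuous_on C k"
      unfolding C_def by (rule compact_uniformly_continuous[OF continuous_on_subset[OF k]]) (auto intro!: compact_Times)
    then obtain d where d: "d > 0" "\<And>p q. p \<in> C \<Longrightarrow> q \<in> C \<Longrightarrow> dist q p < d \<Longrightarrow> dist (k q) (k p) < e"
      unfolding uniformly_continuous_on_def using e by metis
    show ?thesis
    proof (intro exI[of _ "min d 1 / 2"] conjI allI impI)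
      fix p q assume pq: "dist p q \<le> min d 1 / 2" "p \<notin> domD tb g1 g2"
      show "\<bar>k q\<bar> \<le> e"
      proof (cases "q \<in> domD tb g1 g2")
        case False then show ?thesis using k0 e by simp
      next
        case True
        then have q0: "snd q \<in> {0..tb}" "g1 (snd q) < fst q" "fst q < g2 (snd q)"
          by (auto simp: domD_def case_prod_unfold)
        then have q: "\<bar>fst q\<bar> \<le> M" "snd q \<in> {0..tb}" using M[rule_format, OF q0(1)] by auto
        have "dist (fst p) (fst q) \<le> 1/2" "dist (snd p) (snd q) \<le> 1/2"
          using dist_fst_le[of p q] dist_snd_le[of p q] pq by auto
        then have "\<bar>fst p - fst q\<bar> \<le> 1/2" "\<bar>snd p - snd q\<bar> \<le> 1/2" by (simp_all add: dist_real_def)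
        then have "-M-1 \<le> fst p" "fst p \<le> M+1" "-1 \<le> snd p" "snd p \<le> tb+1"
          "-M-1 \<le> fst q" "fst q \<le> M+1" "-1 \<le> snd q" "snd q \<le> tb+1"
          using q(1) q(2)[unfolded atLeastAtMost_iff] by linarith+
        then have "p \<in> C" "q \<in> C" by (simp_all add: C_def mem_Times_iff)
        then have "dist (k q) (k p) < e" using d pq by (intro d(2)) (auto simp: dist_commute)
        then show ?thesis using k0[OF pq(2)] by (simp add: dist_real_def)
      qed
    qed (use d in auto)
  qed
  obtain d1 d2 where d: "d1 > 0" "d2 > 0"
    "\<And>p q. dist p q \<le> d1 \<Longrightarrow> p \<notin> domD tb g1 g2 \<Longrightarrow> \<bar>z q\<bar> \<le> e"
    "\<And>p q. dist p q \<le> d2 \<Longrightarrow> p \<notin> domD tb g1 g2 \<Longrightarrow> \<bar>z2 q\<bar> \<le> e"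
    using uc[OF z z0] uc[OF z2 z20] by metis
  define \<delta> where "\<delta> = min r (min d1 d2) / (4 * L + 2)"
  have \<delta>: "\<delta> > 0" using d r L by (simp add: \<delta>_def)
  define P where "P t t' \<longleftrightarrow> (0 \<le> t \<and> t' \<le> tb \<longrightarrow>
     \<bar>Fl y y' t t'\<bar> \<le> 2 * (LINT p:strip t t' \<inter> near r|lborel. \<bar>f p\<bar>) + (20 + 32 * L) * e * (t' - t))" for t t'
  have "P t t'"
  proof (rule Bolzano[OF t(2)])
    fix a b c assume *: "P a b" "P b c" "a \<le> b" "b \<le> c"
    have "strip a c \<inter> near r = (strip a b \<inter> near r) \<union> (strip b c \<inter> near r)"
      "(strip a b \<inter> near r) \<inter> (strip b c \<inter> near r) = {}"
      using * by (auto simp: strip_def)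
    moreover have "set_integrable lborel (strip a b \<inter> near r) (\<lambda>p. \<bar>f p\<bar>)" for a b
      by (intro set_integrable_abs f_set) measurable
    ultimately have "(LINT p:strip a c \<inter> near r|lborel. \<bar>f p\<bar>)
       = (LINT p:strip a b \<inter> near r|lborel. \<bar>f p\<bar>) + (LINT p:strip b c \<inter> near r|lborel. \<bar>f p\<bar>)"
      by (simp add: set_integral_Un)
    then show "P a c" using * Fl_split_t[of a b c y y'] unfolding P_def
      by (auto simp: algebra_simps abs_le_iff)
  next
    fix x assume "t \<le> x" "x \<le> t'"
    show "\<exists>d>0. \<forall>a b. a \<le> x \<and> x \<le> b \<and> b - a < d \<longrightarrow> P a b"
    proof (intro exI[of _ \<delta>] conjI allI impI \<delta>)
      fix a b assume ab: "a \<le> x \<and> x \<le> b \<and> b - a < \<delta>"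
      show "P a b" unfolding P_def
      proof (intro impI)
        assume ab0: "0 \<le> a \<and> b \<le> tb"
        show "\<bar>Fl y y' a b\<bar> \<le> 2 * (LINT p:strip a b \<inter> near r|lborel. \<bar>f p\<bar>) + (20 + 32 * L) * e * (b - a)"
        proof (cases "a = b")
          case True
          have "strip b b = {}" by (auto simp: strip_def)
          then show ?thesis using True by (simp add: Fl_def set_lebesgue_integral_def)
        next
          case False
          have "(4 * L + 2) * (b - a) \<le> (4 * L + 2) * \<delta>" using ab L by (intro mult_left_mono) auto
          then have s: "(4 * L + 2) * (b - a) \<le> min r (min d1 d2)" using L by (simp add: \<delta>_def)
          show ?thesis
          proof (rule row[OF zero y])
            fix p q assume "dist p q \<le> (4 * L + 2) * (b - a)" "p \<notin> domD tb g1 g2"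
            then show "\<bar>z q\<bar> \<le> e \<and> \<bar>z2 q\<bar> \<le> e" using d(3,4)[of p q] s by auto
          qed (use False ab ab0 s e in auto)
        qed
      qed
    qed
  qed
  then show ?thesis using t by (simp add: P_def)
qed

text \<open>Cutting along thin rows, only cells near the boundary of the domain contribute; there the
  boundary terms are small and the lengths of the transition cells are bounded since the
  boundary curves are Lipschitz.\<close>
lemma box_law_across_boundary:
  assumes zero: "\<And>a b c d. a \<le> b \<Longrightarrow> c \<le> d \<Longrightarrow> {a..b} \<times> {c..d} \<subseteq> domD tb g1 g2 \<Longrightarrow>
     (LINT p:{a<..b} \<times> {c<..d}|lborel. f p) = integral {c..d} (\<lambda>t. z (b, t)) - integral {c..d} (\<lambda>t. z (a, t))
       - 2 * (integral {a..b} (\<lambda>y. z2 (y, d)) - integral {a..b} (\<lambda>y. z2 (y, c)))"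
    and y: "y \<le> y'" and t: "0 \<le> t" "t \<le> t'" "t' \<le> tb"
  shows "(LINT p:{y<..y'} \<times> {t<..t'}|lborel. f p) = integral {t..t'} (\<lambda>t. z (y', t)) - integral {t..t'} (\<lambda>t. z (y, t))
       - 2 * (integral {y..y'} (\<lambda>y. z2 (y, t')) - integral {y..y'} (\<lambda>y. z2 (y, t)))"
proof -
  have "(\<lambda>n. LINT p:strip t t' \<inter> near (1 / real (Suc n))|lborel. \<bar>f p\<bar>) \<longlonglongrightarrow> (\<integral>p. 0 \<partial>(lborel :: (real \<times> real) measure))"
    unfolding set_lebesgue_integral_def
  proof (rule integral_dominated_convergence[where w="\<lambda>p. \<bar>f p\<bar>"])
    show "AE p in lborel. norm (indicator (strip t t' \<inter> near (1 / real (Suc n))) p *\<^sub>R \<bar>f p\<bar>) \<le> \<bar>f p\<bar>" for n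
      by (rule AE_I2) (simp add: indicator_def)
    show "AE p in lborel. (\<lambda>n. indicator (strip t t' \<inter> near (1 / real (Suc n))) p *\<^sub>R \<bar>f p\<bar>) \<longlonglongrightarrow> 0"
    proof (rule AE_I2)
      fix p :: "real \<times> real"
      show "(\<lambda>n. indicator (strip t t' \<inter> near (1 / real (Suc n))) p *\<^sub>R \<bar>f p\<bar>) \<longlonglongrightarrow> 0"
      proof (cases "p \<in> domD tb g1 g2")
        case True
        then have d: "\<bar>fst p - g1 (snd p)\<bar> > 0" "\<bar>fst p - g2 (snd p)\<bar> > 0" by (auto simp: domD_def)
        have l: "(\<lambda>n. 1 / real (Suc n)) \<longlonglongrightarrow> 0" using LIMSEQ_Suc[OF lim_const_over_n[of 1]] by simp
        have "\<forall>\<^sub>F n in sequentially. indicator (strip t t' \<inter> near (1 / real (Suc n))) p *\<^sub>R \<bar>f p\<bar> = 0"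
          using order_tendstoD(2)[OF l d(1)] order_tendstoD(2)[OF l d(2)]
          by eventually_elim (auto simp: near_def indicator_def)
        then show ?thesis by (rule tendsto_eventually)
      qed (simp add: f0)
    qed
    show "(\<lambda>p. indicator (strip t t' \<inter> near (1 / real (Suc n))) p *\<^sub>R \<bar>f p\<bar>) \<in> borel_measurable lborel" for n
      by (intro borel_measurable_scaleR borel_measurable_indicator borel_measurable_abs borel_measurable_integrable f) auto
  qed (use f in auto)
  then have E0: "(\<lambda>n. 2 * (LINT p:strip t t' \<inter> near (1 / real (Suc n))|lborel. \<bar>f p\<bar>) + (20 + 32 * L) * (1 / real (Suc n)) * (t' - t))
     \<longlonglongrightarrow> 2 * 0 + (20 + 32 * L) * 0 * (t' - t)"
    using LIMSEQ_Suc[OF lim_const_over_n[of 1]] by (intro tendsto_intros) auto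
  have "\<bar>Fl y y' t t'\<bar> \<le> 2 * 0 + (20 + 32 * L) * 0 * (t' - t)"
  proof (rule LIMSEQ_le_const[OF E0], intro exI allI impI)
    fix n show "\<bar>Fl y y' t t'\<bar> \<le> 2 * (LINT p:strip t t' \<inter> near (1 / real (Suc n))|lborel. \<bar>f p\<bar>) + (20 + 32 * L) * (1 / real (Suc n)) * (t' - t)"
      by (rule all_rows) (use zero y t in \<open>auto simp: Fl_def\<close>)
  qed
  then show ?thesis by (simp add: Fl_def)
qed

end

lemma convex_combination_point:
  fixes a b x :: real
  assumes "a < b" shows "(1 - (x - a) / (b - a)) * a + (x - a) / (b - a) * b = x"
proof -
  have "(1 - (x - a) / (b - a)) * a + (x - a) / (b - a) * b = a + (x - a) / (b - a) * (b - a)"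
    by (simp only: left_diff_distrib right_diff_distrib)
  then show ?thesis using assms by simp
qed

section \<open>Geometry of the rulings\<close>

text \<open>f1 and f2 stand for the boundary values along g1 and g2, and G, LG, P, LP for the norms
  that enter \<open>zeta\<close>. The number 1/25 is a rational bound just above (sqrt 721 - 25)/48,
  which turns the later estimates into linear arithmetic.\<close>

locale ruled_boundary =
  fixes tb :: real and g1 g2 f1 f2 :: "real \<Rightarrow> real" and G LG P LP :: real
  assumes tb: "tb > 0"
    and g_lip: "\<And>s t. s \<in> {0..tb} \<Longrightarrow> t \<in> {0..tb} \<Longrightarrow> \<bar>g1 s - g1 t\<bar> \<le> LG * \<bar>s - t\<bar>"
      "\<And>s t. s \<in> {0..tb} \<Longrightarrow> t \<in> {0..tb} \<Longrightarrow> \<bar>g2 s - g2 t\<bar> \<le> LG * \<bar>s - t\<bar>"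
    and f_lip: "\<And>s t. s \<in> {0..tb} \<Longrightarrow> t \<in> {0..tb} \<Longrightarrow> \<bar>f1 s - f1 t\<bar> \<le> LP * \<bar>s - t\<bar>"
      "\<And>s t. s \<in> {0..tb} \<Longrightarrow> t \<in> {0..tb} \<Longrightarrow> \<bar>f2 s - f2 t\<bar> \<le> LP * \<bar>s - t\<bar>"
    and gG: "\<And>s. s \<in> {0..tb} \<Longrightarrow> \<bar>g1 s\<bar> \<le> G" "\<And>s. s \<in> {0..tb} \<Longrightarrow> \<bar>g2 s\<bar> \<le> G"
    and fP: "\<And>s. s \<in> {0..tb} \<Longrightarrow> \<bar>f1 s\<bar> \<le> P" "\<And>s. s \<in> {0..tb} \<Longrightarrow> \<bar>f2 s\<bar> \<le> P"
    and small: "4 * (G + LG) * (P + LP) \<le> 1 / 25" and LG0: "LG \<ge> 0" and LP0: "LP \<ge> 0"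
    and g_sign: "\<And>t. t \<in> {0<..<tb} \<Longrightarrow> g1 t < 0" "\<And>t. t \<in> {0<..<tb} \<Longrightarrow> 0 < g2 t"
    and g_ends: "g1 0 = 0" "g1 tb = 0" "g2 0 = 0" "g2 tb = 0"
    and g1_convex: "convex_on {0..tb} g1" and g2_concave: "concave_on {0..tb} g2"
begin

lemma G0: "G \<ge> 0" and P0: "P \<ge> 0"
  using gG(1)[of 0] fP(1)[of 0] tb by auto

lemma small2: "4 * LG * P + 4 * G * LP \<le> 1 / 25"
proof -
  have "G * P \<ge> 0" "LG * LP \<ge> 0" using G0 P0 LG0 LP0 by auto
  then show ?thesis using small by (simp add: algebra_simps)
qed

lemma small3: "4 * LG * P \<le> 1"
proof -
  have "4 * G * LP \<ge> 0" using G0 LP0 by simp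
  then show ?thesis using small2 by linarith
qed

lemma g_sign': "t \<in> {0..tb} \<Longrightarrow> g1 t \<le> 0" "t \<in> {0..tb} \<Longrightarrow> 0 \<le> g2 t"
  using g_sign[of t] g_ends by (cases "t = 0"; cases "t = tb"; simp)+

text \<open>\<open>F s r = s\<close> says that the chord from the point s of the first boundary
  curve to the point r of the second is horizontal at its first end.\<close>

definition F :: "real \<Rightarrow> real \<Rightarrow> real" where
  "F s r = r + 2 * (g2 r - g1 s) * (f2 r + f1 s)"

text \<open>F is r plus a product of two factors. An increment of either factor is bounded by a
  Lipschitz constant and the other factor by a norm; these mixed products are what the smallness
  assumption bounds.\<close>

lemma F_diff:
  assumes "s \<in> {0..tb}" "s' \<in> {0..tb}" "r \<in> {0..tb}" "r' \<in> {0..tb}"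
  shows "\<bar>(F s' r' - F s r) - (r' - r)\<bar> \<le> (\<bar>r' - r\<bar> + \<bar>s' - s\<bar>) / 25"
proof -
  have G: "\<bar>g2 r' - g1 s'\<bar> \<le> 2 * G" using gG assms by (auto simp: abs_le_iff intro: order_trans) 
     (smt (verit) gG assms)+
  have Pb: "\<bar>f2 r + f1 s\<bar> \<le> 2 * P" using fP(2)[OF assms(3)] fP(1)[OF assms(1)] by linarith
  have d1: "\<bar>(g2 r' - g2 r) - (g1 s' - g1 s)\<bar> \<le> LG * (\<bar>r' - r\<bar> + \<bar>s' - s\<bar>)"
    using g_lip(2)[OF assms(4,3)] g_lip(1)[OF assms(2,1)] by (simp add: distrib_left)
  have d2: "\<bar>(f2 r' - f2 r) + (f1 s' - f1 s)\<bar> \<le> LP * (\<bar>r' - r\<bar> + \<bar>s' - s\<bar>)"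
    using f_lip(2)[OF assms(4,3)] f_lip(1)[OF assms(2,1)] by (simp add: distrib_left)
  have "(F s' r' - F s r) - (r' - r) = 2 * ((g2 r' - g1 s') * ((f2 r' - f2 r) + (f1 s' - f1 s)))
     + 2 * (((g2 r' - g2 r) - (g1 s' - g1 s)) * (f2 r + f1 s))"
    by (simp add: F_def algebra_simps)
  moreover have "\<bar>(g2 r' - g1 s') * ((f2 r' - f2 r) + (f1 s' - f1 s))\<bar> \<le> (2 * G) * (LP * (\<bar>r' - r\<bar> + \<bar>s' - s\<bar>))"
    unfolding abs_mult by (rule mult_mono[OF G d2]) (use G0 in auto)
  moreover have "\<bar>((g2 r' - g2 r) - (g1 s' - g1 s)) * (f2 r + f1 s)\<bar> \<le> (LG * (\<bar>r' - r\<bar> + \<bar>s' - s\<bar>)) * (2 * P)"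
    unfolding abs_mult by (rule mult_mono[OF d1 Pb]) (use LG0 in auto)
  moreover have "(4 * LG * P + 4 * G * LP) * S = 2 * ((2 * G) * (LP * S)) + 2 * ((LG * S) * (2 * P))" for S
    by (simp add: algebra_simps)
  ultimately have "\<bar>(F s' r' - F s r) - (r' - r)\<bar> \<le> (4 * LG * P + 4 * G * LP) * (\<bar>r' - r\<bar> + \<bar>s' - s\<bar>)"
    by (simp only:) linarith
  also have "\<dots> \<le> (1 / 25) * (\<bar>r' - r\<bar> + \<bar>s' - s\<bar>)" by (rule mult_right_mono[OF small2]) auto
  finally show ?thesis by simp
qed

lemma g_cont: "continuous_on {0..tb} g1" "continuous_on {0..tb} g2"
  and f_cont: "continuous_on {0..tb} f1" "continuous_on {0..tb} f2"
proof -
  have "LG-lipschitz_on {0..tb} g1" "LG-lipschitz_on {0..tb} g2" "LP-lipschitz_on {0..tb} f1" "LP-lipschitz_on {0..tb} f2"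
    using g_lip f_lip LG0 LP0 by (auto simp: lipschitz_on_def dist_real_def)
  then show "continuous_on {0..tb} g1" "continuous_on {0..tb} g2"
    "continuous_on {0..tb} f1" "continuous_on {0..tb} f2" by (blast intro: lipschitz_on_continuous_on)+
qed

definition lam :: "real \<Rightarrow> real" where "lam s = (THE r. r \<in> {0..tb} \<and> F s r = s)"

text \<open>Existence by the intermediate value theorem: at r = 0 and r = tb the curve g2 vanishes,
  and |g1 s| is at most LG times the distance from s to that end, so the correction term cannot
  exceed this distance. Uniqueness because the correction varies by at most a 25th of the change of
  r.\<close>

lemma lam_ex1:
  assumes s: "s \<in> {0..tb}" shows "\<exists>!r. r \<in> {0..tb} \<and> F s r = s"
proof -
  have uniq: "r = r'" if "r \<in> {0..tb}" "F s r = s" "r' \<in> {0..tb}" "F s r' = s" for r r'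
    using F_diff[OF s s that(1,3)] that by (simp add: abs_if split: if_splits)
  have F0: "F s 0 \<le> s"
  proof -
    have "g1 s \<le> 0" "0 \<le> g2 0" using g_sign'(1)[OF s] g_ends by auto
    have "\<bar>g1 s\<bar> \<le> LG * s" using g_lip(1)[OF s, of 0] s tb g_ends by auto
    moreover have "\<bar>f2 0 + f1 s\<bar> \<le> 2 * P" using fP(2)[of 0] fP(1)[OF s] tb by auto
    ultimately have "\<bar>g1 s * (f2 0 + f1 s)\<bar> \<le> (LG * s) * (2 * P)"
      unfolding abs_mult by (intro mult_mono) (use s LG0 in auto)
    moreover have "F s 0 = - 2 * (g1 s * (f2 0 + f1 s))" by (simp add: F_def g_ends)
    ultimately have "F s 0 \<le> (4 * LG * P) * s" by (simp add: abs_le_iff algebra_simps)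
    also have "\<dots> \<le> 1 * s" by (rule mult_right_mono[OF small3]) (use s in auto)
    finally show ?thesis by simp
  qed
  have F1: "s \<le> F s tb"
  proof -
    have "\<bar>g1 s\<bar> \<le> LG * (tb - s)" using g_lip(1)[OF s, of tb] s tb g_ends by auto
    moreover have "\<bar>f2 tb + f1 s\<bar> \<le> 2 * P" using fP(2)[of tb] fP(1)[OF s] tb by auto
    ultimately have "\<bar>g1 s * (f2 tb + f1 s)\<bar> \<le> (LG * (tb - s)) * (2 * P)"
      unfolding abs_mult by (intro mult_mono) (use s LG0 in auto)
    moreover have "F s tb = tb - 2 * (g1 s * (f2 tb + f1 s))" by (simp add: F_def g_ends)
    ultimately have "tb - F s tb \<le> (4 * LG * P) * (tb - s)" by (simp add: abs_le_iff algebra_simps)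
    also have "\<dots> \<le> 1 * (tb - s)" by (rule mult_right_mono[OF small3]) (use s in auto)
    finally show ?thesis by simp
  qed
  have "continuous_on {0..tb} (F s)" unfolding F_def by (intro continuous_intros g_cont f_cont)
  then obtain r where r: "0 \<le> r" "r \<le> tb" "F s r = s" using IVT'[of "F s" 0 s tb] F0 F1 tb by auto
  show ?thesis
  proof (rule ex1I[of _ r])
    show "r \<in> {0..tb} \<and> F s r = s" using r by simp
    fix r' assume "r' \<in> {0..tb} \<and> F s r' = s"
    then show "r' = r" using uniq r by (metis atLeastAtMost_iff)
  qed
qed

lemma lam: assumes "s \<in> {0..tb}" shows "lam s \<in> {0..tb}" "F s (lam s) = s"
  unfolding lam_def using theI'[OF lam_ex1[OF assms]] by blast+

text \<open>Writing d and l for the increments of s and \<open>lam s\<close>, \<open>F_diff\<close>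
  reads |d - l| \<le> (l + d)/25 up to absolute values; solving for l gives 24/26 and its
  inverse.\<close>

lemma lam_lip:
  assumes "0 \<le> s" "s \<le> s'" "s' \<le> tb"
  shows "12/13 * (s' - s) \<le> lam s' - lam s" "lam s' - lam s \<le> 13/12 * (s' - s)"
proof -
  have s: "s \<in> {0..tb}" "s' \<in> {0..tb}" using assms by auto
  have "\<bar>(s' - s) - (lam s' - lam s)\<bar> \<le> (\<bar>lam s' - lam s\<bar> + (s' - s)) / 25"
    using F_diff[OF s lam(1)[OF s(1)] lam(1)[OF s(2)]] assms
    unfolding lam(2)[OF s(1)] lam(2)[OF s(2)] by simp
  then show "12/13 * (s' - s) \<le> lam s' - lam s" "lam s' - lam s \<le> 13/12 * (s' - s)"
    using assms by (auto simp: abs_if split: if_splits)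
qed

lemma lam_strict: "0 \<le> s \<Longrightarrow> s < s' \<Longrightarrow> s' \<le> tb \<Longrightarrow> lam s < lam s'"
  using lam_lip(1)[of s s'] by auto

lemma lam_ends: "lam 0 = 0" "lam tb = tb"
proof -
  have "F 0 0 = 0" "F tb tb = tb" by (simp_all add: F_def g_ends)
  moreover have "0 \<in> {0..tb}" "tb \<in> {0..tb}" using tb by auto
  ultimately show "lam 0 = 0" "lam tb = tb"
    unfolding lam_def using lam_ex1 by (blast intro: the1_equality)+
qed

lemma lam_inner: "s \<in> {0<..<tb} \<Longrightarrow> lam s \<in> {0<..<tb}"
  using lam_strict[of 0 s] lam_strict[of s tb] lam_ends by auto

lemma lam_cont: "continuous_on {0..tb} lam"
proof (rule lipschitz_on_continuous_on[of "13/12"])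
  show "(13/12)-lipschitz_on {0..tb} lam"
  proof (rule lipschitz_onI)
    fix x y assume "x \<in> {0..tb}" "y \<in> {0..tb}"
    then show "dist (lam x) (lam y) \<le> 13/12 * dist x y"
      using lam_lip[of x y] lam_lip[of y x] by (cases "x \<le> y") (auto simp: dist_real_def abs_if)
  qed simp
qed

definition wid :: "real \<Rightarrow> real" where "wid s = g2 (lam s) - g1 s"
definition rise :: "real \<Rightarrow> real" where "rise s = f2 (lam s) - f1 s"
definition Y :: "real \<Rightarrow> real \<Rightarrow> real" where "Y h s = g1 s + h * wid s"
definition U :: "real \<Rightarrow> real \<Rightarrow> real" where "U h s = f1 s + h * rise s"
text \<open>The t-coordinate in W of the point with parameter h on the ruling from s. Its
  h-derivative is -4 U times that of Y, so the rulings project to the characteristics dt/dy = -4 u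
  of Bu.\<close>

definition tt :: "real \<Rightarrow> real \<Rightarrow> real" where
  "tt h s = s - 4 * f1 s * h * wid s - 2 * rise s * h\<^sup>2 * wid s"
definition TT :: "real \<Rightarrow> real \<Rightarrow> real" where "TT h s = tt h s + 4 * Y h s * U h s"

text \<open>In this form h occurs only in the product with \<open>rise\<close> and inside Y, and
  there is no division by the length of the ruling.\<close>

lemma TT_alt: "TT h s = s + 4 * g1 s * f1 s + 2 * (h * rise s) * (Y h s + g1 s)"
  by (simp add: TT_def tt_def Y_def U_def algebra_simps power2_eq_square)

lemma wid_pos: "s \<in> {0<..<tb} \<Longrightarrow> wid s > 0"
  using g_sign(1)[of s] g_sign(2)[OF lam_inner, of s] by (simp add: wid_def)

lemma wid_nonneg: "s \<in> {0..tb} \<Longrightarrow> wid s \<ge> 0"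
  using g_sign'(1)[of s] g_sign'(2)[OF lam(1), of s] by (simp add: wid_def)

lemma Y_range: "s \<in> {0..tb} \<Longrightarrow> h \<in> {0..1} \<Longrightarrow> g1 s \<le> Y h s \<and> Y h s \<le> g2 (lam s)"
proof -
  assume s: "s \<in> {0..tb}" and h: "h \<in> {0..1}"
  have "0 \<le> h * wid s" "h * wid s \<le> 1 * wid s"
    by (rule mult_nonneg_nonneg mult_right_mono; use wid_nonneg[OF s] h in simp)+
  then show ?thesis unfolding Y_def by (simp add: wid_def)
qed

text \<open>Along a fixed line \<open>y = const\<close> both \<open>t\<close> and \<open>t + 4 y u\<close> move at a rate close to that of the
  label \<open>s\<close> of the ruling. The increment of the affine parameter \<open>h\<close> is only controlled after
  multiplication by the length of the ruling, which tends to zero at the ends.\<close>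
lemma label_monotone:
  assumes s: "0 \<le> s" "s \<le> s'" "s' \<le> tb" and h: "h \<in> {0..1}" "h' \<in> {0..1}"
    and y: "Y h s = Y h' s'"
  shows "\<bar>(TT h' s' - TT h s) - (s' - s)\<bar> \<le> (s' - s) / 2" "\<bar>(tt h' s' - tt h s) - (s' - s)\<bar> \<le> (s' - s) / 2"
proof -
  define \<delta> where "\<delta> = s' - s"
  define y where "y = Y h s"
  define dg1 dg2 df1 df2 dn dh where "dg1 = g1 s' - g1 s" and "dg2 = g2 (lam s') - g2 (lam s)"
    and "df1 = f1 s' - f1 s" and "df2 = f2 (lam s') - f2 (lam s)" and "dn = rise s' - rise s" and "dh = h' - h"
  have ss: "s \<in> {0..tb}" "s' \<in> {0..tb}" using s by auto
  have \<delta>: "\<delta> \<ge> 0" using s by (simp add: \<delta>_def)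
  have dl: "0 \<le> lam s' - lam s" "lam s' - lam s \<le> 13/12 * \<delta>" using lam_lip[OF s] \<delta> by (auto simp: \<delta>_def)
  have b1: "\<bar>dg1\<bar> \<le> LG * \<delta>" using g_lip(1)[OF ss(2,1)] \<delta> by (simp add: dg1_def \<delta>_def)
  have b2: "\<bar>dg2\<bar> \<le> LG * (13/12 * \<delta>)"
  proof -
    have "\<bar>dg2\<bar> \<le> LG * \<bar>lam s' - lam s\<bar>" unfolding dg2_def by (rule g_lip(2)) (use lam ss in auto)
    also have "\<dots> \<le> LG * (13/12 * \<delta>)" by (rule mult_left_mono) (use dl LG0 in auto)
    finally show ?thesis .
  qed
  have b3: "\<bar>df1\<bar> \<le> LP * \<delta>" using f_lip(1)[OF ss(2,1)] \<delta> by (simp add: df1_def \<delta>_def)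
  have b4: "\<bar>df2\<bar> \<le> LP * (13/12 * \<delta>)"
  proof -
    have "\<bar>df2\<bar> \<le> LP * \<bar>lam s' - lam s\<bar>" unfolding df2_def by (rule f_lip(2)) (use lam ss in auto)
    also have "\<dots> \<le> LP * (13/12 * \<delta>)" by (rule mult_left_mono) (use dl LP0 in auto)
    finally show ?thesis .
  qed
  have b5: "\<bar>dn\<bar> \<le> LP * (25/12 * \<delta>)"
  proof -
    have "dn = df2 - df1" by (simp add: dn_def rise_def df1_def df2_def)
    moreover have "LP * (25/12 * \<delta>) = LP * \<delta> + LP * (13/12 * \<delta>)" by (simp add: algebra_simps)
    ultimately show ?thesis using b3 b4 by linarith
  qed
  have n: "\<bar>rise s\<bar> \<le> 2 * P" "\<bar>rise s'\<bar> \<le> 2 * P"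
    using fP(1)[OF ss(1)] fP(1)[OF ss(2)] fP(2)[OF lam(1)[OF ss(1)]] fP(2)[OF lam(1)[OF ss(2)]]
    unfolding rise_def by linarith+
  have yr: "g1 s \<le> y" "y \<le> g2 (lam s)" "g1 s' \<le> y" "y \<le> g2 (lam s')"
    using Y_range[OF ss(1) h(1)] Y_range[OF ss(2) h(2)] y by (auto simp: y_def)
  have sg: "g1 s' \<le> 0" "0 \<le> g2 (lam s')" using g_sign'(1)[OF ss(2)] g_sign'(2)[OF lam(1)[OF ss(2)]] by auto
  have yG: "\<bar>y\<bar> \<le> G" using yr gG(1)[OF ss(1)] gG(2)[OF lam(1)[OF ss(1)]] by linarith
  \<comment> \<open>The ruling ends on opposite sides of 0, so |y| is at most its length. This
    supplies the factor that absorbs the increment \<open>dh\<close> in \<open>a5\<close> and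
    \<open>a8\<close>.\<close>
  have yw: "\<bar>y\<bar> \<le> wid s'" "\<bar>y + g1 s'\<bar> \<le> 2 * wid s'" using yr sg by (auto simp: wid_def abs_le_iff)
  have yG2: "\<bar>y + g1 s'\<bar> \<le> 2 * G" using yG gG(1)[OF ss(2)] by linarith
  \<comment> \<open>Equality of the two ordinates expresses this product through increments of the
    boundary curves, whose order is \<open>LG * \<delta>\<close>; for \<open>dh\<close> alone no
    such bound is available.\<close>
  have wdh: "\<bar>wid s' * dh\<bar> \<le> LG * (13/12 * \<delta>)"
  proof -
    have "wid s' * dh = - ((1 - h) * dg1 + h * dg2)"
      using y by (simp add: Y_def wid_def dh_def dg1_def dg2_def algebra_simps)
    moreover have "\<bar>(1 - h) * dg1\<bar> \<le> (1 - h) * (LG * (13/12 * \<delta>))"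
    proof -
      have "LG * \<delta> \<le> LG * (13/12 * \<delta>)" using LG0 \<delta> by (intro mult_left_mono) auto
      then have "\<bar>dg1\<bar> \<le> LG * (13/12 * \<delta>)" using b1 by linarith
      then show ?thesis unfolding abs_mult using h by (intro mult_mono) auto
    qed
    moreover have "\<bar>h * dg2\<bar> \<le> h * (LG * (13/12 * \<delta>))"
      unfolding abs_mult using h b2 by (intro mult_mono) auto
    moreover have "(1 - h) * B + h * B = B" for B :: real by (simp add: algebra_simps)
    ultimately show ?thesis by (smt (verit))
  qed
  have hb: "\<bar>h\<bar> \<le> 1" using h by auto
  \<comment> \<open>The two parts of the smallness bound times \<delta>. Each of the eight error
    terms is at most a numerical multiple of one of them.\<close>
  define X Z where "X = 4 * LG * P * \<delta>" and "Z = 4 * G * LP * \<delta>"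
  have XZ: "X + Z \<le> \<delta> / 25" "X \<ge> 0" "Z \<ge> 0"
  proof -
    have "(4 * LG * P + 4 * G * LP) * \<delta> \<le> (1/25) * \<delta>" by (rule mult_right_mono[OF small2 \<delta>])
    then show "X + Z \<le> \<delta> / 25" by (simp add: X_def Z_def algebra_simps)
    show "X \<ge> 0" "Z \<ge> 0" using LG0 P0 G0 LP0 \<delta> by (auto simp: X_def Z_def)
  qed
  define a1 a2 a3 a4 a5 a6 a7 a8 where "a1 = dg1 * f1 s'"
    and "a2 = g1 s * df1"
    and "a3 = h * rise s * dg1"
    and "a4 = (y + g1 s') * (h * dn)"
    and "a5 = (y + g1 s') * (rise s' * dh)"
    and "a6 = y * df1"
    and "a7 = y * (h * dn)"
    and "a8 = y * (rise s' * dh)"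
  note aa = a1_def a2_def a3_def a4_def a5_def a6_def a7_def a8_def
  have c1: "\<bar>a1\<bar> \<le> X / 4"
    using mult_mono[OF b1 fP(1)[OF ss(2)]] LG0 \<delta> by (simp add: abs_mult X_def mult_ac aa)
  have c2: "\<bar>a2\<bar> \<le> Z / 4"
    using mult_mono[OF gG(1)[OF ss(1)] b3] G0 by (simp add: abs_mult Z_def mult_ac aa)
  have c3: "\<bar>a3\<bar> \<le> X / 2"
  proof -
    have "\<bar>h\<bar> * \<bar>rise s\<bar> * \<bar>dg1\<bar> \<le> 1 * (2 * P) * (LG * \<delta>)"
      by (intro mult_mono hb n b1) (use P0 LG0 \<delta> in auto)
    then show ?thesis by (simp add: abs_mult X_def mult_ac aa)
  qed
  have c4: "\<bar>a4\<bar> \<le> 25/24 * Z"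
  proof -
    have "\<bar>y + g1 s'\<bar> * (\<bar>h\<bar> * \<bar>dn\<bar>) \<le> (2 * G) * (1 * (LP * (25/12 * \<delta>)))"
      by (intro mult_mono yG2 hb b5) (use G0 LP0 \<delta> in auto)
    then show ?thesis by (simp add: abs_mult Z_def mult_ac aa)
  qed
  have c5: "\<bar>a5\<bar> \<le> 13/12 * X"
  proof -
    have "\<bar>y + g1 s'\<bar> * (\<bar>rise s'\<bar> * \<bar>dh\<bar>) \<le> (2 * wid s') * (\<bar>rise s'\<bar> * \<bar>dh\<bar>)"
      by (intro mult_right_mono yw) auto
    also have "\<dots> = 2 * \<bar>rise s'\<bar> * \<bar>wid s' * dh\<bar>" using wid_nonneg[OF ss(2)] by (simp add: abs_mult)
    also have "\<dots> \<le> 2 * (2 * P) * (LG * (13/12 * \<delta>))"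
      by (intro mult_mono wdh n mult_left_mono) (use P0 in auto)
    finally show ?thesis by (simp add: abs_mult X_def mult_ac aa)
  qed
  have c6: "\<bar>a6\<bar> \<le> Z / 4"
    using mult_mono[OF yG b3] G0 by (simp add: abs_mult Z_def mult_ac aa)
  have c7: "\<bar>a7\<bar> \<le> 25/48 * Z"
  proof -
    have "\<bar>y\<bar> * (\<bar>h\<bar> * \<bar>dn\<bar>) \<le> G * (1 * (LP * (25/12 * \<delta>)))"
      by (intro mult_mono yG hb b5) (use G0 LP0 \<delta> in auto)
    then show ?thesis by (simp add: abs_mult Z_def mult_ac aa)
  qed
  have c8: "\<bar>a8\<bar> \<le> 13/24 * X"
  proof -
    have "\<bar>y\<bar> * (\<bar>rise s'\<bar> * \<bar>dh\<bar>) \<le> wid s' * (\<bar>rise s'\<bar> * \<bar>dh\<bar>)"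
      by (intro mult_right_mono yw) auto
    also have "\<dots> = \<bar>rise s'\<bar> * \<bar>wid s' * dh\<bar>" using wid_nonneg[OF ss(2)] by (simp add: abs_mult)
    also have "\<dots> \<le> (2 * P) * (LG * (13/12 * \<delta>))"
      by (intro mult_mono wdh n) (use P0 in auto)
    finally show ?thesis by (simp add: abs_mult X_def mult_ac aa)
  qed
  have eT: "(TT h' s' - TT h s) - (s' - s) = 4 * a1 + 4 * a2 + 2 * a3 + 2 * a4 + 2 * a5"
    unfolding aa TT_alt y[symmetric] y_def[symmetric] dg1_def df1_def dn_def dh_def by (simp add: algebra_simps)
  have T: "\<bar>(TT h' s' - TT h s) - (s' - s)\<bar> \<le> (s' - s) / 6"
    unfolding eT abs_le_iff using c1 c2 c3 c4 c5 XZ unfolding \<delta>_def abs_le_iff by linarith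
  then show "\<bar>(TT h' s' - TT h s) - (s' - s)\<bar> \<le> (s' - s) / 2" using s by linarith
  have T': "\<bar>4 * (a6 + a7 + a8)\<bar> \<le> (s' - s) / 6"
  proof -
    have "Z + 25/12 * Z + 13/6 * X \<le> (s' - s) / 6" using XZ unfolding \<delta>_def by linarith
    moreover have "\<bar>a6 + a7 + a8\<bar> \<le> \<bar>a6\<bar> + \<bar>a7\<bar> + \<bar>a8\<bar>" by linarith
    ultimately show ?thesis using c6 c7 c8 unfolding abs_mult by simp
  qed
  have et: "(tt h' s' - tt h s) - (s' - s) = ((TT h' s' - TT h s) - (s' - s))
      - 4 * (a6 + a7 + a8)"
    unfolding aa TT_def y[symmetric] y_def[symmetric] U_def df1_def dn_def dh_def by (simp add: algebra_simps)
  show "\<bar>(tt h' s' - tt h s) - (s' - s)\<bar> \<le> (s' - s) / 2"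
    unfolding et using T T' s by linarith
qed

lemma label_increase:
  assumes "0 \<le> s" "s \<le> s'" "s' \<le> tb" "h \<in> {0..1}" "h' \<in> {0..1}" "Y h s = Y h' s'"
  shows "(s' - s) / 2 \<le> TT h' s' - TT h s" "TT h' s' - TT h s \<le> 2 * (s' - s)" "(s' - s) / 2 \<le> tt h' s' - tt h s"
proof -
  have r: "d / 2 \<le> x" "x \<le> 2 * d" if "\<bar>x - d\<bar> \<le> d / 2" for x d :: real
    using that by (auto simp: abs_if split: if_splits)
  show "(s' - s) / 2 \<le> TT h' s' - TT h s" "TT h' s' - TT h s \<le> 2 * (s' - s)" "(s' - s) / 2 \<le> tt h' s' - tt h s"
    by (rule r label_monotone assms)+
qed

abbreviation "D \<equiv> domD tb g1 g2"

lemma D_iff: "(y, t) \<in> D \<longleftrightarrow> 0 < t \<and> t < tb \<and> g1 t < y \<and> y < g2 t"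
  by (auto simp: domD_def)

lemma D_convex: "convex D"
proof (rule convexI)
  fix p q :: "real \<times> real" and a b :: real
  assume *: "p \<in> D" "q \<in> D" "0 \<le> a" "0 \<le> b" "a + b = 1"
  obtain y t y' t' where pq: "p = (y, t)" "q = (y', t')" by (cases p, cases q) auto
  have p: "0 < t" "t < tb" "g1 t < y" "y < g2 t" and q: "0 < t'" "t' < tb" "g1 t' < y'" "y' < g2 t'"
    using * by (auto simp: pq D_iff)
  have st: "r < (a * x + b * x' :: real)" if "r < x" "r < x'" for r x x'
  proof -
    have "a * (x - r) + b * (x' - r) > 0"
    proof (cases "a = 0")
      case True then show ?thesis using * that by simp
    next
      case False
      then have "a * (x - r) > 0" "b * (x' - r) \<ge> 0" using * that by auto
      then show ?thesis by simp
    qed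
    then show ?thesis using *(5) by (simp add: algebra_simps flip: distrib_right)
  qed
  have a: "a = 1 - b" "b \<le> 1" using *(3-5) by auto
  have tI: "t \<in> {0..tb}" "t' \<in> {0..tb}" using p q by auto
  have "g1 (a * t + b * t') \<le> a * g1 t + b * g1 t'"
    using convex_onD[OF g1_convex *(4) a(2) tI] unfolding a(1) real_scaleR_def .
  moreover have "a * g2 t + b * g2 t' \<le> g2 (a * t + b * t')"
    using concave_onD[OF g2_concave *(4) a(2) tI] unfolding a(1) real_scaleR_def .
  moreover have "0 < a * (y - g1 t) + b * (y' - g1 t')" "0 < a * (g2 t - y) + b * (g2 t' - y')"
    by (rule st; use p q in simp)+
  moreover have "0 < a * t + b * t'" "0 < a * (tb - t) + b * (tb - t')" by (rule st; use p q in simp)+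
  moreover have "a * tb + b * tb = tb" using *(5) by (metis distrib_right mult_1)
  ultimately show "a *\<^sub>R p + b *\<^sub>R q \<in> D" unfolding pq by (simp add: D_iff algebra_simps)
qed

lemma D_open: "open D"
proof -
  have 1: "open (UNIV \<times> {0<..<tb} :: (real \<times> real) set)" by (intro open_Times) auto
  have c: "continuous_on (UNIV \<times> {0<..<tb}) (\<lambda>p. g1 (snd p))" "continuous_on (UNIV \<times> {0<..<tb}) (\<lambda>p. g2 (snd p))"
    by (intro continuous_on_compose2[OF g_cont(1)] continuous_on_compose2[OF g_cont(2)] continuous_intros; force)+
  have op: "open {p \<in> UNIV \<times> {0<..<tb}. f p < g p}"
    if "continuous_on (UNIV \<times> {0<..<tb}) f" "continuous_on (UNIV \<times> {0<..<tb}) g" for f g :: "real \<times> real \<Rightarrow> real"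
    using open_Collect_less_Int[OF that] 1 by (metis open_Int)
  have o: "open {p \<in> UNIV \<times> {0<..<tb}. g1 (snd p) < fst p}" "open {p \<in> UNIV \<times> {0<..<tb}. fst p < g2 (snd p)}"
    by (rule op; intro c continuous_intros)+
  have e: "D = {p \<in> UNIV \<times> {0<..<tb}. g1 (snd p) < fst p} \<inter> {p \<in> UNIV \<times> {0<..<tb}. fst p < g2 (snd p)}"
    by (auto simp: domD_def)
  show ?thesis unfolding e by (rule open_Int[OF o])
qed


lemma wid_cont: "continuous_on {0..tb} wid" and rise_cont: "continuous_on {0..tb} rise"
  unfolding wid_def rise_def
  by (intro continuous_intros g_cont f_cont continuous_on_compose2[OF g_cont(2) lam_cont]
      continuous_on_compose2[OF f_cont(2) lam_cont]; use lam in auto)+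

lemma chart_cont:
  "continuous_on ({0..1} \<times> {0..tb}) (\<lambda>p. Y (fst p) (snd p))"
  "continuous_on ({0..1} \<times> {0..tb}) (\<lambda>p. U (fst p) (snd p))"
  "continuous_on ({0..1} \<times> {0..tb}) (\<lambda>p. tt (fst p) (snd p))"
  "continuous_on ({0..1} \<times> {0..tb}) (\<lambda>p. TT (fst p) (snd p))"
proof -
  let ?Q = "{0..1} \<times> {0..tb} :: (real \<times> real) set"
  have c: "continuous_on ?Q (\<lambda>p. k (snd p))" if "continuous_on {0..tb} k" for k :: "real \<Rightarrow> real"
    by (intro continuous_on_compose2[OF that] continuous_intros) auto
  show Y: "continuous_on ?Q (\<lambda>p. Y (fst p) (snd p))"
    unfolding Y_def by (intro continuous_intros c g_cont wid_cont)
  show U: "continuous_on ?Q (\<lambda>p. U (fst p) (snd p))"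
    unfolding U_def by (intro continuous_intros c f_cont rise_cont)
  show t: "continuous_on ?Q (\<lambda>p. tt (fst p) (snd p))"
    unfolding tt_def by (intro continuous_intros c f_cont rise_cont wid_cont)
  show "continuous_on ?Q (\<lambda>p. TT (fst p) (snd p))"
    unfolding TT_def by (intro continuous_intros Y U t)
qed

lemma Y_ends: "Y 0 s = g1 s" "Y 1 s = g2 (lam s)" by (simp_all add: Y_def wid_def)

lemma tt_ends: "tt 0 s = s" "s \<in> {0..tb} \<Longrightarrow> tt 1 s = lam s"
  using lam(2)[of s] by (auto simp: tt_def wid_def rise_def F_def algebra_simps)

lemma Y_surj:
  assumes "s \<in> {0..tb}" "g1 s \<le> y" "y \<le> g2 (lam s)"
  shows "\<exists>h\<in>{0..1}. y = Y h s"
proof (cases "wid s = 0")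
  case True
  then show ?thesis using assms by (intro bexI[of _ 0]) (auto simp: Y_def wid_def)
next
  case False
  then have "wid s > 0" using wid_nonneg[OF assms(1)] by simp
  then show ?thesis using assms by (intro bexI[of _ "(y - g1 s) / wid s"]) (auto simp: Y_def wid_def field_simps)
qed

text \<open>The label as a function of y and the value of t + 4 y u, rather than of y and t: in
  these coordinates a competitor can be inserted in place of u. Uniqueness of s comes from
  \<open>label_increase\<close>.\<close>

definition Lb :: "real \<times> real \<Rightarrow> real" where
  "Lb q = (THE s. s \<in> {0..tb} \<and> (\<exists>h\<in>{0..1}. q = (Y h s, TT h s)))"

lemma Lb_eq: assumes "s \<in> {0..tb}" "h \<in> {0..1}" shows "Lb (Y h s, TT h s) = s"
  unfolding Lb_def
proof (rule the_equality)
  fix s' assume "s' \<in> {0..tb} \<and> (\<exists>h'\<in>{0..1}. (Y h s, TT h s) = (Y h' s', TT h' s'))"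
  then obtain h' where h': "s' \<in> {0..tb}" "h' \<in> {0..1}" "Y h s = Y h' s'" "TT h s = TT h' s'" by auto
  show "s' = s"
  proof (cases "s \<le> s'")
    case True
    then show ?thesis using label_increase(1)[of s s' h h'] h' assms by auto
  next
    case False
    then show ?thesis using label_increase(1)[of s' s h' h] h' assms by auto
  qed
qed (use assms in auto)

definition chart :: "(real \<times> real) set" where
  "chart = (\<lambda>p. (Y (fst p) (snd p), TT (fst p) (snd p))) ` ({0..1} \<times> {0..tb})"

lemma chartI: "h \<in> {0..1} \<Longrightarrow> s \<in> {0..tb} \<Longrightarrow> (Y h s, TT h s) \<in> chart"
  unfolding chart_def by (rule image_eqI[of _ _ "(h, s)"]) auto

lemma chartE:
  assumes "q \<in> chart"
  obtains h where "h \<in> {0..1}" "Lb q \<in> {0..tb}" "fst q = Y h (Lb q)" "snd q = TT h (Lb q)"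
proof -
  obtain h s where *: "h \<in> {0..1}" "s \<in> {0..tb}" "q = (Y h s, TT h s)"
    using assms by (auto simp: chart_def)
  then have "Lb q = s" using Lb_eq by simp
  then show ?thesis using * by (intro that[of h]) auto
qed

text \<open>The parametrisation has a compact domain, so preimages of closed sets are images of
  compact sets. At s = 0 and s = tb the rulings degenerate and h is not determined, but s still
  is.\<close>

lemma Lb_cont: "continuous_on chart Lb"
  unfolding continuous_on_closed_invariant
proof (intro allI impI)
  fix B :: "real set" assume B: "closed B"
  let ?f = "\<lambda>p. (Y (fst p) (snd p), TT (fst p) (snd p))"
  let ?Q = "{0..1} \<times> {0..tb} :: (real \<times> real) set"
  have "compact (?Q \<inter> (UNIV \<times> B))"
    by (intro compact_Int_closed compact_Times compact_Icc closed_Times closed_UNIV B)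
  then have "compact (?f ` (?Q \<inter> (UNIV \<times> B)))"
    by (rule compact_continuous_image[rotated]) (auto intro!: continuous_intros continuous_on_subset[OF chart_cont(1)] continuous_on_subset[OF chart_cont(4)])
  moreover have "?f ` (?Q \<inter> (UNIV \<times> B)) \<inter> chart = Lb -` B \<inter> chart"
  proof (intro equalityI subsetI)
    fix q assume "q \<in> ?f ` (?Q \<inter> (UNIV \<times> B)) \<inter> chart"
    then obtain p where p: "p \<in> ?Q" "snd p \<in> B" "q = ?f p" "q \<in> chart" by auto
    then have "Lb q = snd p" using Lb_eq[of "snd p" "fst p"] by (auto simp: mem_Times_iff)
    then show "q \<in> Lb -` B \<inter> chart" using p by simp
  next
    fix q assume q: "q \<in> Lb -` B \<inter> chart"
    then obtain h where "h \<in> {0..1}" "Lb q \<in> {0..tb}" "fst q = Y h (Lb q)" "snd q = TT h (Lb q)"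
      using chartE by blast
    then have "q = ?f (h, Lb q)" "(h, Lb q) \<in> ?Q \<inter> (UNIV \<times> B)" using q by (auto intro: prod_eqI)
    then show "q \<in> ?f ` (?Q \<inter> (UNIV \<times> B)) \<inter> chart" using q by blast
  qed
  ultimately show "\<exists>A. closed A \<and> A \<inter> chart = Lb -` B \<inter> chart" using compact_imp_closed by blast
qed

definition slope :: "real \<Rightarrow> real" where "slope s = rise s / wid s"
definition alpha :: "real \<Rightarrow> real" where "alpha s = s + 4 * g1 s * f1 s - 2 * slope s * (g1 s)\<^sup>2"

text \<open>Since u is affine in y along the ruling, \<open>h * rise s\<close> is the slope times y
  - g1 s, and the product in \<open>TT_alt\<close> becomes a difference of squares.\<close>

lemma TT_slope:
  assumes "s \<in> {0<..<tb}" shows "TT h s = alpha s + 2 * slope s * (Y h s)\<^sup>2"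
proof -
  have "wid s \<noteq> 0" using wid_pos[OF assms] by simp
  then have k: "h * rise s = slope s * (Y h s - g1 s)" by (simp add: Y_def slope_def)
  show ?thesis unfolding TT_alt alpha_def k by (simp add: algebra_simps power2_eq_square)
qed

lemma U_slope:
  assumes "s \<in> {0<..<tb}" shows "U h s = f1 s + slope s * (Y h s - g1 s)"
  using wid_pos[OF assms] by (simp add: Y_def slope_def U_def)

end

section \<open>Labels and level curves of a competitor\<close>

text \<open>Both inclusions of the equality between the graph of u and the ruled surface, read in
  the coordinates of W. Taking u continuous on the whole plane allows competitors to be compared
  with it off the domain as well.\<close>

locale ruled_graph = ruled_boundary +
  fixes u :: "real \<times> real \<Rightarrow> real" and Lu :: real
  assumes u_cont: "continuous_on UNIV u"
    and u_lip: "Lu-lipschitz_on (closure (domD tb g1 g2)) u"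
    and ruled_in: "\<And>h s. h \<in> {0<..<1} \<Longrightarrow> s \<in> {0<..<tb} \<Longrightarrow> (Y h s, tt h s) \<in> domD tb g1 g2"
      "\<And>h s. h \<in> {0<..<1} \<Longrightarrow> s \<in> {0<..<tb} \<Longrightarrow> u (Y h s, tt h s) = U h s"
    and ruled_cover: "\<And>p. p \<in> domD tb g1 g2 \<Longrightarrow> \<exists>h\<in>{0<..<1}. \<exists>s\<in>{0<..<tb}. p = (Y h s, tt h s)"
begin

abbreviation "W \<equiv> closure D"

lemma Q_closure: "{0..1} \<times> {0..tb} = closure ({0<..<1} \<times> {0<..<tb} :: (real \<times> real) set)"
  using tb by (simp add: closure_Times)

text \<open>Passing to the closed parameter rectangle gives a compact, hence closed, image; density
  of the open rectangle gives the other inclusion.\<close>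

lemma W_image: "W = (\<lambda>p. (Y (fst p) (snd p), tt (fst p) (snd p))) ` ({0..1} \<times> {0..tb})"
proof
  let ?f = "\<lambda>p. (Y (fst p) (snd p), tt (fst p) (snd p))"
  have c: "continuous_on ({0..1} \<times> {0..tb}) ?f" by (intro continuous_intros chart_cont)
  have "compact (?f ` ({0..1} \<times> {0..tb}))"
    by (intro compact_continuous_image c compact_Times compact_Icc)
  moreover have "D \<subseteq> ?f ` ({0..1} \<times> {0..tb})"
  proof
    fix p assume "p \<in> D"
    then obtain h s where "h \<in> {0<..<1}" "s \<in> {0<..<tb}" "p = (Y h s, tt h s)" using ruled_cover by blast
    then show "p \<in> ?f ` ({0..1} \<times> {0..tb})" by (intro image_eqI[of _ _ "(h, s)"]) auto
  qed
  ultimately show "W \<subseteq> ?f ` ({0..1} \<times> {0..tb})" by (intro closure_minimal compact_imp_closed)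
  show "?f ` ({0..1} \<times> {0..tb}) \<subseteq> W"
    unfolding Q_closure
    by (rule image_closure_subset[OF _ closed_closure])
       (use c ruled_in(1) closure_subset[of D] in \<open>auto simp: Q_closure[symmetric]\<close>)
qed

lemma WI: "h \<in> {0..1} \<Longrightarrow> s \<in> {0..tb} \<Longrightarrow> (Y h s, tt h s) \<in> W"
  unfolding W_image by (rule image_eqI[of _ _ "(h, s)"]) auto

lemma WE:
  assumes "p \<in> W" obtains h s where "h \<in> {0..1}" "s \<in> {0..tb}" "p = (Y h s, tt h s)"
  using assms unfolding W_image by auto

lemma WE2:
  assumes "(y, t) \<in> W" obtains h s where "h \<in> {0..1}" "s \<in> {0..tb}" "y = Y h s" "t = tt h s"
  using WE[OF assms] by (metis prod.inject)

lemma W_compact: "compact W"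
  unfolding W_image by (intro compact_continuous_image compact_Times compact_Icc continuous_intros chart_cont)

lemma u_ruled:
  assumes "h \<in> {0..1}" "s \<in> {0..tb}" shows "u (Y h s, tt h s) = U h s"
proof -
  let ?f = "\<lambda>p. u (Y (fst p) (snd p), tt (fst p) (snd p)) - U (fst p) (snd p)"
  have "continuous_on (closure ({0<..<1} \<times> {0<..<tb})) ?f"
    unfolding Q_closure[symmetric]
    by (intro continuous_intros continuous_on_compose2[OF u_cont] chart_cont) auto
  then have "?f (h, s) = 0"
    by (rule continuous_constant_on_closure) (use assms ruled_in(2) in \<open>auto simp: Q_closure[symmetric]\<close>)
  then show ?thesis by simp
qed

text \<open>The class of competitors. Monotonicity is asked on slices of the closure, so that labels
  are defined and injective along a slice up to the boundary.\<close>

definition adm :: "(real \<times> real \<Rightarrow> real) \<Rightarrow> bool" where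
  "adm v \<longleftrightarrow> continuous_on UNIV v \<and> (\<forall>p. p \<notin> D \<longrightarrow> v p = u p) \<and>
    (\<forall>y t t'. (y, t) \<in> W \<longrightarrow> (y, t') \<in> W \<longrightarrow> t < t' \<longrightarrow> t + 4 * y * v (y, t) < t' + 4 * y * v (y, t'))"

lemma admD:
  assumes "adm v"
  shows "continuous_on UNIV v" "\<And>p. p \<notin> D \<Longrightarrow> v p = u p"
    "\<And>y t t'. (y, t) \<in> W \<Longrightarrow> (y, t') \<in> W \<Longrightarrow> t < t' \<Longrightarrow> t + 4 * y * v (y, t) < t' + 4 * y * v (y, t')"
  using assms by (auto simp: adm_def)

text \<open>Along a line y = const both t and t + 4 y u increase with the label, hence with each
  other.\<close>

lemma adm_u: "adm u"
  unfolding adm_def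
proof (intro conjI allI impI u_cont)
  fix y t t' assume *: "(y, t) \<in> W" "(y, t') \<in> W" "t < t'"
  obtain h s where h: "h \<in> {0..1}" "s \<in> {0..tb}" "y = Y h s" "t = tt h s" by (rule WE2[OF *(1)])
  obtain h' s' where h': "h' \<in> {0..1}" "s' \<in> {0..tb}" "y = Y h' s'" "t' = tt h' s'" by (rule WE2[OF *(2)])
  have "s < s'"
  proof (rule ccontr)
    assume "\<not> s < s'"
    then have "(s - s') / 2 \<le> tt h s - tt h' s'" "s' \<le> s"
      using label_increase(3)[of s' s h' h] h h' by auto
    then show False using *(3) h h' by simp
  qed
  moreover have "(s' - s) / 2 \<le> TT h' s' - TT h s" if "s < s'"
    using label_increase(1)[of s s' h h'] h h' that by auto
  ultimately have "TT h s < TT h' s'" by force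
  moreover have "t + 4 * y * u (y, t) = TT h s" "t' + 4 * y * u (y, t') = TT h' s'"
    using u_ruled[OF h(1,2)] u_ruled[OF h'(1,2)] h h' by (simp_all add: TT_def)
  ultimately show "t + 4 * y * u (y, t) < t' + 4 * y * u (y, t')" by simp
qed auto

text \<open>The first and last point of a compact slice cannot lie in the open set D; at such points
  all competitors agree with u.\<close>

lemma slice_ends:
  assumes "(y, t) \<in> W"
  obtains a b where "a \<le> t" "t \<le> b" "(y, a) \<notin> D" "(y, b) \<notin> D" "\<And>x. x \<in> {a..b} \<longleftrightarrow> (y, x) \<in> W"
proof -
  define K where "K = {x. (y, x) \<in> W}"
  have "K = snd ` (W \<inter> ({y} \<times> UNIV))" by (force simp: K_def)
  moreover have "compact (W \<inter> ({y} \<times> UNIV))"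
    by (intro compact_Int_closed W_compact closed_Times) auto
  ultimately have K: "compact K" by (auto intro!: compact_continuous_image continuous_intros)
  have tK: "t \<in> K" using assms by (simp add: K_def)
  obtain a where a: "a \<in> K" "\<And>x. x \<in> K \<Longrightarrow> a \<le> x" using compact_attains_inf[OF K] tK by blast
  obtain b where b: "b \<in> K" "\<And>x. x \<in> K \<Longrightarrow> x \<le> b" using compact_attains_sup[OF K] tK by blast
  have near: "\<exists>e>0. \<forall>x. \<bar>x - c\<bar> \<le> e \<longrightarrow> x \<in> K" if c: "(y, c) \<in> D" for c
  proof -
    obtain e where e: "e > 0" "cball (y, c) e \<subseteq> D" using D_open c open_contains_cball by blast
    have "(y, x) \<in> D" if "\<bar>x - c\<bar> \<le> e" for x
      using e(2) that by (auto simp: dist_prod_def dist_real_def abs_minus_commute subset_iff)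
    then show ?thesis using e(1) closure_subset[of D] by (auto simp: K_def)
  qed
  have "(y, a) \<notin> D"
  proof
    assume "(y, a) \<in> D"
    then obtain e where "e > 0" "\<forall>x. \<bar>x - a\<bar> \<le> e \<longrightarrow> x \<in> K" using near by blast
    then show False using a(2)[of "a - e"] by auto
  qed
  moreover have "(y, b) \<notin> D"
  proof
    assume "(y, b) \<in> D"
    then obtain e where "e > 0" "\<forall>x. \<bar>x - b\<bar> \<le> e \<longrightarrow> x \<in> K" using near by blast
    then show False using b(2)[of "b + e"] by auto
  qed
  moreover have "x \<in> {a..b} \<longleftrightarrow> (y, x) \<in> W" for x
  proof
    assume x: "x \<in> {a..b}"
    show "(y, x) \<in> W"
    proof (cases "a = b")
      case True then show ?thesis using x a by (simp add: K_def)
    next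
      case False
      then have ab: "a < b" using x by auto
      define r where "r = (x - a) / (b - a)"
      have r: "0 \<le> r" "r \<le> 1" using x ab by (auto simp: r_def)
      have "(1 - r) *\<^sub>R (y, a) + r *\<^sub>R (y, b) \<in> W"
        by (rule convexD_alt[OF convex_closure[OF D_convex]]) (use a b r in \<open>auto simp: K_def\<close>)
      moreover have "(1 - r) * a + r * b = x" unfolding r_def by (rule convex_combination_point) (use ab in auto)
      moreover have "(1 - r) * y + r * y = y" by (simp add: algebra_simps)
      ultimately show ?thesis by simp
    qed
  qed (use a b in \<open>auto simp: K_def\<close>)
  ultimately show ?thesis using a b tK by (intro that[of a b]) auto
qed

text \<open>At the ends of a slice all competitors agree, so by the intermediate value theorem t + 4
  y v has the same range for each of them. This makes the labels of the ruled surface available to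
  every competitor.\<close>

lemma transfer:
  assumes v: "adm v1" "adm v2" and t: "(y, t) \<in> W"
  shows "\<exists>t'. (y, t') \<in> W \<and> t' + 4 * y * v2 (y, t') = t + 4 * y * v1 (y, t)"
proof -
  obtain a b where ab: "a \<le> t" "t \<le> b" "(y, a) \<notin> D" "(y, b) \<notin> D" "\<And>x. x \<in> {a..b} \<longleftrightarrow> (y, x) \<in> W"
    by (rule slice_ends[OF t]) (rule that)
  have e: "v1 (y, a) = v2 (y, a)" "v1 (y, b) = v2 (y, b)"
    using admD(2)[OF v(1)] admD(2)[OF v(2)] ab by auto
  have W: "(y, a) \<in> W" "(y, b) \<in> W" using ab(5)[of a] ab(5)[of b] ab(1,2) by simp_all
  have "a + 4 * y * v1 (y, a) \<le> t + 4 * y * v1 (y, t)" "t + 4 * y * v1 (y, t) \<le> b + 4 * y * v1 (y, b)"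
    using admD(3)[OF v(1) W(1) t] admD(3)[OF v(1) t W(2)] ab(1,2)
    by (cases "a = t"; cases "t = b"; force)+
  moreover have "continuous_on {a..b} (\<lambda>x. x + 4 * y * v2 (y, x))"
    by (intro continuous_intros continuous_on_slice admD(1)[OF v(2)])
  ultimately obtain t' where "a \<le> t'" "t' \<le> b" "t' + 4 * y * v2 (y, t') = t + 4 * y * v1 (y, t)"
    using IVT'[of "\<lambda>x. x + 4 * y * v2 (y, x)" a "t + 4 * y * v1 (y, t)" b] ab(1,2) e by auto
  then show ?thesis using ab(5)[of t'] by auto
qed

definition lab :: "(real \<times> real \<Rightarrow> real) \<Rightarrow> real \<times> real \<Rightarrow> real" where
  "lab v p = Lb (fst p, snd p + 4 * fst p * v p)"

lemma in_chart:
  assumes "adm v" "p \<in> W" shows "(fst p, snd p + 4 * fst p * v p) \<in> chart"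
proof -
  obtain t' where t': "(fst p, t') \<in> W" "t' + 4 * fst p * u (fst p, t') = snd p + 4 * fst p * v p"
    using transfer[OF assms(1) adm_u, of "fst p" "snd p"] assms(2) by auto
  obtain h s where h: "h \<in> {0..1}" "s \<in> {0..tb}" "fst p = Y h s" "t' = tt h s" by (rule WE2[OF t'(1)])
  then have "snd p + 4 * fst p * v p = TT h s"
    using t'(2) u_ruled[OF h(1,2)] by (simp add: TT_def)
  then show ?thesis using chartI[OF h(1,2)] h(3) by simp
qed

lemma labE:
  assumes "adm v" "p \<in> W"
  obtains h where "h \<in> {0..1}" "lab v p \<in> {0..tb}" "fst p = Y h (lab v p)" "snd p + 4 * fst p * v p = TT h (lab v p)"
  using chartE[OF in_chart[OF assms]] unfolding lab_def by auto

lemma lab_eq: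
  assumes "s \<in> {0..tb}" "h \<in> {0..1}" "fst p = Y h s" "snd p + 4 * fst p * v p = TT h s"
  shows "lab v p = s"
  unfolding lab_def assms(3,4)[unfolded assms(3)] using Lb_eq[OF assms(1,2)] assms(3,4) by simp

lemma lab_u: "h \<in> {0..1} \<Longrightarrow> s \<in> {0..tb} \<Longrightarrow> lab u (Y h s, tt h s) = s"
  by (rule lab_eq) (auto simp: u_ruled TT_def)

lemma lab_strict:
  assumes "adm v" "(y, t) \<in> W" "(y, t') \<in> W" "t < t'"
  shows "lab v (y, t) < lab v (y, t')"
proof (rule ccontr)
  assume n: "\<not> lab v (y, t) < lab v (y, t')"
  obtain h where h: "h \<in> {0..1}" "lab v (y, t) \<in> {0..tb}" "y = Y h (lab v (y, t))" "t + 4 * y * v (y, t) = TT h (lab v (y, t))"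
    using labE[OF assms(1,2)] by auto
  obtain h' where h': "h' \<in> {0..1}" "lab v (y, t') \<in> {0..tb}" "y = Y h' (lab v (y, t'))" "t' + 4 * y * v (y, t') = TT h' (lab v (y, t'))"
    using labE[OF assms(1,3)] by auto
  have "(lab v (y, t) - lab v (y, t')) / 2 \<le> TT h (lab v (y, t)) - TT h' (lab v (y, t'))"
    by (rule label_increase(1)) (use n h h' in auto)
  then have "TT h' (lab v (y, t')) \<le> TT h (lab v (y, t))" using n by simp
  then show False using admD(3)[OF assms] h(4) h'(4) by simp
qed

lemma lab_cont: assumes "adm v" shows "continuous_on W (lab v)"
  unfolding lab_def
  by (rule continuous_on_compose2[OF Lb_cont])
     (use in_chart[OF assms] in \<open>auto intro!: continuous_intros continuous_on_subset[OF admD(1)[OF assms]]\<close>)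

text \<open>If u attained the same value of t + 4 y u at a point off D, then v would attain it there
  too, against strict monotonicity. So interior points have interior labels.\<close>

lemma lab_in_D:
  assumes "adm v" "(y, t) \<in> D"
  obtains h t' where "h \<in> {0<..<1}" "lab v (y, t) \<in> {0<..<tb}" "y = Y h (lab v (y, t))"
    "t + 4 * y * v (y, t) = TT h (lab v (y, t))" "(y, t') \<in> D" "lab u (y, t') = lab v (y, t)"
proof -
  have W: "(y, t) \<in> W" using assms closure_subset[of D] by auto
  obtain t' where t': "(y, t') \<in> W" "t' + 4 * y * u (y, t') = t + 4 * y * v (y, t)"
    using transfer[OF assms(1) adm_u W] by auto
  have "(y, t') \<in> D"
  proof (rule ccontr)
    assume n: "(y, t') \<notin> D"
    then have "t' + 4 * y * v (y, t') = t + 4 * y * v (y, t)" using admD(2)[OF assms(1) n] t' by simp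
    then have "t = t'" using admD(3)[OF assms(1) W t'(1)] admD(3)[OF assms(1) t'(1) W] by (cases t t' rule: linorder_cases) auto
    then show False using n assms by simp
  qed
  then obtain h s where h: "h \<in> {0<..<1}" "s \<in> {0<..<tb}" "y = Y h s" "t' = tt h s" using ruled_cover by force
  then have "lab u (y, t') = s" using lab_u[of h s] by auto
  moreover have "lab v (y, t) = s" "t + 4 * y * v (y, t) = TT h s"
    using lab_eq[of s h "(y, t)" v] h t' u_ruled[of h s] by (auto simp: TT_def)
  ultimately show ?thesis using h \<open>(y, t') \<in> D\<close> by (intro that[of h t']) auto
qed

definition crv :: "(real \<times> real \<Rightarrow> real) \<Rightarrow> real \<Rightarrow> real \<Rightarrow> real" where
  "crv v s y = (THE t. (y, t) \<in> W \<and> lab v (y, t) = s)"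

lemma crv_ex1:
  assumes v: "adm v" and s: "s \<in> {0..tb}" "g1 s \<le> y" "y \<le> g2 (lam s)"
  shows "\<exists>!t. (y, t) \<in> W \<and> lab v (y, t) = s"
proof -
  obtain h where h: "h \<in> {0..1}" "y = Y h s" using Y_surj[OF s] by auto
  obtain t where t: "(y, t) \<in> W" "t + 4 * y * v (y, t) = tt h s + 4 * y * u (y, tt h s)"
    using transfer[OF adm_u v, of y "tt h s"] WI[OF h(1) s(1)] h(2) by auto
  have "lab v (y, t) = s" by (rule lab_eq[OF s(1) h(1)]) (use t h u_ruled[OF h(1) s(1)] in \<open>auto simp: TT_def\<close>)
  then show ?thesis using t lab_strict[OF v]
    by (intro ex1I[of _ t]) (auto, metis less_irrefl linorder_neqE_linordered_idom)
qed

lemma crv: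
  assumes v: "adm v" and s: "s \<in> {0..tb}" "g1 s \<le> y" "y \<le> g2 (lam s)"
  shows "(y, crv v s y) \<in> W" "lab v (y, crv v s y) = s"
  using theI'[OF crv_ex1[OF assms]] unfolding crv_def by blast+

lemma crv_eq:
  assumes v: "adm v" and t: "(y, t) \<in> W" "lab v (y, t) = s"
  shows "crv v s y = t"
proof -
  obtain h where h: "h \<in> {0..1}" "s \<in> {0..tb}" "y = Y h s" using labE[OF v t(1)] t(2) by auto
  have "\<exists>!t. (y, t) \<in> W \<and> lab v (y, t) = s"
    by (rule crv_ex1[OF v h(2)]) (use Y_range[OF h(2,1)] h(3) in auto)
  then show ?thesis unfolding crv_def using t by (intro the1_equality) auto
qed

lemma crv_ends:
  assumes v: "adm v" and s: "s \<in> {0..tb}"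
  shows "crv v s (g1 s) = s" "crv v s (g2 (lam s)) = lam s"
proof -
  have n: "(g1 s, s) \<notin> D" "(g2 (lam s), lam s) \<notin> D" by (auto simp: D_iff)
  have "(g1 s, s) \<in> W" "(g2 (lam s), lam s) \<in> W" "lab u (g1 s, s) = s" "lab u (g2 (lam s), lam s) = s"
    using WI[of 0 s] WI[of 1 s] lab_u[of 0 s] lab_u[of 1 s] s by (auto simp: Y_ends tt_ends)
  moreover have "lab v (g1 s, s) = lab u (g1 s, s)" "lab v (g2 (lam s), lam s) = lab u (g2 (lam s), lam s)"
    using admD(2)[OF v] n by (simp_all add: lab_def)
  ultimately show "crv v s (g1 s) = s" "crv v s (g2 (lam s)) = lam s" using crv_eq[OF v] by auto
qed

text \<open>Off D the labels with respect to v and u coincide; the point would then be the interior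
  point of a ruling, which lies in D.\<close>

lemma crv_in_D:
  assumes v: "adm v" and s: "s \<in> {0<..<tb}" "g1 s < y" "y < g2 (lam s)"
  shows "(y, crv v s y) \<in> D"
proof (rule ccontr)
  assume n: "(y, crv v s y) \<notin> D"
  have s': "s \<in> {0..tb}" "g1 s \<le> y" "y \<le> g2 (lam s)" using s by auto
  note c = crv[OF v s']
  have l: "lab u (y, crv v s y) = s" using c(2) admD(2)[OF v n] by (simp add: lab_def)
  obtain h where h: "h \<in> {0..1}" "y = Y h s" using Y_surj[OF s'] by auto
  have "h \<noteq> 0" "h \<noteq> 1" using h s by (auto simp: Y_ends)
  then have h': "h \<in> {0<..<1}" using h by auto
  have "crv u s y = crv v s y" by (rule crv_eq[OF adm_u c(1) l])
  moreover have "crv u s y = tt h s" by (rule crv_eq[OF adm_u]) (use WI lab_u h s' in auto)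
  ultimately show False using ruled_in(1)[OF h' s(1)] n h(2) by simp
qed

lemma crv_level:
  assumes v: "adm v" and s: "s \<in> {0<..<tb}" "g1 s \<le> y" "y \<le> g2 (lam s)"
  shows "crv v s y + 4 * y * v (y, crv v s y) = alpha s + 2 * slope s * y\<^sup>2"
proof -
  have s': "s \<in> {0..tb}" using s by auto
  note c = crv[OF v s' s(2,3)]
  obtain h where "y = Y h (lab v (y, crv v s y))" "crv v s y + 4 * y * v (y, crv v s y) = TT h (lab v (y, crv v s y))"
    by (rule labE[OF v c(1)], rule that, simp_all)
  then show ?thesis using TT_slope[OF s(1), of h] unfolding c(2) by simp
qed

text \<open>The map from (y, t) to y and the label is a continuous injection of the compact set W,
  so its inverse is continuous, jointly in label and y.\<close>

lemma crv_cont: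
  assumes v: "adm v"
  shows "continuous_on {q. snd q \<in> {0..tb} \<and> g1 (snd q) \<le> fst q \<and> fst q \<le> g2 (lam (snd q))} (\<lambda>q. crv v (snd q) (fst q))"
    (is "continuous_on ?A _")
proof -
  let ?f = "\<lambda>p. (fst p, lab v p)" and ?g = "\<lambda>q. (fst q, crv v (snd q) (fst q))"
  have img: "?f ` W = ?A"
  proof (intro equalityI subsetI)
    fix q assume "q \<in> ?f ` W"
    then obtain p where p: "p \<in> W" "q = ?f p" by auto
    obtain h where "h \<in> {0..1}" "lab v p \<in> {0..tb}" "fst p = Y h (lab v p)" using labE[OF v p(1)] by auto
    then show "q \<in> ?A" using Y_range[of "lab v p" h] p(2) by auto
  next
    fix q assume "q \<in> ?A"
    then show "q \<in> ?f ` W" using crv[OF v, of "snd q" "fst q"]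
      by (intro image_eqI[of _ _ "?g q"]) (auto intro: prod_eqI)
  qed
  have "continuous_on (?f ` W) ?g"
  proof (rule continuous_on_inv[OF _ W_compact])
    show "continuous_on W ?f" by (intro continuous_intros lab_cont v)
    show "\<forall>p\<in>W. ?g (?f p) = p" using crv_eq[OF v] by (auto intro!: prod_eqI)
  qed
  then have "continuous_on ?A (\<lambda>q. snd (?g q))" unfolding img by (rule continuous_on_snd)
  then show ?thesis by simp
qed

text \<open>Beyond the right end of the ruling, the set where g2 exceeds y is an interval by
  concavity, and it misses \<open>lam s\<close>. The point and the right foot \<open>lam k\<close>
  of its own label k both lie in this interval, hence on the same side of
  \<open>lam s\<close>.\<close>

lemma outside_right:
  assumes v: "adm v" and s: "s \<in> {0<..<tb}" and y: "g2 (lam s) < y" and p: "(y, t) \<in> D"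
  shows "lab v (y, t) < s \<longleftrightarrow> t < lam s"
proof -
  have ls: "lam s \<in> {0..tb}" using lam s by auto
  have side: "a < lam s \<longleftrightarrow> b < lam s" if "a \<in> {0..tb}" "b \<in> {0..tb}" "y < g2 a" "y < g2 b" for a b
  proof -
    have no: "\<not> (a < lam s \<and> lam s < b)" if *: "a \<in> {0..tb}" "b \<in> {0..tb}" "y < g2 a" "y < g2 b" for a b
    proof
      assume ab: "a < lam s \<and> lam s < b"
      define r where "r = (lam s - a) / (b - a)"
      have r: "0 \<le> r" "r \<le> 1" using ab by (auto simp: r_def)
      have "(1 - r) * a + r * b = lam s" unfolding r_def by (rule convex_combination_point) (use ab in auto)
      then have "(1 - r) * g2 a + r * g2 b \<le> g2 (lam s)"
        using concave_onD[OF g2_concave r *(1,2)] by simp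
      moreover have "(1 - r) * y + r * y \<le> (1 - r) * g2 a + r * g2 b"
        by (intro add_mono mult_left_mono) (use r * in auto)
      ultimately show False using assms(3) by (simp add: algebra_simps)
    qed
    have "a \<noteq> lam s" "b \<noteq> lam s" using that y by auto
    then show ?thesis using no[OF that] no[of b a] that by auto
  qed
  obtain h t' where h: "h \<in> {0<..<1}" "lab v (y, t) \<in> {0<..<tb}" "y = Y h (lab v (y, t))" "(y, t') \<in> D" "lab u (y, t') = lab v (y, t)"
    using lab_in_D[OF v p] by metis
  define k where "k = lab v (y, t)"
  have k: "k \<in> {0<..<tb}" "lam k \<in> {0..tb}" using h lam by (auto simp: k_def)
  have "h * wid k < 1 * wid k" by (rule mult_strict_right_mono) (use h wid_pos[OF k(1)] in auto)
  then have "y < g2 (lam k)" using h(3) by (simp add: Y_def wid_def k_def)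
  moreover have "t \<in> {0..tb}" "y < g2 t" using p by (auto simp: D_iff)
  ultimately have "t < lam s \<longleftrightarrow> lam k < lam s" using side[of t "lam k"] k by auto
  moreover have "lam k < lam s \<longleftrightarrow> k < s"
    using lam_strict[of k s] lam_strict[of s k] k s by (cases k s rule: linorder_cases) auto
  ultimately show ?thesis by (simp add: k_def)
qed

text \<open>The mirror argument with the convexity of g1; on this side the foot of a ruling is its
  label itself.\<close>

lemma outside_left:
  assumes v: "adm v" and s: "s \<in> {0<..<tb}" and y: "y < g1 s" and p: "(y, t) \<in> D"
  shows "lab v (y, t) < s \<longleftrightarrow> t < s"
proof -
  have side: "a < s \<longleftrightarrow> b < s" if "a \<in> {0..tb}" "b \<in> {0..tb}" "g1 a < y" "g1 b < y" for a b
  proof -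
    have no: "\<not> (a < s \<and> s < b)" if *: "a \<in> {0..tb}" "b \<in> {0..tb}" "g1 a < y" "g1 b < y" for a b
    proof
      assume ab: "a < s \<and> s < b"
      define r where "r = (s - a) / (b - a)"
      have r: "0 \<le> r" "r \<le> 1" using ab by (auto simp: r_def)
      have "(1 - r) * a + r * b = s" unfolding r_def by (rule convex_combination_point) (use ab in auto)
      then have "g1 s \<le> (1 - r) * g1 a + r * g1 b"
        using convex_onD[OF g1_convex r *(1,2)] by simp
      moreover have "(1 - r) * g1 a + r * g1 b \<le> (1 - r) * y + r * y"
        by (intro add_mono mult_left_mono) (use r * in auto)
      ultimately show False using assms(3) by (simp add: algebra_simps)
    qed
    have "a \<noteq> s" "b \<noteq> s" using that y by auto
    then show ?thesis using no[OF that] no[of b a] that by auto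
  qed
  obtain h t' where h: "h \<in> {0<..<1}" "lab v (y, t) \<in> {0<..<tb}" "y = Y h (lab v (y, t))" "(y, t') \<in> D" "lab u (y, t') = lab v (y, t)"
    using lab_in_D[OF v p] by metis
  define k where "k = lab v (y, t)"
  have k: "k \<in> {0<..<tb}" using h by (auto simp: k_def)
  have "h * wid k > 0" using h wid_pos[OF k] by auto
  then have "g1 k < y" using h(3) by (simp add: Y_def k_def)
  moreover have "t \<in> {0..tb}" "g1 t < y" using p by (auto simp: D_iff)
  ultimately have "t < s \<longleftrightarrow> k < s" using side[of t k] k by auto
  then show ?thesis by (simp add: k_def)
qed

end

lemma set_integral_region_const:
  fixes c :: "real \<Rightarrow> real"
  assumes c: "continuous_on UNIV c" and y: "y1 \<le> y2" and a: "\<And>y. y \<in> {y1..y2} \<Longrightarrow> a \<le> c y"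
  shows "emeasure lborel {p. y1 < fst p \<and> fst p \<le> y2 \<and> a < snd p \<and> snd p \<le> c (fst p)} < \<infinity>"
    and "measure lborel {p. y1 < fst p \<and> fst p \<le> y2 \<and> a < snd p \<and> snd p \<le> c (fst p)} = integral {y1..y2} (\<lambda>y. c y - a)"
proof -
  let ?R = "{p. y1 < fst p \<and> fst p \<le> y2 \<and> a < snd p \<and> snd p \<le> c (fst p)}"
  have [measurable]: "c \<in> borel_measurable borel" by (rule borel_measurable_continuous_onI[OF c])
  have R: "?R \<in> sets (lborel \<Otimes>\<^sub>M lborel)"
  proof -
    have "{p \<in> space (lborel \<Otimes>\<^sub>M lborel). y1 < fst p \<and> fst p \<le> y2 \<and> a < snd p \<and> snd p \<le> c (fst p)} \<in> sets (lborel \<Otimes>\<^sub>M lborel)"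
      by measurable
    then show ?thesis by (simp add: space_pair_measure)
  qed
  have "emeasure lborel ?R = emeasure (lborel \<Otimes>\<^sub>M lborel) ?R" by (simp add: lborel_prod)
  also have "\<dots> = (\<integral>\<^sup>+y. emeasure lborel (Pair y -` ?R) \<partial>lborel)"
    by (rule lborel.emeasure_pair_measure_alt[OF R])
  also have "\<dots> = (\<integral>\<^sup>+y. ennreal (indicator {y1<..y2} y * (c y - a)) \<partial>lborel)"
  proof (rule nn_integral_cong)
    fix y
    have "Pair y -` ?R = (if y \<in> {y1<..y2} then {a<..c y} else {})" by auto
    then show "emeasure lborel (Pair y -` ?R) = ennreal (indicator {y1<..y2} y * (c y - a))"
      using a[of y] by (auto simp: indicator_def)
  qed
  also have "\<dots> = ennreal (\<integral>y. indicator {y1<..y2} y * (c y - a) \<partial>lborel)"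
  proof (rule nn_integral_eq_integral)
    have "set_integrable lborel {y1..y2} (\<lambda>y. c y - a)"
      by (rule borel_integrable_atLeastAtMost') (intro continuous_intros continuous_on_subset[OF c] subset_UNIV)
    then have "set_integrable lborel {y1<..y2} (\<lambda>y. c y - a)" by (rule set_integrable_subset) auto
    then show "integrable lborel (\<lambda>y. indicator {y1<..y2} y * (c y - a))" by (simp add: set_integrable_def)
    show "AE y in lborel. 0 \<le> indicator {y1<..y2} y * (c y - a)"
      using a by (intro AE_I2) (auto simp: indicator_def)
  qed
  also have "(\<integral>y. indicator {y1<..y2} y * (c y - a) \<partial>lborel) = integral {y1..y2} (\<lambda>y. c y - a)"
    using integral_Ioc_eq[of "\<lambda>y. c y - a" y1 y2] c by (simp add: mult.commute continuous_on_diff)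
  finally have e: "emeasure lborel ?R = ennreal (integral {y1..y2} (\<lambda>y. c y - a))" .
  then show "emeasure lborel ?R < \<infinity>" by simp
  have "0 \<le> integral {y1..y2} (\<lambda>y. c y - a)"
    by (rule integral_nonneg) (use a in \<open>auto intro!: integrable_continuous_real continuous_intros continuous_on_subset[OF c]\<close>)
  with e show "measure lborel ?R = integral {y1..y2} (\<lambda>y. c y - a)" by (simp add: measure_def)
qed

text \<open>Freezing t at \<open>c y\<close> beyond the curve replaces the moving limit of
  integration by a fixed one, at the price of an explicit continuous term.\<close>

lemma continuous_integral_to_curve:
  assumes v: "continuous_on UNIV (v :: real \<times> real \<Rightarrow> real)" and c: "continuous_on UNIV c"
    and r: "\<And>y. 0 \<le> c y \<and> c y \<le> T"
  shows "continuous_on UNIV (\<lambda>y. integral {0..c y} (\<lambda>t. v (y, t)))"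
proof -
  have e: "integral {0..c y} (\<lambda>t. v (y, t)) = integral (cbox 0 T) (\<lambda>t. v (y, min t (c y))) - (T - c y) * v (y, c y)" for y
  proof -
    have m: "continuous_on A (\<lambda>t. v (y, min t (c y)))" for A
      by (intro continuous_on_compose2[OF v] continuous_intros subset_UNIV)
    have "integral {0..c y} (\<lambda>t. v (y, min t (c y))) + integral {c y..T} (\<lambda>t. v (y, min t (c y))) = integral {0..T} (\<lambda>t. v (y, min t (c y)))"
      by (rule Henstock_Kurzweil_Integration.integral_combine) (use r m in \<open>auto intro!: integrable_continuous_real\<close>)
    moreover have "integral {0..c y} (\<lambda>t. v (y, min t (c y))) = integral {0..c y} (\<lambda>t. v (y, t))"
      by (rule integral_cong) auto
    moreover have "integral {c y..T} (\<lambda>t. v (y, min t (c y))) = integral {c y..T} (\<lambda>t. v (y, c y))"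
      by (rule integral_cong) (auto simp: min_absorb2)
    ultimately show ?thesis using r[of y] by simp
  qed
  have "continuous_on UNIV (\<lambda>y. integral (cbox 0 T) (\<lambda>t. v (y, min t (c y))))"
  proof (rule integral_continuous_on_param)
    have "continuous_on (UNIV \<times> cbox 0 T) (\<lambda>q. v (fst q, min (snd q) (c (fst q))))"
      by (intro continuous_on_compose2[OF v] continuous_intros continuous_on_compose2[OF c] subset_UNIV)
    then show "continuous_on (UNIV \<times> cbox 0 T) (\<lambda>(y, t). v (y, min t (c y)))" by (simp add: case_prod_unfold)
  qed
  then show ?thesis unfolding e
    by (intro continuous_intros c continuous_on_compose2[OF v]) auto
qed

lemma continuous_on_integral_halfplane:
  fixes E :: "real \<times> real \<Rightarrow> real"
  assumes E: "integrable lborel E"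
  shows "continuous_on UNIV (\<lambda>x. LINT p:{p. fst p \<le> x}|lborel. E p)"
proof (rule continuous_on_sequentiallyI)
  fix x :: "nat \<Rightarrow> real" and a assume x: "x \<longlonglongrightarrow> a"
  have S: "{p :: real \<times> real. fst p \<le> r} \<in> sets borel" for r
    by (intro borel_closed closed_Collect_le continuous_intros)
  show "(\<lambda>n. LINT p:{p. fst p \<le> x n}|lborel. E p) \<longlonglongrightarrow> (LINT p:{p. fst p \<le> a}|lborel. E p)"
    unfolding set_lebesgue_integral_def
  proof (rule integral_dominated_convergence[where w="\<lambda>p. norm (E p)"])
    show "AE p in lborel. (\<lambda>n. indicator {p. fst p \<le> x n} p *\<^sub>R E p) \<longlonglongrightarrow> indicator {p. fst p \<le> a} p *\<^sub>R E p"
      using AE_lborel_fst_snd_neq(1)[of a]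
    proof eventually_elim
      case (elim p)
      have "\<forall>\<^sub>F n in sequentially. (fst p \<le> x n) = (fst p \<le> a)"
      proof (cases "fst p < a")
        case True
        then show ?thesis using order_tendstoD(1)[OF x True] by (auto elim: eventually_mono)
      next
        case False
        then have "a < fst p" using elim by simp
        then show ?thesis using order_tendstoD(2)[OF x, of "fst p"] by (auto elim: eventually_mono)
      qed
      then have "\<forall>\<^sub>F n in sequentially. indicator {p. fst p \<le> x n} p *\<^sub>R E p = indicator {p. fst p \<le> a} p *\<^sub>R E p"
        by eventually_elim (simp add: indicator_def)
      then show ?case by (rule tendsto_eventually)
    qed
    show "AE p in lborel. norm (indicator {p. fst p \<le> x n} p *\<^sub>R E p) \<le> norm (E p)" for n
      by (rule AE_I2) (simp add: indicator_def)
  qed (use E S in \<open>auto intro!: borel_measurable_scaleR borel_measurable_indicator\<close>)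
qed

section \<open>Slopes of the rulings\<close>

context ruled_graph
begin

lemma slope_cont: "continuous_on {0<..<tb} slope"
  unfolding slope_def
  by (intro continuous_on_divide continuous_on_subset[OF rise_cont] continuous_on_subset[OF wid_cont])
     (use wid_pos in force)+

lemma Lu0: "Lu \<ge> 0" using u_lip by (rule lipschitz_on_nonneg)

text \<open>The rulings shrink at both ends of I, but \<open>lam s - s\<close> is -2
  \<open>wid s\<close> times a sum of two boundary values. The two ends of a ruling are therefore at
  a distance comparable to \<open>wid s\<close>, and the Lipschitz constant of u bounds the quotient
  uniformly.\<close>

lemma slope_bound: assumes s: "s \<in> {0<..<tb}" shows "\<bar>slope s\<bar> \<le> Lu * (1 + 4 * P)"
proof -
  have s': "s \<in> {0..tb}" using s by auto
  have w: "wid s > 0" using wid_pos[OF s] .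
  have "u (g1 s, s) = f1 s" "u (g2 (lam s), lam s) = f2 (lam s)"
    using u_ruled[of 0 s] u_ruled[of 1 s] s' by (auto simp: Y_ends tt_ends U_def rise_def)
  then have "\<bar>rise s\<bar> = dist (u (g2 (lam s), lam s)) (u (g1 s, s))" by (simp add: rise_def dist_real_def)
  also have "\<dots> \<le> Lu * dist (g2 (lam s), lam s) (g1 s, s)"
    by (rule lipschitz_onD[OF u_lip]) (use WI[of 0 s] WI[of 1 s] s' in \<open>auto simp: Y_ends tt_ends\<close>)
  also have "\<dots> \<le> Lu * (wid s + \<bar>lam s - s\<bar>)"
  proof (rule mult_left_mono[OF _ Lu0])
    show "dist (g2 (lam s), lam s) (g1 s, s) \<le> wid s + \<bar>lam s - s\<bar>"
      using sqrt_sum_squares_le_sum_abs[of "g2 (lam s) - g1 s" "lam s - s"] w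
      by (simp add: dist_prod_def dist_real_def wid_def)
  qed
  also have "\<dots> \<le> Lu * (wid s + wid s * (4 * P))"
  proof -
    have "lam s - s = - 2 * wid s * (f2 (lam s) + f1 s)" using lam(2)[OF s'] unfolding F_def wid_def[symmetric] by linarith
    then have "\<bar>lam s - s\<bar> = wid s * (2 * \<bar>f2 (lam s) + f1 s\<bar>)" using w by (simp add: abs_mult)
    also have "\<dots> \<le> wid s * (4 * P)"
      using w fP(1)[OF s'] fP(2)[OF lam(1)[OF s']] by (intro mult_left_mono) auto
    finally show ?thesis using Lu0 by (intro mult_left_mono) auto
  qed
  also have "\<dots> = Lu * (1 + 4 * P) * wid s" by (simp add: algebra_simps)
  finally show ?thesis using w by (simp add: slope_def abs_divide pos_divide_le_eq)
qed

text \<open>On a compact label interval \<open>wid\<close> has a positive minimum, so the quotient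
  inherits the Lipschitz bounds of numerator and denominator.\<close>

lemma slope_locally_lipschitz:
  assumes "0 < e" "e < tb"
  shows "\<exists>C\<ge>0. \<forall>s\<in>{e..tb - e}. \<forall>s'\<in>{e..tb - e}. s \<le> s' \<longrightarrow> \<bar>slope s' - slope s\<bar> \<le> C * (s' - s)"
proof (cases "{e..tb - e} = {}")
  case False
  have sub: "{e..tb - e} \<subseteq> {0<..<tb}" using assms by auto
  obtain s0 where s0: "s0 \<in> {e..tb - e}" "\<And>s. s \<in> {e..tb - e} \<Longrightarrow> wid s0 \<le> wid s"
    using continuous_attains_inf[OF compact_Icc False continuous_on_subset[OF wid_cont]] assms by auto
  have w0: "wid s0 > 0" using wid_pos s0 sub by blast
  define M where "M = Lu * (1 + 4 * P)"
  define C where "C = (25/12) * (LP + M * LG) / wid s0"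
  have M0: "M \<ge> 0" using Lu0 P0 by (simp add: M_def)
  have "\<bar>slope s' - slope s\<bar> \<le> C * (s' - s)" if s: "s \<in> {e..tb - e}" "s' \<in> {e..tb - e}" "s \<le> s'" for s s'
  proof -
    have i: "s \<in> {0<..<tb}" "s' \<in> {0<..<tb}" using s assms by auto
    then have ic: "s \<in> {0..tb}" "s' \<in> {0..tb}" by auto
    have dl: "0 \<le> lam s' - lam s" "lam s' - lam s \<le> 13/12 * (s' - s)" using lam_lip[of s s'] ic s by auto
    have l: "LG * \<bar>lam s' - lam s\<bar> \<le> LG * (13/12 * (s' - s))" "LP * \<bar>lam s' - lam s\<bar> \<le> LP * (13/12 * (s' - s))"
      by (rule mult_left_mono; use dl LG0 LP0 in simp)+
    have d1: "\<bar>g1 s' - g1 s\<bar> \<le> LG * (s' - s)" "\<bar>f1 s' - f1 s\<bar> \<le> LP * (s' - s)"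
      using g_lip(1)[OF ic(2,1)] f_lip(1)[OF ic(2,1)] s by auto
    have d2: "\<bar>g2 (lam s') - g2 (lam s)\<bar> \<le> LG * \<bar>lam s' - lam s\<bar>" "\<bar>f2 (lam s') - f2 (lam s)\<bar> \<le> LP * \<bar>lam s' - lam s\<bar>"
      using g_lip(2) f_lip(2) lam(1) ic by auto
    have tri: "\<bar>(z' - x') - (z - x)\<bar> \<le> (25/12) * (L * c)"
      if "\<bar>x' - x\<bar> \<le> L * c" "\<bar>z' - z\<bar> \<le> b" "b \<le> L * (13/12 * c)" for x x' z z' b c L :: real
    proof -
      have "b \<le> 13/12 * (L * c)" using that(3) by simp
      then show ?thesis using that(1,2) by (auto simp: abs_if split: if_splits)
    qed
    have dw: "\<bar>wid s' - wid s\<bar> \<le> (25/12) * (LG * (s' - s))" and dr: "\<bar>rise s' - rise s\<bar> \<le> (25/12) * (LP * (s' - s))"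
      unfolding wid_def rise_def by (rule tri[OF d1(1) d2(1) l(1)], rule tri[OF d1(2) d2(2) l(2)])
    have w: "wid s > 0" "wid s' > 0" using wid_pos i by auto
    have "slope s' - slope s = ((rise s' - rise s) - slope s * (wid s' - wid s)) / wid s'"
      using w by (simp add: slope_def field_simps)
    then have "\<bar>slope s' - slope s\<bar> = \<bar>(rise s' - rise s) - slope s * (wid s' - wid s)\<bar> / wid s'"
      using w by simp
    also have "\<dots> \<le> ((25/12) * (LP * (s' - s)) + M * ((25/12) * (LG * (s' - s)))) / wid s0"
    proof (rule frac_le[OF _ _ w0])
      have "\<bar>slope s * (wid s' - wid s)\<bar> \<le> M * ((25/12) * (LG * (s' - s)))"
        unfolding abs_mult by (rule mult_mono[OF _ dw]) (use slope_bound[OF i(1)] M0 in \<open>auto simp: M_def\<close>)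
      then show "\<bar>(rise s' - rise s) - slope s * (wid s' - wid s)\<bar> \<le> (25/12) * (LP * (s' - s)) + M * ((25/12) * (LG * (s' - s)))"
        using dr by linarith
      then show "0 \<le> (25/12) * (LP * (s' - s)) + M * ((25/12) * (LG * (s' - s)))" by linarith
      show "wid s0 \<le> wid s'" using s0(2) s(2) .
    qed
    also have "\<dots> = C * (s' - s)" by (simp add: C_def algebra_simps add_divide_distrib)
    finally show ?thesis .
  qed
  moreover have "C \<ge> 0" using LP0 LG0 M0 w0 by (simp add: C_def)
  ultimately show ?thesis by blast
qed auto

text \<open>The slope of the ruling through the point, the candidate for Bu; \<open>B_rep_u\<close>
  confirms it.\<close>

definition mu :: "real \<times> real \<Rightarrow> real" where "mu p = (if p \<in> D then slope (lab u p) else 0)"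

lemma D_sub_W: "D \<subseteq> W" by (rule closure_subset)

lemma lab_range: "adm v \<Longrightarrow> p \<in> D \<Longrightarrow> lab v p \<in> {0<..<tb}"
  using lab_in_D[of v "fst p" "snd p"] by (metis prod.collapse)

lemma slope_lab_cont: "adm v \<Longrightarrow> continuous_on D (\<lambda>p. slope (lab v p))"
  by (rule continuous_on_compose2[OF slope_cont continuous_on_subset[OF lab_cont D_sub_W]])
     (use lab_range in auto)

lemma D_borel [measurable]: "D \<in> sets borel" using D_open by simp

lemma slope_lab_borel: "adm v \<Longrightarrow> (\<lambda>p. indicator D p *\<^sub>R slope (lab v p)) \<in> borel_measurable borel"
  by (rule borel_measurable_continuous_on_indicator[OF D_borel slope_lab_cont])

lemma mu_borel [measurable]: "mu \<in> borel_measurable borel"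
  using slope_lab_borel[OF adm_u] by (rule measurable_cong[THEN iffD1, rotated]) (simp add: mu_def indicator_def)

lemma mu_bound: "\<bar>mu p\<bar> \<le> Lu * (1 + 4 * P)"
  using slope_bound[OF lab_range[OF adm_u]] Lu0 P0 by (auto simp: mu_def)

lemma D_bounded: "bounded D" using W_compact D_sub_W by (metis bounded_subset compact_imp_bounded)

lemma D_finite: "emeasure lborel D < \<infinity>"
  using emeasure_bounded_finite[OF D_bounded] by simp

lemma bounded_set_integrable:
  fixes k :: "real \<times> real \<Rightarrow> real"
  assumes [measurable]: "k \<in> borel_measurable borel" "A \<in> sets borel" and "A \<subseteq> D" "\<And>p. p \<in> A \<Longrightarrow> \<bar>k p\<bar> \<le> C"
  shows "set_integrable lborel A k"
  unfolding set_integrable_def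
proof (rule integrable_bounded_box[OF _ D_bounded])
  show "\<bar>indicator A p *\<^sub>R k p\<bar> \<le> max C 0" for p using assms(4)[of p] by (auto simp: indicator_def)
qed (use assms in \<open>auto simp: indicator_def\<close>)

lemma sublevel_open: "adm v \<Longrightarrow> open {p \<in> D. lab v p < s}"
proof -
  assume v: "adm v"
  obtain A where "open A" "A \<inter> D = {p \<in> D. lab v p < s}"
    using open_Collect_less_Int[OF continuous_on_subset[OF lab_cont[OF v] D_sub_W] continuous_on_const] by blast
  then show ?thesis using D_open by (metis open_Int)
qed

lemma slice_between:
  assumes "(y, a) \<in> D" "(y, b) \<in> D" "t \<in> {a..b}" shows "(y, t) \<in> D"
proof (cases "a = b")
  case False
  then have ab: "a < b" using assms by auto
  define r where "r = (t - a) / (b - a)"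
  have r: "0 \<le> r" "r \<le> 1" using assms ab by (auto simp: r_def)
  have "(1 - r) *\<^sub>R (y, a) + r *\<^sub>R (y, b) \<in> D" by (rule convexD_alt[OF D_convex assms(1,2) r])
  moreover have "(1 - r) * a + r * b = t" unfolding r_def by (rule convex_combination_point[OF ab])
  moreover have "(1 - r) * y + r * y = y" by (simp add: algebra_simps)
  ultimately show ?thesis by simp
qed (use assms in auto)

lemma lab_less_crv:
  assumes v: "adm v" and s: "s \<in> {0..tb}" "g1 s \<le> y" "y \<le> g2 (lam s)" and p: "(y, t) \<in> W"
  shows "lab v (y, t) < s \<longleftrightarrow> t < crv v s y"
  using lab_strict[OF v p crv(1)[OF v s]] lab_strict[OF v crv(1)[OF v s] p] crv(2)[OF v s]
  by (cases t "crv v s y" rule: linorder_cases) auto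

end

lemma AE_not_on_graph:
  assumes c: "continuous_on UNIV (c :: real \<Rightarrow> real)"
  shows "AE p in (lborel :: (real \<times> real) measure). snd p \<noteq> c (fst p)"
proof -
  have [measurable]: "c \<in> borel_measurable borel" by (rule borel_measurable_continuous_onI[OF c])
  have "AE p in (lborel :: real measure) \<Otimes>\<^sub>M (lborel :: real measure). snd p \<noteq> c (fst p)"
  proof (rule lborel_pair.AE_pair_measure)
    show "{p \<in> space ((lborel :: real measure) \<Otimes>\<^sub>M (lborel :: real measure)). snd p \<noteq> c (fst p)} \<in> sets (lborel \<Otimes>\<^sub>M lborel)"
      by measurable
    show "AE x in (lborel :: real measure). AE y in (lborel :: real measure). snd (x, y) \<noteq> c (fst (x, y))"
      by (rule AE_I2) (simp add: AE_lborel_singleton)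
  qed
  then show ?thesis unfolding lborel_prod .
qed

lemma (in ruled_graph) lab_between:
  assumes w: "adm w" and p: "p \<in> D"
  shows "g1 (lab w p) < fst p" "fst p < g2 (lam (lab w p))"
proof -
  obtain h where h: "h \<in> {0<..<1}" "lab w p \<in> {0<..<tb}" "fst p = Y h (lab w p)"
    using lab_in_D[OF w, of "fst p" "snd p"] p by auto
  have "0 < h * wid (lab w p)" "h * wid (lab w p) < 1 * wid (lab w p)"
    using h(1) wid_pos[OF h(2)] by (auto intro!: mult_strict_right_mono)
  moreover have "fst p = g1 (lab w p) + h * wid (lab w p)" using h(3) unfolding Y_def .
  moreover have "wid (lab w p) = g2 (lam (lab w p)) - g1 (lab w p)" by (rule wid_def)
  ultimately show "g1 (lab w p) < fst p" "fst p < g2 (lam (lab w p))" by linarith+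
qed

section \<open>Balance of excess below a ruling\<close>

text \<open>b is a density of Bv. Integrability on D may be assumed, since |b| is at most the area
  density of v and an infinite area leaves nothing to prove.\<close>

locale comparison = ruled_graph +
  fixes v b :: "real \<times> real \<Rightarrow> real"
  assumes v_adm: "adm v"
    and b_borel [measurable]: "b \<in> borel_measurable borel" and b_int: "set_integrable lborel (domD tb g1 g2) b"
    and law_v: "\<And>y y' t t'. y \<le> y' \<Longrightarrow> t \<le> t' \<Longrightarrow> {y..y'} \<times> {t..t'} \<subseteq> domD tb g1 g2 \<Longrightarrow> box_law v b y y' t t'"
    and law_u: "\<And>y y' t t'. y \<le> y' \<Longrightarrow> t \<le> t' \<Longrightarrow> {y..y'} \<times> {t..t'} \<subseteq> domD tb g1 g2 \<Longrightarrow> box_law u mu y y' t t'"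
begin

lemma v_cont: "continuous_on UNIV v" using admD(1)[OF v_adm] .

lemma v_off: "p \<notin> D \<Longrightarrow> v p = u p" using admD(2)[OF v_adm] .

lemma mu_int: "set_integrable lborel D mu"
  by (rule bounded_set_integrable) (auto intro: mu_bound)

definition f :: "real \<times> real \<Rightarrow> real" where "f p = indicator D p * (b p - mu p)"

lemma f_int: "integrable lborel f"
  using set_integral_diff(1)[OF b_int mu_int] by (simp add: set_integrable_def f_def[abs_def])

text \<open>For v or u alone no law is available beyond D. The differences of v and u and of their
  squares vanish off D and are continuous, so \<open>box_law_across_boundary\<close> applies to
  them.\<close>

lemma law_diff:
  assumes y: "y \<le> y'" and t: "0 \<le> t" "t \<le> t'" "t' \<le> tb"
  shows "(LINT p:{y<..y'} \<times> {t<..t'}|lborel. f p)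
    = integral {t..t'} (\<lambda>t. v (y', t) - u (y', t)) - integral {t..t'} (\<lambda>t. v (y, t) - u (y, t))
      - 2 * (integral {y..y'} (\<lambda>y. (v (y, t'))\<^sup>2 - (u (y, t'))\<^sup>2) - integral {y..y'} (\<lambda>y. (v (y, t))\<^sup>2 - (u (y, t))\<^sup>2))"
proof (rule box_law_across_boundary[where z="\<lambda>p. v p - u p" and ?z2.0="\<lambda>p. (v p)\<^sup>2 - (u p)\<^sup>2", OF LG0 g_lip g_ends _ _ _ _ _ f_int _ _ y t])
  show "g1 t \<le> g2 t" if "t \<in> {0..tb}" for t using g_sign'[of t] that by auto
  show "continuous_on UNIV (\<lambda>p. v p - u p)" "continuous_on UNIV (\<lambda>p. (v p)\<^sup>2 - (u p)\<^sup>2)"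
    by (intro continuous_intros v_cont u_cont)+
  show "v p - u p = 0" "(v p)\<^sup>2 - (u p)\<^sup>2 = 0" if "p \<notin> D" for p using v_off[OF that] by auto
  show "f p = 0" if "p \<notin> D" for p using that by (simp add: f_def)
next
  fix a b' c d :: real assume *: "a \<le> b'" "c \<le> d" "{a..b'} \<times> {c..d} \<subseteq> D"
  have sub: "{a<..b'} \<times> {c<..d} \<subseteq> D" using *(3) by auto
  have [measurable]: "{a<..b'} \<times> {c<..d} \<in> sets borel" by (simp add: borel_Times)
  have "(LINT p:{a<..b'} \<times> {c<..d}|lborel. f p) = (LINT p:{a<..b'} \<times> {c<..d}|lborel. b p - mu p)"
    unfolding set_lebesgue_integral_def
    by (rule Bochner_Integration.integral_cong) (use sub in \<open>auto simp: f_def indicator_def\<close>)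
  also have "\<dots> = (LINT p:{a<..b'} \<times> {c<..d}|lborel. b p) - (LINT p:{a<..b'} \<times> {c<..d}|lborel. mu p)"
    by (rule set_integral_diff(2); rule set_integrable_subset[OF b_int] set_integrable_subset[OF mu_int]) (use sub in auto)
  finally have e: "(LINT p:{a<..b'} \<times> {c<..d}|lborel. f p) = (LINT p:{a<..b'} \<times> {c<..d}|lborel. b p) - (LINT p:{a<..b'} \<times> {c<..d}|lborel. mu p)" .
  have i: "integral {l..r} (\<lambda>t. k t - k' t) = integral {l..r} k - integral {l..r} k'"
    if "continuous_on UNIV k" "continuous_on UNIV k'" for l r and k k' :: "real \<Rightarrow> real"
    by (rule Henstock_Kurzweil_Integration.integral_diff)
       (auto intro!: integrable_continuous_real continuous_on_subset[OF that(1)] continuous_on_subset[OF that(2)])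
  note i1 = i[OF continuous_on_slice(1)[OF v_cont] continuous_on_slice(1)[OF u_cont]]
  note i2 = i[OF continuous_on_power[OF continuous_on_slice(2)[OF v_cont]] continuous_on_power[OF continuous_on_slice(2)[OF u_cont]]]
  show "(LINT p:{a<..b'} \<times> {c<..d}|lborel. f p)
    = integral {c..d} (\<lambda>t. v (b', t) - u (b', t)) - integral {c..d} (\<lambda>t. v (a, t) - u (a, t))
      - 2 * (integral {a..b'} (\<lambda>y. (v (y, d))\<^sup>2 - (u (y, d))\<^sup>2) - integral {a..b'} (\<lambda>y. (v (y, c))\<^sup>2 - (u (y, c))\<^sup>2))"
    unfolding e i1 i2 using law_v[OF *] law_u[OF *] unfolding box_law_def by simp
qed

text \<open>On the level curve 4 y w is the parabola minus the height of the curve, so the curve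
  integral in \<open>level_curve_flux\<close> cancels against \<open>slope s\<close> times the area.
  Apart from its ends, nothing specific to the curve of w remains.\<close>

lemma curve_flux:
  assumes w: "adm w" and k[measurable]: "k \<in> borel_measurable borel" and ki: "set_integrable lborel D k"
    and law: "\<And>y y' t t'. y \<le> y' \<Longrightarrow> t \<le> t' \<Longrightarrow> {y..y'} \<times> {t..t'} \<subseteq> D \<Longrightarrow> box_law w k y y' t t'"
    and s: "s \<in> {0<..<tb}" and c: "continuous_on UNIV c" and cc: "\<And>y. y \<in> {y1..y2} \<Longrightarrow> c y = crv w s y"
    and y: "y1 \<le> y2" "0 \<notin> {y1..y2}" "g1 s \<le> y1" "y2 \<le> g2 (lam s)"
    and box: "{y1..y2} \<times> {a..d} \<subseteq> D" and ad: "\<And>y. y \<in> {y1..y2} \<Longrightarrow> a \<le> c y \<and> c y \<le> d"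
  shows "(LINT p:{p. y1 < fst p \<and> fst p \<le> y2 \<and> a < snd p \<and> snd p \<le> c (fst p)}|lborel. k p - slope s)
    = (integral {a..c y2} (\<lambda>t. w (y2, t)) + 2 * y2 * (w (y2, c y2))\<^sup>2)
      - (integral {a..c y1} (\<lambda>t. w (y1, t)) + 2 * y1 * (w (y1, c y1))\<^sup>2)
      + 2 * integral {y1..y2} (\<lambda>y. (w (y, a))\<^sup>2)
      - slope s * integral {y1..y2} (\<lambda>y. alpha s + 2 * slope s * y\<^sup>2 - a)"
proof -
  let ?R = "{p. y1 < fst p \<and> fst p \<le> y2 \<and> a < snd p \<and> snd p \<le> c (fst p)}"
  have [measurable]: "c \<in> borel_measurable borel" by (rule borel_measurable_continuous_onI[OF c])
  have R[measurable]: "?R \<in> sets borel"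
  proof -
    have "Measurable.pred borel (\<lambda>p. y1 < fst p \<and> fst p \<le> y2 \<and> a < snd p \<and> snd p \<le> c (fst p))" by measurable
    then show ?thesis by (simp add: pred_def)
  qed
  have RD: "?R \<subseteq> D"
  proof
    fix p assume p: "p \<in> ?R"
    then have "p \<in> {y1..y2} \<times> {a..d}" using ad[of "fst p"] by (auto simp: mem_Times_iff)
    then show "p \<in> D" using box by blast
  qed
  have lev: "c y + 4 * y * w (y, c y) = alpha s + 2 * slope s * y\<^sup>2" if "y \<in> {y1..y2}" for y
    unfolding cc[OF that] by (rule crv_level[OF w s]) (use that y in auto)
  have flux: "(LINT p:?R|lborel. k p)
    = (integral {a..c y2} (\<lambda>t. w (y2, t)) + 2 * y2 * (w (y2, c y2))\<^sup>2)
      - (integral {a..c y1} (\<lambda>t. w (y1, t)) + 2 * y1 * (w (y1, c y1))\<^sup>2)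
      - 4 * slope s * integral {y1..y2} (\<lambda>y. y * w (y, c y)) + 2 * integral {y1..y2} (\<lambda>y. (w (y, a))\<^sup>2)"
  proof (rule level_curve_flux[OF y(2) admD(1)[OF w] c _ k _ _ ad lev y(1)])
    show "box_law w k y y' t1 t2" if "y1 \<le> y" "y \<le> y'" "y' \<le> y2" "a \<le> t1" "t1 \<le> t2" "t2 \<le> d" for y y' t1 t2
    proof (rule law)
      have "{y..y'} \<times> {t1..t2} \<subseteq> {y1..y2} \<times> {a..d}" using that by auto
      then show "{y..y'} \<times> {t1..t2} \<subseteq> D" using box by blast
    qed (use that in auto)
    show "set_integrable lborel ({y1..y2} \<times> {a..d}) k"
      by (rule set_integrable_subset[OF ki]) (use box in \<open>auto simp: borel_Times\<close>)
    show "t + 4 * y * w (y, t) \<le> t' + 4 * y * w (y, t')"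
      if "y \<in> {y1..y2}" "a \<le> t" "t \<le> t'" "t' \<le> d" for y t t'
    proof (cases "t = t'")
      case False
      have "(y, t) \<in> D" "(y, t') \<in> D" using box that by auto
      then show ?thesis using admD(3)[OF w, of y t t'] D_sub_W that False by force
    qed simp
  qed
  have em: "emeasure lborel ?R < \<infinity>" and me: "measure lborel ?R = integral {y1..y2} (\<lambda>y. c y - a)"
    using set_integral_region_const[OF c y(1), of a] ad by auto
  have ce: "integral {y1..y2} (\<lambda>y. c y - a) = integral {y1..y2} (\<lambda>y. alpha s + 2 * slope s * y\<^sup>2 - a) - 4 * integral {y1..y2} (\<lambda>y. y * w (y, c y))"
  proof -
    have wc: "continuous_on UNIV (\<lambda>y. w (y, c y))"
      by (intro continuous_on_compose2[OF admD(1)[OF w]] continuous_intros c) auto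
    have "integral {y1..y2} (\<lambda>y. c y - a) = integral {y1..y2} (\<lambda>y. (alpha s + 2 * slope s * y\<^sup>2 - a) - 4 * (y * w (y, c y)))"
      by (rule integral_cong) (use lev in \<open>force simp: algebra_simps\<close>)
    also have "\<dots> = integral {y1..y2} (\<lambda>y. alpha s + 2 * slope s * y\<^sup>2 - a) - integral {y1..y2} (\<lambda>y. 4 * (y * w (y, c y)))"
      by (rule Henstock_Kurzweil_Integration.integral_diff)
         (auto intro!: integrable_continuous_real continuous_intros continuous_on_subset[OF wc])
    finally show ?thesis by simp
  qed
  have "(LINT p:?R|lborel. k p - slope s) = (LINT p:?R|lborel. k p) - (LINT p:?R|lborel. slope s)"
    by (rule set_integral_diff(2)[OF set_integrable_subset[OF ki _ RD]])
       (use em in \<open>auto simp: set_integrable_def\<close>)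
  also have "(LINT p:?R|lborel. slope s) = slope s * measure lborel ?R"
    unfolding set_lebesgue_integral_def by simp
  finally show ?thesis unfolding flux me ce by (simp add: algebra_simps)
qed

context
  fixes s :: real
  assumes s: "s \<in> {0<..<tb}"
begin

private lemma s': "s \<in> {0..tb}" using s by auto

private lemma AB: "g1 s < 0" "0 < g2 (lam s)" using g_sign(1)[OF s] g_sign(2)[OF lam_inner[OF s]] by auto

private definition "cl y = max (g1 s) (min y (g2 (lam s)))"

private lemma cl_range: "g1 s \<le> cl y" "cl y \<le> g2 (lam s)" using AB by (auto simp: cl_def)

text \<open>The level curve continued by constants beyond the ends of the ruling, to have a
  continuous function on the line.\<close>

private definition "cc w y = crv w s (cl y)"

private lemma cc_cont: assumes "adm w" shows "continuous_on UNIV (cc w)"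
proof -
  have "continuous_on UNIV (\<lambda>y. crv w (snd (cl y, s)) (fst (cl y, s)))"
    by (rule continuous_on_compose2[OF crv_cont[OF assms], of UNIV "\<lambda>y. (cl y, s)"])
       (use cl_range s' in \<open>auto simp: cl_def intro!: continuous_intros\<close>)
  then show ?thesis by (simp add: cc_def)
qed

private lemma cc_eq: "y \<in> {g1 s..g2 (lam s)} \<Longrightarrow> cc w y = crv w s y"
  by (simp add: cc_def cl_def)

private lemma W_range: "(y, t) \<in> W \<Longrightarrow> 0 \<le> t \<and> t \<le> tb"
proof -
  have "D \<subseteq> UNIV \<times> {0..tb}" by (auto simp: domD_def)
  then have "W \<subseteq> UNIV \<times> {0..tb}" by (rule closure_minimal) (intro closed_Times; simp)
  then show "(y, t) \<in> W \<Longrightarrow> 0 \<le> t \<and> t \<le> tb" by auto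
qed

private lemma cc_range: "adm w \<Longrightarrow> 0 \<le> cc w y \<and> cc w y \<le> tb"
  unfolding cc_def by (rule W_range[OF crv(1)[OF _ s' cl_range]])

text \<open>The difference of the two excess densities. Its mass left of a line y = x is followed as
  x moves across the domain.\<close>

private definition "E p = indicator {p \<in> D. lab v p < s} p * (b p - slope s) - indicator {p \<in> D. lab u p < s} p * (mu p - slope s)"

private lemma sub_borel [measurable]: "adm w \<Longrightarrow> {p \<in> D. lab w p < s} \<in> sets borel"
  using sublevel_open by (intro borel_open)

private lemma E_parts:
  "set_integrable lborel {p \<in> D. lab v p < s} (\<lambda>p. b p - slope s)"
  "set_integrable lborel {p \<in> D. lab u p < s} (\<lambda>p. mu p - slope s)"
proof -
  have c: "set_integrable lborel D (\<lambda>p. slope s)" by (rule bounded_set_integrable) auto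
  show "set_integrable lborel {p \<in> D. lab v p < s} (\<lambda>p. b p - slope s)"
    by (rule set_integrable_subset[OF set_integral_diff(1)[OF b_int c]]) (use sub_borel[OF v_adm] in auto)
  show "set_integrable lborel {p \<in> D. lab u p < s} (\<lambda>p. mu p - slope s)"
    by (rule set_integrable_subset[OF set_integral_diff(1)[OF mu_int c]]) (use sub_borel[OF adm_u] in auto)
qed

private lemma E_int: "integrable lborel E"
  unfolding E_def[abs_def] by (rule Bochner_Integration.integrable_diff) (use E_parts in \<open>simp_all add: set_integrable_def\<close>)

private definition "I x = (LINT p:{p. fst p \<le> x}|lborel. E p)"

private lemma half_borel [measurable]: "{p :: real \<times> real. fst p \<le> x} \<in> sets borel"
  "{p :: real \<times> real. x < fst p} \<in> sets borel"
  by (intro borel_closed borel_open closed_Collect_le open_Collect_less continuous_intros)+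

private lemma E_set: "A \<in> sets borel \<Longrightarrow> set_integrable lborel A E"
  unfolding set_integrable_def by (intro integrable_mult_indicator E_int) simp

private definition "g y = integral {0..cc v y} (\<lambda>t. v (y, t)) - integral {0..cc u y} (\<lambda>t. u (y, t))"

text \<open>Mass of E left of x minus the flux through the line y = x below the two curves; its
  constancy is Green's formula for the difference of the two regions. Taking the difference allows
  \<open>law_diff\<close> to treat the lower parts, which reach the boundary of D.\<close>

private definition "\<Lambda> x = I x - (g x + 2 * x * ((v (x, cc v x))\<^sup>2 - (u (x, cc u x))\<^sup>2))"

private lemma \<Lambda>_cont: "continuous_on UNIV \<Lambda>"
proof -
  have "continuous_on UNIV (\<lambda>x. v (x, cc v x))" "continuous_on UNIV (\<lambda>x. u (x, cc u x))"
    by (intro continuous_on_compose2[OF v_cont] continuous_on_compose2[OF u_cont] continuous_intros cc_cont v_adm adm_u subset_UNIV)+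
  then show ?thesis unfolding \<Lambda>_def I_def g_def
    by (intro continuous_intros continuous_on_integral_halfplane E_int
        continuous_integral_to_curve[OF v_cont cc_cont[OF v_adm] cc_range[OF v_adm]]
        continuous_integral_to_curve[OF u_cont cc_cont[OF adm_u] cc_range[OF adm_u]])
qed

private lemma local_balance:
  assumes y: "y1 \<le> y2" "0 \<notin> {y1..y2}" "g1 s < y1" "y2 < g2 (lam s)"
    and box: "{y1..y2} \<times> {a..d} \<subseteq> D"
    and ad: "\<And>y. y \<in> {y1..y2} \<Longrightarrow> a < cc v y \<and> cc v y < d" "\<And>y. y \<in> {y1..y2} \<Longrightarrow> a < cc u y \<and> cc u y < d"
  shows "\<Lambda> y1 = \<Lambda> y2"
proof -
  let ?S = "{p :: real \<times> real. y1 < fst p \<and> fst p \<le> y2}"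
  let ?R = "\<lambda>w. {p. y1 < fst p \<and> fst p \<le> y2 \<and> a < snd p \<and> snd p \<le> cc w (fst p)}"
  have inr: "y \<in> {g1 s..g2 (lam s)}" if "y \<in> {y1..y2}" for y using that y by auto
  have "(y1, a) \<in> D" using box y ad(1)[of y1] by (auto simp: subset_iff)
  then have a: "0 < a" "a < tb" by (auto simp: D_iff)
  have Rb[measurable]: "?R w \<in> sets borel" if "adm w" for w
  proof -
    have [measurable]: "cc w \<in> borel_measurable borel" by (rule borel_measurable_continuous_onI[OF cc_cont[OF that]])
    have "Measurable.pred borel (\<lambda>p. y1 < fst p \<and> fst p \<le> y2 \<and> a < snd p \<and> snd p \<le> cc w (fst p))" by measurable
    then show ?thesis by (simp add: pred_def)
  qed
  have RD: "?R w \<subseteq> D" if "w = v \<or> w = u" for w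
  proof
    fix p assume p: "p \<in> ?R w"
    then have "p \<in> {y1..y2} \<times> {a..d}" using ad(1)[of "fst p"] ad(2)[of "fst p"] that by (auto simp: mem_Times_iff)
    then show "p \<in> D" using box by blast
  qed
  have [measurable]: "{y1<..y2} \<times> {0<..a} \<in> sets borel" by (simp add: borel_Times)
  have i1: "integrable lborel (\<lambda>p. indicator ({y1<..y2} \<times> {0<..a}) p * f p)"
    using integrable_mult_indicator[OF _ f_int, of "{y1<..y2} \<times> {0<..a}"] by simp
  have cs: "set_integrable lborel D (\<lambda>p. slope s)" by (rule bounded_set_integrable) auto
  have i2: "integrable lborel (\<lambda>p. indicator (?R v) p * (b p - slope s))"
  proof -
    have "set_integrable lborel (?R v) (\<lambda>p. b p - slope s)"
      by (rule set_integrable_subset[OF set_integral_diff(1)[OF b_int cs] _ RD[of v]]) (simp_all add: Rb v_adm)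
    then show ?thesis unfolding set_integrable_def real_scaleR_def .
  qed
  have i3: "integrable lborel (\<lambda>p. indicator (?R u) p * (mu p - slope s))"
  proof -
    have "set_integrable lborel (?R u) (\<lambda>p. mu p - slope s)"
      by (rule set_integrable_subset[OF set_integral_diff(1)[OF mu_int cs] _ RD[of u]]) (simp_all add: Rb adm_u)
    then show ?thesis unfolding set_integrable_def real_scaleR_def .
  qed
  have "{p. fst p \<le> y2} = {p. fst p \<le> y1} \<union> ?S" "{p. fst p \<le> y1} \<inter> ?S = {}" using y by auto
  moreover have [measurable]: "?S \<in> sets borel"
  proof -
    have "?S = {p. y1 < fst p} \<inter> {p. fst p \<le> y2}" by auto
    then show ?thesis using half_borel by simp
  qed
  ultimately have "I y2 = I y1 + (LINT p:?S|lborel. E p)"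
    unfolding I_def by (simp add: set_integral_Un E_set)
  also have "(LINT p:?S|lborel. E p) = (\<integral>p. indicator ({y1<..y2} \<times> {0<..a}) p * f p
     + indicator (?R v) p * (b p - slope s) - indicator (?R u) p * (mu p - slope s) \<partial>lborel)"
    unfolding set_lebesgue_integral_def
  proof (rule integral_cong_AE)
    \<comment> \<open>The sublevel sets exclude their curve while the regions \<open>?R\<close>
      include it; the two curves are null sets.\<close>
    show "AE p in lborel. indicator ?S p *\<^sub>R E p = indicator ({y1<..y2} \<times> {0<..a}) p * f p
     + indicator (?R v) p * (b p - slope s) - indicator (?R u) p * (mu p - slope s)"
      using AE_not_on_graph[OF cc_cont[OF v_adm]] AE_not_on_graph[OF cc_cont[OF adm_u]]
    proof eventually_elim
      case (elim p)
      obtain yy t where p: "p = (yy, t)" by force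
      show ?case
      proof (cases "yy \<in> {y1<..y2}")
        case False
        then have "p \<notin> ?S" "p \<notin> ?R v" "p \<notin> ?R u" "p \<notin> {y1<..y2} \<times> {0<..a}" by (auto simp: p)
        then show ?thesis by simp
      next
        case yin: True
        then have yy: "yy \<in> {y1..y2}" by auto
        have iS: "indicator ?S p = (1 :: real)" using yin by (simp add: p)
        show ?thesis
        proof (cases "p \<in> D")
          case False
          have nR: "p \<notin> ?R v" "p \<notin> ?R u" using RD[of v] RD[of u] False by blast+
          have "indicator (?R v) p = (0 :: real)" "indicator (?R u) p = (0 :: real)"
            by (rule indicator_simps(2)[OF nR(1)], rule indicator_simps(2)[OF nR(2)])
          then show ?thesis using False by (simp only: E_def f_def) (simp add: indicator_def)
        next
          case True
          have t0: "t > 0" using True by (simp add: p D_iff)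
          have l: "lab w p < s \<longleftrightarrow> t < cc w yy" if "adm w" for w
            unfolding p cc_eq[OF inr[OF yy]] 
            by (rule lab_less_crv[OF that s']) (use inr[OF yy] True D_sub_W p in auto)
          have ne: "t \<noteq> cc v yy" "t \<noteq> cc u yy" using elim by (auto simp: p)
          have ind: "(p \<in> ?R w) = (a < t \<and> t < cc w yy)" if "t \<noteq> cc w yy" for w
            using yin that by (auto simp: p)
          show ?thesis
          proof (cases "t \<le> a")
            case ta: True
            then have "lab v p < s" "lab u p < s" using l[OF v_adm] l[OF adm_u] ad(1)[OF yy] ad(2)[OF yy] by auto
            moreover have nR: "p \<notin> ?R v" "p \<notin> ?R u" using ind ne ta by auto
            have "indicator (?R v) p = (0 :: real)" "indicator (?R u) p = (0 :: real)"
              by (rule indicator_simps(2)[OF nR(1)], rule indicator_simps(2)[OF nR(2)])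
            moreover have "indicator ({y1<..y2} \<times> {0<..a}) p = (1 :: real)" using yin t0 ta by (simp add: p)
            ultimately show ?thesis using True iS by (simp only: E_def f_def) (simp add: indicator_def)
          next
            case ta: False
            then have m: "p \<in> ?R v \<longleftrightarrow> lab v p < s" "p \<in> ?R u \<longleftrightarrow> lab u p < s"
              using ind ne l[OF v_adm] l[OF adm_u] by auto
            have "indicator (?R v) p = (indicator {p \<in> D. lab v p < s} p :: real)"
              "indicator (?R u) p = (indicator {p \<in> D. lab u p < s} p :: real)"
              unfolding indicator_def m using True by simp_all
            moreover have "indicator ({y1<..y2} \<times> {0<..a}) p = (0 :: real)" using ta by (simp add: p)
            ultimately show ?thesis using iS by (simp only: E_def) simp
          qed
        qed
      qed
    qed
  qed (use i1 i2 i3 E_int in \<open>auto intro!: borel_measurable_scaleR borel_measurable_indicator borel_measurable_diff borel_measurable_add dest: borel_measurable_integrable\<close>)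
  also have "\<dots> = (LINT p:{y1<..y2} \<times> {0<..a}|lborel. f p) + (LINT p:?R v|lborel. b p - slope s) - (LINT p:?R u|lborel. mu p - slope s)"
    using i1 i2 i3 by (simp add: set_lebesgue_integral_def)
  finally have Ieq: "I y2 = I y1 + ((LINT p:{y1<..y2} \<times> {0<..a}|lborel. f p) + (LINT p:?R v|lborel. b p - slope s) - (LINT p:?R u|lborel. mu p - slope s))" .
  have ad': "\<And>y. y \<in> {y1..y2} \<Longrightarrow> a \<le> cc v y \<and> cc v y \<le> d" "\<And>y. y \<in> {y1..y2} \<Longrightarrow> a \<le> cc u y \<and> cc u y \<le> d"
    using ad by (auto simp: less_imp_le)
  have yc: "g1 s \<le> y1" "y2 \<le> g2 (lam s)" using y by auto
  have Fv: "(LINT p:?R v|lborel. b p - slope s)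
    = (integral {a..cc v y2} (\<lambda>t. v (y2, t)) + 2 * y2 * (v (y2, cc v y2))\<^sup>2)
      - (integral {a..cc v y1} (\<lambda>t. v (y1, t)) + 2 * y1 * (v (y1, cc v y1))\<^sup>2)
      + 2 * integral {y1..y2} (\<lambda>y. (v (y, a))\<^sup>2)
      - slope s * integral {y1..y2} (\<lambda>y. alpha s + 2 * slope s * y\<^sup>2 - a)"
    by (rule curve_flux[OF v_adm b_borel b_int law_v s cc_cont[OF v_adm] cc_eq[OF inr] y(1,2) yc box ad'(1)])
  have Fu: "(LINT p:?R u|lborel. mu p - slope s)
    = (integral {a..cc u y2} (\<lambda>t. u (y2, t)) + 2 * y2 * (u (y2, cc u y2))\<^sup>2)
      - (integral {a..cc u y1} (\<lambda>t. u (y1, t)) + 2 * y1 * (u (y1, cc u y1))\<^sup>2)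
      + 2 * integral {y1..y2} (\<lambda>y. (u (y, a))\<^sup>2)
      - slope s * integral {y1..y2} (\<lambda>y. alpha s + 2 * slope s * y\<^sup>2 - a)"
    by (rule curve_flux[OF adm_u mu_borel mu_int law_u s cc_cont[OF adm_u] cc_eq[OF inr] y(1,2) yc box ad'(2)])
  have i: "integral {l..r} (\<lambda>t. k t - k' t) = integral {l..r} k - integral {l..r} k'"
    if "continuous_on UNIV k" "continuous_on UNIV k'" for l r and k k' :: "real \<Rightarrow> real"
    by (rule Henstock_Kurzweil_Integration.integral_diff)
       (auto intro!: integrable_continuous_real continuous_on_subset[OF that(1)] continuous_on_subset[OF that(2)])
  note j1 = i[OF continuous_on_slice(1)[OF v_cont] continuous_on_slice(1)[OF u_cont]]
  note j2 = i[OF continuous_on_power[OF continuous_on_slice(2)[OF v_cont]] continuous_on_power[OF continuous_on_slice(2)[OF u_cont]]]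
  have z0: "integral {y1..y2} (\<lambda>y. (v (y, 0))\<^sup>2) = integral {y1..y2} (\<lambda>y. (u (y, 0))\<^sup>2)"
    by (rule integral_cong) (use v_off in \<open>auto simp: D_iff\<close>)
  note fb = law_diff[OF y(1) order_refl less_imp_le[OF a(1)] less_imp_le[OF a(2)], unfolded j1 j2 z0]
  have glue: "integral {0..c} (\<lambda>t. w (y, t)) = integral {0..a} (\<lambda>t. w (y, t)) + integral {a..c} (\<lambda>t. w (y, t))"
    if "continuous_on UNIV w" "a \<le> c" for w :: "real \<times> real \<Rightarrow> real" and y c
    by (rule Henstock_Kurzweil_Integration.integral_combine[symmetric])
       (use that a in \<open>auto intro!: integrable_continuous_real continuous_on_slice\<close>)
  have g: "g y = integral {0..a} (\<lambda>t. v (y, t)) - integral {0..a} (\<lambda>t. u (y, t))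
       + integral {a..cc v y} (\<lambda>t. v (y, t)) - integral {a..cc u y} (\<lambda>t. u (y, t))" if "y \<in> {y1..y2}" for y
    unfolding g_def using glue[OF v_cont, of "cc v y" y] glue[OF u_cont, of "cc u y" y] ad'[OF that] by simp
  have yy: "y1 \<in> {y1..y2}" "y2 \<in> {y1..y2}" using y by auto
  show ?thesis unfolding \<Lambda>_def Ieq g[OF yy(1)] g[OF yy(2)] fb Fv Fu by (simp add: algebra_simps)
qed

private lemma locally_constant:
  assumes x: "g1 s < x" "x < g2 (lam s)" "x \<noteq> 0"
  shows "\<exists>e>0. \<forall>y1 y2. x - e \<le> y1 \<longrightarrow> y1 \<le> y2 \<longrightarrow> y2 \<le> x + e \<longrightarrow> \<Lambda> y1 = \<Lambda> y2"
proof -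
  have xr: "x \<in> {g1 s..g2 (lam s)}" using x by auto
  have inD: "(x, cc v x) \<in> D" "(x, cc u x) \<in> D"
    unfolding cc_eq[OF xr] by (rule crv_in_D[OF v_adm s x(1,2)] crv_in_D[OF adm_u s x(1,2)])+
  define l h where "l = min (cc v x) (cc u x)" and "h = max (cc v x) (cc u x)"
  have lh: "{x..x} \<times> {l..h} \<subseteq> D"
  proof
    fix p assume "p \<in> {x..x} \<times> {l..h}"
    moreover have "(x, l) \<in> D" "(x, h) \<in> D" using inD by (auto simp: l_def h_def min_def max_def)
    ultimately show "p \<in> D" using slice_between[of x l h] by (cases p) auto
  qed
  obtain e where e: "e > 0" "{x - e..x + e} \<times> {l - e..h + e} \<subseteq> D"
    by (rule closed_box_enlarge[OF D_open lh]) (auto simp: l_def h_def)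
  have near: "\<exists>r>0. \<forall>y. \<bar>y - x\<bar> \<le> r \<longrightarrow> \<bar>cc w y - cc w x\<bar> < e" if w: "adm w" for w
  proof -
    obtain r where r: "r > 0" "\<And>y. dist y x < r \<Longrightarrow> dist (cc w y) (cc w x) < e"
      using cc_cont[OF w] e(1) unfolding continuous_on_iff by (metis UNIV_I)
    then show ?thesis by (intro exI[of _ "r/2"]) (auto simp: dist_real_def)
  qed
  obtain r1 r2 where r: "r1 > 0" "\<And>y. \<bar>y - x\<bar> \<le> r1 \<Longrightarrow> \<bar>cc v y - cc v x\<bar> < e"
    "r2 > 0" "\<And>y. \<bar>y - x\<bar> \<le> r2 \<Longrightarrow> \<bar>cc u y - cc u x\<bar> < e"
    using near[OF v_adm] near[OF adm_u] by metis
  define \<delta> where "\<delta> = Min {e, r1, r2, (x - g1 s) / 2, (g2 (lam s) - x) / 2, \<bar>x\<bar> / 2}"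
  have \<delta>: "\<delta> \<le> e" "\<delta> \<le> r1" "\<delta> \<le> r2" "\<delta> \<le> (x - g1 s) / 2" "\<delta> \<le> (g2 (lam s) - x) / 2" "\<delta> \<le> \<bar>x\<bar> / 2"
    unfolding \<delta>_def by (rule Min_le; simp)+
  have \<delta>0: "\<delta> > 0" unfolding \<delta>_def using e r x by simp
  show ?thesis
  proof (intro exI[of _ \<delta>] conjI \<delta>0 allI impI)
    fix y1 y2 assume y: "x - \<delta> \<le> y1" "y1 \<le> y2" "y2 \<le> x + \<delta>"
    have yx: "\<bar>yy - x\<bar> \<le> \<delta>" if "yy \<in> {y1..y2}" for yy using that y by auto
    show "\<Lambda> y1 = \<Lambda> y2"
    proof (rule local_balance[OF y(2)])
      show "0 \<notin> {y1..y2}"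
      proof
        assume "0 \<in> {y1..y2}" then show False using yx[of 0] \<delta>(6) \<delta>0 by auto
      qed
      show "g1 s < y1" "y2 < g2 (lam s)" using y \<delta>(4,5) x by auto
      have "{y1..y2} \<times> {l - e..h + e} \<subseteq> {x - e..x + e} \<times> {l - e..h + e}" using y \<delta>(1) by auto
      then show "{y1..y2} \<times> {l - e..h + e} \<subseteq> D" using e(2) by blast
      fix yy assume yy: "yy \<in> {y1..y2}"
      have b: "\<bar>cc v yy - cc v x\<bar> < e" "\<bar>cc u yy - cc u x\<bar> < e"
        using r(2)[of yy] r(4)[of yy] yx[OF yy] \<delta>(2,3) by auto
      have l: "l \<le> cc v x" "l \<le> cc u x" "cc v x \<le> h" "cc u x \<le> h" by (auto simp: l_def h_def)
      show "l - e < cc v yy \<and> cc v yy < h + e" "l - e < cc u yy \<and> cc u yy < h + e"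
        using b l by (auto simp: abs_if split: if_splits)
    qed
  qed
qed

private lemma \<Lambda>_const:
  assumes "y \<in> {g1 s..g2 (lam s)}" shows "\<Lambda> y = \<Lambda> (g1 s)"
proof (rule has_derivative_zero_unique_strong_interval[where f=\<Lambda> and k="{g1 s, 0, g2 (lam s)}" and a="g1 s" and b="g2 (lam s)"])
  fix x assume x: "x \<in> {g1 s..g2 (lam s)} - {g1 s, 0, g2 (lam s)}"
  then obtain e where e: "e > 0" "\<And>y1 y2. x - e \<le> y1 \<Longrightarrow> y1 \<le> y2 \<Longrightarrow> y2 \<le> x + e \<Longrightarrow> \<Lambda> y1 = \<Lambda> y2"
    using locally_constant[of x] by auto
  have "(\<Lambda> has_derivative (\<lambda>h. 0)) (at x)"
  proof (rule has_derivative_transform_within_open[of "\<lambda>_. \<Lambda> x" _ _ _ "{x - e<..<x + e}"])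
    show "\<Lambda> x = \<Lambda> y" if "y \<in> {x - e<..<x + e}" for y
    proof (cases "x \<le> y")
      case True
      show ?thesis by (rule e(2)) (use True e(1) that in auto)
    next
      case False
      show ?thesis by (rule e(2)[symmetric]) (use False e(1) that in auto)
    qed
  qed (use e(1) in auto)
  then show "(\<Lambda> has_derivative (\<lambda>h. 0)) (at x within {g1 s..g2 (lam s)})" by (rule has_derivative_at_withinI)
qed (use AB \<Lambda>_cont assms in \<open>auto intro: continuous_on_subset\<close>)

private lemma boundary_values:
  "v (g1 s, s) = u (g1 s, s)" "v (g2 (lam s), lam s) = u (g2 (lam s), lam s)"
  by (rule v_off; simp add: D_iff)+

text \<open>Left of the ruling both sublevel sets are the part of D with t < s, by
  \<open>outside_left\<close>, so E reduces to f on a box.\<close>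

private lemma left_part: "I (g1 s) = g (g1 s)"
proof -
  have ends: "cc v (g1 s) = s" "cc u (g1 s) = s" using crv_ends(1)[OF v_adm s'] crv_ends(1)[OF adm_u s'] AB by (auto simp: cc_eq)
  \<comment> \<open>One unit beyond the bound G the left side of the box is off D and carries no
    flux; nor do the sides t = 0 and t = s, by the choice of g1 s as right end.\<close>
  let ?B = "{- G - 1<..g1 s} \<times> {0<..s}"
  have gl: "- G - 1 \<le> g1 s" using gG(1)[OF s'] by auto
  have "I (g1 s) = (LINT p:?B|lborel. f p)"
    unfolding I_def set_lebesgue_integral_def
  proof (rule integral_cong_AE)
    show "AE p in lborel. indicator {p. fst p \<le> g1 s} p *\<^sub>R E p = indicator ?B p *\<^sub>R f p"
      using AE_lborel_fst_snd_neq(1)[of "g1 s"] AE_lborel_fst_snd_neq(2)[of s]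
    proof eventually_elim
      case (elim p)
      obtain y t where p: "p = (y, t)" by force
      show ?case
      proof (cases "p \<in> D \<and> y < g1 s")
        case True
        then have "t \<in> {0..tb}" "0 < t" "g1 t < y" by (auto simp: p D_iff)
        then have "- G - 1 < y" using gG(1)[of t] by auto
        moreover have "lab v p < s \<longleftrightarrow> t < s" "lab u p < s \<longleftrightarrow> t < s"
          using outside_left[OF v_adm s] outside_left[OF adm_u s] True p by auto
        ultimately show ?thesis using True elim \<open>0 < t\<close> by (auto simp: p E_def f_def indicator_def)
      next
        case False
        then show ?thesis using elim by (auto simp: p E_def f_def indicator_def)
      qed
    qed
    show "(\<lambda>p. indicator {p. fst p \<le> g1 s} p *\<^sub>R E p) \<in> borel_measurable lborel"
      using E_int by (intro borel_measurable_scaleR borel_measurable_indicator) auto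
    have "?B \<in> sets borel" by (simp add: borel_Times)
    then show "(\<lambda>p. indicator ?B p *\<^sub>R f p) \<in> borel_measurable lborel"
      using f_int by (intro borel_measurable_scaleR borel_measurable_indicator) auto
  qed
  also have "\<dots> = integral {0..s} (\<lambda>t. v (g1 s, t) - u (g1 s, t))"
  proof -
    have "v (- G - 1, t) - u (- G - 1, t) = 0" for t
    proof -
      have "(- G - 1, t) \<notin> D" using gG(1)[of t] by (auto simp: D_iff)
      then show ?thesis using v_off by simp
    qed
    moreover have "integral {- G - 1..g1 s} (\<lambda>y. (v (y, t))\<^sup>2 - (u (y, t))\<^sup>2) = 0" if "t = 0 \<or> t = s" for t
    proof -
      have "(y, t) \<notin> D" if "y \<le> g1 s" for y using that \<open>t = 0 \<or> t = s\<close> by (auto simp: D_iff)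
      then have "integral {- G - 1..g1 s} (\<lambda>y. (v (y, t))\<^sup>2 - (u (y, t))\<^sup>2) = integral {- G - 1..g1 s} (\<lambda>y. 0)"
        by (intro integral_cong) (auto simp: v_off)
      then show ?thesis by simp
    qed
    ultimately show ?thesis using law_diff[OF gl, of 0 s] s by simp
  qed
  also have "\<dots> = g (g1 s)"
    unfolding g_def ends
    by (rule Henstock_Kurzweil_Integration.integral_diff; intro integrable_continuous_real continuous_on_slice v_cont u_cont)
  finally show ?thesis .
qed

text \<open>The counterpart with \<open>outside_right\<close>. The flux now enters with the opposite
  sign because the line bounds the box on the left, so the two outer parts cancel the ends of
  \<Lambda>.\<close>

private lemma right_part: "(LINT p:{p. g2 (lam s) < fst p}|lborel. E p) = - g (g2 (lam s))"
proof -
  have ls: "lam s \<in> {0<..<tb}" using lam_inner[OF s] .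
  have ends: "cc v (g2 (lam s)) = lam s" "cc u (g2 (lam s)) = lam s"
    using crv_ends(2)[OF v_adm s'] crv_ends(2)[OF adm_u s'] AB by (auto simp: cc_eq)
  let ?B = "{g2 (lam s)<..G + 1} \<times> {0<..lam s}"
  have gl: "g2 (lam s) \<le> G + 1" using gG(2)[of "lam s"] ls by auto
  have "(LINT p:{p. g2 (lam s) < fst p}|lborel. E p) = (LINT p:?B|lborel. f p)"
    unfolding set_lebesgue_integral_def
  proof (rule integral_cong_AE)
    show "AE p in lborel. indicator {p. g2 (lam s) < fst p} p *\<^sub>R E p = indicator ?B p *\<^sub>R f p"
      using AE_lborel_fst_snd_neq(2)[of "lam s"]
    proof eventually_elim
      case (elim p)
      obtain y t where p: "p = (y, t)" by force
      show ?case
      proof (cases "p \<in> D \<and> g2 (lam s) < y")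
        case True
        then have "t \<in> {0..tb}" "0 < t" "y < g2 t" by (auto simp: p D_iff)
        then have "y \<le> G + 1" using gG(2)[of t] by auto
        moreover have "lab v p < s \<longleftrightarrow> t < lam s" "lab u p < s \<longleftrightarrow> t < lam s"
          using outside_right[OF v_adm s] outside_right[OF adm_u s] True p by auto
        ultimately show ?thesis using True elim \<open>0 < t\<close> by (auto simp: p E_def f_def indicator_def)
      next
        case False
        then show ?thesis by (auto simp: p E_def f_def indicator_def)
      qed
    qed
    show "(\<lambda>p. indicator {p. g2 (lam s) < fst p} p *\<^sub>R E p) \<in> borel_measurable lborel"
      using E_int by (intro borel_measurable_scaleR borel_measurable_indicator) auto
    have "?B \<in> sets borel" by (simp add: borel_Times)
    then show "(\<lambda>p. indicator ?B p *\<^sub>R f p) \<in> borel_measurable lborel"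
      using f_int by (intro borel_measurable_scaleR borel_measurable_indicator) auto
  qed
  also have "\<dots> = - integral {0..lam s} (\<lambda>t. v (g2 (lam s), t) - u (g2 (lam s), t))"
  proof -
    have "v (G + 1, t) - u (G + 1, t) = 0" for t
    proof -
      have "(G + 1, t) \<notin> D" using gG(2)[of t] by (auto simp: D_iff)
      then show ?thesis using v_off by simp
    qed
    moreover have "integral {g2 (lam s)..G + 1} (\<lambda>y. (v (y, t))\<^sup>2 - (u (y, t))\<^sup>2) = 0" if "t = 0 \<or> t = lam s" for t
    proof -
      have "(y, t) \<notin> D" if "g2 (lam s) \<le> y" for y using that \<open>t = 0 \<or> t = lam s\<close> by (auto simp: D_iff)
      then have "integral {g2 (lam s)..G + 1} (\<lambda>y. (v (y, t))\<^sup>2 - (u (y, t))\<^sup>2) = integral {g2 (lam s)..G + 1} (\<lambda>y. 0)"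
        by (intro integral_cong) (auto simp: v_off)
      then show ?thesis by simp
    qed
    ultimately show ?thesis using law_diff[OF gl, of 0 "lam s"] ls by simp
  qed
  also have "integral {0..lam s} (\<lambda>t. v (g2 (lam s), t) - u (g2 (lam s), t)) = g (g2 (lam s))"
    unfolding g_def ends
    by (rule Henstock_Kurzweil_Integration.integral_diff; intro integrable_continuous_real continuous_on_slice v_cont u_cont)
  finally show ?thesis .
qed

private lemma \<Lambda>_left: "\<Lambda> (g1 s) = 0"
proof -
  have ends: "cc v (g1 s) = s" "cc u (g1 s) = s"
    using crv_ends[OF v_adm s'] crv_ends[OF adm_u s'] AB by (auto simp: cc_eq)
  show ?thesis unfolding \<Lambda>_def left_part ends boundary_values by simp
qed

text \<open>The cancellation behind the calibration: below every ruling, the excess of the curvature over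
  the slope of that ruling has the same total for \<open>v\<close> and for \<open>u\<close>.\<close>
theorem sublevel_balance:
  "(LINT p:{p \<in> D. lab v p < s}|lborel. b p - slope s) = (LINT p:{p \<in> D. lab u p < s}|lborel. mu p - slope s)"
proof -
  have ends: "cc v (g1 s) = s" "cc u (g1 s) = s" "cc v (g2 (lam s)) = lam s" "cc u (g2 (lam s)) = lam s"
    using crv_ends[OF v_adm s'] crv_ends[OF adm_u s'] AB by (auto simp: cc_eq)
  have "\<Lambda> (g2 (lam s)) = 0" using \<Lambda>_const[of "g2 (lam s)"] \<Lambda>_left AB by simp
  then have IB: "I (g2 (lam s)) = g (g2 (lam s))" unfolding \<Lambda>_def ends boundary_values by simp
  have "(UNIV :: (real \<times> real) set) = {p. fst p \<le> g2 (lam s)} \<union> {p. g2 (lam s) < fst p}"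
    "{p :: real \<times> real. fst p \<le> g2 (lam s)} \<inter> {p. g2 (lam s) < fst p} = {}" by auto
  then have "(LINT p:UNIV|lborel. E p) = I (g2 (lam s)) + (LINT p:{p. g2 (lam s) < fst p}|lborel. E p)"
    unfolding I_def by (metis set_integral_Un E_set half_borel)
  then have "(\<integral>p. E p \<partial>lborel) = 0" unfolding IB right_part by (simp add: set_lebesgue_integral_def)
  then show ?thesis
    using E_parts unfolding E_def set_lebesgue_integral_def set_integrable_def by simp
qed

text \<open>The balance stopped at a line y = const. Unlike the full balance it retains the values
  of v and u on their curves, which is what rigidity extracts.\<close>

lemma partial_balance:
  assumes y: "g1 s \<le> y" "y \<le> g2 (lam s)"
  shows "(LINT p:{p \<in> D. lab v p < s} \<inter> {p. fst p \<le> y}|lborel. b p - slope s)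
      - (LINT p:{p \<in> D. lab u p < s} \<inter> {p. fst p \<le> y}|lborel. mu p - slope s)
    = (integral {0..crv v s y} (\<lambda>t. v (y, t)) + 2 * y * (v (y, crv v s y))\<^sup>2)
      - (integral {0..crv u s y} (\<lambda>t. u (y, t)) + 2 * y * (u (y, crv u s y))\<^sup>2)"
proof -
  let ?H = "{p :: real \<times> real. fst p \<le> y}"
  have yr: "y \<in> {g1 s..g2 (lam s)}" using y by auto
  have "\<Lambda> y = 0" using \<Lambda>_const[OF yr] \<Lambda>_left by simp
  then have "I y = g y + 2 * y * ((v (y, crv v s y))\<^sup>2 - (u (y, crv u s y))\<^sup>2)"
    unfolding \<Lambda>_def cc_eq[OF yr] by simp
  moreover have "I y = (LINT p:{p \<in> D. lab v p < s} \<inter> ?H|lborel. b p - slope s) - (LINT p:{p \<in> D. lab u p < s} \<inter> ?H|lborel. mu p - slope s)"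
  proof -
    have i: "set_integrable lborel ({p \<in> D. lab v p < s} \<inter> ?H) (\<lambda>p. b p - slope s)"
      "set_integrable lborel ({p \<in> D. lab u p < s} \<inter> ?H) (\<lambda>p. mu p - slope s)"
      using set_integrable_subset[OF E_parts(1), of "{p \<in> D. lab v p < s} \<inter> ?H"] set_integrable_subset[OF E_parts(2), of "{p \<in> D. lab u p < s} \<inter> ?H"]
        sub_borel[OF v_adm] sub_borel[OF adm_u] half_borel by simp_all
    have "I y = (\<integral>p. indicator ({p \<in> D. lab v p < s} \<inter> ?H) p *\<^sub>R (b p - slope s) - indicator ({p \<in> D. lab u p < s} \<inter> ?H) p *\<^sub>R (mu p - slope s) \<partial>lborel)"
      unfolding I_def set_lebesgue_integral_def E_def
      by (rule Bochner_Integration.integral_cong) (simp_all add: indicator_inter_arith algebra_simps)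
    then show ?thesis using i unfolding set_lebesgue_integral_def set_integrable_def by simp
  qed
  ultimately show ?thesis unfolding g_def cc_eq[OF yr] by (simp add: algebra_simps)
qed

text \<open>Left of the ruling the two sets agree by \<open>outside_left\<close>; over it each is
  the part of D below its own curve, and the remaining parts of the strip outside D cancel.\<close>

lemma area_gap:
  assumes y: "g1 s \<le> y" "y < g2 (lam s)"
  shows "measure lborel ({p \<in> D. lab v p < s} \<inter> {p. fst p \<le> y}) - measure lborel ({p \<in> D. lab u p < s} \<inter> {p. fst p \<le> y})
    = integral {g1 s..y} (\<lambda>z. crv v s z - crv u s z)"
proof -
  let ?A = "\<lambda>w. {p \<in> D. lab w p < s} \<inter> {p. fst p \<le> y}"
  let ?R = "\<lambda>w. {p. g1 s < fst p \<and> fst p \<le> y \<and> 0 < snd p \<and> snd p \<le> cc w (fst p)}"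
  have A: "?A w \<in> sets borel" "emeasure lborel (?A w) < \<infinity>" if "adm w" for w
  proof -
    show 1: "?A w \<in> sets borel" using sub_borel[OF that] half_borel(1) by (rule sets.Int)
    have "emeasure lborel (?A w) \<le> emeasure lborel D" by (rule emeasure_mono) auto
    then show "emeasure lborel (?A w) < \<infinity>" using D_finite by (rule le_less_trans)
  qed
  have R: "?R w \<in> sets borel" "emeasure lborel (?R w) < \<infinity>" "measure lborel (?R w) = integral {g1 s..y} (cc w)" if "adm w" for w
  proof -
    have [measurable]: "cc w \<in> borel_measurable borel" by (rule borel_measurable_continuous_onI[OF cc_cont[OF that]])
    have "Measurable.pred borel (\<lambda>p. g1 s < fst p \<and> fst p \<le> y \<and> 0 < snd p \<and> snd p \<le> cc w (fst p))" by measurable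
    then show "?R w \<in> sets borel" by (simp add: pred_def)
    show "emeasure lborel (?R w) < \<infinity>" "measure lborel (?R w) = integral {g1 s..y} (cc w)"
      using set_integral_region_const[OF cc_cont[OF that] y(1), of 0] cc_range[OF that] by simp_all
  qed
  have int: "integrable lborel (indicator (?A w) :: _ \<Rightarrow> real)" "integrable lborel (indicator (?R w) :: _ \<Rightarrow> real)" if "adm w" for w
    by (rule integrable_real_indicator[OF _ A(2)[OF that]], unfold sets_lborel, rule A(1)[OF that],
        rule integrable_real_indicator[OF _ R(2)[OF that]], unfold sets_lborel, rule R(1)[OF that])
  have diff: "(\<integral>p. indicator (X v) p - indicator (X u) p \<partial>lborel) = measure lborel (X v) - measure lborel (X u)"
    if "\<And>w. adm w \<Longrightarrow> integrable lborel (indicator (X w) :: _ \<Rightarrow> real)" for X :: "(real \<times> real \<Rightarrow> real) \<Rightarrow> (real \<times> real) set"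
    using that[OF v_adm] that[OF adm_u] by simp
  have "measure lborel (?A v) - measure lborel (?A u) = (\<integral>p. indicator (?A v) p - indicator (?A u) p \<partial>lborel)"
    by (rule diff[of ?A, OF int(1), symmetric])
  moreover have "(\<integral>p. indicator (?A v) p - indicator (?A u) p \<partial>lborel) = (\<integral>p. (indicator (?R v) p - indicator (?R u) p :: real) \<partial>(lborel :: (real \<times> real) measure))"
  proof (rule integral_cong_AE)
    show "AE p in lborel. indicator (?A v) p - indicator (?A u) p = (indicator (?R v) p - indicator (?R u) p :: real)"
      using AE_not_on_graph[OF cc_cont[OF v_adm]] AE_not_on_graph[OF cc_cont[OF adm_u]] AE_lborel_fst_snd_neq(1)[of "g1 s"]
    proof eventually_elim
      case (elim p)
      obtain yy t where p: "p = (yy, t)" by force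
      consider "y < yy" | "yy < g1 s" | "g1 s < yy" "yy \<le> y" using elim p by force
      then show ?case
      proof cases
        case 1
        then show ?thesis by (simp add: p)
      next
        case 2
        have "(p \<in> ?A v) = (p \<in> ?A u)"
          using outside_left[OF v_adm s 2, of t] outside_left[OF adm_u s 2, of t] by (auto simp: p)
        moreover have "p \<notin> ?R v" "p \<notin> ?R u" using 2 by (auto simp: p)
        ultimately show ?thesis by (simp add: indicator_def)
      next
        case 3
        then have yr: "yy \<in> {g1 s..g2 (lam s)}" using y by auto
        show ?thesis
        proof (cases "p \<in> D")
          case True
          have "lab w p < s \<longleftrightarrow> t < cc w yy" if "adm w" for w
            unfolding p cc_eq[OF yr] by (rule lab_less_crv[OF that s']) (use yr True D_sub_W p in auto)
          then have "(p \<in> ?A w) = (p \<in> ?R w)" if "adm w" "t \<noteq> cc w yy" for w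
            using that True 3 by (auto simp: p D_iff)
          then have "(p \<in> ?A v) = (p \<in> ?R v)" "(p \<in> ?A u) = (p \<in> ?R u)" using elim v_adm adm_u by (auto simp: p)
          then show ?thesis by (simp only: indicator_def)
        next
          case False
          have "(yy, cc w yy) \<in> D" if "adm w" for w
            unfolding cc_eq[OF yr] by (rule crv_in_D[OF that s]) (use 3 y in auto)
          then have "t \<notin> {cc v yy..cc u yy}" "t \<notin> {cc u yy..cc v yy}"
            using slice_between[of yy _ _ t] v_adm adm_u False p by blast+
          then have "(p \<in> ?R v) = (p \<in> ?R u)" by (auto simp: p)
          moreover have "p \<notin> ?A v" "p \<notin> ?A u" using False by auto
          ultimately show ?thesis by (simp only: indicator_def)
        qed
      qed
    qed
    show "(\<lambda>p. indicator (?A v) p - indicator (?A u) p :: real) \<in> borel_measurable lborel"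
      using int(1)[OF v_adm] int(1)[OF adm_u] by (intro borel_measurable_integrable Bochner_Integration.integrable_diff)
    show "(\<lambda>p. indicator (?R v) p - indicator (?R u) p :: real) \<in> borel_measurable lborel"
      using int(2)[OF v_adm] int(2)[OF adm_u] by (intro borel_measurable_integrable Bochner_Integration.integrable_diff)
  qed
  moreover have "(\<integral>p. indicator (?R v) p - indicator (?R u) p \<partial>(lborel :: (real \<times> real) measure)) = measure lborel (?R v) - measure lborel (?R u)"
    by (rule diff[of ?R, OF int(2)])
  moreover have "integral {g1 s..y} (cc v) - integral {g1 s..y} (cc u) = integral {g1 s..y} (\<lambda>z. cc v z - cc u z)"
    by (rule Henstock_Kurzweil_Integration.integral_diff[symmetric])
       (auto intro!: integrable_continuous_real continuous_on_subset[OF cc_cont] v_adm adm_u)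
  moreover have "integral {g1 s..y} (\<lambda>z. cc v z - cc u z) = integral {g1 s..y} (\<lambda>z. crv v s z - crv u s z)"
    by (rule integral_cong) (use y in \<open>auto simp: cc_eq\<close>)
  ultimately show ?thesis using R(3)[OF v_adm] R(3)[OF adm_u] by linarith
qed

lemma level_null:
  assumes w: "adm w" shows "AE p in lborel. p \<in> D \<longrightarrow> lab w p \<noteq> s"
  using AE_not_on_graph[OF cc_cont[OF w]]
proof eventually_elim
  case (elim p)
  show ?case
  proof (intro impI notI)
    assume p: "p \<in> D" "lab w p = s"
    have r: "g1 s < fst p" "fst p < g2 (lam s)" using lab_between[OF w p(1)] p(2) by auto
    have "crv w s (fst p) = snd p" by (rule crv_eq[OF w]) (use p D_sub_W in auto)
    then show False using elim r by (simp add: cc_eq)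
  qed
qed

end
end

section \<open>The tangent lines of the area density\<close>

text \<open>N1 m + N2 m b is the tangent line at b = m of the convex function sqrt(1 + b^2); (N1 m,
  N2 m) is the unit vector along (1, m).\<close>

definition N1 :: "real \<Rightarrow> real" where "N1 m = 1 / sqrt (1 + m\<^sup>2)"
definition N2 :: "real \<Rightarrow> real" where "N2 m = m / sqrt (1 + m\<^sup>2)"

lemma sqrt1_pos: "sqrt (1 + m\<^sup>2) > 0" "1 \<le> sqrt (1 + m\<^sup>2)" for m :: real
  by (auto simp: add_pos_nonneg)

lemma N_bound: "\<bar>N1 m\<bar> \<le> 1" "\<bar>N2 m\<bar> \<le> 1"
proof -
  have "\<bar>m\<bar> \<le> sqrt (1 + m\<^sup>2)" by (rule real_le_rsqrt) simp
  then show "\<bar>N1 m\<bar> \<le> 1" "\<bar>N2 m\<bar> \<le> 1"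
    using sqrt1_pos[of m] by (auto simp: N1_def N2_def abs_divide divide_le_eq_1)
qed

text \<open>Cauchy-Schwarz for (1, m) and (1, b); the Lagrange identity gives the defect (b - m)^2
  under the root, hence also the case of equality.\<close>

lemma sqrt1_mult: "1 + m * b \<le> sqrt (1 + m\<^sup>2) * sqrt (1 + b\<^sup>2)"
  and sqrt1_mult_eq: "sqrt (1 + m\<^sup>2) * sqrt (1 + b\<^sup>2) \<le> 1 + m * b \<Longrightarrow> b = m"
  and sqrt1_mult_le: "sqrt (1 + m\<^sup>2) * sqrt (1 + b\<^sup>2) \<le> 1 + m * b + (b - m)\<^sup>2 / 2" for m b :: real
proof -
  have e: "sqrt (1 + m\<^sup>2) * sqrt (1 + b\<^sup>2) = sqrt ((1 + m * b)\<^sup>2 + (b - m)\<^sup>2)"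
    unfolding real_sqrt_mult[symmetric] by (rule arg_cong[of _ _ sqrt]) (simp add: power2_eq_square algebra_simps)
  show "1 + m * b \<le> sqrt (1 + m\<^sup>2) * sqrt (1 + b\<^sup>2)"
    unfolding e by (rule real_le_rsqrt) simp
  show "b = m" if "sqrt (1 + m\<^sup>2) * sqrt (1 + b\<^sup>2) \<le> 1 + m * b"
  proof -
    have "sqrt ((1 + m * b)\<^sup>2 + (b - m)\<^sup>2) \<le> \<bar>1 + m * b\<bar>" using that unfolding e by linarith
    then have "(1 + m * b)\<^sup>2 + (b - m)\<^sup>2 \<le> \<bar>1 + m * b\<bar>\<^sup>2" by (rule sqrt_le_D)
    then have "(b - m)\<^sup>2 \<le> 0" by simp
    then show "b = m" by simp
  qed
  have "2 * (sqrt (1 + m\<^sup>2) * sqrt (1 + b\<^sup>2)) \<le> (sqrt (1 + m\<^sup>2))\<^sup>2 + (sqrt (1 + b\<^sup>2))\<^sup>2"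
    using sum_squares_bound[of "sqrt (1 + m\<^sup>2)" "sqrt (1 + b\<^sup>2)"] by simp
  moreover have "(sqrt (1 + m\<^sup>2))\<^sup>2 = 1 + m\<^sup>2" "(sqrt (1 + b\<^sup>2))\<^sup>2 = 1 + b\<^sup>2" by simp_all
  moreover have "(b - m)\<^sup>2 = b\<^sup>2 + m\<^sup>2 - 2 * (m * b)" by (simp add: power2_diff)
  ultimately show "sqrt (1 + m\<^sup>2) * sqrt (1 + b\<^sup>2) \<le> 1 + m * b + (b - m)\<^sup>2 / 2"
    by linarith
qed

lemma tangent_le: "N1 m + N2 m * b \<le> sqrt (1 + b\<^sup>2)"
proof -
  have "N1 m + N2 m * b = (1 + m * b) / sqrt (1 + m\<^sup>2)" by (simp add: N1_def N2_def add_divide_distrib)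
  also have "\<dots> \<le> sqrt (1 + b\<^sup>2)"
    using sqrt1_mult[of m b] sqrt1_pos(1)[of m] by (simp add: pos_divide_le_eq mult.commute)
  finally show ?thesis .
qed

lemma tangent_eq: "N1 m + N2 m * b = sqrt (1 + b\<^sup>2) \<Longrightarrow> b = m"
proof -
  assume "N1 m + N2 m * b = sqrt (1 + b\<^sup>2)"
  then have "(1 + m * b) / sqrt (1 + m\<^sup>2) = sqrt (1 + b\<^sup>2)" by (simp add: N1_def N2_def add_divide_distrib)
  then have "sqrt (1 + m\<^sup>2) * sqrt (1 + b\<^sup>2) = 1 + m * b"
    using sqrt1_pos(1)[of m] by (simp add: divide_eq_eq mult.commute)
  then show "b = m" by (intro sqrt1_mult_eq) simp
qed

lemma tangent_self: "N1 m + N2 m * m = sqrt (1 + m\<^sup>2)"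
proof -
  have "N1 m + N2 m * m = (1 + m\<^sup>2) / sqrt (1 + m\<^sup>2)"
    by (simp add: N1_def N2_def add_divide_distrib power2_eq_square)
  then show ?thesis by (simp add: real_div_sqrt)
qed

text \<open>The derivatives satisfy N1' + m N2' = 0, so this combination of increments is quadratic.
  Hence weights dN1 on areas and dN2 on integrals of Bv see only the excess over m, to which
  \<open>sublevel_balance\<close> applies.\<close>

lemma N_increment: "\<bar>(N1 m' - N1 m) + m * (N2 m' - N2 m)\<bar> \<le> (m' - m)\<^sup>2"
proof -
  have "(N1 m' - N1 m) + m * (N2 m' - N2 m) = (1 + m' * m) / sqrt (1 + m'\<^sup>2) - sqrt (1 + m\<^sup>2)"
    using tangent_self[of m] by (simp add: N1_def N2_def add_divide_distrib algebra_simps)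
  also have "\<dots> = ((1 + m' * m) - sqrt (1 + m'\<^sup>2) * sqrt (1 + m\<^sup>2)) / sqrt (1 + m'\<^sup>2)"
    using sqrt1_pos(1)[of m'] by (simp add: diff_divide_distrib)
  finally have "\<bar>(N1 m' - N1 m) + m * (N2 m' - N2 m)\<bar> = (sqrt (1 + m'\<^sup>2) * sqrt (1 + m\<^sup>2) - (1 + m' * m)) / sqrt (1 + m'\<^sup>2)"
    using sqrt1_mult[of m' m] sqrt1_pos(1)[of m'] by (simp add: abs_divide)
  also have "\<dots> \<le> (sqrt (1 + m'\<^sup>2) * sqrt (1 + m\<^sup>2) - (1 + m' * m)) / 1"
    by (rule divide_left_mono) (use sqrt1_mult[of m' m] sqrt1_pos[of m'] in auto)
  also have "\<dots> \<le> (m' - m)\<^sup>2"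
    using sqrt1_mult_le[of m' m] zero_le_power2[of "m' - m"] unfolding power2_commute[of m m'] div_by_1 by linarith
  finally show ?thesis .
qed

lemma N_lipschitz: "\<bar>N1 m' - N1 m\<bar> \<le> 2 * \<bar>m' - m\<bar>" "\<bar>N2 m' - N2 m\<bar> \<le> 2 * \<bar>m' - m\<bar>"
proof -
  define A B where "A = sqrt (1 + m\<^sup>2)" and "B = sqrt (1 + m'\<^sup>2)"
  have A: "A \<ge> 1" "A > 0" and B: "B \<ge> 1" "B > 0" using sqrt1_pos by (auto simp: A_def B_def)
  have "\<bar>norm (1 :: real, m) - norm (1 :: real, m')\<bar> \<le> norm ((1 :: real, m) - (1, m'))"
    by (rule norm_triangle_ineq3)
  then have d: "\<bar>A - B\<bar> \<le> \<bar>m' - m\<bar>" by (simp add: norm_Pair A_def B_def abs_minus_commute)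
  have e: "1 / B - 1 / A = (A - B) / (A * B)" using A B by (simp add: field_simps)
  have aux: "x \<le> 2 * d" if "x = q" "q \<le> a" "a \<le> d" "0 \<le> d" for x q a d :: real using that by linarith
  have AB: "A * B \<ge> 1" using A B mult_mono[of 1 A 1 B] by simp
  have "\<bar>A - B\<bar> / (A * B) \<le> \<bar>A - B\<bar> / 1" by (rule divide_left_mono) (use AB in auto)
  then show n1: "\<bar>N1 m' - N1 m\<bar> \<le> 2 * \<bar>m' - m\<bar>"
  proof -
    have "\<bar>N1 m' - N1 m\<bar> = \<bar>A - B\<bar> / (A * B)" using e A B by (simp add: N1_def abs_divide abs_mult flip: A_def B_def)
    then show ?thesis using \<open>\<bar>A - B\<bar> / (A * B) \<le> \<bar>A - B\<bar> / 1\<close> d aux abs_ge_zero unfolding div_by_1 by blast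
  qed
  have "N2 m' - N2 m = (m' - m) / B + (m / A) * ((A - B) / B)"
    using A B by (simp add: N2_def field_simps flip: A_def B_def)
  moreover have "\<bar>(m' - m) / B\<bar> \<le> \<bar>m' - m\<bar>"
    using B divide_left_mono[of 1 B "\<bar>m' - m\<bar>"] by (simp add: abs_divide)
  moreover have "\<bar>(m / A) * ((A - B) / B)\<bar> \<le> 1 * \<bar>m' - m\<bar>"
    unfolding abs_mult
  proof (rule mult_mono)
    show "\<bar>m / A\<bar> \<le> 1" using N_bound(2)[of m] by (simp add: N2_def A_def)
    have "\<bar>A - B\<bar> / B \<le> \<bar>A - B\<bar> / 1" by (rule divide_left_mono) (use B in auto)
    then show "\<bar>(A - B) / B\<bar> \<le> \<bar>m' - m\<bar>" using d B by (simp add: abs_divide)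
  qed auto
  moreover have "\<bar>x\<bar> \<le> 2 * d" if "x = p + q" "\<bar>p\<bar> \<le> d" "\<bar>q\<bar> \<le> 1 * d" for x p q d :: real using that by linarith
  ultimately show "\<bar>N2 m' - N2 m\<bar> \<le> 2 * \<bar>m' - m\<bar>" by blast
qed

lemma N_cont: "continuous_on A N1" "continuous_on A N2"
  unfolding N1_def N2_def using sqrt1_pos(1) by (intro continuous_intros; metis less_irrefl)+

lemma strip_eqs:
  fixes l :: "'a \<Rightarrow> real"
  shows "{p \<in> A. a \<le> l p \<and> l p < c} = {p \<in> A. l p < c} - {p \<in> A. l p < a}"
    and "a \<le> c \<Longrightarrow> c \<le> d \<Longrightarrow> {p \<in> A. a \<le> l p \<and> l p < d} = {p \<in> A. a \<le> l p \<and> l p < c} \<union> {p \<in> A. c \<le> l p \<and> l p < d}"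
    and "{p \<in> A. a \<le> l p \<and> l p < c} \<inter> {p \<in> A. c \<le> l p \<and> l p < d} = {}"
  by auto

section \<open>Summation over the labels\<close>

context ruled_graph
begin

definition H :: "(real \<times> real \<Rightarrow> real) \<Rightarrow> (real \<times> real \<Rightarrow> real) \<Rightarrow> (real \<Rightarrow> real) \<Rightarrow> (real \<Rightarrow> real) \<Rightarrow> real" where
  "H w k a1 a2 = (LINT p:D|lborel. a1 (lab w p) + a2 (lab w p) * k p)"

lemma lab_borel: "adm w \<Longrightarrow> (\<lambda>p. indicator D p *\<^sub>R lab w p) \<in> borel_measurable borel"
  by (rule borel_measurable_continuous_on_indicator[OF D_borel continuous_on_subset[OF lab_cont D_sub_W]])

lemma affine_integral:
  fixes k :: "real \<times> real \<Rightarrow> real"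
  assumes A: "A \<in> sets borel" "A \<subseteq> D" and k: "set_integrable lborel A k"
  shows "set_integrable lborel A (\<lambda>p. c + d * k p)" "(LINT p:A|lborel. c + d * k p) = c * measure lborel A + d * (LINT p:A|lborel. k p)"
proof -
  have c: "set_integrable lborel A (\<lambda>p. c)" by (rule bounded_set_integrable[where C="\<bar>c\<bar>"]) (use A in auto)
  have d: "set_integrable lborel A (\<lambda>p. d * k p)" by (intro set_integrable_mult_right k)
  show "set_integrable lborel A (\<lambda>p. c + d * k p)" by (rule set_integral_add(1)[OF c d])
  have "(LINT p:A|lborel. c) = c * measure lborel A" unfolding set_lebesgue_integral_def by simp
  moreover have "(LINT p:A|lborel. d * k p) = d * (LINT p:A|lborel. k p)" by simp
  ultimately show "(LINT p:A|lborel. c + d * k p) = c * measure lborel A + d * (LINT p:A|lborel. k p)"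
    using set_integral_add(2)[OF c d] by simp
qed

lemma H_int:
  fixes k :: "real \<times> real \<Rightarrow> real" and a1 a2 :: "real \<Rightarrow> real"
  assumes w: "adm w" and k[measurable]: "k \<in> borel_measurable borel" and ki: "set_integrable lborel D k"
    and [measurable]: "a1 \<in> borel_measurable borel" "a2 \<in> borel_measurable borel"
    and B: "\<And>x. \<bar>a1 x\<bar> \<le> B" "\<And>x. \<bar>a2 x\<bar> \<le> B"
  shows "set_integrable lborel D (\<lambda>p. a1 (lab w p) + a2 (lab w p) * k p)"
  unfolding set_integrable_def
proof (rule Bochner_Integration.integrable_bound)
  note [measurable] = lab_borel[OF w]
  have "set_integrable lborel D (\<lambda>p. B * (1 + \<bar>k p\<bar>))"
    using affine_integral(1)[OF D_borel subset_refl set_integrable_abs[OF ki], of B B] by (simp add: distrib_left)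
  then show "integrable lborel (\<lambda>p. indicator D p *\<^sub>R (B * (1 + \<bar>k p\<bar>)))" by (simp add: set_integrable_def)
  have "(\<lambda>p. indicator D p *\<^sub>R (a1 (indicator D p *\<^sub>R lab w p) + a2 (indicator D p *\<^sub>R lab w p) * k p)) \<in> borel_measurable borel"
    by measurable
  moreover have "(\<lambda>p. indicator D p *\<^sub>R (a1 (indicator D p *\<^sub>R lab w p) + a2 (indicator D p *\<^sub>R lab w p) * k p))
     = (\<lambda>p. indicator D p *\<^sub>R (a1 (lab w p) + a2 (lab w p) * k p))" by (auto simp: indicator_def fun_eq_iff)
  ultimately show "(\<lambda>p. indicator D p *\<^sub>R (a1 (lab w p) + a2 (lab w p) * k p)) \<in> borel_measurable lborel" by simp
  have B0: "B \<ge> 0" using B(1)[of 0] by linarith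
  show "AE p in lborel. norm (indicator D p *\<^sub>R (a1 (lab w p) + a2 (lab w p) * k p)) \<le> norm (indicator D p *\<^sub>R (B * (1 + \<bar>k p\<bar>)))"
  proof (rule AE_I2)
    fix p
    have "\<bar>a2 (lab w p) * k p\<bar> \<le> B * \<bar>k p\<bar>" unfolding abs_mult by (rule mult_right_mono[OF B(2)]) simp
    then have "\<bar>a1 (lab w p) + a2 (lab w p) * k p\<bar> \<le> B * (1 + \<bar>k p\<bar>)"
      using B(1)[of "lab w p"] by (simp add: distrib_left)
    then show "norm (indicator D p *\<^sub>R (a1 (lab w p) + a2 (lab w p) * k p)) \<le> norm (indicator D p *\<^sub>R (B * (1 + \<bar>k p\<bar>)))"
      using B0 by (simp add: indicator_def)
  qed
qed

definition clamp :: "real \<Rightarrow> real \<Rightarrow> real \<Rightarrow> real" where "clamp a c x = max a (min x c)"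

lemma clamp_range: "a \<le> c \<Longrightarrow> clamp a c x \<in> {a..c}" by (auto simp: clamp_def)

lemma clamped_borel:
  assumes "0 < a" "a \<le> c" "c < tb" "continuous_on UNIV N"
  shows "(\<lambda>x. N (slope (clamp a c x))) \<in> borel_measurable borel"
proof (rule borel_measurable_continuous_onI)
  have "continuous_on UNIV (clamp a c)" unfolding clamp_def by (intro continuous_intros)
  then have "continuous_on UNIV (\<lambda>x. slope (clamp a c x))"
    by (rule continuous_on_compose2[OF slope_cont]) (use clamp_range[OF assms(2)] assms(1,3) in \<open>auto simp: clamp_def\<close>)
  then show "continuous_on UNIV (\<lambda>x. N (slope (clamp a c x)))"
    by (rule continuous_on_compose2[OF assms(4)]) auto
qed

text \<open>Labels are clamped to a compact interval because the slope is a quotient whose Lipschitz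
  control degenerates at both ends of I.\<close>

definition Hc where "Hc w k a c = H w k (\<lambda>x. N1 (slope (clamp a c x))) (\<lambda>x. N2 (slope (clamp a c x)))"

definition weight :: "(real \<times> real \<Rightarrow> real) \<Rightarrow> (real \<times> real \<Rightarrow> real) \<Rightarrow> real \<Rightarrow> real \<Rightarrow> real" where
  "weight w k a c = (LINT p:{p \<in> D. a \<le> lab w p \<and> lab w p < c}|lborel. 1 + \<bar>k p\<bar>)"

lemma strip_borel: "adm w \<Longrightarrow> {p \<in> D. a \<le> lab w p \<and> lab w p < c} \<in> sets borel"
proof -
  assume w: "adm w"
  show ?thesis unfolding strip_eqs(1)
    by (rule sets.Diff; rule borel_open[OF sublevel_open[OF w]])
qed

lemma weight_int:
  fixes k :: "real \<times> real \<Rightarrow> real"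
  assumes w: "adm w" and ki: "set_integrable lborel D k"
  shows "set_integrable lborel {p \<in> D. a \<le> lab w p \<and> lab w p < c} (\<lambda>p. 1 + \<bar>k p\<bar>)"
proof (rule set_integrable_subset)
  show "set_integrable lborel D (\<lambda>p. 1 + \<bar>k p\<bar>)"
    using affine_integral(1)[OF D_borel subset_refl set_integrable_abs[OF ki], of 1 1] unfolding mult_1_left .
  show "{p \<in> D. a \<le> lab w p \<and> lab w p < c} \<in> sets lborel"
    unfolding sets_lborel by (rule strip_borel[OF w])
qed (rule Collect_restrict)

lemma weight_add:
  assumes "adm w" "set_integrable lborel D k" "a \<le> c" "c \<le> d"
  shows "weight w k a d = weight w k a c + weight w k c d"
proof -
  show ?thesis unfolding weight_def strip_eqs(2)[OF assms(3,4)]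
    by (rule set_integral_Un[OF strip_eqs(3) weight_int[OF assms(1,2)] weight_int[OF assms(1,2)]])
qed

lemma Hc_int:
  assumes w: "adm w" and k: "k \<in> borel_measurable borel" "set_integrable lborel D k" and a: "0 < a" "a \<le> c" "c < tb"
  shows "set_integrable lborel D (\<lambda>p. N1 (slope (clamp a c (lab w p))) + N2 (slope (clamp a c (lab w p))) * k p)"
  by (rule H_int[OF w k clamped_borel[OF a N_cont(1)] clamped_borel[OF a N_cont(2)]]) (rule N_bound)+

text \<open>A function of the label clamped to [a, d] is the sum of the same function clamped to
  [a, c] and to [c, d], minus its value at c.\<close>

lemma Hc_add:
  assumes w: "adm w" and k: "k \<in> borel_measurable borel" "set_integrable lborel D k" and a: "0 < a" "a \<le> c" "c \<le> d" "d < tb"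
  shows "Hc w k a d = Hc w k a c + Hc w k c d - (N1 (slope c) * measure lborel D + N2 (slope c) * (LINT p:D|lborel. k p))"
proof -
  have e: "N (slope (clamp a d x)) = N (slope (clamp a c x)) + N (slope (clamp c d x)) - N (slope c)" for N :: "real \<Rightarrow> real" and x
    using a by (cases "x \<le> c") (auto simp: clamp_def max_def min_def)
  note cc = affine_integral[OF D_borel subset_refl k(2), of "N1 (slope c)" "N2 (slope c)"]
  have i1: "set_integrable lborel D (\<lambda>p. N1 (slope (clamp a c (lab w p))) + N2 (slope (clamp a c (lab w p))) * k p)"
    and i2: "set_integrable lborel D (\<lambda>p. N1 (slope (clamp c d (lab w p))) + N2 (slope (clamp c d (lab w p))) * k p)"
    by (rule Hc_int[OF w k]; use a in simp)+
  have "Hc w k a d = (LINT p:D|lborel. ((N1 (slope (clamp a c (lab w p))) + N2 (slope (clamp a c (lab w p))) * k p)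
      + (N1 (slope (clamp c d (lab w p))) + N2 (slope (clamp c d (lab w p))) * k p))
      - (N1 (slope c) + N2 (slope c) * k p))"
    unfolding Hc_def H_def e by (simp add: algebra_simps)
  also have "\<dots> = (Hc w k a c + Hc w k c d) - (LINT p:D|lborel. N1 (slope c) + N2 (slope c) * k p)"
    unfolding Hc_def H_def 
    unfolding set_integral_diff(2)[OF set_integral_add(1)[OF i1 i2] cc(1)] set_integral_add(2)[OF i1 i2] ..
  also have "(LINT p:D|lborel. N1 (slope c) + N2 (slope c) * k p) = N1 (slope c) * measure lborel D + N2 (slope c) * (LINT p:D|lborel. k p)"
    by (rule cc(2))
  finally show ?thesis .
qed

text \<open>One step of a summation by parts in the label: below a and above c the clamped integrand
  is constant in the label, so the error comes only from the strip between, where N1 and N2 vary by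
  at most 2 C (c - a).\<close>

lemma Hc_step:
  assumes w: "adm w" and k: "k \<in> borel_measurable borel" "set_integrable lborel D k" and a: "0 < a" "a \<le> c" "c < tb"
    and C: "C \<ge> 0" "\<And>x. x \<in> {a..c} \<Longrightarrow> \<bar>slope c - slope x\<bar> \<le> C * (c - a)"
  shows "\<bar>Hc w k a c - (N1 (slope c) * measure lborel D + N2 (slope c) * (LINT p:D|lborel. k p)
      - (N1 (slope c) - N1 (slope a)) * measure lborel {p \<in> D. lab w p < a}
      - (N2 (slope c) - N2 (slope a)) * (LINT p:{p \<in> D. lab w p < a}|lborel. k p))\<bar>
    \<le> 2 * C * (c - a) * weight w k a c"
proof -
  let ?E = "{p \<in> D. lab w p < a}" and ?S = "{p \<in> D. a \<le> lab w p \<and> lab w p < c}"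
  define d1 d2 where "d1 = N1 (slope c) - N1 (slope a)" and "d2 = N2 (slope c) - N2 (slope a)"
  have E[measurable]: "?E \<in> sets borel" using sublevel_open[OF w] by simp
  have Ek: "set_integrable lborel ?E k" by (rule set_integrable_subset[OF k(2)]) (use E in auto)
  note cc = affine_integral[OF D_borel subset_refl k(2), of "N1 (slope c)" "N2 (slope c)"]
  have ED: "?E \<subseteq> D" by auto
  note ce = affine_integral[OF E ED Ek, of d1 d2]
  have main: "set_integrable lborel D (\<lambda>p. N1 (slope (clamp a c (lab w p))) + N2 (slope (clamp a c (lab w p))) * k p)"
    by (rule Hc_int[OF w k a])
  let ?F = "\<lambda>p. indicator D p *\<^sub>R (N1 (slope (clamp a c (lab w p))) + N2 (slope (clamp a c (lab w p))) * k p)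
      - (indicator D p *\<^sub>R (N1 (slope c) + N2 (slope c) * k p) - indicator ?E p *\<^sub>R (d1 + d2 * k p))"
  have i: "integrable lborel (\<lambda>p. indicator D p *\<^sub>R (N1 (slope c) + N2 (slope c) * k p))"
    "integrable lborel (\<lambda>p. indicator ?E p *\<^sub>R (d1 + d2 * k p))"
    using cc(1) ce(1) by (simp_all add: set_integrable_def)
  have "Hc w k a c - ((LINT p:D|lborel. N1 (slope c) + N2 (slope c) * k p) - (LINT p:?E|lborel. d1 + d2 * k p)) = (\<integral>p. ?F p \<partial>lborel)"
    unfolding Hc_def H_def set_lebesgue_integral_def using main[unfolded set_integrable_def] i by simp
  moreover have "(LINT p:D|lborel. N1 (slope c) + N2 (slope c) * k p) = N1 (slope c) * measure lborel D + N2 (slope c) * (LINT p:D|lborel. k p)"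
    by (rule cc(2))
  moreover have "(LINT p:?E|lborel. d1 + d2 * k p) = d1 * measure lborel ?E + d2 * (LINT p:?E|lborel. k p)"
    by (rule ce(2))
  moreover have "\<bar>\<integral>p. ?F p \<partial>lborel\<bar> \<le> (\<integral>p. 2 * C * (c - a) * (indicator ?S p *\<^sub>R (1 + \<bar>k p\<bar>)) \<partial>lborel)"
  proof -
    have "\<bar>\<integral>p. ?F p \<partial>lborel\<bar> \<le> (\<integral>p. \<bar>?F p\<bar> \<partial>lborel)" using integral_norm_bound[of lborel ?F] by simp
    also have "\<dots> \<le> (\<integral>p. 2 * C * (c - a) * (indicator ?S p *\<^sub>R (1 + \<bar>k p\<bar>)) \<partial>lborel)"
    proof (rule Bochner_Integration.integral_mono)
      show "integrable lborel (\<lambda>p. \<bar>?F p\<bar>)"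
        by (intro integrable_abs Bochner_Integration.integrable_diff i main[unfolded set_integrable_def])
      show "integrable lborel (\<lambda>p. 2 * C * (c - a) * (indicator ?S p *\<^sub>R (1 + \<bar>k p\<bar>)))"
        using weight_int[OF w k(2), of a c] by (intro integrable_mult_right) (simp add: set_integrable_def)
      fix p
      show "\<bar>?F p\<bar> \<le> 2 * C * (c - a) * (indicator ?S p *\<^sub>R (1 + \<bar>k p\<bar>))"
      proof (cases "p \<in> D")
        case True
        consider "lab w p < a" | "a \<le> lab w p" "lab w p < c" | "c \<le> lab w p" by linarith
        then show ?thesis
        proof cases
          case 1
          then have "clamp a c (lab w p) = a" using a by (auto simp: clamp_def)
          then show ?thesis using 1 True by (simp add: d1_def d2_def algebra_simps)
        next
          case 2
          then have cl: "clamp a c (lab w p) = lab w p" by (auto simp: clamp_def)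
          let ?s = "slope (lab w p)"
          have "\<bar>slope c - ?s\<bar> \<le> C * (c - a)" using C(2) 2 by auto
          then have n: "\<bar>N1 ?s - N1 (slope c)\<bar> \<le> 2 * C * (c - a)" "\<bar>N2 ?s - N2 (slope c)\<bar> \<le> 2 * C * (c - a)"
            using N_lipschitz[of ?s "slope c"] by (simp_all add: abs_minus_commute)
          have "?F p = (N1 ?s - N1 (slope c)) + (N2 ?s - N2 (slope c)) * k p"
            using True 2 cl by (simp add: algebra_simps)
          moreover have "\<bar>(N2 ?s - N2 (slope c)) * k p\<bar> \<le> 2 * C * (c - a) * \<bar>k p\<bar>"
            unfolding abs_mult by (rule mult_right_mono[OF n(2)]) simp
          ultimately have "\<bar>?F p\<bar> \<le> 2 * C * (c - a) + 2 * C * (c - a) * \<bar>k p\<bar>" using n(1) by linarith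
          then show ?thesis using True 2 by (simp add: distrib_left)
        next
          case 3
          then have "clamp a c (lab w p) = c" using a by (auto simp: clamp_def)
          then show ?thesis using 3 True a by simp
        qed
      qed simp
    qed
    finally show ?thesis .
  qed
  moreover have "(\<integral>p. 2 * C * (c - a) * (indicator ?S p *\<^sub>R (1 + \<bar>k p\<bar>)) \<partial>lborel) = 2 * C * (c - a) * weight w k a c"
    unfolding weight_def set_lebesgue_integral_def by (rule integral_mult_right_zero)
  ultimately show ?thesis unfolding d1_def d2_def by (simp add: algebra_simps)
qed

end

context comparison
begin

text \<open>All four sides of a box around D lie off D, so \<open>law_diff\<close> has no boundary
  terms.\<close>

lemma total_balance: "(LINT p:D|lborel. b p) = (LINT p:D|lborel. mu p)"
proof -
  let ?B = "{- G - 1<..G + 1} \<times> {0<..tb}"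
  have DB: "D \<subseteq> ?B"
  proof
    fix p assume "p \<in> D"
    then obtain y t where p: "p = (y, t)" "0 < t" "t < tb" "g1 t < y" "y < g2 t" by (cases p) (auto simp: D_iff)
    then show "p \<in> ?B" using gG(1)[of t] gG(2)[of t] by auto
  qed
  have off: "(y, t) \<notin> D" if "y = - G - 1 \<or> y = G + 1 \<or> t = 0 \<or> t = tb" for y t
    using that gG(1)[of t] gG(2)[of t] by (auto simp: D_iff)
  have z: "integral {0..tb} (\<lambda>t. v (y, t) - u (y, t)) = 0" if "y = - G - 1 \<or> y = G + 1" for y
    using v_off[OF off] that by auto
  have z2: "integral {- G - 1..G + 1} (\<lambda>y. (v (y, t))\<^sup>2 - (u (y, t))\<^sup>2) = 0" if "t = 0 \<or> t = tb" for t
    using v_off[OF off] that by auto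
  have "(LINT p:?B|lborel. f p) = 0"
    using law_diff[of "- G - 1" "G + 1" 0 tb] G0 tb z z2 by simp
  moreover have "(LINT p:?B|lborel. f p) = (LINT p:D|lborel. b p - mu p)"
    unfolding set_lebesgue_integral_def
    by (rule Bochner_Integration.integral_cong) (use DB in \<open>auto simp: f_def indicator_def\<close>)
  ultimately show ?thesis using set_integral_diff(2)[OF b_int mu_int] by simp
qed

definition J where "J a c = Hc v b a c - Hc u mu a c"

lemma J_add: "0 < a \<Longrightarrow> a \<le> c \<Longrightarrow> c \<le> d \<Longrightarrow> d < tb \<Longrightarrow> J a d = J a c + J c d"
  unfolding J_def using Hc_add[OF v_adm b_borel b_int, of a c d] Hc_add[OF adm_u mu_borel mu_int, of a c d] total_balance
  by (simp add: algebra_simps)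

definition wt where "wt a c = weight v b a c + weight u mu a c"

text \<open>\<open>sublevel_balance\<close> turns the first-order part into the increment
  combination of \<open>N_increment\<close> times a difference of areas, which is quadratic in c -
  a. The rest is the strip error, which carries an additive weight.\<close>

lemma J_small:
  assumes a: "0 < a" "a \<le> c" "c < tb" and C: "C \<ge> 0" "\<And>x. x \<in> {a..c} \<Longrightarrow> \<bar>slope c - slope x\<bar> \<le> C * (c - a)"
  shows "\<bar>J a c\<bar> \<le> (c - a) * (C\<^sup>2 * measure lborel D * (c - a) + 2 * C * wt a c)"
proof -
  let ?Ev = "{p \<in> D. lab v p < a}" and ?Eu = "{p \<in> D. lab u p < a}"
  have s: "a \<in> {0<..<tb}" using a by auto
  define d1 d2 where "d1 = N1 (slope c) - N1 (slope a)" and "d2 = N2 (slope c) - N2 (slope a)"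
  have E: "?Ev \<in> sets borel" "?Eu \<in> sets borel" using sublevel_open[OF v_adm] sublevel_open[OF adm_u] by simp_all
  have fin: "emeasure lborel ?Ev < \<infinity>" "emeasure lborel ?Eu < \<infinity>"
    using emeasure_mono[of ?Ev D lborel] emeasure_mono[of ?Eu D lborel] D_finite by (auto intro: le_less_trans)
  have ce: "(LINT p:?Ev|lborel. slope a) = slope a * measure lborel ?Ev" "(LINT p:?Eu|lborel. slope a) = slope a * measure lborel ?Eu"
    unfolding set_lebesgue_integral_def by simp_all
  have cs: "set_integrable lborel A (\<lambda>p. slope a)" if "A \<in> sets borel" "A \<subseteq> D" for A
    by (rule bounded_set_integrable[where C="\<bar>slope a\<bar>"]) (use that in auto)
  have kb: "set_integrable lborel ?Ev b" "set_integrable lborel ?Eu mu"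
    by (rule set_integrable_subset[OF b_int], use E in auto, rule set_integrable_subset[OF mu_int], use E in auto)
  have bal: "(LINT p:?Ev|lborel. b p) - slope a * measure lborel ?Ev = (LINT p:?Eu|lborel. mu p) - slope a * measure lborel ?Eu"
    using sublevel_balance[OF s] set_integral_diff(2)[OF kb(1) cs[OF E(1)]] set_integral_diff(2)[OF kb(2) cs[OF E(2)]] ce by auto
  define MV MU BV BU where "MV = measure lborel ?Ev" and "MU = measure lborel ?Eu"
    and "BV = (LINT p:?Ev|lborel. b p)" and "BU = (LINT p:?Eu|lborel. mu p)"
  have MD: "0 \<le> MV" "MV \<le> measure lborel D" "0 \<le> MU" "MU \<le> measure lborel D"
    unfolding MV_def MU_def using D_finite E by (auto intro!: measure_mono_fmeasurable simp: fmeasurable_def)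
  have hv: "\<bar>Hc v b a c - (N1 (slope c) * measure lborel D + N2 (slope c) * (LINT p:D|lborel. b p) - d1 * MV - d2 * BV)\<bar>
     \<le> 2 * C * (c - a) * weight v b a c"
    unfolding d1_def d2_def MV_def BV_def by (rule Hc_step[OF v_adm b_borel b_int a C])
  have hu: "\<bar>Hc u mu a c - (N1 (slope c) * measure lborel D + N2 (slope c) * (LINT p:D|lborel. mu p) - d1 * MU - d2 * BU)\<bar>
     \<le> 2 * C * (c - a) * weight u mu a c"
    unfolding d1_def d2_def MU_def BU_def by (rule Hc_step[OF adm_u mu_borel mu_int a C])
  have BB: "BV - BU = slope a * (MV - MU)"
    using bal unfolding MV_def[symmetric] MU_def[symmetric] BV_def[symmetric] BU_def[symmetric] right_diff_distrib by linarith
  have "d1 * (MV - MU) + d2 * (BV - BU) = (d1 + slope a * d2) * (MV - MU)"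
    unfolding BB distrib_right by (simp only: ac_simps)
  moreover have "\<bar>(d1 + slope a * d2) * (MV - MU)\<bar> \<le> (C * (c - a))\<^sup>2 * measure lborel D"
    unfolding abs_mult
  proof (rule mult_mono)
    have "\<bar>d1 + slope a * d2\<bar> \<le> (slope c - slope a)\<^sup>2" unfolding d1_def d2_def by (rule N_increment)
    also have "\<dots> \<le> (C * (c - a))\<^sup>2"
      using C(2)[of a] a by (intro abs_le_square_iff[THEN iffD1]) auto
    finally show "\<bar>d1 + slope a * d2\<bar> \<le> (C * (c - a))\<^sup>2" .
    show "\<bar>MV - MU\<bar> \<le> measure lborel D" using MD by linarith
  qed auto
  moreover have "(c - a) * (C\<^sup>2 * measure lborel D * (c - a) + 2 * C * wt a c)
     = (C * (c - a))\<^sup>2 * measure lborel D + 2 * C * (c - a) * weight v b a c + 2 * C * (c - a) * weight u mu a c"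
    by (simp add: wt_def algebra_simps power2_eq_square)
  moreover have "J a c = (Hc v b a c - (N1 (slope c) * measure lborel D + N2 (slope c) * (LINT p:D|lborel. b p) - d1 * MV - d2 * BV))
     - (Hc u mu a c - (N1 (slope c) * measure lborel D + N2 (slope c) * (LINT p:D|lborel. mu p) - d1 * MU - d2 * BU))
     - (d1 * (MV - MU) + d2 * (BV - BU))"
    unfolding J_def total_balance by (simp add: algebra_simps)
  moreover have "\<bar>j\<bar> \<le> r" if "x = y" "\<bar>y\<bar> \<le> q" "r = q + p1 + p2" "j = h1 - h2 - x" "\<bar>h1\<bar> \<le> p1" "\<bar>h2\<bar> \<le> p2"
    for j r x y q p1 p2 h1 h2 :: real using that by linarith
  ultimately show ?thesis using hv hu by blast
qed

text \<open>J is additive and at most the length of the interval times an additive quantity;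
  subdivision makes it arbitrarily small. The Stieltjes integrals over the labels never have to be
  defined.\<close>

lemma J_zero:
  assumes e: "0 < e" "e < tb - e" shows "J e (tb - e) = 0"
proof -
  obtain C where C: "C \<ge> 0" "\<And>s s'. s \<in> {e..tb - e} \<Longrightarrow> s' \<in> {e..tb - e} \<Longrightarrow> s \<le> s' \<Longrightarrow> \<bar>slope s' - slope s\<bar> \<le> C * (s' - s)"
    using slope_locally_lipschitz[of e] e by auto
  define X where "X a c = C\<^sup>2 * measure lborel D * (c - a) + 2 * C * wt a c" for a c
  have "\<bar>J e (tb - e)\<bar> \<le> \<eta> * X e (tb - e)" if \<eta>: "\<eta> > 0" for \<eta>
  proof -
    define P where "P a c \<longleftrightarrow> (e \<le> a \<and> c \<le> tb - e \<longrightarrow> \<bar>J a c\<bar> \<le> \<eta> * X a c)" for a c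
    have "P e (tb - e)"
    proof (rule Bolzano)
      show "e \<le> tb - e" using e by simp
      fix a c d assume *: "P a c" "P c d" "a \<le> c" "c \<le> d"
      show "P a d" unfolding P_def
      proof
        assume r: "e \<le> a \<and> d \<le> tb - e"
        have "J a d = J a c + J c d" by (rule J_add) (use r * e in auto)
        moreover have "X a d = X a c + X c d"
          unfolding X_def wt_def using weight_add[OF v_adm b_int *(3,4)] weight_add[OF adm_u mu_int *(3,4)]
          by (simp add: algebra_simps)
        moreover have "\<bar>J a c\<bar> \<le> \<eta> * X a c" "\<bar>J c d\<bar> \<le> \<eta> * X c d" using * r unfolding P_def by auto
        ultimately show "\<bar>J a d\<bar> \<le> \<eta> * X a d" by (simp add: distrib_left)
      qed
    next
      fix x
      show "\<exists>d>0. \<forall>a c. a \<le> x \<and> x \<le> c \<and> c - a < d \<longrightarrow> P a c"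
      proof (intro exI[of _ \<eta>] conjI \<eta> allI impI)
        fix a c assume ac: "a \<le> x \<and> x \<le> c \<and> c - a < \<eta>"
        show "P a c" unfolding P_def
        proof
          assume r: "e \<le> a \<and> c \<le> tb - e"
          have "\<bar>J a c\<bar> \<le> (c - a) * X a c" unfolding X_def
          proof (rule J_small[OF _ _ _ C(1)])
            show "\<bar>slope c - slope y\<bar> \<le> C * (c - a)" if "y \<in> {a..c}" for y
            proof -
              have "\<bar>slope c - slope y\<bar> \<le> C * (c - y)" by (rule C(2)) (use that r in auto)
              also have "\<dots> \<le> C * (c - a)" using that C(1) by (intro mult_left_mono) auto
              finally show ?thesis .
            qed
          qed (use r ac e in auto)
          also have "\<dots> \<le> \<eta> * X a c"
          proof (rule mult_right_mono)
            have "0 \<le> weight w k a c" for w k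
              unfolding weight_def set_lebesgue_integral_def by (rule Bochner_Integration.integral_nonneg) (simp add: indicator_def)
            then show "0 \<le> X a c" unfolding X_def wt_def using C(1) ac by simp
          qed (use ac in auto)
          finally show "\<bar>J a c\<bar> \<le> \<eta> * X a c" .
        qed
      qed
    qed
    then show ?thesis by (simp add: P_def)
  qed
  note key = this
  have X0: "X e (tb - e) \<ge> 0"
  proof -
    have "0 \<le> 1 * X e (tb - e)" using key[of 1] by (intro order_trans[OF abs_ge_zero]) simp
    then show ?thesis by simp
  qed
  have "\<bar>J e (tb - e)\<bar> \<le> 0 + d" if d: "d > 0" for d
  proof -
    have "\<bar>J e (tb - e)\<bar> \<le> (d / (X e (tb - e) + 1)) * X e (tb - e)" by (rule key) (use d X0 in auto)
    also have "\<dots> \<le> (d / (X e (tb - e) + 1)) * (X e (tb - e) + 1)" by (rule mult_left_mono) (use d X0 in auto)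
    also have "\<dots> = d" using X0 by simp
    finally show ?thesis by simp
  qed
  then have "\<bar>J e (tb - e)\<bar> \<le> 0" by (rule field_le_epsilon)
  then show ?thesis by simp
qed

text \<open>Every interior point has its label inside the clamping interval from some index on, and
  1 + |k| dominates. For u the integrand is the area density itself, since the tangent line touches
  at the slope.\<close>

lemma calibration:
  "(LINT p:D|lborel. N1 (slope (lab v p)) + N2 (slope (lab v p)) * b p) = (LINT p:D|lborel. sqrt (1 + (mu p)\<^sup>2))"
  "set_integrable lborel D (\<lambda>p. N1 (slope (lab v p)) + N2 (slope (lab v p)) * b p)"
proof -
  \<comment> \<open>The factor 3 keeps \<open>e n\<close> below \<open>tb - e n\<close> from n = 0
    on.\<close>
  define e where "e n = tb / (3 * real (Suc n))" for n
  have e: "0 < e n" "e n < tb - e n" for n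
  proof -
    show "0 < e n" using tb by (simp add: e_def)
    have "e n \<le> tb / 3" unfolding e_def by (rule divide_left_mono) (use tb in auto)
    then show "e n < tb - e n" using tb by simp
  qed
  have el: "e \<longlonglongrightarrow> 0"
  proof -
    have "(\<lambda>n. (tb/3) / real (Suc n)) \<longlonglongrightarrow> 0" using LIMSEQ_Suc[OF lim_const_over_n[of "tb/3"]] by simp
    then show ?thesis unfolding e_def[abs_def] by simp
  qed
  have lim: "(\<lambda>n. Hc w k (e n) (tb - e n)) \<longlonglongrightarrow> (LINT p:D|lborel. N1 (slope (lab w p)) + N2 (slope (lab w p)) * k p)
      \<and> set_integrable lborel D (\<lambda>p. N1 (slope (lab w p)) + N2 (slope (lab w p)) * k p)"
    if w: "adm w" and k: "k \<in> borel_measurable borel" "set_integrable lborel D k" for w k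
  proof -
    have D1: "set_integrable lborel D (\<lambda>p. 1 + \<bar>k p\<bar>)"
      using affine_integral(1)[OF D_borel subset_refl set_integrable_abs[OF k(2)], of 1 1] unfolding mult_1_left .
    have bd: "\<bar>N1 x + N2 x * y\<bar> \<le> 1 + \<bar>y\<bar>" for x y
    proof -
      have "\<bar>N2 x * y\<bar> \<le> 1 * \<bar>y\<bar>" unfolding abs_mult by (rule mult_right_mono[OF N_bound(2)]) simp
      then show ?thesis using N_bound(1)[of x] by linarith
    qed
    have meas: "(\<lambda>p. indicator D p *\<^sub>R (N1 (slope (lab w p)) + N2 (slope (lab w p)) * k p)) \<in> borel_measurable borel"
    proof -
      have s: "(\<lambda>p. indicator D p *\<^sub>R slope (lab w p)) \<in> borel_measurable borel" by (rule slope_lab_borel[OF w])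
      have n: "N1 \<in> borel_measurable borel" "N2 \<in> borel_measurable borel" using N_cont borel_measurable_continuous_onI by blast+
      have "(\<lambda>p. indicator D p *\<^sub>R (N1 (indicator D p *\<^sub>R slope (lab w p)) + N2 (indicator D p *\<^sub>R slope (lab w p)) * k p)) \<in> borel_measurable borel"
        using s n k(1) by measurable
      moreover have "(\<lambda>p. indicator D p *\<^sub>R (N1 (indicator D p *\<^sub>R slope (lab w p)) + N2 (indicator D p *\<^sub>R slope (lab w p)) * k p))
        = (\<lambda>p. indicator D p *\<^sub>R (N1 (slope (lab w p)) + N2 (slope (lab w p)) * k p))" by (auto simp: indicator_def fun_eq_iff)
      ultimately show ?thesis by simp
    qed
    have "(\<lambda>n. Hc w k (e n) (tb - e n)) \<longlonglongrightarrow> (LINT p:D|lborel. N1 (slope (lab w p)) + N2 (slope (lab w p)) * k p)"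
      unfolding Hc_def H_def set_lebesgue_integral_def
    proof (rule integral_dominated_convergence[where w="\<lambda>p. indicator D p *\<^sub>R (1 + \<bar>k p\<bar>)"])
      show "integrable lborel (\<lambda>p. indicator D p *\<^sub>R (1 + \<bar>k p\<bar>))" using D1 by (simp add: set_integrable_def)
      show "(\<lambda>p. indicator D p *\<^sub>R (N1 (slope (lab w p)) + N2 (slope (lab w p)) * k p)) \<in> borel_measurable lborel" using meas by simp
      show "(\<lambda>p. indicator D p *\<^sub>R (N1 (slope (clamp (e n) (tb - e n) (lab w p))) + N2 (slope (clamp (e n) (tb - e n) (lab w p))) * k p)) \<in> borel_measurable lborel" for n
        using Hc_int[OF w k, of "e n" "tb - e n"] e[of n] unfolding set_integrable_def by (intro borel_measurable_integrable) auto
      show "AE p in lborel. norm (indicator D p *\<^sub>R (N1 (slope (clamp (e n) (tb - e n) (lab w p))) + N2 (slope (clamp (e n) (tb - e n) (lab w p))) * k p))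
         \<le> indicator D p *\<^sub>R (1 + \<bar>k p\<bar>)" for n
        by (rule AE_I2) (simp add: indicator_def bd)
      show "AE p in lborel. (\<lambda>n. indicator D p *\<^sub>R (N1 (slope (clamp (e n) (tb - e n) (lab w p))) + N2 (slope (clamp (e n) (tb - e n) (lab w p))) * k p))
         \<longlonglongrightarrow> indicator D p *\<^sub>R (N1 (slope (lab w p)) + N2 (slope (lab w p)) * k p)"
      proof (rule AE_I2)
        fix p
        show "(\<lambda>n. indicator D p *\<^sub>R (N1 (slope (clamp (e n) (tb - e n) (lab w p))) + N2 (slope (clamp (e n) (tb - e n) (lab w p))) * k p))
         \<longlonglongrightarrow> indicator D p *\<^sub>R (N1 (slope (lab w p)) + N2 (slope (lab w p)) * k p)"
        proof (cases "p \<in> D")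
          case True
          then have l: "0 < lab w p" "0 < tb - lab w p" using lab_range[OF w True] by auto
          have "\<forall>\<^sub>F n in sequentially. clamp (e n) (tb - e n) (lab w p) = lab w p"
            using order_tendstoD(2)[OF el l(1)] order_tendstoD(2)[OF el l(2)]
            by eventually_elim (auto simp: clamp_def)
          then show ?thesis by (intro tendsto_eventually, elim eventually_mono) simp
        qed simp
      qed
    qed
    moreover have "set_integrable lborel D (\<lambda>p. N1 (slope (lab w p)) + N2 (slope (lab w p)) * k p)"
      unfolding set_integrable_def
    proof (rule Bochner_Integration.integrable_bound)
      show "integrable lborel (\<lambda>p. indicator D p *\<^sub>R (1 + \<bar>k p\<bar>))" using D1 by (simp add: set_integrable_def)
      show "AE p in lborel. norm (indicator D p *\<^sub>R (N1 (slope (lab w p)) + N2 (slope (lab w p)) * k p)) \<le> norm (indicator D p *\<^sub>R (1 + \<bar>k p\<bar>))"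
        by (rule AE_I2) (simp add: indicator_def bd)
    qed (use meas in simp)
    ultimately show ?thesis by blast
  qed
  show "set_integrable lborel D (\<lambda>p. N1 (slope (lab v p)) + N2 (slope (lab v p)) * b p)"
    using lim[OF v_adm b_borel b_int] by blast
  have "Hc v b (e n) (tb - e n) = Hc u mu (e n) (tb - e n)" for n
    using J_zero[OF e[of n]] by (simp add: J_def)
  then have "(LINT p:D|lborel. N1 (slope (lab v p)) + N2 (slope (lab v p)) * b p) = (LINT p:D|lborel. N1 (slope (lab u p)) + N2 (slope (lab u p)) * mu p)"
    using lim[OF v_adm b_borel b_int] lim[OF adm_u mu_borel mu_int] LIMSEQ_unique by force
  also have "\<dots> = (LINT p:D|lborel. sqrt (1 + (mu p)\<^sup>2))"
    unfolding set_lebesgue_integral_def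
    by (rule Bochner_Integration.integral_cong) (auto simp: indicator_def mu_def tangent_self)
  finally show "(LINT p:D|lborel. N1 (slope (lab v p)) + N2 (slope (lab v p)) * b p) = (LINT p:D|lborel. sqrt (1 + (mu p)\<^sup>2))" .
qed

end

section \<open>Rigidity in the case of equality\<close>

context ruled_graph
begin

lemma W_slice: "(y, c) \<in> W \<Longrightarrow> (y, c') \<in> W \<Longrightarrow> t \<in> {c..c'} \<Longrightarrow> (y, t) \<in> W"
proof -
  assume *: "(y, c) \<in> W" "(y, c') \<in> W" "t \<in> {c..c'}"
  show "(y, t) \<in> W"
  proof (cases "c < c'")
    case True
    define \<theta> where "\<theta> = (t - c) / (c' - c)"
    have "0 \<le> \<theta>" "\<theta> \<le> 1" using True *(3) by (auto simp: \<theta>_def)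
    then have "(1 - \<theta>) *\<^sub>R (y, c) + \<theta> *\<^sub>R (y, c') \<in> W"
      by (rule convexD_alt[OF convex_closure[OF D_convex] *(1,2)])
    moreover have "(1 - \<theta>) * c + \<theta> * c' = t" unfolding \<theta>_def by (rule convex_combination_point[OF True])
    moreover have "(1 - \<theta>) * y + \<theta> * y = y" by (simp add: algebra_simps)
    ultimately show ?thesis by simp
  next
    case False
    then have "t = c" using *(3) by auto
    then show ?thesis using *(1) by simp
  qed
qed

text \<open>To first order, the flux \<open>\<integral>w + 2yw\<^sup>2\<close> below a level grows like \<open>w\<close> times the growth of the level
  \<open>t + 4yw\<close>; monotonicity of the level makes the error quadratic although \<open>w\<close> is only continuous.\<close>
lemma flux_increment:
  assumes w: "adm w" and y: "y \<noteq> 0" and cW: "(y, c) \<in> W" "(y, c') \<in> W" and c: "c \<le> c'" "0 \<le> c"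
    and T: "T = (c' + 4 * y * w (y, c')) - (c + 4 * y * w (y, c))"
  shows "\<bar>(integral {0..c'} (\<lambda>t. w (y, t)) + 2 * y * (w (y, c'))\<^sup>2)
      - (integral {0..c} (\<lambda>t. w (y, t)) + 2 * y * (w (y, c))\<^sup>2) - w (y, c) * T\<bar> \<le> T * (T + 2 * (c' - c)) / (8 * \<bar>y\<bar>)"
proof -
  define J where "J = integral {c..c'} (\<lambda>t. w (y, t))"
  \<comment> \<open>The growth of the level between c and t. Monotonicity puts it between 0 and T,
    and the error of the flux increment is an explicit expression in T, c' - c and the integral of
    \<tau>.\<close>
  define \<tau> where "\<tau> t = (t - c) + 4 * y * (w (y, t) - w (y, c))" for t
  define \<Theta> where "\<Theta> = integral {c..c'} \<tau>"
  note wc = continuous_on_slice(1)[OF admD(1)[OF w]]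
  have glue: "integral {0..c'} (\<lambda>t. w (y, t)) = integral {0..c} (\<lambda>t. w (y, t)) + J"
    unfolding J_def by (rule Henstock_Kurzweil_Integration.integral_combine[symmetric])
      (use c in \<open>auto intro!: integrable_continuous_real wc\<close>)
  have "((\<lambda>t. t - c) has_integral ((c' - c)\<^sup>2 / 2 - (c - c)\<^sup>2 / 2)) {c..c'}"
    by (rule fundamental_theorem_of_calculus[OF c(1)])
       (auto intro!: derivative_eq_intros simp: has_real_derivative_iff_has_vector_derivative[symmetric])
  moreover have "((\<lambda>t. w (y, t)) has_integral J) {c..c'}"
    unfolding J_def by (intro integrable_integral integrable_continuous_real wc)
  moreover have "((\<lambda>t. w (y, c)) has_integral ((c' - c) * w (y, c))) {c..c'}"
    using has_integral_const_real[of "w (y, c)" c c'] c by simp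
  ultimately have \<tau>i: "(\<tau> has_integral ((c' - c)\<^sup>2 / 2 + 4 * y * (J - (c' - c) * w (y, c)))) {c..c'}"
    unfolding \<tau>_def by (auto intro!: has_integral_add has_integral_mult_right has_integral_diff)
  then have \<Theta>: "\<Theta> = (c' - c)\<^sup>2 / 2 + 4 * y * (J - (c' - c) * w (y, c))" unfolding \<Theta>_def by (rule integral_unique)
  have mono: "t + 4 * y * w (y, t) \<le> t' + 4 * y * w (y, t')" if "t \<in> {c..c'}" "t' \<in> {c..c'}" "t \<le> t'" for t t'
    using admD(3)[OF w W_slice[OF cW that(1)] W_slice[OF cW that(2)]] that(3) by (cases "t = t'") auto
  have \<tau>r: "0 \<le> \<tau> t" "\<tau> t \<le> T" if "t \<in> {c..c'}" for t
    using mono[of c t] mono[of t c'] that c unfolding \<tau>_def T by (auto simp: algebra_simps)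
  have T0: "0 \<le> T" using \<tau>r[of c] c by auto
  have "0 \<le> \<Theta>" unfolding \<Theta>_def using \<tau>i \<tau>r(1) by (intro integral_nonneg) (auto simp: integrable_on_def)
  moreover have "\<Theta> \<le> (c' - c) * T"
  proof -
    have "\<Theta> \<le> integral {c..c'} (\<lambda>t. T)"
      unfolding \<Theta>_def using \<tau>i \<tau>r(2) by (intro integral_le) (auto simp: integrable_on_def)
    then show ?thesis using c by simp
  qed
  ultimately have B: "\<bar>2 * \<Theta> + T\<^sup>2 - 2 * T * (c' - c)\<bar> \<le> T * (T + 2 * (c' - c))"
    using zero_le_power2[of T] by (auto simp: abs_if power2_eq_square algebra_simps)
  define X where "X = (integral {0..c'} (\<lambda>t. w (y, t)) + 2 * y * (w (y, c'))\<^sup>2)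
      - (integral {0..c} (\<lambda>t. w (y, t)) + 2 * y * (w (y, c))\<^sup>2) - w (y, c) * T"
  have "8 * y * X = 2 * \<Theta> + T\<^sup>2 - 2 * T * (c' - c)"
  proof -
    have "2 * \<Theta> = (c' - c)\<^sup>2 + 8 * y * (J - (c' - c) * w (y, c))" unfolding \<Theta> by simp
    then show ?thesis unfolding X_def glue T by (simp add: algebra_simps power2_eq_square)
  qed
  then have "8 * \<bar>y\<bar> * \<bar>X\<bar> \<le> T * (T + 2 * (c' - c))" using B by (metis abs_mult abs_numeral)
  then show ?thesis unfolding X_def[symmetric] using y by (simp add: pos_le_divide_eq mult.commute)
qed

text \<open>Passing from s to \<sigma> changes the subtracted slope on the old sublevel set, which
  yields -r times its area, and adds the strip of labels between s and \<sigma>. There k is the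
  slope of the label, so the quotient is bounded by C, while the strip shrinks to a null
  set.\<close>

lemma excess_ratio:
  assumes w: "adm w" and k [measurable]: "k \<in> borel_measurable borel" and ki: "set_integrable lborel D k"
    and ks: "AE p in lborel. p \<in> D \<longrightarrow> k p = slope (lab w p)" and null: "AE p in lborel. p \<in> D \<longrightarrow> lab w p \<noteq> s"
    and C: "\<And>z z'. z \<in> {s..c} \<Longrightarrow> z' \<in> {s..c} \<Longrightarrow> z \<le> z' \<Longrightarrow> \<bar>slope z' - slope z\<bar> \<le> C * (z' - z)" "C \<ge> 0"
    and \<sigma>: "\<And>n. s < \<sigma> n \<and> \<sigma> n \<le> c" "\<sigma> \<longlonglongrightarrow> s"
    and r: "(\<lambda>n. (slope (\<sigma> n) - slope s) / (\<sigma> n - s)) \<longlonglongrightarrow> r"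
  shows "(\<lambda>n. ((LINT p:{p \<in> D. lab w p < \<sigma> n} \<inter> {p. fst p \<le> y}|lborel. k p - slope (\<sigma> n))
      - (LINT p:{p \<in> D. lab w p < s} \<inter> {p. fst p \<le> y}|lborel. k p - slope s)) / (\<sigma> n - s))
    \<longlonglongrightarrow> - r * measure lborel ({p \<in> D. lab w p < s} \<inter> {p. fst p \<le> y})"
proof -
  define A where "A z = {p \<in> D. lab w p < z} \<inter> {p. fst p \<le> y}" for z
  have A[measurable]: "A z \<in> sets borel" for z
    unfolding A_def by (rule sets.Int[OF borel_open[OF sublevel_open[OF w]] borel_closed])
      (intro closed_Collect_le continuous_intros)
  have AD: "A z \<subseteq> D" for z unfolding A_def by (metis Collect_restrict le_infI1)
  have int: "integrable lborel (\<lambda>p. indicator (A z) p * (k p - slope z))" for z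
  proof -
    have "set_integrable lborel (A z) (\<lambda>p. - slope z + 1 * k p)"
      by (rule affine_integral(1)[OF A AD set_integrable_subset[OF ki _ AD]]) simp
    then show ?thesis by (simp add: set_integrable_def)
  qed
  define q where "q n p = (indicator (A (\<sigma> n)) p * (k p - slope (\<sigma> n)) - indicator (A s) p * (k p - slope s)) / (\<sigma> n - s)" for n p
  have eq: "((LINT p:A (\<sigma> n)|lborel. k p - slope (\<sigma> n)) - (LINT p:A s|lborel. k p - slope s)) / (\<sigma> n - s) = (\<integral>p. q n p \<partial>lborel)" for n
    unfolding q_def set_lebesgue_integral_def using int by simp
  have inA: "p \<in> A z \<longleftrightarrow> p \<in> D \<and> fst p \<le> y \<and> lab w p < z" for p z unfolding A_def by blast
  have "(\<lambda>n. \<integral>p. q n p \<partial>lborel) \<longlonglongrightarrow> (\<integral>p. indicator (A s) p * (- r) \<partial>lborel)"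
  proof (rule integral_dominated_convergence[where w="\<lambda>p. indicator D p * C"])
    show "integrable lborel (\<lambda>p. indicator D p * C)" using D_finite by simp
    show "AE p in lborel. (\<lambda>n. q n p) \<longlonglongrightarrow> indicator (A s) p * (- r)" using null
    proof eventually_elim
      case (elim p)
      show ?case
      proof (cases "p \<in> D \<and> fst p \<le> y")
        case False
        then have "p \<notin> A z" for z using inA by blast
        then show ?thesis by (simp add: q_def)
      next
        case True
        show ?thesis
        proof (cases "lab w p < s")
          case l: True
          have "p \<in> A (\<sigma> n)" "p \<in> A s" for n using inA True l \<sigma>(1)[of n] by auto
          then have "q n p = - ((slope (\<sigma> n) - slope s) / (\<sigma> n - s))" "indicator (A s) p = (1 :: real)" for n
            by (simp_all add: q_def diff_divide_distrib)
          then show ?thesis using tendsto_minus[OF r] by simp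
        next
          case l: False
          then have "s < lab w p" using elim True by auto
          then have "\<forall>\<^sub>F n in sequentially. \<sigma> n < lab w p" by (rule order_tendstoD(2)[OF \<sigma>(2)])
          then have "\<forall>\<^sub>F n in sequentially. q n p = 0"
          proof eventually_elim
            case (elim n)
            then have "p \<notin> A (\<sigma> n)" "p \<notin> A s" using inA l by auto
            then show ?case by (simp add: q_def)
          qed
          moreover have "p \<notin> A s" using inA l by auto
          ultimately show ?thesis using tendsto_eventually[of "\<lambda>n. q n p" 0] by simp
        qed
      qed
    qed
    show "AE p in lborel. norm (q n p) \<le> indicator D p * C" for n using ks
    proof eventually_elim
      case (elim p)
      have d: "\<sigma> n - s > 0" using \<sigma>(1)[of n] by simp
      consider "p \<notin> A (\<sigma> n)" | "p \<in> A s" | "p \<in> A (\<sigma> n)" "p \<notin> A s" by blast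
      then show ?case
      proof cases
        case 1
        then have "p \<notin> A s" using inA \<sigma>(1)[of n] by auto
        then show ?thesis using 1 C(2) by (simp add: q_def)
      next
        case 2
        then have i: "p \<in> A (\<sigma> n)" "p \<in> D" using inA \<sigma>(1)[of n] by auto
        have "\<bar>slope (\<sigma> n) - slope s\<bar> \<le> C * (\<sigma> n - s)" by (rule C(1)) (use \<sigma>(1)[of n] in auto)
        then have "\<bar>slope (\<sigma> n) - slope s\<bar> / (\<sigma> n - s) \<le> C" using d by (simp add: pos_divide_le_eq)
        moreover have "q n p = - ((slope (\<sigma> n) - slope s) / (\<sigma> n - s))" using 2 i by (simp add: q_def diff_divide_distrib)
        ultimately show ?thesis using i d by (simp add: abs_divide)
      next
        case 3
        then have i: "p \<in> D" "s \<le> lab w p" "lab w p < \<sigma> n" using inA[of p s] inA[of p "\<sigma> n"] by auto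
        have "\<bar>slope (\<sigma> n) - slope (lab w p)\<bar> \<le> C * (\<sigma> n - lab w p)" by (rule C(1)) (use i \<sigma>(1)[of n] in auto)
        also have "\<dots> \<le> C * (\<sigma> n - s)" using i C(2) by (intro mult_left_mono) auto
        finally have "\<bar>slope (\<sigma> n) - slope (lab w p)\<bar> / (\<sigma> n - s) \<le> C" using d by (simp add: pos_divide_le_eq)
        moreover have "q n p = - ((slope (\<sigma> n) - slope (lab w p)) / (\<sigma> n - s))"
          using 3 i elim by (simp add: q_def minus_divide_left)
        ultimately show ?thesis using i d by (simp add: abs_divide)
      qed
    qed
    show "q n \<in> borel_measurable lborel" for n
      unfolding q_def using int by (intro borel_measurable_divide borel_measurable_diff borel_measurable_integrable) auto
  qed simp
  moreover have "(\<integral>p. indicator (A s) p * (- r) \<partial>lborel) = - r * measure lborel (A s)" by simp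
  ultimately show ?thesis unfolding A_def[symmetric] eq by (simp add: mult.commute)
qed

end

context comparison
begin

context
  fixes s :: real
  assumes s: "s \<in> {0<..<tb}" and ae: "AE p in lborel. p \<in> D \<longrightarrow> b p = slope (lab v p)"
begin

private lemma ruling_ends: "g1 s < 0" "0 < g2 (lam s)" using g_sign(1)[OF s] g_sign(2)[OF lam_inner[OF s]] by auto

private lemma level_growth:
  assumes z: "s < z" "z < tb" and y: "g1 s \<le> y" "y \<le> g2 (lam s)" "g1 z \<le> y" "y \<le> g2 (lam z)"
  shows "1 / 2 \<le> ((alpha z + 2 * slope z * y\<^sup>2) - (alpha s + 2 * slope s * y\<^sup>2)) / (z - s)"
    "((alpha z + 2 * slope z * y\<^sup>2) - (alpha s + 2 * slope s * y\<^sup>2)) / (z - s) \<le> 2"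
proof -
  have sz: "s \<in> {0..tb}" "z \<in> {0..tb}" "z \<in> {0<..<tb}" using s z by auto
  obtain h h' where h: "h \<in> {0..1}" "y = Y h s" "h' \<in> {0..1}" "y = Y h' z"
    using Y_surj[OF sz(1) y(1,2)] Y_surj[OF sz(2) y(3,4)] by blast
  have 1: "(z - s) / 2 \<le> TT h' z - TT h s" "TT h' z - TT h s \<le> 2 * (z - s)"
    by (rule label_increase; use sz z h in auto)+
  have 2: "TT h' z - TT h s = (alpha z + 2 * slope z * y\<^sup>2) - (alpha s + 2 * slope s * y\<^sup>2)"
    using TT_slope[OF s, of h] TT_slope[OF sz(3), of h'] h by simp
  have d: "z - s > 0" using z by simp
  show "1 / 2 \<le> ((alpha z + 2 * slope z * y\<^sup>2) - (alpha s + 2 * slope s * y\<^sup>2)) / (z - s)"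
    "((alpha z + 2 * slope z * y\<^sup>2) - (alpha s + 2 * slope s * y\<^sup>2)) / (z - s) \<le> 2"
    using 1 unfolding 2 using d by (simp_all add: pos_le_divide_eq pos_divide_le_eq)
qed

private lemma crv_slice_cont: assumes w: "adm w" shows "continuous_on {g1 s..g2 (lam s)} (crv w s)"
proof -
  have "continuous_on {g1 s..g2 (lam s)} (\<lambda>y. crv w (snd (y, s)) (fst (y, s)))"
    by (rule continuous_on_compose2[OF crv_cont[OF w], of _ "\<lambda>y. (y, s)"]) (use s in \<open>auto intro!: continuous_intros\<close>)
  then show ?thesis by simp
qed

text \<open>By \<open>flux_increment\<close> the flux changes by w times the change of the level, up
  to a product of the level change with a factor tending to zero. So its quotient converges along
  every sequence on which that of the level does.\<close>

private lemma flux_ratio: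
  assumes w: "adm w" and y: "g1 s < y" "y < g2 (lam s)" "y \<noteq> 0"
    and \<sigma>: "\<And>n. s < \<sigma> n \<and> \<sigma> n < tb" "\<sigma> \<longlonglongrightarrow> s"
    and ev: "\<forall>\<^sub>F n in sequentially. g1 (\<sigma> n) \<le> y \<and> y \<le> g2 (lam (\<sigma> n))"
    and Q: "(\<lambda>n. ((alpha (\<sigma> n) + 2 * slope (\<sigma> n) * y\<^sup>2) - (alpha s + 2 * slope s * y\<^sup>2)) / (\<sigma> n - s)) \<longlonglongrightarrow> Q"
  shows "(\<lambda>n. ((integral {0..crv w (\<sigma> n) y} (\<lambda>t. w (y, t)) + 2 * y * (w (y, crv w (\<sigma> n) y))\<^sup>2)
      - (integral {0..crv w s y} (\<lambda>t. w (y, t)) + 2 * y * (w (y, crv w s y))\<^sup>2)) / (\<sigma> n - s)) \<longlonglongrightarrow> w (y, crv w s y) * Q"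
proof -
  define c where "c n = crv w (\<sigma> n) y" for n
  define T where "T n = (alpha (\<sigma> n) + 2 * slope (\<sigma> n) * y\<^sup>2) - (alpha s + 2 * slope s * y\<^sup>2)" for n
  define Z where "Z t = integral {0..t} (\<lambda>t. w (y, t)) + 2 * y * (w (y, t))\<^sup>2" for t
  let ?c = "crv w s y"
  have s': "s \<in> {0..tb}" and yr: "g1 s \<le> y" "y \<le> g2 (lam s)" using s y by auto
  have cl: "c \<longlonglongrightarrow> ?c"
  proof -
    let ?S = "{q. snd q \<in> {0..tb} \<and> g1 (snd q) \<le> fst q \<and> fst q \<le> g2 (lam (snd q))}"
    have "(\<lambda>n. (y, \<sigma> n)) \<longlonglongrightarrow> (y, s)" by (intro tendsto_intros \<sigma>)
    then have "(\<lambda>n. crv w (snd (y, \<sigma> n)) (fst (y, \<sigma> n))) \<longlonglongrightarrow> crv w (snd (y, s)) (fst (y, s))"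
    proof (rule continuous_on_tendsto_compose[OF crv_cont[OF w]])
      show "(y, s) \<in> ?S" using s' yr by simp
      show "\<forall>\<^sub>F n in sequentially. (y, \<sigma> n) \<in> ?S"
        using ev by eventually_elim (use \<sigma>(1) s in \<open>auto intro: less_imp_le less_trans\<close>)
    qed
    then show ?thesis by (simp add: c_def[abs_def])
  qed
  have Ql: "(\<lambda>n. T n / (\<sigma> n - s)) \<longlonglongrightarrow> Q" using Q by (simp add: T_def)
  have dl: "(\<lambda>n. \<sigma> n - s) \<longlonglongrightarrow> 0" using tendsto_diff[OF \<sigma>(2) tendsto_const[of s]] by simp
  have Tl: "T \<longlonglongrightarrow> 0"
  proof -
    have "(\<lambda>n. T n / (\<sigma> n - s) * (\<sigma> n - s)) \<longlonglongrightarrow> Q * 0" by (rule tendsto_mult[OF Ql dl])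
    moreover have "T n / (\<sigma> n - s) * (\<sigma> n - s) = T n" for n using \<sigma>(1)[of n] by simp
    ultimately show ?thesis by simp
  qed
  have el: "(\<lambda>n. T n / (\<sigma> n - s) * ((T n + 2 * (c n - ?c)) / (8 * \<bar>y\<bar>))) \<longlonglongrightarrow> 0"
    using tendsto_mult[OF Ql tendsto_divide[OF tendsto_add[OF Tl tendsto_mult[OF tendsto_const[of 2] tendsto_diff[OF cl tendsto_const[of ?c]]]] tendsto_const[of "8 * \<bar>y\<bar>"]]] y(3) by simp
  have "(\<lambda>n. (Z (c n) - Z ?c) / (\<sigma> n - s) - w (y, ?c) * (T n / (\<sigma> n - s))) \<longlonglongrightarrow> 0"
  proof (rule Lim_null_comparison[OF _ el])
    show "\<forall>\<^sub>F n in sequentially. norm ((Z (c n) - Z ?c) / (\<sigma> n - s) - w (y, ?c) * (T n / (\<sigma> n - s)))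
        \<le> T n / (\<sigma> n - s) * ((T n + 2 * (c n - ?c)) / (8 * \<bar>y\<bar>))" using ev
    proof eventually_elim
      case (elim n)
      have z: "\<sigma> n \<in> {0..tb}" "\<sigma> n \<in> {0<..<tb}" "s < \<sigma> n" "\<sigma> n - s > 0" using \<sigma>(1)[of n] s by auto
      have yn: "g1 (\<sigma> n) \<le> y" "y \<le> g2 (lam (\<sigma> n))" using elim by auto
      note W1 = crv[OF w s' yr] and W2 = crv[OF w z(1) yn]
      have "?c < c n" unfolding c_def
        using lab_less_crv[OF w z(1) yn W1(1)] W1(2) z(3) by simp
      moreover have "0 \<le> ?c"
      proof -
        have "D \<subseteq> UNIV \<times> {0..tb}" by (auto simp: domD_def)
        then have "W \<subseteq> UNIV \<times> {0..tb}" by (rule closure_minimal) (intro closed_Times; simp)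
        then show ?thesis using W1(1) by auto
      qed
      moreover have "T n = (c n + 4 * y * w (y, c n)) - (?c + 4 * y * w (y, ?c))"
        unfolding T_def c_def using crv_level[OF w s yr] crv_level[OF w z(2) yn] by simp
      ultimately have "\<bar>Z (c n) - Z ?c - w (y, ?c) * T n\<bar> \<le> T n * (T n + 2 * (c n - ?c)) / (8 * \<bar>y\<bar>)"
        unfolding Z_def using flux_increment[OF w y(3) W1(1) W2(1)[folded c_def]] by simp
      then have "\<bar>Z (c n) - Z ?c - w (y, ?c) * T n\<bar> / (\<sigma> n - s) \<le> T n * (T n + 2 * (c n - ?c)) / (8 * \<bar>y\<bar>) / (\<sigma> n - s)"
        using z(4) by (intro divide_right_mono) auto
      moreover have "(Z (c n) - Z ?c) / (\<sigma> n - s) - w (y, ?c) * (T n / (\<sigma> n - s)) = (Z (c n) - Z ?c - w (y, ?c) * T n) / (\<sigma> n - s)"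
        by (simp add: diff_divide_distrib)
      ultimately show ?case using z(4) by (simp add: abs_divide mult.commute)
    qed
  qed
  then have "(\<lambda>n. ((Z (c n) - Z ?c) / (\<sigma> n - s) - w (y, ?c) * (T n / (\<sigma> n - s))) + w (y, ?c) * (T n / (\<sigma> n - s))) \<longlonglongrightarrow> 0 + w (y, ?c) * Q"
    by (intro tendsto_add tendsto_mult tendsto_const Ql)
  then show ?thesis by (simp add: Z_def c_def)
qed

text \<open>Differentiating the balance in the label along a sequence on which both difference quotients of
  the rulings converge leaves \<open>(v - u) q = - r E\<close>, where \<open>E\<close> is the area enclosed by the two
  level curves and \<open>E' = - 4 y (v - u)\<close>; hence \<open>E / q\<close> is constant.\<close>
lemma level_curves_agree:
  assumes y: "g1 s < y" "y < g2 (lam s)"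
  shows "crv v s y = crv u s y"
proof -
  define e where "e = min (s / 2) ((tb - s) / 2)"
  have e: "0 < e" "e < tb" "e \<le> s" "s < tb - e" using s by (auto simp: e_def min_def field_simps)
  obtain C where C: "C \<ge> 0" "\<And>z z'. z \<in> {e..tb - e} \<Longrightarrow> z' \<in> {e..tb - e} \<Longrightarrow> z \<le> z' \<Longrightarrow> \<bar>slope z' - slope z\<bar> \<le> C * (z' - z)"
    using slope_locally_lipschitz[OF e(1,2)] by blast
  define \<sigma>0 where "\<sigma>0 n = s + (tb - e - s) / real (Suc n)" for n
  have \<sigma>0: "s < \<sigma>0 n" "\<sigma>0 n \<le> tb - e" for n
  proof -
    show "s < \<sigma>0 n" using e by (simp add: \<sigma>0_def)
    have "(tb - e - s) / real (Suc n) \<le> (tb - e - s) / 1" by (rule divide_left_mono) (use e in auto)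
    then show "\<sigma>0 n \<le> tb - e" by (simp add: \<sigma>0_def)
  qed
  have \<sigma>0l: "\<sigma>0 \<longlonglongrightarrow> s"
  proof -
    have "(\<lambda>n. s + (tb - e - s) / real (Suc n)) \<longlonglongrightarrow> s + 0"
      by (intro tendsto_add tendsto_const LIMSEQ_Suc[OF lim_const_over_n])
    then show ?thesis by (simp add: \<sigma>0_def[abs_def])
  qed
  \<comment> \<open>The slope is Lipschitz but need not be differentiable in the label. Both
    quotients are bounded, so a subsequence makes them converge together; the coefficients of the
    quotient of the level are then known for all y at once.\<close>
  define ra rm where "ra z = (alpha z - alpha s) / (z - s)" and "rm z = (slope z - slope s) / (z - s)" for z
  have "(ra (\<sigma>0 n), rm (\<sigma>0 n)) \<in> {1/2..2} \<times> {-C..C}" for n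
  proof -
    have z: "\<sigma>0 n \<in> {0<..<tb}" using \<sigma>0[of n] s e by auto
    have z0: "g1 (\<sigma>0 n) \<le> 0" "0 \<le> g2 (lam (\<sigma>0 n))"
      using g_sign(1)[OF z] g_sign(2)[OF lam_inner[OF z]] by auto
    \<comment> \<open>At y = 0 the level reduces to \<open>alpha\<close>, and 0 lies between the
      ends of every ruling.\<close>
    have "ra (\<sigma>0 n) \<in> {1/2..2}"
      using level_growth[of "\<sigma>0 n" 0] z \<sigma>0(1)[of n] ruling_ends z0 by (auto simp: ra_def)
    moreover have "\<bar>slope (\<sigma>0 n) - slope s\<bar> \<le> C * (\<sigma>0 n - s)" by (rule C(2)) (use e \<sigma>0[of n] in auto)
    then have "\<bar>rm (\<sigma>0 n)\<bar> \<le> C" using \<sigma>0(1)[of n] by (simp add: rm_def abs_divide pos_divide_le_eq)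
    ultimately show ?thesis by auto
  qed
  moreover have "seq_compact ({1/2..2 :: real} \<times> {-C..C})"
    by (intro compact_imp_seq_compact compact_Times compact_Icc)
  ultimately obtain l \<rho> where \<rho>: "strict_mono \<rho>" "((\<lambda>n. (ra (\<sigma>0 n), rm (\<sigma>0 n))) \<circ> \<rho>) \<longlonglongrightarrow> l"
    by (auto elim!: seq_compactE[where f="\<lambda>n. (ra (\<sigma>0 n), rm (\<sigma>0 n))"])
  define \<sigma> where "\<sigma> n = \<sigma>0 (\<rho> n)" for n
  define \<kappa> r where "\<kappa> = fst l" and "r = snd l"
  have \<sigma>: "\<And>n. s < \<sigma> n \<and> \<sigma> n \<le> tb - e" "\<sigma> \<longlonglongrightarrow> s" "\<And>n. s < \<sigma> n \<and> \<sigma> n < tb"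
  proof -
    show 1: "s < \<sigma> n \<and> \<sigma> n \<le> tb - e" for n using \<sigma>0 by (simp add: \<sigma>_def)
    show "s < \<sigma> n \<and> \<sigma> n < tb" for n using 1[of n] e(1) by linarith
    show "\<sigma> \<longlonglongrightarrow> s" using LIMSEQ_subseq_LIMSEQ[OF \<sigma>0l \<rho>(1)] by (simp add: \<sigma>_def[abs_def] comp_def)
  qed
  have lims: "(\<lambda>n. ra (\<sigma> n)) \<longlonglongrightarrow> \<kappa>" "(\<lambda>n. rm (\<sigma> n)) \<longlonglongrightarrow> r"
    using tendsto_fst[OF \<rho>(2)] tendsto_snd[OF \<rho>(2)] by (simp_all add: \<kappa>_def r_def \<sigma>_def comp_def)
  define q where "q x = \<kappa> + 2 * r * x\<^sup>2" for x
  have ql: "(\<lambda>n. ((alpha (\<sigma> n) + 2 * slope (\<sigma> n) * x\<^sup>2) - (alpha s + 2 * slope s * x\<^sup>2)) / (\<sigma> n - s)) \<longlonglongrightarrow> q x" for x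
  proof -
    have "((alpha (\<sigma> n) + 2 * slope (\<sigma> n) * x\<^sup>2) - (alpha s + 2 * slope s * x\<^sup>2)) / (\<sigma> n - s) = ra (\<sigma> n) + 2 * rm (\<sigma> n) * x\<^sup>2" for n
      unfolding ra_def rm_def by (simp add: add_divide_distrib diff_divide_distrib algebra_simps)
    then show ?thesis unfolding q_def by (simp only:) (intro tendsto_intros lims)
  qed
  have ev: "\<forall>\<^sub>F n in sequentially. g1 (\<sigma> n) \<le> x \<and> x \<le> g2 (lam (\<sigma> n))" if x: "g1 s < x" "x < g2 (lam s)" for x
  proof -
    have \<sigma>r: "\<forall>\<^sub>F n in sequentially. \<sigma> n \<in> {0..tb}" and s': "s \<in> {0..tb}"
      using \<sigma>(3) s by (auto intro: less_imp_le less_trans intro!: always_eventually)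
    have 1: "(\<lambda>n. g1 (\<sigma> n)) \<longlonglongrightarrow> g1 s" by (rule continuous_on_tendsto_compose[OF g_cont(1) \<sigma>(2) s' \<sigma>r])
    have l: "(\<lambda>n. lam (\<sigma> n)) \<longlonglongrightarrow> lam s" by (rule continuous_on_tendsto_compose[OF lam_cont \<sigma>(2) s' \<sigma>r])
    have lr: "\<forall>\<^sub>F n in sequentially. lam (\<sigma> n) \<in> {0..tb}" using \<sigma>r by eventually_elim (rule lam(1))
    have 2: "(\<lambda>n. g2 (lam (\<sigma> n))) \<longlonglongrightarrow> g2 (lam s)" by (rule continuous_on_tendsto_compose[OF g_cont(2) l lam(1)[OF s'] lr])
    show ?thesis using order_tendstoD(2)[OF 1 x(1)] order_tendstoD(1)[OF 2 x(2)]
      by eventually_elim auto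
  qed
  \<comment> \<open>The lower bound of \<open>level_growth\<close> passes to the limit over the open
    ruling and to its ends by continuity; it allows the division by q.\<close>
  have q_pos: "1/2 \<le> q x" if x: "g1 s \<le> x" "x \<le> g2 (lam s)" for x
  proof -
    have "{g1 s<..<g2 (lam s)} \<subseteq> {x. 1/2 \<le> q x}"
    proof
      fix x assume "x \<in> {g1 s<..<g2 (lam s)}"
      then have x: "g1 s < x" "x < g2 (lam s)" by auto
      have "\<forall>\<^sub>F n in sequentially. 1/2 \<le> ((alpha (\<sigma> n) + 2 * slope (\<sigma> n) * x\<^sup>2) - (alpha s + 2 * slope s * x\<^sup>2)) / (\<sigma> n - s)"
        using ev[OF x] by eventually_elim (use \<sigma>(3) x level_growth(1) in auto)
      then have "1/2 \<le> q x" by (rule tendsto_lowerbound[OF ql]) simp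
      then show "x \<in> {x. 1/2 \<le> q x}" by simp
    qed
    then have "closure {g1 s<..<g2 (lam s)} \<subseteq> {x. 1/2 \<le> q x}"
      by (rule closure_minimal) (auto simp: q_def intro!: closed_Collect_le continuous_intros)
    then show ?thesis using ruling_ends x by (auto simp: closure_greaterThanLessThan)
  qed
  define V where "V x = v (x, crv v s x)" for x
  define U' where "U' x = u (x, crv u s x)" for x
  define E where "E x = integral {g1 s..x} (\<lambda>z. crv v s z - crv u s z)" for x
  have gap: "crv v s x - crv u s x = - 4 * x * (V x - U' x)" if "g1 s \<le> x" "x \<le> g2 (lam s)" for x
    using crv_level[OF v_adm s that] crv_level[OF adm_u s that] by (simp add: V_def U'_def algebra_simps)
  have mu_ae: "AE p in lborel. p \<in> D \<longrightarrow> mu p = slope (lab u p)" by (simp add: mu_def)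
  have Ck: "\<And>z z'. z \<in> {s..tb - e} \<Longrightarrow> z' \<in> {s..tb - e} \<Longrightarrow> z \<le> z' \<Longrightarrow> \<bar>slope z' - slope z\<bar> \<le> C * (z' - z)"
    by (rule C(2)) (use e in auto)
  \<comment> \<open>Difference quotients of \<open>partial_balance\<close> between s and \<sigma>:
    \<open>excess_ratio\<close> gives the limit of the masses, \<open>flux_ratio\<close> that of the
    fluxes, and \<open>area_gap\<close> turns the difference of areas into E.\<close>
  have key: "(V x - U' x) * q x = - r * E x" if x: "g1 s < x" "x < g2 (lam s)" "x \<noteq> 0" for x
  proof -
    let ?H = "{p :: real \<times> real. fst p \<le> x}"
    define PV where "PV z = (LINT p:{p \<in> D. lab v p < z} \<inter> ?H|lborel. b p - slope z)" for z
    define PU where "PU z = (LINT p:{p \<in> D. lab u p < z} \<inter> ?H|lborel. mu p - slope z)" for z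
    define ZV where "ZV z = integral {0..crv v z x} (\<lambda>t. v (x, t)) + 2 * x * (v (x, crv v z x))\<^sup>2" for z
    define ZU where "ZU z = integral {0..crv u z x} (\<lambda>t. u (x, t)) + 2 * x * (u (x, crv u z x))\<^sup>2" for z
    define MV MU where "MV = measure lborel ({p \<in> D. lab v p < s} \<inter> ?H)" and "MU = measure lborel ({p \<in> D. lab u p < s} \<inter> ?H)"
    have pb: "PV z - PU z = ZV z - ZU z" if "z \<in> {0<..<tb}" "g1 z \<le> x" "x \<le> g2 (lam z)" for z
      unfolding PV_def PU_def ZV_def ZU_def by (rule partial_balance[OF that])
    have pv: "(\<lambda>n. (PV (\<sigma> n) - PV s) / (\<sigma> n - s)) \<longlonglongrightarrow> - r * MV"
      unfolding PV_def MV_def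
      by (rule excess_ratio[OF v_adm b_borel b_int ae level_null[OF s v_adm] Ck C(1) \<sigma>(1,2) lims(2)[unfolded rm_def]])
    have pu: "(\<lambda>n. (PU (\<sigma> n) - PU s) / (\<sigma> n - s)) \<longlonglongrightarrow> - r * MU"
      unfolding PU_def MU_def
      by (rule excess_ratio[OF adm_u mu_borel mu_int mu_ae level_null[OF s adm_u] Ck C(1) \<sigma>(1,2) lims(2)[unfolded rm_def]])
    have zv: "(\<lambda>n. (ZV (\<sigma> n) - ZV s) / (\<sigma> n - s)) \<longlonglongrightarrow> V x * q x"
      unfolding ZV_def V_def by (rule flux_ratio[OF v_adm x \<sigma>(3,2) ev[OF x(1,2)] ql])
    have zu: "(\<lambda>n. (ZU (\<sigma> n) - ZU s) / (\<sigma> n - s)) \<longlonglongrightarrow> U' x * q x"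
      unfolding ZU_def U'_def by (rule flux_ratio[OF adm_u x \<sigma>(3,2) ev[OF x(1,2)] ql])
    have ps: "PV s - PU s = ZV s - ZU s" by (rule pb[OF s]) (use x in auto)
    have "\<forall>\<^sub>F n in sequentially. (PV (\<sigma> n) - PV s) / (\<sigma> n - s) - (PU (\<sigma> n) - PU s) / (\<sigma> n - s)
        = (ZV (\<sigma> n) - ZV s) / (\<sigma> n - s) - (ZU (\<sigma> n) - ZU s) / (\<sigma> n - s)" using ev[OF x(1,2)]
    proof eventually_elim
      case (elim n)
      have "PV (\<sigma> n) - PU (\<sigma> n) = ZV (\<sigma> n) - ZU (\<sigma> n)" by (rule pb) (use elim \<sigma>(3)[of n] s in auto)
      then have "(PV (\<sigma> n) - PV s) - (PU (\<sigma> n) - PU s) = (ZV (\<sigma> n) - ZV s) - (ZU (\<sigma> n) - ZU s)" using ps by linarith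
      then show ?case by (metis diff_divide_distrib)
    qed
    then have "(\<lambda>n. (ZV (\<sigma> n) - ZV s) / (\<sigma> n - s) - (ZU (\<sigma> n) - ZU s) / (\<sigma> n - s)) \<longlonglongrightarrow> - r * MV - - r * MU"
      by (rule Lim_transform_eventually[OF tendsto_diff[OF pv pu]])
    then have "- r * MV - - r * MU = V x * q x - U' x * q x"
      by (rule LIMSEQ_unique[OF _ tendsto_diff[OF zv zu]])
    moreover have "MV - MU = E x" unfolding MV_def MU_def E_def by (rule area_gap[OF s]) (use x in auto)
    ultimately show ?thesis by (simp add: algebra_simps flip: \<open>MV - MU = E x\<close>)
  qed
  have E0: "E x = 0" if x: "g1 s < x" "x < g2 (lam s)" for x
  proof -
    have kc: "continuous_on {g1 s..x} (\<lambda>z. crv v s z - crv u s z)"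
      by (intro continuous_on_diff; rule continuous_on_subset[OF crv_slice_cont]) (use x v_adm adm_u in auto)
    have Ed: "(E has_real_derivative (crv v s z - crv u s z)) (at z within {g1 s..x})" if "z \<in> {g1 s..x}" for z
      unfolding E_def has_real_derivative_iff_has_vector_derivative by (rule integral_has_vector_derivative[OF kc that])
    have qne: "q z \<noteq> 0" if "z \<in> {g1 s..x}" for z using q_pos[of z] that x by auto
    have Qd: "((\<lambda>z. E z / q z) has_real_derivative ((crv v s z - crv u s z) * q z - E z * (4 * r * z)) / (q z * q z)) (at z within {g1 s..x})"
      if "z \<in> {g1 s..x}" for z
    proof -
      have qd: "(q has_real_derivative 4 * r * z) (at z within {g1 s..x})"
        unfolding q_def[abs_def] by (auto intro!: derivative_eq_intros)
      show ?thesis by (rule DERIV_divide[OF Ed[OF that] qd qne[OF that]])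
    qed
    \<comment> \<open>Here q' = 4 r z, and \<open>gap\<close> with \<open>key\<close> gives E' q =
      -4 z (V - U') q = 4 r z E, so the numerator E' q - E q' is zero.\<close>
    have "E x / q x = E (g1 s) / q (g1 s)"
    proof (rule has_derivative_zero_unique_strong_interval[where f="\<lambda>z. E z / q z" and k="{g1 s}" and a="g1 s" and b=x])
      show "continuous_on {g1 s..x} (\<lambda>z. E z / q z)"
        by (rule DERIV_continuous_on[OF Qd])
      fix z assume z: "z \<in> {g1 s..x} - {g1 s}"
      then have zr: "g1 s < z" "z < g2 (lam s)" "z \<in> {g1 s..x}" using x by auto
      have "(crv v s z - crv u s z) * q z = E z * (4 * r * z)"
      proof (cases "z = 0")
        case True
        then show ?thesis using gap[of z] zr by simp
      next
        case False
        have "(crv v s z - crv u s z) * q z = - 4 * z * ((V z - U' z) * q z)" using gap[of z] zr by simp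
        then show ?thesis unfolding key[OF zr(1,2) False] by (simp add: mult.commute mult.left_commute)
      qed
      then have "((\<lambda>z. E z / q z) has_real_derivative 0) (at z within {g1 s..x})" using Qd[OF zr(3)] by simp
      then show "((\<lambda>z. E z / q z) has_derivative (\<lambda>h. 0)) (at z within {g1 s..x})"
        by (simp add: has_field_derivative_def lambda_zero)
    qed (use x in auto)
    moreover have "E (g1 s) = 0" by (simp add: E_def)
    ultimately show ?thesis using qne[of x] x by simp
  qed
  show ?thesis
  proof (cases "y = 0")
    case True
    then show ?thesis using gap[of y] y by simp
  next
    case False
    have "q y \<noteq> 0" using q_pos[of y] y by auto
    then have "V y = U' y" using key[OF y False] E0[OF y] by simp
    then show ?thesis using gap[of y] y by simp
  qed
qed

end

text \<open>Each point of D lies on its own v-level curve, hence on the u-level curve with the same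
  label, and t + 4 y v = t + 4 y u. At y = 0 this carries no information, and continuity closes the
  gap.\<close>

theorem rigidity:
  assumes ae: "AE p in lborel. p \<in> D \<longrightarrow> b p = slope (lab v p)" and p: "p \<in> D"
  shows "v p = u p"
proof -
  have off_axis: "v (y, t) = u (y, t)" if "(y, t) \<in> D" "y \<noteq> 0" for y t
  proof -
    define s where "s = lab v (y, t)"
    have s: "s \<in> {0<..<tb}" unfolding s_def by (rule lab_range[OF v_adm that(1)])
    have y: "g1 s < y" "y < g2 (lam s)" using lab_between[OF v_adm that(1)] by (simp_all add: s_def)
    have "crv v s y = t" by (rule crv_eq[OF v_adm]) (use that D_sub_W s_def in auto)
    moreover have "crv v s y = crv u s y" by (rule level_curves_agree[OF s ae y])
    ultimately have "t + 4 * y * v (y, t) = t + 4 * y * u (y, t)"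
      using crv_level[OF v_adm s, of y] crv_level[OF adm_u s, of y] y by simp
    then show ?thesis using that(2) by simp
  qed
  obtain y t where p': "p = (y, t)" by force
  show ?thesis
  proof (cases "y = 0")
    case False
    then show ?thesis using off_axis p p' by simp
  next
    case True
    have c: "continuous_on UNIV (\<lambda>h. v (h, t) - u (h, t))"
      by (intro continuous_intros continuous_on_compose2[OF v_cont] continuous_on_compose2[OF u_cont]) auto
    then have "((\<lambda>h. v (h, t) - u (h, t)) \<longlongrightarrow> v (0, t) - u (0, t)) (at 0)"
      by (simp add: continuous_on_def)
    moreover have "((\<lambda>h. v (h, t) - u (h, t)) \<longlongrightarrow> 0) (at 0)"
    proof (rule tendsto_eventually)
      have "open ((\<lambda>h. (h, t)) -` D)" by (rule open_vimage[OF D_open]) (intro continuous_intros)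
      then have "\<forall>\<^sub>F h in at 0. h \<in> (\<lambda>h. (h, t)) -` D"
        by (rule eventually_at_in_open') (use p p' True in auto)
      moreover have "\<forall>\<^sub>F h in at (0 :: real). h \<noteq> 0" by (simp add: eventually_at_filter)
      ultimately show "\<forall>\<^sub>F h in at 0. v (h, t) - u (h, t) = 0" by eventually_elim (use off_axis in auto)
    qed
    ultimately have "v (0, t) - u (0, t) = 0" by (rule tendsto_unique[OF at_neq_bot])
    then show ?thesis using p' True by simp
  qed
qed

end

section \<open>The distributional gradient of the ruled graph\<close>

lemma integral_translate:
  fixes f :: "real \<times> real \<Rightarrow> real"
  assumes [measurable]: "f \<in> borel_measurable borel"
  shows "(\<integral>p. f (p + c) \<partial>lborel) = (\<integral>p. f p \<partial>lborel)"
proof -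
  have "(\<integral>p. f p \<partial>distr lborel borel ((+) c)) = (\<integral>p. f (c + p) \<partial>lborel)" by (rule integral_distr) simp_all
  then show ?thesis by (simp add: lborel_distr_plus add.commute)
qed

text \<open>Fubini and translation invariance move the shift from a, which is only bounded, to
  \<psi>, which is Lipschitz in t. One factor e is the length of the averaging interval, the other
  the largest shift.\<close>

lemma average_translate:
  fixes a \<psi> :: "real \<times> real \<Rightarrow> real"
  assumes a [measurable]: "a \<in> borel_measurable borel" and N: "\<And>p. \<bar>a p\<bar> \<le> N"
    and \<psi>: "continuous_on UNIV \<psi>" and supp: "\<And>p. \<psi> p \<noteq> 0 \<Longrightarrow> p \<in> cball 0 R" and B: "\<And>p. \<bar>\<psi> p\<bar> \<le> B"
    and C: "\<And>p r. 0 \<le> r \<Longrightarrow> r \<le> 1 \<Longrightarrow> \<bar>\<psi> (p - (0, r)) - \<psi> p\<bar> \<le> C * r" and e: "0 < e" "e \<le> 1"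
  shows "\<bar>e * (\<integral>p. \<psi> p * a p \<partial>lborel) - (\<integral>p. \<psi> p * (LINT r:{0..e}|lborel. a (p + (0, r))) \<partial>lborel)\<bar>
    \<le> e\<^sup>2 * (C * N * measure lborel (cball (0 :: real \<times> real) (R + 1)))"
proof -
  let ?m = "measure lborel (cball (0 :: real \<times> real) (R + 1))"
  have [measurable]: "\<psi> \<in> borel_measurable borel" by (rule borel_measurable_continuous_onI[OF \<psi>])
  have N0: "N \<ge> 0" using N[of 0] by linarith
  have C0: "C \<ge> 0" using C[of 1 0] by linarith
  define g where "g r p = indicator {0..e} r * (\<psi> p * a (p + (0, r)))" for r p
  have gm [measurable]: "(\<lambda>z. g (fst z) (snd z)) \<in> borel_measurable borel"
  proof -
    have [measurable]: "(\<lambda>z :: real \<times> real \<times> real. snd z + (0, fst z)) \<in> borel_measurable borel"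
      by (intro borel_measurable_continuous_onI continuous_intros)
    have [measurable]: "(snd :: real \<times> real \<times> real \<Rightarrow> _) \<in> borel_measurable borel" "(fst :: real \<times> real \<times> real \<Rightarrow> _) \<in> borel_measurable borel"
      by (intro borel_measurable_continuous_onI continuous_intros)+
    show ?thesis unfolding g_def by measurable
  qed
  have "integrable lborel (\<lambda>z :: real \<times> real \<times> real. g (fst z) (snd z))"
  proof (rule integrableI_bounded_set[where A="cbox (0, 0) (e, 0) \<union> {0..e} \<times> cball 0 R" and B="B * N"])
    have b: "bounded (cbox (0, 0) (e, 0) \<union> {0..e} \<times> cball 0 R :: (real \<times> real \<times> real) set)"
      by (intro bounded_Un[THEN iffD2] conjI bounded_cbox bounded_Times bounded_cball) simp_all
    show "emeasure lborel (cbox (0, 0) (e, 0) \<union> {0..e} \<times> cball 0 R :: (real \<times> real \<times> real) set) < \<infinity>"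
      using emeasure_bounded_finite[OF b] by simp
    show "cbox (0, 0) (e, 0) \<union> {0..e} \<times> cball 0 R \<in> sets (lborel :: (real \<times> real \<times> real) measure)"
      by (simp, intro sets.Un borel_closed closed_cbox closed_Times) simp_all
    show "AE z in lborel. z \<in> cbox (0, 0) (e, 0) \<union> {0..e} \<times> cball 0 R \<longrightarrow> norm (g (fst z) (snd z)) \<le> B * N"
    proof (intro AE_I2 impI)
      fix z :: "real \<times> real \<times> real"
      have "\<bar>\<psi> (snd z)\<bar> * \<bar>a (snd z + (0, fst z))\<bar> \<le> B * N" by (intro mult_mono B N) (use B[of 0] in auto)
      then show "norm (g (fst z) (snd z)) \<le> B * N"
        using order_trans[OF abs_ge_zero B[of 0]] N0 by (auto simp: g_def abs_mult indicator_def)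
    qed
    show "AE z in lborel. z \<notin> cbox (0, 0) (e, 0) \<union> {0..e} \<times> cball 0 R \<longrightarrow> g (fst z) (snd z) = 0"
    proof (intro AE_I2 impI)
      fix z :: "real \<times> real \<times> real" assume "z \<notin> cbox (0, 0) (e, 0) \<union> {0..e} \<times> cball 0 R"
      then have "fst z \<notin> {0..e} \<or> \<psi> (snd z) = 0" using supp[of "snd z"] by (cases z) auto
      then show "g (fst z) (snd z) = 0" by (auto simp: g_def)
    qed
  qed simp
  then have gi: "integrable (lborel \<Otimes>\<^sub>M lborel) (case_prod g)" by (simp add: lborel_prod case_prod_unfold)
  define F where "F r = (\<integral>p. \<psi> (p - (0, r)) * a p \<partial>lborel)" for r
  have inner: "(\<integral>p. g r p \<partial>lborel) = indicator {0..e} r * F r" for r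
  proof -
    have "(\<lambda>p. \<psi> (p - (0, r)) * a p) \<in> borel_measurable borel"
      by (intro borel_measurable_times a borel_measurable_continuous_onI continuous_on_compose2[OF \<psi>] continuous_intros) auto
    then have "(\<integral>p. \<psi> p * a (p + (0, r)) \<partial>lborel) = F r"
      unfolding F_def using integral_translate[of "\<lambda>p. \<psi> (p - (0, r)) * a p" "(0, r)"] by simp
    then show ?thesis unfolding g_def by simp
  qed
  have "(\<integral>p. \<psi> p * (LINT r:{0..e}|lborel. a (p + (0, r))) \<partial>lborel) = (\<integral>p. (\<integral>r. g r p \<partial>lborel) \<partial>lborel)"
  proof (rule Bochner_Integration.integral_cong[OF refl])
    fix p
    have "g r p = \<psi> p * (indicator {0..e} r *\<^sub>R a (p + (0, r)))" for r by (simp add: g_def)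
    then show "\<psi> p * (LINT r:{0..e}|lborel. a (p + (0, r))) = (\<integral>r. g r p \<partial>lborel)"
      by (simp add: set_lebesgue_integral_def)
  qed
  also have "\<dots> = (\<integral>r. (\<integral>p. g r p \<partial>lborel) \<partial>lborel)" by (rule lborel_pair.Fubini_integral[OF gi])
  finally have E: "(\<integral>p. \<psi> p * (LINT r:{0..e}|lborel. a (p + (0, r))) \<partial>lborel) = (\<integral>r. indicator {0..e} r * F r \<partial>lborel)"
    unfolding inner .
  have Fi: "integrable lborel (\<lambda>r. indicator {0..e} r * F r)"
    using lborel_pair.integrable_fst[OF gi] unfolding inner .
  have ci: "integrable lborel (\<lambda>r :: real. indicator {0..e} r * c)" for c :: real
    by (intro integrable_mult_left integrable_real_indicator) (use e in simp_all)
  have cv: "(\<integral>r. indicator {0..e} r * c \<partial>(lborel :: real measure)) = e * c" for c :: real using e by simp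
  have Fd: "\<bar>F 0 - F r\<bar> \<le> C * e * N * ?m" if r: "r \<in> {0..e}" for r
  proof -
    have I: "integrable lborel (\<lambda>p. \<psi> (p - (0, x)) * a p)" if x: "x \<in> {0..e}" for x
    proof (rule integrable_bounded_box[where A="cball 0 (R + 1)" and C="B * N"])
      show "(\<lambda>p. \<psi> (p - (0, x)) * a p) \<in> borel_measurable borel"
        by (intro borel_measurable_times a borel_measurable_continuous_onI continuous_on_compose2[OF \<psi>] continuous_intros) auto
      show "\<bar>\<psi> (p - (0, x)) * a p\<bar> \<le> B * N" for p
        unfolding abs_mult by (intro mult_mono B N) (use B[of 0] in auto)
      show "\<psi> (p - (0, x)) * a p = 0" if "p \<notin> cball 0 (R + 1)" for p
      proof -
        have "norm p \<le> norm (p - (0, x)) + norm ((0, x) :: real \<times> real)"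
          using norm_triangle_ineq[of "p - (0, x)" "(0, x)"] by simp
        then have "p - (0, x) \<notin> cball 0 R" using that x e by (auto simp: norm_Pair)
        then have "\<psi> (p - (0, x)) = 0" using supp by blast
        then show ?thesis by simp
      qed
    qed simp
    have z: "0 \<in> {0..e}" using e by simp
    have "F 0 - F r = (\<integral>p. \<psi> (p - (0, 0)) * a p - \<psi> (p - (0, r)) * a p \<partial>lborel)"
      unfolding F_def by (rule Bochner_Integration.integral_diff[OF I[OF z] I[OF r], symmetric])
    moreover have "norm \<dots> \<le> (\<integral>p. indicator (cball 0 (R + 1)) p * (C * e * N) \<partial>(lborel :: (real \<times> real) measure))"
    proof (rule Bochner_Integration.integral_norm_bound_integral)
      show "integrable lborel (\<lambda>p. \<psi> (p - (0, 0)) * a p - \<psi> (p - (0, r)) * a p)"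
        by (rule Bochner_Integration.integrable_diff[OF I[OF z] I[OF r]])
      show "integrable lborel (\<lambda>p :: real \<times> real. indicator (cball 0 (R + 1)) p * (C * e * N))"
        using emeasure_bounded_finite[OF bounded_cball, of "0 :: real \<times> real" "R + 1"] by simp
      fix p :: "real \<times> real"
      show "norm (\<psi> (p - (0, 0)) * a p - \<psi> (p - (0, r)) * a p) \<le> indicator (cball 0 (R + 1)) p * (C * e * N)"
      proof (cases "p \<in> cball 0 (R + 1)")
        case True
        have "\<bar>\<psi> (p - (0, r)) - \<psi> p\<bar> * \<bar>a p\<bar> \<le> (C * e) * N"
        proof (rule mult_mono[OF _ N])
          have "\<bar>\<psi> (p - (0, r)) - \<psi> p\<bar> \<le> C * r" by (rule C) (use r e in auto)
          also have "\<dots> \<le> C * e" using r C0 by (intro mult_left_mono) auto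
          finally show "\<bar>\<psi> (p - (0, r)) - \<psi> p\<bar> \<le> C * e" .
        qed (use C0 e in auto)
        moreover have "norm (\<psi> (p - (0, 0)) * a p - \<psi> (p - (0, r)) * a p) = \<bar>\<psi> (p - (0, r)) - \<psi> p\<bar> * \<bar>a p\<bar>"
          by (simp add: abs_mult[symmetric] left_diff_distrib abs_minus_commute flip: zero_prod_def)
        ultimately show ?thesis using True by simp
      next
        case False
        have "norm p \<le> norm (p - (0, r)) + norm ((0, r) :: real \<times> real)"
          using norm_triangle_ineq[of "p - (0, r)" "(0, r)"] by simp
        then have "p - (0, r) \<notin> cball 0 R" "p \<notin> cball 0 R" using False r e by (auto simp: norm_Pair)
        then have "\<psi> (p - (0, r)) = 0" "\<psi> p = 0" using supp by blast+
        then show ?thesis using False by (simp flip: zero_prod_def)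
      qed
    qed
    ultimately show ?thesis by (simp add: mult.commute)
  qed
  have "e * F 0 - (\<integral>r. indicator {0..e} r * F r \<partial>lborel) = (\<integral>r. indicator {0..e} r * F 0 - indicator {0..e} r * F r \<partial>lborel)"
    unfolding Bochner_Integration.integral_diff[OF ci Fi] cv ..
  moreover have "norm \<dots> \<le> (\<integral>r. indicator {0..e} r * (C * e * N * ?m) \<partial>(lborel :: real measure))"
  proof (rule Bochner_Integration.integral_norm_bound_integral[OF Bochner_Integration.integrable_diff[OF ci Fi] ci])
    fix r :: real
    show "norm (indicator {0..e} r * F 0 - indicator {0..e} r * F r) \<le> indicator {0..e} r * (C * e * N * ?m)"
      using Fd[of r] by (cases "r \<in> {0..e}") (simp_all add: indicator_def)
  qed
  ultimately have "\<bar>e * F 0 - (\<integral>r. indicator {0..e} r * F r \<partial>lborel)\<bar> \<le> e * (C * e * N * ?m)" unfolding cv by simp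
  moreover have "F 0 = (\<integral>p. \<psi> p * a p \<partial>lborel)" unfolding F_def by (simp flip: zero_prod_def)
  ultimately show ?thesis unfolding E by (simp add: power2_eq_square mult_ac)
qed

text \<open>With a primitive of V the left side becomes a function of the shift that vanishes at
  zero and whose derivative, a difference of increments of V, is at most 2 L times the size of the
  shift.\<close>

lemma shift_increment:
  fixes V :: "real \<Rightarrow> real"
  assumes V: "\<And>x y. \<bar>V x - V y\<bar> \<le> L * \<bar>x - y\<bar>" and e: "0 \<le> e"
  shows "\<bar>integral {0..e} (\<lambda>r. V r - V (r - \<tau>)) - \<tau> * (V e - V 0)\<bar> \<le> 2 * L * \<tau>\<^sup>2"
proof -
  have L: "L \<ge> 0" using V[of 1 0] by simp
  have Vc: "continuous_on A V" for A
    by (rule lipschitz_on_continuous_on[of L], rule lipschitz_onI) (use V L in \<open>auto simp: dist_real_def\<close>)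
  define I where "I = {- \<bar>\<tau>\<bar> - 1..e + \<bar>\<tau>\<bar> + 1}"
  obtain Q where Q: "\<And>x. x \<in> I \<Longrightarrow> (Q has_vector_derivative V x) (at x within I)"
    using antiderivative_continuous[OF Vc, of "- \<bar>\<tau>\<bar> - 1" "e + \<bar>\<tau>\<bar> + 1"] unfolding I_def by blast
  have Qd: "(Q has_real_derivative V x) (at x)" if "- \<bar>\<tau>\<bar> \<le> x" "x \<le> e + \<bar>\<tau>\<bar>" for x
  proof -
    have "at x within I = at x" unfolding I_def by (rule at_within_Icc_at) (use that in auto)
    then show ?thesis using Q[of x] that by (simp add: I_def has_real_derivative_iff_has_vector_derivative)
  qed
  have "((\<lambda>r. V r - V (r - \<tau>)) has_integral ((Q e - Q (e - \<tau>)) - (Q 0 - Q (0 - \<tau>)))) {0..e}"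
  proof (rule fundamental_theorem_of_calculus[OF e])
    fix r assume r: "r \<in> {0..e}"
    have "((\<lambda>r. Q r - Q (r - \<tau>)) has_real_derivative V r - V (r - \<tau>)) (at r)"
      by (rule DERIV_diff[OF Qd DERIV_shift[THEN iffD1, of Q _ r "- \<tau>", simplified]])
         (use r Qd[of "r - \<tau>"] in auto)
    then show "((\<lambda>r. Q r - Q (r - \<tau>)) has_vector_derivative V r - V (r - \<tau>)) (at r within {0..e})"
      by (simp add: has_real_derivative_iff_has_vector_derivative has_vector_derivative_at_within)
  qed
  then have i: "integral {0..e} (\<lambda>r. V r - V (r - \<tau>)) = (Q e - Q (e - \<tau>)) - (Q 0 - Q (0 - \<tau>))" by (rule integral_unique)
  define H where "H x = (Q e - Q (e - x)) - (Q 0 - Q (0 - x)) - x * (V e - V 0)" for x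
  have "norm (H \<tau> - H 0) \<le> (2 * L * \<bar>\<tau>\<bar>) * norm (\<tau> - 0)"
  proof (rule field_differentiable_bound[of "{- \<bar>\<tau>\<bar>..\<bar>\<tau>\<bar>}"])
    fix x assume x: "x \<in> {- \<bar>\<tau>\<bar>..\<bar>\<tau>\<bar>}"
    have "(H has_real_derivative (V (e - x) - V (0 - x)) - (V e - V 0)) (at x)"
      unfolding H_def
      by (rule derivative_eq_intros refl DERIV_chain2[OF Qd] | use x e in \<open>auto\<close>)+
    then show "(H has_real_derivative (V (e - x) - V (0 - x)) - (V e - V 0)) (at x within {- \<bar>\<tau>\<bar>..\<bar>\<tau>\<bar>})"
      by (rule DERIV_subset) simp
    have "\<bar>V (e - x) - V e\<bar> \<le> L * \<bar>x\<bar>" "\<bar>V (0 - x) - V 0\<bar> \<le> L * \<bar>x\<bar>" using V[of "e - x" e] V[of "0 - x" 0] by simp_all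
    moreover have "L * \<bar>x\<bar> \<le> L * \<bar>\<tau>\<bar>" using x L by (intro mult_left_mono) auto
    ultimately show "norm ((V (e - x) - V (0 - x)) - (V e - V 0)) \<le> 2 * L * \<bar>\<tau>\<bar>" by (simp add: abs_if split: if_splits)
  qed auto
  then show ?thesis unfolding i H_def by (simp add: power2_eq_square abs_mult_self_eq mult.assoc)
qed

lemma difference_quotient_limit:
  fixes \<psi> :: "real \<times> real \<Rightarrow> real"
  assumes "\<psi> differentiable (at p)" and e: "e \<longlonglongrightarrow> 0" "\<And>n. e n \<noteq> 0"
  shows "(\<lambda>n. (\<psi> (p - e n *\<^sub>R c) - \<psi> p) / e n) \<longlonglongrightarrow> - frechet_derivative \<psi> (at p) c"
proof -
  let ?f = "frechet_derivative \<psi> (at p)"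
  have d: "(\<psi> has_derivative ?f) (at p)" using assms(1) by (rule frechet_derivative_works[THEN iffD1])
  have "((\<lambda>x. p - x *\<^sub>R c) has_derivative (\<lambda>x. - (x *\<^sub>R c))) (at 0)" by (auto intro!: derivative_eq_intros)
  then have "((\<lambda>x. \<psi> (p - x *\<^sub>R c)) has_derivative (\<lambda>x. ?f (- (x *\<^sub>R c)))) (at 0)"
    using has_derivative_compose[of "\<lambda>x. p - x *\<^sub>R c" _ 0 UNIV \<psi> ?f] d by simp
  moreover have "?f (- (x *\<^sub>R c)) = (- ?f c) * x" for x
    using has_derivative_bounded_linear[OF d] by (simp add: linear_simps mult.commute)
  ultimately have "((\<lambda>x. \<psi> (p - x *\<^sub>R c)) has_real_derivative - ?f c) (at 0)"
    unfolding has_field_derivative_def by (simp only:)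
  then have "((\<lambda>x. (\<psi> (p - x *\<^sub>R c) - \<psi> p) / x) \<longlongrightarrow> - ?f c) (at 0)" by (simp add: DERIV_def)
  then show ?thesis by (rule filterlim_compose) (use e in \<open>auto intro!: filterlim_atI\<close>)
qed

lemma difference_bound:
  fixes \<psi> :: "real \<times> real \<Rightarrow> real"
  assumes d: "\<And>p. \<psi> differentiable (at p)" and c: "norm c \<le> 1" and supp: "\<And>p. \<psi> p \<noteq> 0 \<Longrightarrow> p \<in> cball 0 R"
    and B: "\<And>p. p \<in> cball 0 (R + 1) \<Longrightarrow> \<bar>frechet_derivative \<psi> (at p) c\<bar> \<le> C" and C: "0 \<le> C"
    and x: "0 \<le> x" "x \<le> 1"
  shows "\<bar>\<psi> (p - x *\<^sub>R c) - \<psi> p\<bar> \<le> C * x"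
proof (cases "\<psi> (p - x *\<^sub>R c) = 0 \<and> \<psi> p = 0")
  case True
  then show ?thesis using C x by simp
next
  case False
  have xc: "norm (x *\<^sub>R c) \<le> 1" using c x by (simp add: mult_le_one)
  have "norm p \<le> norm (p - x *\<^sub>R c) + norm (x *\<^sub>R c)" "norm (p - x *\<^sub>R c) \<le> norm p + norm (x *\<^sub>R c)"
    using norm_triangle_ineq[of "p - x *\<^sub>R c" "x *\<^sub>R c"] norm_triangle_ineq4[of p "x *\<^sub>R c"] by simp_all
  then have ends: "p \<in> cball 0 (R + 1)" "p - x *\<^sub>R c \<in> cball 0 (R + 1)"
    using False supp[of p] supp[of "p - x *\<^sub>R c"] xc by auto
  have "norm (\<psi> (p - x *\<^sub>R c) - \<psi> (p - 0 *\<^sub>R c)) \<le> C * norm (x - 0)"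
  proof (rule field_differentiable_bound[of "{0..x}"])
    fix z assume z: "z \<in> {0..x}"
    let ?q = "p - z *\<^sub>R c"
    have d1: "(\<psi> has_derivative frechet_derivative \<psi> (at ?q)) (at ?q)" using d by (rule frechet_derivative_works[THEN iffD1])
    have d2: "((\<lambda>z. p - z *\<^sub>R c) has_derivative (\<lambda>x. - (x *\<^sub>R c))) (at z)" by (auto intro!: derivative_eq_intros)
    have "((\<lambda>z. \<psi> (p - z *\<^sub>R c)) has_derivative (\<lambda>x. frechet_derivative \<psi> (at ?q) (- (x *\<^sub>R c)))) (at z)"
      by (rule has_derivative_compose[OF d2 d1])
    moreover have "frechet_derivative \<psi> (at ?q) (- (x *\<^sub>R c)) = (- frechet_derivative \<psi> (at ?q) c) * x" for x
      using linear_frechet_derivative[OF d, of ?q] by (simp add: linear_neg linear_scale mult.commute)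
    ultimately have "((\<lambda>z. \<psi> (p - z *\<^sub>R c)) has_real_derivative - frechet_derivative \<psi> (at ?q) c) (at z)"
      unfolding has_field_derivative_def by (simp only:)
    then show "((\<lambda>z. \<psi> (p - z *\<^sub>R c)) has_real_derivative - frechet_derivative \<psi> (at ?q) c) (at z within {0..x})"
      by (rule DERIV_subset) simp
    have "?q = (1 - z / x) *\<^sub>R p + (z / x) *\<^sub>R (p - x *\<^sub>R c)" if "x \<noteq> 0"
      using that by (simp add: scaleR_diff_right scaleR_diff_left)
    moreover have "0 \<le> z / x" "z / x \<le> 1" if "x \<noteq> 0" using z that x by (auto simp: divide_le_eq_1)
    ultimately have "?q \<in> cball 0 (R + 1)"
      using convexD_alt[OF convex_cball ends, of "z / x"] ends z by (cases "x = 0") auto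
    then show "norm (- frechet_derivative \<psi> (at ?q) c) \<le> C" using B by simp
  qed (use x in auto)
  then show ?thesis using x by simp
qed

text \<open>Discrete integration by parts: translation invariance moves the difference quotient from
  the merely continuous w to \<psi>, where it converges boundedly.\<close>

lemma translation_limit:
  fixes \<psi> w :: "real \<times> real \<Rightarrow> real"
  assumes d: "\<And>p. \<psi> differentiable (at p)" and c: "norm c \<le> 1" and supp: "\<And>p. \<psi> p \<noteq> 0 \<Longrightarrow> p \<in> cball 0 R"
    and B: "\<And>p. p \<in> cball 0 (R + 1) \<Longrightarrow> \<bar>frechet_derivative \<psi> (at p) c\<bar> \<le> C" and C: "0 \<le> C"
    and Dm: "(\<lambda>p. frechet_derivative \<psi> (at p) c) \<in> borel_measurable borel"
    and w: "continuous_on UNIV w" and e: "e \<longlonglongrightarrow> 0" "\<And>n. 0 < e n \<and> e n \<le> 1"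
  shows "(\<lambda>n. \<integral>p. \<psi> p * ((w (p + e n *\<^sub>R c) - w p) / e n) \<partial>lborel) \<longlonglongrightarrow> - (\<integral>p. w p * frechet_derivative \<psi> (at p) c \<partial>lborel)"
    and "integrable lborel (\<lambda>p. w p * frechet_derivative \<psi> (at p) c)"
proof -
  have [measurable]: "w \<in> borel_measurable borel" by (rule borel_measurable_continuous_onI[OF w])
  have \<psi>c: "continuous_on UNIV \<psi>" by (rule differentiable_imp_continuous_on) (simp add: d differentiable_on_def differentiable_at_withinI)
  have [measurable]: "\<psi> \<in> borel_measurable borel" by (rule borel_measurable_continuous_onI[OF \<psi>c])
  have sh: "(\<lambda>p. \<psi> (p - x *\<^sub>R c)) \<in> borel_measurable borel" for x
    by (intro borel_measurable_continuous_onI continuous_on_compose2[OF \<psi>c] continuous_intros) auto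
  obtain N where N: "\<And>p. p \<in> cball 0 (R + 1) \<Longrightarrow> \<bar>w p\<bar> \<le> N"
  proof -
    have "\<exists>N. \<forall>x\<in>w ` cball 0 (R + 1). norm x \<le> N"
      using compact_imp_bounded[OF compact_continuous_image[OF continuous_on_subset[OF w subset_UNIV] compact_cball[of 0 "R + 1"]]]
      unfolding bounded_iff .
    then show ?thesis using that unfolding real_norm_def by blast
  qed
  have \<psi>B: "\<exists>B. \<forall>p. \<bar>\<psi> p\<bar> \<le> B"
  proof -
    obtain B where "\<And>p. p \<in> cball 0 R \<Longrightarrow> \<bar>\<psi> p\<bar> \<le> B"
    proof -
      have "\<exists>N. \<forall>x\<in>\<psi> ` cball 0 R. norm x \<le> N"
        using compact_imp_bounded[OF compact_continuous_image[OF continuous_on_subset[OF \<psi>c subset_UNIV] compact_cball[of 0 R]]]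
        unfolding bounded_iff .
      then show ?thesis using that unfolding real_norm_def by blast
    qed
    then have "\<bar>\<psi> p\<bar> \<le> max B 0" for p using supp[of p] by (cases "\<psi> p = 0") (auto simp: le_max_iff_disj)
    then show ?thesis by blast
  qed
  then obtain B0 where B0: "\<And>p. \<bar>\<psi> p\<bar> \<le> B0" by blast
  have off: "\<psi> (p - x *\<^sub>R c) = 0" if "p \<notin> cball 0 (R + 1)" "0 \<le> x" "x \<le> 1" for p x
  proof -
    have "norm (x *\<^sub>R c) \<le> 1" using c that by (simp add: mult_le_one)
    moreover have "norm p \<le> norm (p - x *\<^sub>R c) + norm (x *\<^sub>R c)" using norm_triangle_ineq[of "p - x *\<^sub>R c" "x *\<^sub>R c"] by simp
    ultimately have "p - x *\<^sub>R c \<notin> cball 0 R" using that by auto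
    then show ?thesis using supp by blast
  qed
  define g where "g n p = w p * ((\<psi> (p - e n *\<^sub>R c) - \<psi> p) / e n)" for n p
  have dom: "\<bar>g n p\<bar> \<le> indicator (cball 0 (R + 1)) p * (N * C)" for n p
  proof (cases "p \<in> cball 0 (R + 1)")
    case True
    have "\<bar>\<psi> (p - e n *\<^sub>R c) - \<psi> p\<bar> \<le> C * e n"
      by (rule difference_bound[OF d c supp B C]) (use e(2)[of n] in auto)
    then have "\<bar>(\<psi> (p - e n *\<^sub>R c) - \<psi> p) / e n\<bar> \<le> C" using e(2)[of n] by (simp add: abs_divide pos_divide_le_eq)
    then have "\<bar>w p\<bar> * \<bar>(\<psi> (p - e n *\<^sub>R c) - \<psi> p) / e n\<bar> \<le> N * C"
      using N[OF True] order_trans[OF abs_ge_zero N[OF True]] by (intro mult_mono) auto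
    then show ?thesis using True by (simp only: g_def abs_mult) simp
  next
    case False
    then have "\<psi> (p - e n *\<^sub>R c) = 0" "\<psi> p = 0" using off[OF False, of "e n"] off[OF False, of 0] e(2)[of n] by auto
    then show ?thesis using False by (simp add: g_def)
  qed
  have wi: "integrable lborel (\<lambda>p :: real \<times> real. indicator (cball 0 (R + 1)) p * (N * C))"
    using emeasure_bounded_finite[OF bounded_cball, of "0 :: real \<times> real" "R + 1"] by simp
  have gm: "g n \<in> borel_measurable lborel" for n using sh unfolding g_def by measurable
  have lim: "(\<lambda>n. g n p) \<longlonglongrightarrow> - (w p * frechet_derivative \<psi> (at p) c)" for p
  proof -
    have ne: "e n \<noteq> 0" for n using e(2)[of n] by simp
    show ?thesis
      using tendsto_mult[OF tendsto_const[of "w p"] difference_quotient_limit[OF d e(1) ne, of p c]] unfolding g_def by simp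
  qed
  have Dm': "(\<lambda>p. - (w p * frechet_derivative \<psi> (at p) c)) \<in> borel_measurable lborel" using Dm by measurable
  have ae: "AE p in lborel. (\<lambda>n. g n p) \<longlonglongrightarrow> - (w p * frechet_derivative \<psi> (at p) c)" using lim by simp
  have aed: "AE p in lborel. norm (g n p) \<le> indicator (cball 0 (R + 1)) p * (N * C)" for n using dom by simp
  have conv: "(\<lambda>n. \<integral>p. g n p \<partial>lborel) \<longlonglongrightarrow> (\<integral>p. - (w p * frechet_derivative \<psi> (at p) c) \<partial>lborel)"
    by (rule integral_dominated_convergence[OF Dm' gm wi ae aed])
  have "integrable lborel (\<lambda>p. - (w p * frechet_derivative \<psi> (at p) c))"
    by (rule integrable_dominated_convergence[OF Dm' gm wi ae aed])
  then show "integrable lborel (\<lambda>p. w p * frechet_derivative \<psi> (at p) c)" by simp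
  have "(\<integral>p. \<psi> p * ((w (p + e n *\<^sub>R c) - w p) / e n) \<partial>lborel) = (\<integral>p. g n p \<partial>lborel)" for n
  proof -
    let ?c = "e n *\<^sub>R c"
    have en: "0 < e n" "e n \<le> 1" using e(2)[of n] by auto
    have i1: "integrable lborel (\<lambda>p. w p * \<psi> (p - x *\<^sub>R c))" if x: "0 \<le> x" "x \<le> 1" for x
    proof (rule integrable_bounded_box[where A="cball 0 (R + 1)" and C="max N 0 * B0"])
      show "(\<lambda>p. w p * \<psi> (p - x *\<^sub>R c)) \<in> borel_measurable borel" using sh by measurable
      show "\<bar>w p * \<psi> (p - x *\<^sub>R c)\<bar> \<le> max N 0 * B0" for p
      proof (cases "p \<in> cball 0 (R + 1)")
        case True
        then show ?thesis unfolding abs_mult by (intro mult_mono B0) (use N[OF True] in auto)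
      next
        case False
        then show ?thesis using off[OF False x] order_trans[OF abs_ge_zero B0[of 0]] by simp
      qed
      show "w p * \<psi> (p - x *\<^sub>R c) = 0" if "p \<notin> cball 0 (R + 1)" for p using off[OF that x] by simp
    qed simp
    have m: "(\<lambda>p. w p * \<psi> (p - ?c)) \<in> borel_measurable borel" using sh by measurable
    have t: "(\<integral>p. w (p + ?c) * \<psi> p \<partial>lborel) = (\<integral>p. w p * \<psi> (p - ?c) \<partial>lborel)"
      using integral_translate[OF m, of ?c] by simp
    have i2: "integrable lborel (\<lambda>p. w (p + ?c) * \<psi> p)"
    proof -
      have "integrable lborel (\<lambda>p. (\<lambda>p. w p * \<psi> (p - ?c)) (?c + p))"
        using i1[of "e n"] en integrable_distr_eq[of "(+) ?c" lborel borel "\<lambda>p. w p * \<psi> (p - ?c)"] m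
        by (simp add: lborel_distr_plus)
      then show ?thesis by (simp add: add.commute)
    qed
    have "(\<integral>p. \<psi> p * ((w (p + ?c) - w p) / e n) \<partial>lborel) = (\<integral>p. (w (p + ?c) * \<psi> p - w p * \<psi> p) / e n \<partial>lborel)"
      by (rule Bochner_Integration.integral_cong) (simp_all add: algebra_simps diff_divide_distrib)
    also have "\<dots> = ((\<integral>p. w p * \<psi> (p - ?c) \<partial>lborel) - (\<integral>p. w p * \<psi> p \<partial>lborel)) / e n"
      using i1[of 0] i2 t by simp
    also have "\<dots> = (\<integral>p. (w p * \<psi> (p - ?c) - w p * \<psi> p) / e n \<partial>lborel)"
      using i1[of 0] i1[of "e n"] en by simp
    also have "\<dots> = (\<integral>p. g n p \<partial>lborel)"
      by (rule Bochner_Integration.integral_cong) (simp_all add: g_def algebra_simps diff_divide_distrib)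
    finally show ?thesis .
  qed
  then show "(\<lambda>n. \<integral>p. \<psi> p * ((w (p + e n *\<^sub>R c) - w p) / e n) \<partial>lborel) \<longlonglongrightarrow> - (\<integral>p. w p * frechet_derivative \<psi> (at p) c \<partial>lborel)"
    using conv by simp
qed

text \<open>Mollifying in \<open>t\<close> at scale \<open>e\<close> and differencing in \<open>y\<close> at scale \<open>e\<^sup>2\<close> makes the equation hold
  up to \<open>O(e)\<close> although \<open>u\<close> is merely Lipschitz.\<close>
context ruled_graph
begin

lemma u_bound: "p \<in> D \<Longrightarrow> \<bar>u p\<bar> \<le> P"
proof -
  assume "p \<in> D"
  then obtain h s where h: "h \<in> {0<..<1}" "s \<in> {0<..<tb}" "p = (Y h s, tt h s)" using ruled_cover by blast
  have s: "s \<in> {0..tb}" "lam s \<in> {0..tb}" using h lam(1)[of s] by auto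
  have "u p = (1 - h) * f1 s + h * f2 (lam s)" using u_ruled[of h s] h by (simp add: U_def rise_def algebra_simps)
  also have "\<bar>\<dots>\<bar> \<le> (1 - h) * P + h * P"
  proof -
    have "\<bar>(1 - h) * f1 s\<bar> \<le> (1 - h) * P" "\<bar>h * f2 (lam s)\<bar> \<le> h * P"
      using fP(1)[OF s(1)] fP(2)[OF s(2)] h(1) by (auto simp: abs_mult intro!: mult_left_mono)
    then show ?thesis by linarith
  qed
  finally show ?thesis by (simp add: algebra_simps)
qed

abbreviation "M \<equiv> Lu * (1 + 4 * P)"

lemma M0: "M \<ge> 0" using mu_bound[of 0] by linarith

text \<open>Along a ruling u is affine and the projection to W is a parabola. A ruling ends off D,
  so it cannot end before the step is complete as long as the displacement stays in a ball inside
  D.\<close>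

lemma ruling_step:
  assumes p: "(y, t) \<in> D" and ball: "\<And>q. dist q (y, t) < d \<Longrightarrow> q \<in> D"
    and h: "0 \<le> h" "h \<le> 1" "h * (1 + 4 * P + 2 * M) < d"
  shows "u (y + h, t - 4 * u (y, t) * h - 2 * mu (y, t) * h\<^sup>2) = u (y, t) + mu (y, t) * h"
proof -
  obtain k s where k: "k \<in> {0<..<1}" "s \<in> {0<..<tb}" "y = Y k s" "t = tt k s" using ruled_cover[OF p] by auto
  have s': "s \<in> {0..tb}" using k by auto
  have w: "wid s > 0" by (rule wid_pos[OF k(2)])
  define m where "m = slope s"
  have m: "mu (y, t) = m" using p lab_u[of k s] k by (simp add: mu_def m_def)
  have mM: "\<bar>m\<bar> \<le> M" unfolding m_def by (rule slope_bound[OF k(2)])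
  have uk: "u (y, t) = U k s" using u_ruled[of k s] k by simp
  have along: "Y (k + x / wid s) s = y + x" "U (k + x / wid s) s = u (y, t) + m * x"
    "tt (k + x / wid s) s = t - 4 * u (y, t) * x - 2 * m * x\<^sup>2" for x
  proof -
    show 1: "Y (k + x / wid s) s = y + x" using w by (simp add: Y_def k(3) distrib_right)
    show 2: "U (k + x / wid s) s = u (y, t) + m * x"
      using 1 U_slope[OF k(2), of "k + x / wid s"] U_slope[OF k(2), of k] uk k(3) by (simp add: m_def algebra_simps)
    have "TT (k + x / wid s) s = TT k s + 2 * m * ((y + x)\<^sup>2 - y\<^sup>2)"
      unfolding TT_slope[OF k(2)] 1 m_def k(3) by (simp add: algebra_simps)
    then show "tt (k + x / wid s) s = t - 4 * u (y, t) * x - 2 * m * x\<^sup>2"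
      unfolding TT_def 1 2 k(3)[symmetric] k(4)[symmetric] uk[symmetric] by (simp add: algebra_simps power2_eq_square)
  qed
  have "k + h / wid s \<le> 1"
  proof (rule ccontr)
    assume "\<not> k + h / wid s \<le> 1"
    \<comment> \<open>The step at which the ruling would reach its end on g2; the displacement is
      still below d, which would place that end in D.\<close>
    define x where "x = (1 - k) * wid s"
    have "1 - k < h / wid s" using \<open>\<not> k + h / wid s \<le> 1\<close> by simp
    then have x: "0 \<le> x" "x < h" "k + x / wid s = 1" using w k(1) by (simp_all add: x_def pos_less_divide_eq)
    have e: "(y + x, t - 4 * u (y, t) * x - 2 * m * x\<^sup>2) = (g2 (lam s), lam s)"
      using along(1)[of x] along(3)[of x] unfolding x(3) Y_ends tt_ends(2)[OF s'] by simp
    have "dist (y + x, t - 4 * u (y, t) * x - 2 * m * x\<^sup>2) (y, t) \<le> \<bar>x\<bar> + \<bar>4 * u (y, t) * x + 2 * m * x\<^sup>2\<bar>"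
      using norm_Pair_le[of x "- 4 * u (y, t) * x - 2 * m * x\<^sup>2"] by (simp add: dist_norm abs_if split: if_splits)
    also have "\<dots> \<le> x * (1 + 4 * P + 2 * M)"
    proof -
      have "\<bar>4 * u (y, t) * x\<bar> \<le> 4 * P * x" using u_bound[OF p] x by (simp add: abs_mult mult_right_mono)
      moreover have "\<bar>2 * m * x\<^sup>2\<bar> \<le> 2 * M * x"
      proof -
        have "\<bar>m\<bar> * (x * x) \<le> M * (x * 1)" using mM x h by (intro mult_mono mult_left_mono) auto
        then show ?thesis by (simp add: abs_mult power2_eq_square)
      qed
      ultimately have "\<bar>4 * u (y, t) * x + 2 * m * x\<^sup>2\<bar> \<le> 4 * P * x + 2 * M * x" by linarith
      then show ?thesis using x by (simp add: algebra_simps)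
    qed
    also have "\<dots> \<le> h * (1 + 4 * P + 2 * M)" using x P0 M0 by (intro mult_right_mono) auto
    also have "\<dots> < d" by (rule h(3))
    finally have "(g2 (lam s), lam s) \<in> D" unfolding e by (rule ball)
    then show False by (simp add: D_iff)
  qed
  moreover have "0 \<le> k + h / wid s" using k(1) h w by simp
  ultimately have "u (Y (k + h / wid s) s, tt (k + h / wid s) s) = U (k + h / wid s) s" using u_ruled s' by simp
  then show ?thesis unfolding along m .
qed

text \<open>Along the ruling u grows by mu h while t moves by -4 u h up to second order. Averaging
  over t turns this shift into 4 u times the increment of u, which is the increment of 2 u^2 up to a
  square. With h = e^2 each of the errors is O(e^2).\<close>

lemma mean_step:
  assumes uL: "\<And>p q. \<bar>u p - u q\<bar> \<le> Lu * dist p q" and ball: "\<And>q. dist q (y, t) < 2 * d \<Longrightarrow> q \<in> D"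
    and e: "0 < e" "e \<le> 1" "e < d" "e\<^sup>2 * (1 + 4 * P + 2 * M) < d"
  shows "\<bar>integral {0..e} (\<lambda>r. (u (y + e\<^sup>2, t + r) - u (y, t + r)) / e\<^sup>2 - mu (y, t + r)) - 2 * ((u (y, t + e))\<^sup>2 - (u (y, t))\<^sup>2)\<bar>
    \<le> (Lu * (4 * Lu + 2 * M) + 32 * Lu * P\<^sup>2 + 8 * Lu * P + 2 * Lu\<^sup>2) * e\<^sup>2"
proof -
  define h where "h = e\<^sup>2"
  have h: "0 < h" "h \<le> 1" "h \<le> e" using e by (auto simp: h_def power2_eq_square intro: mult_le_one)
  define V where "V r = u (y + h, t + r)" for r
  define A where "A r = (V r - u (y, t + r)) / h - mu (y, t + r)" for r
  \<comment> \<open>The shift in t with u frozen at the base point, so that it is the same for all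
    r. After division by h the freezing costs O(e).\<close>
  define \<tau> where "\<tau> = 4 * u (y, t) * h"
  have pD: "(y, t) \<in> D" by (rule ball) (use e in auto)
  have qD: "(y, t + r) \<in> D" if "r \<in> {0..e}" for r by (rule ball) (use that e in \<open>auto simp: dist_prod_def dist_real_def\<close>)
  have V: "\<bar>V x - V x'\<bar> \<le> Lu * \<bar>x - x'\<bar>" for x x'
    using uL[of "(y + h, t + x)" "(y + h, t + x')"] by (simp add: V_def dist_prod_def dist_real_def)
  have uy: "\<bar>u (y, x) - u (y, x')\<bar> \<le> Lu * \<bar>x - x'\<bar>" for x x'
    using uL[of "(y, x)" "(y, x')"] by (simp add: dist_prod_def dist_real_def)
  have uh: "\<bar>u (y + h, x) - u (y, x)\<bar> \<le> Lu * h" for x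
    using uL[of "(y + h, x)" "(y, x)"] h by (simp add: dist_prod_def dist_real_def)
  have A: "\<bar>A r - (V r - V (r - \<tau>)) / h\<bar> \<le> Lu * (4 * Lu + 2 * M) * e" if r: "r \<in> {0..e}" for r
  proof -
    let ?q = "(y, t + r)"
    have "u (y + h, t + r - 4 * u ?q * h - 2 * mu ?q * h\<^sup>2) = u ?q + mu ?q * h"
    proof (rule ruling_step[OF qD[OF r], of d])
      fix q assume "dist q ?q < d"
      moreover have "dist q (y, t) \<le> dist q ?q + dist ?q (y, t)" by (rule dist_triangle)
      moreover have "dist ?q (y, t) \<le> e" using r by (simp add: dist_prod_def dist_real_def)
      ultimately show "q \<in> D" using e by (intro ball) linarith
    qed (use h e in \<open>auto simp: h_def\<close>)
    then have "A r = (V r - V (r - 4 * u ?q * h - 2 * mu ?q * h\<^sup>2)) / h"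
      using h by (simp add: A_def V_def field_simps add_diff_eq)
    then have "A r - (V r - V (r - \<tau>)) / h = (V (r - \<tau>) - V (r - 4 * u ?q * h - 2 * mu ?q * h\<^sup>2)) / h"
      by (simp add: diff_divide_distrib)
    also have "\<bar>\<dots>\<bar> = \<bar>V (r - \<tau>) - V (r - 4 * u ?q * h - 2 * mu ?q * h\<^sup>2)\<bar> / h" using h by (simp add: abs_divide)
    also have "\<dots> \<le> (Lu * \<bar>(r - \<tau>) - (r - 4 * u ?q * h - 2 * mu ?q * h\<^sup>2)\<bar>) / h"
      using h by (intro divide_right_mono V) auto
    also have "(r - \<tau>) - (r - 4 * u ?q * h - 2 * mu ?q * h\<^sup>2) = h * (4 * (u ?q - u (y, t)) + 2 * mu ?q * h)"
      by (simp add: \<tau>_def algebra_simps power2_eq_square)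
    also have "(Lu * \<bar>h * (4 * (u ?q - u (y, t)) + 2 * mu ?q * h)\<bar>) / h = Lu * \<bar>4 * (u ?q - u (y, t)) + 2 * mu ?q * h\<bar>"
      using h by (simp add: abs_mult)
    also have "\<dots> \<le> Lu * (4 * (Lu * e) + 2 * (M * e))"
    proof (rule mult_left_mono[OF _ Lu0])
      have "\<bar>u ?q - u (y, t)\<bar> \<le> Lu * e"
        using uy[of "t + r" t] mult_left_mono[OF _ Lu0, of r e] r by auto
      moreover have "\<bar>mu ?q * h\<bar> \<le> M * e"
        unfolding abs_mult by (intro mult_mono mu_bound) (use h M0 in auto)
      ultimately show "\<bar>4 * (u ?q - u (y, t)) + 2 * mu ?q * h\<bar> \<le> 4 * (Lu * e) + 2 * (M * e)"
        by (auto simp: abs_if mult.assoc split: if_splits)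
    qed
    finally show ?thesis by (simp add: algebra_simps)
  qed
  have Vc: "continuous_on X V" for X
    unfolding V_def by (intro continuous_on_compose2[OF u_cont] continuous_intros) auto
  have Ac: "continuous_on {0..e} A"
  proof -
    have "continuous_on {0..e} (\<lambda>r. slope (lab u (y, t + r)))"
      by (rule continuous_on_compose2[OF slope_lab_cont[OF adm_u]]) (use qD in \<open>auto intro!: continuous_intros\<close>)
    then have "continuous_on {0..e} (\<lambda>r. mu (y, t + r))"
      by (rule continuous_on_cong[THEN iffD1, rotated 2]) (use qD in \<open>auto simp: mu_def\<close>)
    moreover have "continuous_on {0..e} (\<lambda>r. u (y, t + r))"
      by (intro continuous_on_compose2[OF u_cont] continuous_intros) auto
    ultimately show ?thesis unfolding A_def using h by (intro continuous_intros Vc) auto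
  qed
  have Sc: "continuous_on {0..e} (\<lambda>r. V r - V (r - \<tau>))"
    by (intro continuous_intros Vc continuous_on_compose2[OF Vc[of UNIV], of _ "\<lambda>r. r - \<tau>"]) auto
  then have Sc': "continuous_on {0..e} (\<lambda>r. (V r - V (r - \<tau>)) / h)" using h by (intro continuous_on_divide continuous_on_const) auto
  have "norm (integral {0..e} (\<lambda>r. A r - (V r - V (r - \<tau>)) / h)) \<le> (Lu * (4 * Lu + 2 * M) * e) * (e - 0)"
    by (rule integral_bound) (use e A Ac Sc' in \<open>auto intro!: continuous_intros\<close>)
  moreover have "integral {0..e} (\<lambda>r. A r - (V r - V (r - \<tau>)) / h) = integral {0..e} A - integral {0..e} (\<lambda>r. V r - V (r - \<tau>)) / h"
    using Henstock_Kurzweil_Integration.integral_diff[OF integrable_continuous_real[OF Ac] integrable_continuous_real[OF Sc']] by simp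
  ultimately have 1: "\<bar>integral {0..e} A - integral {0..e} (\<lambda>r. V r - V (r - \<tau>)) / h\<bar> \<le> Lu * (4 * Lu + 2 * M) * h"
    by (simp add: h_def power2_eq_square mult_ac)
  have "\<bar>integral {0..e} (\<lambda>r. V r - V (r - \<tau>)) - \<tau> * (V e - V 0)\<bar> \<le> 2 * Lu * \<tau>\<^sup>2"
    by (rule shift_increment[OF V]) (use e in simp)
  then have "\<bar>integral {0..e} (\<lambda>r. V r - V (r - \<tau>)) - \<tau> * (V e - V 0)\<bar> / h \<le> 2 * Lu * \<tau>\<^sup>2 / h"
    using h by (intro divide_right_mono) auto
  moreover have "2 * Lu * \<tau>\<^sup>2 / h \<le> 32 * Lu * P\<^sup>2 * h"
  proof -
    have "(u (y, t))\<^sup>2 \<le> P\<^sup>2" using u_bound[OF pD] by (rule abs_le_square_iff[THEN iffD1, OF order_trans]) simp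
    then have "32 * Lu * h * (u (y, t))\<^sup>2 \<le> 32 * Lu * h * P\<^sup>2" using Lu0 h by (intro mult_left_mono) auto
    then show ?thesis using h by (simp add: \<tau>_def power2_eq_square field_simps)
  qed
  moreover have "\<bar>integral {0..e} (\<lambda>r. V r - V (r - \<tau>)) - \<tau> * (V e - V 0)\<bar> / h
      = \<bar>integral {0..e} (\<lambda>r. V r - V (r - \<tau>)) / h - 4 * u (y, t) * (V e - V 0)\<bar>"
  proof -
    have "integral {0..e} (\<lambda>r. V r - V (r - \<tau>)) / h - 4 * u (y, t) * (V e - V 0)
      = (integral {0..e} (\<lambda>r. V r - V (r - \<tau>)) - \<tau> * (V e - V 0)) / h"
      using h by (simp add: \<tau>_def diff_divide_distrib)
    then show ?thesis using h by (simp add: abs_divide)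
  qed
  ultimately have 2: "\<bar>integral {0..e} (\<lambda>r. V r - V (r - \<tau>)) / h - 4 * u (y, t) * (V e - V 0)\<bar> \<le> 32 * Lu * P\<^sup>2 * h" by linarith
  define w0 w1 where "w0 = u (y, t)" and "w1 = u (y, t + e)"
  have 3: "\<bar>4 * w0 * (V e - V 0) - 4 * w0 * (w1 - w0)\<bar> \<le> 8 * Lu * P * h"
  proof -
    have "\<bar>(V e - w1) - (V 0 - w0)\<bar> \<le> 2 * (Lu * h)"
      using uh[of "t + e"] uh[of t] by (auto simp: V_def w0_def w1_def abs_if split: if_splits)
    moreover have "\<bar>w0\<bar> \<le> P" unfolding w0_def by (rule u_bound[OF pD])
    ultimately have "\<bar>w0\<bar> * \<bar>(V e - w1) - (V 0 - w0)\<bar> \<le> P * (2 * (Lu * h))" by (intro mult_mono) (use P0 in auto)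
    moreover have "\<bar>4 * w0 * (V e - V 0) - 4 * w0 * (w1 - w0)\<bar> = 4 * (\<bar>w0\<bar> * \<bar>(V e - w1) - (V 0 - w0)\<bar>)"
    proof -
      have "4 * w0 * (V e - V 0) - 4 * w0 * (w1 - w0) = 4 * (w0 * ((V e - w1) - (V 0 - w0)))" by (simp add: algebra_simps)
      then show ?thesis by (simp only: abs_mult abs_numeral)
    qed
    moreover have "4 * (P * (2 * (Lu * h))) = 8 * Lu * P * h" by simp
    ultimately show ?thesis by linarith
  qed
  \<comment> \<open>The remainder is twice the square of w1 - w0, which is O(e^2) by the Lipschitz
    bound.\<close>
  have 4: "\<bar>4 * w0 * (w1 - w0) - 2 * (w1\<^sup>2 - w0\<^sup>2)\<bar> \<le> 2 * Lu\<^sup>2 * h"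
  proof -
    have "\<bar>w1 - w0\<bar> \<le> Lu * e" using uy[of "t + e" t] e by (simp add: w0_def w1_def)
    then have "(w1 - w0)\<^sup>2 \<le> (Lu * e)\<^sup>2" by (intro abs_le_square_iff[THEN iffD1]) auto
    moreover have "4 * w0 * (w1 - w0) - 2 * (w1\<^sup>2 - w0\<^sup>2) = - (2 * (w1 - w0)\<^sup>2)" by (simp add: power2_eq_square algebra_simps)
    ultimately show ?thesis by (simp add: h_def power_mult_distrib)
  qed
  have "\<bar>i - 2 * (w1\<^sup>2 - w0\<^sup>2)\<bar> \<le> b1 + b2 + b3 + b4"
    if "\<bar>i - j\<bar> \<le> b1" "\<bar>j - k\<bar> \<le> b2" "\<bar>k - l\<bar> \<le> b3" "\<bar>l - 2 * (w1\<^sup>2 - w0\<^sup>2)\<bar> \<le> b4" for i j k l b1 b2 b3 b4 :: real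
    using that by linarith
  from this[OF 1 2[folded w0_def] 3 4] show ?thesis
    unfolding A_def V_def w0_def w1_def h_def by (simp add: distrib_right)
qed

text \<open>\<open>mean_step\<close> gives the equation for averages around each point of the
  support. After testing, \<open>average_translate\<close> removes the average, division by e leaves
  an error O(e), and \<open>translation_limit\<close> identifies the limits of the remaining
  terms.\<close>

lemma B_rep_u:
  assumes uL: "\<And>p q. \<bar>u p - u q\<bar> \<le> Lu * dist p q"
  shows "B_rep D u mu"
  unfolding B_rep_def
proof (intro conjI allI impI)
  show "mu \<in> borel_measurable lborel" by simp
  fix K assume K: "compact K \<and> K \<subseteq> D"
  then show "set_integrable lborel K mu"
    by (intro bounded_set_integrable[OF mu_borel, of K M]) (auto intro: mu_bound borel_closed compact_imp_closed)
next
  fix \<psi> assume t: "test_fun D \<psi>"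
  define K where "K = closure {p. \<psi> p \<noteq> 0}"
  have K: "compact K" "K \<subseteq> D" and sm: "smooth2 \<psi>" using t by (auto simp: test_fun_def K_def)
  have d\<psi>: "\<psi> differentiable (at p)" for p using sm by (cases rule: smooth2.cases) blast
  have dd: "dY \<psi> differentiable (at p)" "dT \<psi> differentiable (at p)" for p
    using sm by (cases rule: smooth2.cases, metis smooth2.cases)+
  have cont: "continuous_on UNIV g" if "\<And>p. g differentiable (at p)" for g :: "real \<times> real \<Rightarrow> real"
    by (rule differentiable_imp_continuous_on) (simp add: that differentiable_on_def differentiable_at_withinI)
  have dYc: "continuous_on UNIV (\<lambda>p. frechet_derivative \<psi> (at p) (1, 0))" and dTc: "continuous_on UNIV (\<lambda>p. frechet_derivative \<psi> (at p) (0, 1))"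
    using cont[OF dd(1)] cont[OF dd(2)] by (simp_all add: dY_def[abs_def] dT_def[abs_def])
  have supp: "p \<in> K" if "\<psi> p \<noteq> 0" for p using that closure_subset[of "{p. \<psi> p \<noteq> 0}"] by (auto simp: K_def)
  obtain R where R: "K \<subseteq> cball 0 R" using compact_imp_bounded[OF K(1)] unfolding bounded_iff by (force simp: mem_cball)
  have supp': "p \<in> cball 0 R" if "\<psi> p \<noteq> 0" for p using supp[OF that] R by blast
  have bdd: "\<exists>C\<ge>0. \<forall>p\<in>cball 0 (R + 1). \<bar>g p\<bar> \<le> C" if "continuous_on UNIV g" for g :: "real \<times> real \<Rightarrow> real"
  proof -
    have "\<exists>N. \<forall>x\<in>g ` cball 0 (R + 1). norm x \<le> N"
      using compact_imp_bounded[OF compact_continuous_image[OF continuous_on_subset[OF that subset_UNIV] compact_cball[of 0 "R + 1"]]]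
      unfolding bounded_iff .
    then obtain N where "\<forall>p\<in>cball 0 (R + 1). \<bar>g p\<bar> \<le> N" unfolding real_norm_def by blast
    then show ?thesis by (intro exI[of _ "max N 0"]) (auto simp: le_max_iff_disj)
  qed
  obtain C1 where C1: "C1 \<ge> 0" "\<And>p. p \<in> cball 0 (R + 1) \<Longrightarrow> \<bar>frechet_derivative \<psi> (at p) (1, 0)\<bar> \<le> C1" using bdd[OF dYc] by blast
  obtain C2 where C2: "C2 \<ge> 0" "\<And>p. p \<in> cball 0 (R + 1) \<Longrightarrow> \<bar>frechet_derivative \<psi> (at p) (0, 1)\<bar> \<le> C2" using bdd[OF dTc] by blast
  obtain B0 where B0: "B0 \<ge> 0" "\<And>p. p \<in> cball 0 (R + 1) \<Longrightarrow> \<bar>\<psi> p\<bar> \<le> B0" using bdd[OF cont[OF d\<psi>]] by blast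
  have B: "\<bar>\<psi> p\<bar> \<le> B0" for p using B0 supp'[of p] by (cases "\<psi> p = 0") auto
  have \<psi>2: "\<bar>\<psi> (p - (0, r)) - \<psi> p\<bar> \<le> C2 * r" if "0 \<le> r" "r \<le> 1" for p r
  proof -
    have "\<bar>\<psi> (p - r *\<^sub>R (0, 1)) - \<psi> p\<bar> \<le> C2 * r"
      by (rule difference_bound[OF d\<psi> _ supp' C2(2,1) that]) (simp_all add: norm_Pair)
    then show ?thesis by simp
  qed
  obtain d where d: "d > 0" "\<And>p q. p \<in> K \<Longrightarrow> dist q p < 2 * d \<Longrightarrow> q \<in> D"
  proof -
    have cl: "closed (- D)" using D_open by (simp add: closed_Compl)
    then obtain d0 where "d0 > 0" "\<forall>p\<in>K. \<forall>q\<in>- D. d0 \<le> dist p q"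
      using separate_compact_closed[OF K(1) cl] K(2) by blast
    then show ?thesis by (intro that[of "d0 / 2"]) (force simp: dist_commute)+
  qed
  define Q where "Q = 1 + 4 * P + 2 * M"
  have Q: "Q \<ge> 1" using P0 M0 by (simp add: Q_def)
  \<comment> \<open>Small enough that averaging over t at scale e and following a ruling over e^2
    both stay in D around the support.\<close>
  define e0 where "e0 = min 1 (d / (2 * Q))"
  have e0: "0 < e0" "e0 \<le> 1" "e0 < d" "e0 * Q < d"
  proof -
    show "0 < e0" "e0 \<le> 1" using d(1) Q by (auto simp: e0_def)
    have "e0 * Q \<le> d / (2 * Q) * Q" using Q by (intro mult_right_mono) (auto simp: e0_def)
    then show l: "e0 * Q < d" using Q d(1) by simp
    have "e0 * 1 \<le> e0 * Q" using Q \<open>0 < e0\<close> by (intro mult_left_mono) auto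
    then show "e0 < d" using l by simp
  qed
  define e where "e n = e0 / real (Suc n)" for n
  have e: "0 < e n" "e n \<le> 1" "e n < d" "(e n)\<^sup>2 * Q < d" "(e n)\<^sup>2 \<le> 1" for n
  proof -
    have le: "e n \<le> e0" unfolding e_def using e0 by (simp add: divide_le_eq mult_le_cancel_left1)
    show p: "0 < e n" using e0 by (simp add: e_def)
    show "e n \<le> 1" "e n < d" using le e0 by auto
    then show "(e n)\<^sup>2 \<le> 1" using p by (simp add: power_le_one)
    have "(e n)\<^sup>2 * Q \<le> e0 * Q"
    proof (rule mult_right_mono)
      have "e n * e n \<le> 1 * e0" using p le \<open>e n \<le> 1\<close> by (intro mult_mono) auto
      then show "(e n)\<^sup>2 \<le> e0" by (simp add: power2_eq_square)
    qed (use Q in auto)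
    then show "(e n)\<^sup>2 * Q < d" using e0(4) by simp
  qed
  have el: "e \<longlonglongrightarrow> 0" unfolding e_def[abs_def] by (rule LIMSEQ_Suc[OF lim_const_over_n])
  have e2l: "(\<lambda>n. (e n)\<^sup>2) \<longlonglongrightarrow> 0" using tendsto_power[OF el, of 2] by simp
  define A where "A n p = (u (p + (e n)\<^sup>2 *\<^sub>R (1, 0)) - u p) / (e n)\<^sup>2 - mu p" for n p
  define E where "E n p = ((u (p + e n *\<^sub>R (0, 1)))\<^sup>2 - (u p)\<^sup>2) / e n" for n p
  let ?m = "measure lborel (cball (0 :: real \<times> real) (R + 1))"
  define C0 where "C0 = Lu * (4 * Lu + 2 * M) + 32 * Lu * P\<^sup>2 + 8 * Lu * P + 2 * Lu\<^sup>2"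
  have C0: "C0 \<ge> 0" unfolding C0_def using Lu0 M0 P0 by simp
  have ub [measurable]: "u \<in> borel_measurable borel" by (rule borel_measurable_continuous_onI[OF u_cont])
  have \<psi>b [measurable]: "\<psi> \<in> borel_measurable borel" by (rule borel_measurable_continuous_onI[OF cont[OF d\<psi>]])
  have um [measurable]: "(\<lambda>p. u (p + c)) \<in> borel_measurable borel" for c
    by (intro borel_measurable_continuous_onI continuous_on_compose2[OF u_cont] continuous_intros) auto
  have Am [measurable]: "A n \<in> borel_measurable borel" for n unfolding A_def by measurable
  have AN: "\<bar>A n p\<bar> \<le> Lu + M" for n p
  proof -
    have "\<bar>u (p + (e n)\<^sup>2 *\<^sub>R (1, 0)) - u p\<bar> \<le> Lu * (e n)\<^sup>2"
    proof -
      have "dist (p + x *\<^sub>R (1, 0)) p = \<bar>x\<bar>" for x :: real by (simp add: dist_norm norm_Pair)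
      from this[of "(e n)\<^sup>2"] show ?thesis using uL[of "p + (e n)\<^sup>2 *\<^sub>R (1, 0)" p] by simp
    qed
    then have "\<bar>(u (p + (e n)\<^sup>2 *\<^sub>R (1, 0)) - u p) / (e n)\<^sup>2\<bar> \<le> Lu" using e(1)[of n] by (simp add: abs_divide pos_divide_le_eq)
    then show ?thesis unfolding A_def using mu_bound[of p] by linarith
  qed
  have close: "\<bar>e n * (\<integral>p. \<psi> p * A n p \<partial>lborel) - e n * (\<integral>p. \<psi> p * (2 * E n p) \<partial>lborel)\<bar>
      \<le> (e n)\<^sup>2 * (C2 * (Lu + M) * ?m + B0 * C0 * ?m)" for n
  proof -
    let ?L = "\<lambda>p. LINT r:{0..e n}|lborel. A n (p + (0, r))"
    have 1: "\<bar>e n * (\<integral>p. \<psi> p * A n p \<partial>lborel) - (\<integral>p. \<psi> p * ?L p \<partial>lborel)\<bar> \<le> (e n)\<^sup>2 * (C2 * (Lu + M) * ?m)"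
      by (rule average_translate[OF Am AN cont[OF d\<psi>] supp' B \<psi>2 e(1,2)])
    have ps: "\<bar>\<psi> p * ?L p - \<psi> p * (e n * (2 * E n p))\<bar> \<le> indicator (cball 0 (R + 1)) p * (B0 * (C0 * (e n)\<^sup>2))" for p
    proof (cases "\<psi> p = 0")
      case True
      then show ?thesis using B0(1) C0 by simp
    next
      case False
      obtain y t where p: "p = (y, t)" by force
      have pK: "p \<in> K" by (rule supp[OF False])
      have "set_integrable lborel {0..e n} (\<lambda>r. A n (p + (0, r)))"
        unfolding set_integrable_def
      proof (rule integrableI_bounded_set_indicator[where B="Lu + M"])
        have "(\<lambda>r. p + (0, r)) \<in> borel_measurable borel" by (intro borel_measurable_continuous_onI continuous_intros)
        then show "(\<lambda>r. A n (p + (0, r))) \<in> borel_measurable lborel" using Am by measurable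
      qed (use AN e(1)[of n] in auto)
      then have "?L p = integral {0..e n} (\<lambda>r. A n (p + (0, r)))" by (rule set_borel_integral_eq_integral(2))
      moreover have "A n (p + (0, r)) = (u (y + (e n)\<^sup>2, t + r) - u (y, t + r)) / (e n)\<^sup>2 - mu (y, t + r)" for r
        by (simp add: A_def p)
      ultimately have L: "?L p = integral {0..e n} (\<lambda>r. (u (y + (e n)\<^sup>2, t + r) - u (y, t + r)) / (e n)\<^sup>2 - mu (y, t + r))"
        by simp
      have "e n * (2 * E n p) = 2 * ((u (y, t + e n))\<^sup>2 - (u (y, t))\<^sup>2)" using e(1)[of n] by (simp add: E_def p)
      then have "\<bar>?L p - e n * (2 * E n p)\<bar> \<le> C0 * (e n)\<^sup>2"
        unfolding L C0_def using mean_step[OF uL d(2)[OF pK, unfolded p] e(1-3) e(4)[unfolded Q_def]] by simp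
      then have "\<bar>\<psi> p\<bar> * \<bar>?L p - e n * (2 * E n p)\<bar> \<le> B0 * (C0 * (e n)\<^sup>2)" using B[of p] B0(1) by (intro mult_mono) auto
      moreover have "p \<in> cball 0 (R + 1)" using supp'[OF False] by auto
      ultimately show ?thesis by (simp add: abs_mult right_diff_distrib[symmetric])
    qed
    have Ei: "integrable lborel (\<lambda>p. \<psi> p * (e n * (2 * E n p)))"
    proof -
      have "continuous_on UNIV (\<lambda>p. \<psi> p * (e n * (2 * E n p)))"
        unfolding E_def using e(1)[of n]
        by (intro continuous_intros cont[OF d\<psi>] u_cont continuous_on_compose2[OF u_cont]) auto
      note c = this
      obtain N where N: "N \<ge> 0" "\<And>p. p \<in> cball 0 (R + 1) \<Longrightarrow> \<bar>\<psi> p * (e n * (2 * E n p))\<bar> \<le> N" using bdd[OF c] by blast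
      show ?thesis
      proof (rule integrable_bounded_box[where A="cball 0 (R + 1)" and C=N])
        show z: "\<psi> p * (e n * (2 * E n p)) = 0" if "p \<notin> cball 0 (R + 1)" for p using supp'[of p] that by auto
        show "\<bar>\<psi> p * (e n * (2 * E n p))\<bar> \<le> N" for p
          using N(1) N(2)[of p] z[of p] by (metis abs_zero)
      qed (use borel_measurable_continuous_onI[OF c] in auto)
    qed
    have Lm: "(\<lambda>p. ?L p) \<in> borel_measurable borel"
    proof -
      have [measurable]: "(\<lambda>z :: (real \<times> real) \<times> real. fst z + (0, snd z)) \<in> borel_measurable borel"
        by (intro borel_measurable_continuous_onI continuous_intros)
      have [measurable]: "(snd :: (real \<times> real) \<times> real \<Rightarrow> _) \<in> borel_measurable borel"
        by (intro borel_measurable_continuous_onI continuous_intros)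
      have m: "(\<lambda>z :: (real \<times> real) \<times> real. indicator {0..e n} (snd z) *\<^sub>R A n (fst z + (0, snd z))) \<in> borel_measurable borel"
        using Am by measurable
      have "sets ((borel :: (real \<times> real) measure) \<Otimes>\<^sub>M (lborel :: real measure)) = sets ((borel :: (real \<times> real) measure) \<Otimes>\<^sub>M (borel :: real measure))"
        by (rule sets_pair_measure_cong) simp_all
      also have "\<dots> = sets borel" by (rule arg_cong[where f=sets, OF borel_prod])
      finally have sets: "sets ((borel :: (real \<times> real) measure) \<Otimes>\<^sub>M (lborel :: real measure)) = sets borel" .
      have c: "case_prod (\<lambda>p r. indicator {0..e n} r *\<^sub>R A n (p + (0, r))) \<in> borel_measurable (borel \<Otimes>\<^sub>M lborel)"
        unfolding measurable_cong_sets[OF sets refl] using m by (simp add: case_prod_unfold)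
      show ?thesis unfolding set_lebesgue_integral_def by (rule lborel.borel_measurable_lebesgue_integral[OF c])
    qed
    have mi: "integrable lborel (\<lambda>p :: real \<times> real. indicator (cball 0 (R + 1)) p * (B0 * (C0 * (e n)\<^sup>2)))"
      using emeasure_bounded_finite[OF bounded_cball, of "0 :: real \<times> real" "R + 1"] by simp
    have Di: "integrable lborel (\<lambda>p. \<psi> p * ?L p - \<psi> p * (e n * (2 * E n p)))"
    proof (rule Bochner_Integration.integrable_bound[OF mi])
      show "(\<lambda>p. \<psi> p * ?L p - \<psi> p * (e n * (2 * E n p))) \<in> borel_measurable lborel"
        by (rule borel_measurable_diff[OF _ borel_measurable_integrable[OF Ei]], unfold measurable_lborel2, rule borel_measurable_times[OF \<psi>b Lm])
      show "AE p in lborel. norm (\<psi> p * ?L p - \<psi> p * (e n * (2 * E n p))) \<le> norm (indicator (cball 0 (R + 1)) p * (B0 * (C0 * (e n)\<^sup>2)))"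
        by (rule AE_I2, unfold real_norm_def, rule order_trans[OF ps abs_ge_self])
    qed
    have "integrable lborel (\<lambda>p. (\<psi> p * ?L p - \<psi> p * (e n * (2 * E n p))) + \<psi> p * (e n * (2 * E n p)))"
      by (rule Bochner_Integration.integrable_add[OF Di Ei])
    then have Li: "integrable lborel (\<lambda>p. \<psi> p * ?L p)" by simp
    have "norm (\<integral>p. \<psi> p * ?L p - \<psi> p * (e n * (2 * E n p)) \<partial>lborel) \<le> (\<integral>p. indicator (cball 0 (R + 1)) p * (B0 * (C0 * (e n)\<^sup>2)) \<partial>(lborel :: (real \<times> real) measure))"
      by (rule Bochner_Integration.integral_norm_bound_integral[OF Di mi], unfold real_norm_def, rule ps)
    also have "\<dots> = (e n)\<^sup>2 * (B0 * C0 * ?m)" by (simp add: mult_ac)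
    finally have 2: "\<bar>(\<integral>p. \<psi> p * ?L p \<partial>lborel) - (\<integral>p. \<psi> p * (e n * (2 * E n p)) \<partial>lborel)\<bar> \<le> (e n)\<^sup>2 * (B0 * C0 * ?m)"
      unfolding Bochner_Integration.integral_diff[OF Li Ei] real_norm_def .
    have 3: "(\<integral>p. \<psi> p * (e n * (2 * E n p)) \<partial>lborel) = e n * (\<integral>p. \<psi> p * (2 * E n p) \<partial>lborel)"
    proof -
      have "\<psi> p * (e n * (2 * E n p)) = e n * (\<psi> p * (2 * E n p))" for p by simp
      then show ?thesis by (simp only: integral_mult_right_zero)
    qed
    show ?thesis using 1 2 unfolding 3 distrib_left by linarith
  qed
  have mui: "integrable lborel (\<lambda>p. mu p * \<psi> p)"
  proof (rule integrable_bounded_box[where A="cball 0 R" and C="M * B0"])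
    show "\<bar>mu p * \<psi> p\<bar> \<le> M * B0" for p unfolding abs_mult by (intro mult_mono mu_bound B) (use M0 in auto)
    show "mu p * \<psi> p = 0" if "p \<notin> cball 0 R" for p using supp'[of p] that by auto
  qed simp_all
  have c1: "norm (1 :: real, 0 :: real) \<le> 1" "norm (0 :: real, 1 :: real) \<le> 1" by (simp_all add: norm_Pair)
  have e2: "0 < (e n)\<^sup>2 \<and> (e n)\<^sup>2 \<le> 1" "0 < e n \<and> e n \<le> 1" for n
    using e(1)[of n] e(2)[of n] e(5)[of n] by simp_all
  have u2: "continuous_on UNIV (\<lambda>p. (u p)\<^sup>2)" by (intro continuous_intros u_cont)
  note lY = translation_limit[where e="\<lambda>n. (e n)\<^sup>2" and c="(1, 0)" and w=u, OF d\<psi> c1(1) supp' C1(2,1) borel_measurable_continuous_onI[OF dYc] u_cont e2l e2(1)]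
  note lT = translation_limit[where e=e and c="(0, 1)" and w="\<lambda>p. (u p)\<^sup>2", OF d\<psi> c1(2) supp' C2(2,1) borel_measurable_continuous_onI[OF dTc] u2 el e2(2)]
  have IA: "(\<integral>p. \<psi> p * A n p \<partial>lborel) = (\<integral>p. \<psi> p * ((u (p + (e n)\<^sup>2 *\<^sub>R (1, 0)) - u p) / (e n)\<^sup>2) \<partial>lborel) - (\<integral>p. mu p * \<psi> p \<partial>lborel)" for n
  proof -
    have "integrable lborel (\<lambda>p. \<psi> p * A n p)"
    proof (rule integrable_bounded_box[where A="cball 0 R" and C="B0 * (Lu + M)"])
      show "\<bar>\<psi> p * A n p\<bar> \<le> B0 * (Lu + M)" for p unfolding abs_mult by (intro mult_mono AN B) (use B0 in auto)
      show "\<psi> p * A n p = 0" if "p \<notin> cball 0 R" for p using supp'[of p] that by auto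
    qed simp_all
    from Bochner_Integration.integral_add[OF this mui]
    have "(\<integral>p. \<psi> p * A n p + mu p * \<psi> p \<partial>lborel) = (\<integral>p. \<psi> p * A n p \<partial>lborel) + (\<integral>p. mu p * \<psi> p \<partial>lborel)" .
    moreover have "\<psi> p * A n p + mu p * \<psi> p = \<psi> p * ((u (p + (e n)\<^sup>2 *\<^sub>R (1, 0)) - u p) / (e n)\<^sup>2)" for p
      by (simp add: A_def right_diff_distrib)
    ultimately show ?thesis by simp
  qed
  have "(\<lambda>n. (\<integral>p. \<psi> p * A n p \<partial>lborel) - (\<integral>p. \<psi> p * (2 * E n p) \<partial>lborel)) \<longlonglongrightarrow>
      (- (\<integral>p. u p * dY \<psi> p \<partial>lborel) - (\<integral>p. mu p * \<psi> p \<partial>lborel)) - 2 * (- (\<integral>p. (u p)\<^sup>2 * dT \<psi> p \<partial>lborel))"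
  proof (rule tendsto_diff)
    show "(\<lambda>n. \<integral>p. \<psi> p * A n p \<partial>lborel) \<longlonglongrightarrow> - (\<integral>p. u p * dY \<psi> p \<partial>lborel) - (\<integral>p. mu p * \<psi> p \<partial>lborel)"
      unfolding IA dY_def by (rule tendsto_diff[OF lY(1) tendsto_const])
    have "(\<lambda>n. 2 * (\<integral>p. \<psi> p * E n p \<partial>lborel)) \<longlonglongrightarrow> 2 * (- (\<integral>p. (u p)\<^sup>2 * dT \<psi> p \<partial>lborel))"
      unfolding E_def dT_def by (rule tendsto_mult[OF tendsto_const lT(1)])
    moreover have "(\<integral>p. \<psi> p * (2 * E n p) \<partial>lborel) = 2 * (\<integral>p. \<psi> p * E n p \<partial>lborel)" for n
    proof -
      have "\<psi> p * (2 * E n p) = 2 * (\<psi> p * E n p)" for p by simp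
      then show ?thesis by (simp only: integral_mult_right_zero)
    qed
    ultimately show "(\<lambda>n. \<integral>p. \<psi> p * (2 * E n p) \<partial>lborel) \<longlonglongrightarrow> 2 * (- (\<integral>p. (u p)\<^sup>2 * dT \<psi> p \<partial>lborel))" by simp
  qed
  moreover have "(\<lambda>n. (\<integral>p. \<psi> p * A n p \<partial>lborel) - (\<integral>p. \<psi> p * (2 * E n p) \<partial>lborel)) \<longlonglongrightarrow> 0"
  proof (rule Lim_null_comparison)
    define Z where "Z = C2 * (Lu + M) * ?m + B0 * C0 * ?m"
    show "\<forall>\<^sub>F n in sequentially. norm ((\<integral>p. \<psi> p * A n p \<partial>lborel) - (\<integral>p. \<psi> p * (2 * E n p) \<partial>lborel)) \<le> e n * Z"
    proof (rule always_eventually, rule allI)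
      fix n
      have "e n * \<bar>(\<integral>p. \<psi> p * A n p \<partial>lborel) - (\<integral>p. \<psi> p * (2 * E n p) \<partial>lborel)\<bar> \<le> e n * (e n * Z)"
      proof -
        have eq: "\<bar>e n * x - e n * y\<bar> = e n * \<bar>x - y\<bar>" for x y
          using e(1)[of n] by (simp add: right_diff_distrib[symmetric] abs_mult)
        show ?thesis using close[of n] unfolding eq Z_def[symmetric] by (simp only: power2_eq_square mult.assoc)
      qed
      then show "norm ((\<integral>p. \<psi> p * A n p \<partial>lborel) - (\<integral>p. \<psi> p * (2 * E n p) \<partial>lborel)) \<le> e n * Z"
        using e(1)[of n] by simp
    qed
    show "(\<lambda>n. e n * Z) \<longlonglongrightarrow> 0" using tendsto_mult[OF el tendsto_const[of Z]] by simp
  qed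
  ultimately have "(- (\<integral>p. u p * dY \<psi> p \<partial>lborel) - (\<integral>p. mu p * \<psi> p \<partial>lborel)) - 2 * (- (\<integral>p. (u p)\<^sup>2 * dT \<psi> p \<partial>lborel)) = 0"
    by (rule LIMSEQ_unique)
  moreover have "(\<integral>p. - u p * dY \<psi> p + 2 * (u p)\<^sup>2 * dT \<psi> p \<partial>lborel) = - (\<integral>p. u p * dY \<psi> p \<partial>lborel) + 2 * (\<integral>p. (u p)\<^sup>2 * dT \<psi> p \<partial>lborel)"
  proof -
    have "(\<integral>p. - (u p * dY \<psi> p) + 2 * ((u p)\<^sup>2 * dT \<psi> p) \<partial>lborel) = (\<integral>p. - (u p * dY \<psi> p) \<partial>lborel) + (\<integral>p. 2 * ((u p)\<^sup>2 * dT \<psi> p) \<partial>lborel)"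
      by (rule Bochner_Integration.integral_add) (use lY(2) lT(2) in \<open>simp_all add: dY_def dT_def\<close>)
    then show ?thesis by (simp add: mult.assoc)
  qed
  ultimately show "(\<integral>p. mu p * \<psi> p \<partial>lborel) = (\<integral>p. - u p * dY \<psi> p + 2 * (u p)\<^sup>2 * dT \<psi> p \<partial>lborel)" by linarith
qed

end

section \<open>Norms, horizontal chords and areas in the terms of the statement\<close>

lemma sup_norm_bound:
  fixes f :: "real \<Rightarrow> real"
  assumes tb: "tb > 0" and f: "continuous_on {0..tb} f" and s: "s \<in> {0..tb}"
  shows "\<bar>f s\<bar> \<le> sup_norm {0<..<tb} f"
proof -
  have cl: "closure {0<..<tb} = {0..tb}" using tb by (simp add: closure_greaterThanLessThan)
  have "bounded (f ` {0..tb})" by (rule compact_imp_bounded[OF compact_continuous_image[OF f compact_Icc]])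
  then obtain B where B: "\<forall>x\<in>f ` {0..tb}. norm x \<le> B" unfolding bounded_iff by blast
  have bdd: "bdd_above ((\<lambda>s. \<bar>f s\<bar>) ` {0<..<tb})" by (rule bdd_aboveI[of _ B]) (use B in auto)
  have "continuous_on (closure {0<..<tb}) (\<lambda>s. \<bar>f s\<bar>)" unfolding cl by (intro continuous_intros f)
  then show ?thesis
    by (rule continuous_le_on_closure) (use s cl bdd in \<open>auto simp: sup_norm_def intro: cSUP_upper\<close>)
qed

text \<open>For each pair of points the difference quotient is a lower bound of all Lipschitz
  constants, hence of their infimum; continuity adds the ends of the interval.\<close>

lemma lip_const_lipschitz:
  fixes f :: "real \<Rightarrow> real"
  assumes tb: "tb > 0" and f: "\<exists>L. L-lipschitz_on {0..tb} f"
  shows "lip_const {0<..<tb} f \<ge> 0" and "(lip_const {0<..<tb} f)-lipschitz_on {0..tb} f"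
proof -
  let ?I = "{0<..<tb}" and ?K = "lip_const {0<..<tb} f"
  have cl: "closure ?I = {0..tb}" using tb by (simp add: closure_greaterThanLessThan)
  obtain L where L: "L-lipschitz_on {0..tb} f" using f by blast
  then have "L-lipschitz_on ?I f" by (rule lipschitz_on_subset) auto
  then have ne: "{L. L-lipschitz_on ?I f} \<noteq> {}" by blast
  show K0: "?K \<ge> 0" unfolding lip_const_def by (rule cInf_greatest[OF ne]) (auto dest: lipschitz_on_nonneg)
  have "?K-lipschitz_on ?I f"
  proof (rule lipschitz_onI[OF _ K0])
    fix x y assume xy: "x \<in> ?I" "y \<in> ?I"
    show "dist (f x) (f y) \<le> ?K * dist x y"
    proof (cases "x = y")
      case False
      then have d: "dist x y > 0" by simp
      have "dist (f x) (f y) / dist x y \<le> ?K" unfolding lip_const_def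
      proof (rule cInf_greatest[OF ne])
        fix L assume "L \<in> {L. L-lipschitz_on ?I f}"
        then have "dist (f x) (f y) \<le> L * dist x y" using xy by (auto dest: lipschitz_onD)
        then show "dist (f x) (f y) / dist x y \<le> L" using d by (simp add: pos_divide_le_eq)
      qed
      then show ?thesis using d by (simp add: pos_divide_le_eq)
    qed simp
  qed
  then show "?K-lipschitz_on {0..tb} f"
    using lipschitz_on_closure[of ?K ?I f] lipschitz_on_continuous_on[OF L] unfolding cl by blast
qed

lemma horiz_iff: "(a, b, c) \<in> horiz (x, y, t) \<longleftrightarrow> c = 2 * y * a - 2 * x * b"
proof -
  have "(a, b, c) \<in> horiz (x, y, t) \<longleftrightarrow> (\<exists>k j. (a, b, c) - k *\<^sub>R (1, 0, 2 * y) - j *\<^sub>R (0, 1, - 2 * x) = (0, 0, 0))"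
    unfolding horiz_def hX_def hY_def by (simp add: span_breakdown_eq zero_prod_def)
  also have "\<dots> \<longleftrightarrow> c = 2 * y * a - 2 * x * b" by (auto simp: algebra_simps)
  finally show ?thesis .
qed

lemma test_fun_derivative_zero:
  assumes t: "test_fun D \<psi>" and p: "p \<notin> D"
  shows "dY \<psi> p = 0" "dT \<psi> p = 0"
proof -
  let ?K = "closure {p. \<psi> p \<noteq> 0}"
  have pK: "p \<in> - ?K" using t p by (auto simp: test_fun_def)
  have "(\<psi> has_derivative (\<lambda>_. 0)) (at p)"
  proof (rule has_derivative_transform_within_open[of "\<lambda>_. 0" _ p UNIV "- ?K"])
    show "0 = \<psi> x" if "x \<in> - ?K" for x using that closure_subset[of "{p. \<psi> p \<noteq> 0}"] by auto
  qed (use pK in \<open>auto simp: open_Compl\<close>)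
  then have "frechet_derivative \<psi> (at p) = (\<lambda>_. 0)" by (rule frechet_derivative_at[symmetric])
  then show "dY \<psi> p = 0" "dT \<psi> p = 0" by (simp_all add: dY_def dT_def)
qed

text \<open>The derivatives of a test function vanish off D, so values there do not affect the
  pairing. This permits replacing u and v by extensions to the plane.\<close>

lemma B_rep_cong:
  assumes "\<And>p. p \<in> D \<Longrightarrow> v p = v' p"
  shows "B_rep D v = B_rep D v'"
proof -
  have "(\<integral>p. - v p * dY \<psi> p + 2 * (v p)\<^sup>2 * dT \<psi> p \<partial>lborel) = (\<integral>p. - v' p * dY \<psi> p + 2 * (v' p)\<^sup>2 * dT \<psi> p \<partial>lborel)"
    if "test_fun D \<psi>" for \<psi>
  proof (rule Bochner_Integration.integral_cong[OF refl])
    fix p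
    show "- v p * dY \<psi> p + 2 * (v p)\<^sup>2 * dT \<psi> p = - v' p * dY \<psi> p + 2 * (v' p)\<^sup>2 * dT \<psi> p"
      using assms[of p] test_fun_derivative_zero[OF that, of p] by (cases "p \<in> D") simp_all
  qed
  then show ?thesis unfolding B_rep_def fun_eq_iff by auto
qed

lemma area_H_cong:
  assumes "\<And>p. p \<in> D \<Longrightarrow> v p = v' p"
  shows "area_H D v = area_H D v'"
  unfolding area_H_def
  by (rule arg_cong[where f="\<lambda>B. let w = Eps B in \<integral>\<^sup>+ p. indicator D p * ennreal (sqrt (1 + (w p)\<^sup>2)) \<partial>lborel", OF B_rep_cong])
     (rule assms)

lemma area_integral:
  fixes w :: "real \<times> real \<Rightarrow> real"
  assumes "set_integrable lborel D (\<lambda>p. sqrt (1 + (w p)\<^sup>2))"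
  shows "(\<integral>\<^sup>+ p. indicator D p * ennreal (sqrt (1 + (w p)\<^sup>2)) \<partial>lborel) = ennreal (LINT p:D|lborel. sqrt (1 + (w p)\<^sup>2))"
proof -
  have "(\<integral>\<^sup>+ p. indicator D p * ennreal (sqrt (1 + (w p)\<^sup>2)) \<partial>lborel) = (\<integral>\<^sup>+ p. ennreal (indicator D p *\<^sub>R sqrt (1 + (w p)\<^sup>2)) \<partial>lborel)"
    by (rule nn_integral_cong) (simp add: indicator_def)
  also have "\<dots> = ennreal (LINT p:D|lborel. sqrt (1 + (w p)\<^sup>2))"
    unfolding set_lebesgue_integral_def
    by (rule nn_integral_eq_integral) (use assms in \<open>auto simp: set_integrable_def\<close>)
  finally show ?thesis .
qed

context ruled_graph
begin

text \<open>The density chosen in \<open>area_H\<close> and \<open>mu\<close> obey the same box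
  laws, so they agree almost everywhere in D and give the same area.\<close>

lemma area_u:
  assumes uL: "\<And>p q. \<bar>u p - u q\<bar> \<le> Lu * dist p q"
  shows "area_H D u = ennreal (LINT p:D|lborel. sqrt (1 + (mu p)\<^sup>2))"
    and "set_integrable lborel D (\<lambda>p. sqrt (1 + (mu p)\<^sup>2))"
proof -
  define w where "w = (SOME w. B_rep D u w)"
  have mu: "B_rep D u mu" by (rule B_rep_u[OF uL])
  then have w: "B_rep D u w" unfolding w_def by (rule someI[of "B_rep D u"])
  have law: "box_law u k a b c d" if "B_rep D u k" "{a..b} \<times> {c..d} \<subseteq> D" "a \<le> b" "c \<le> d" for k a b c d
    by (rule box_law_of_B_rep[OF D_open u_cont that])
  have ae: "AE p in lborel. p \<in> D \<longrightarrow> w p = mu p"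
  proof (rule AE_eq_of_box_laws[OF D_open])
    show "w \<in> borel_measurable borel" using w by (simp add: B_rep_def)
    show "set_integrable lborel K w" "set_integrable lborel K mu" if "compact K" "K \<subseteq> D" for K
      using w mu that unfolding B_rep_def by blast+
    show "(LINT p:{a<..b} \<times> {c<..d}|lborel. w p) = (LINT p:{a<..b} \<times> {c<..d}|lborel. mu p)"
      if "{a..b} \<times> {c..d} \<subseteq> D" "a \<le> b" "c \<le> d" for a b c d
      using law[OF w that] law[OF mu that] unfolding box_law_def by simp
  qed simp
  show i: "set_integrable lborel D (\<lambda>p. sqrt (1 + (mu p)\<^sup>2))"
  proof (rule bounded_set_integrable[where C="sqrt (1 + M\<^sup>2)"])
    show "\<bar>sqrt (1 + (mu p)\<^sup>2)\<bar> \<le> sqrt (1 + M\<^sup>2)" for p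
      using mu_bound[of p] abs_le_square_iff[of "mu p" M] M0 by simp
  qed simp_all
  have "(\<integral>\<^sup>+ p. indicator D p * ennreal (sqrt (1 + (w p)\<^sup>2)) \<partial>lborel) = (\<integral>\<^sup>+ p. indicator D p * ennreal (sqrt (1 + (mu p)\<^sup>2)) \<partial>lborel)"
    by (rule nn_integral_cong_AE, use ae in eventually_elim) (simp add: indicator_def)
  then show "area_H D u = ennreal (LINT p:D|lborel. sqrt (1 + (mu p)\<^sup>2))"
    unfolding area_H_def w_def[symmetric] Let_def using area_integral[OF i] by simp
qed

text \<open>If the area of v is finite, its density dominates |b|, so b is integrable and the
  calibration applies. Equality forces the nonnegative gap to the tangent line to vanish almost
  everywhere, and the line touches only where b is the slope of the label.\<close>

theorem area_comparison:
  assumes uL: "\<And>p q. \<bar>u p - u q\<bar> \<le> Lu * dist p q" and v: "adm v" and B: "\<exists>w. B_rep D v w"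
  shows "area_H D u \<le> area_H D v" and "area_H D u = area_H D v \<Longrightarrow> p \<in> D \<Longrightarrow> v p = u p"
proof -
  define b where "b = (SOME w. B_rep D v w)"
  have b: "B_rep D v b" unfolding b_def using B by (rule someI_ex)
  have bm [measurable]: "b \<in> borel_measurable borel" using b by (simp add: B_rep_def)
  have av: "area_H D v = (\<integral>\<^sup>+ p. indicator D p * ennreal (sqrt (1 + (b p)\<^sup>2)) \<partial>lborel)"
    unfolding area_H_def b_def[symmetric] Let_def ..
  have "area_H D u \<le> area_H D v \<and> (area_H D u = area_H D v \<longrightarrow> (\<forall>p\<in>D. v p = u p))"
  proof (cases "area_H D v = \<infinity>")
    case True
    then show ?thesis unfolding area_u(1)[OF uL] by simp
  next
    case False
    have si: "set_integrable lborel D (\<lambda>p. sqrt (1 + (b p)\<^sup>2))" unfolding set_integrable_def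
    proof (rule integrableI_nonneg)
      show "(\<lambda>p. indicator D p *\<^sub>R sqrt (1 + (b p)\<^sup>2)) \<in> borel_measurable lborel" by measurable
      have "(\<integral>\<^sup>+ p. ennreal (indicator D p *\<^sub>R sqrt (1 + (b p)\<^sup>2)) \<partial>lborel) = area_H D v"
        unfolding av by (rule nn_integral_cong) (simp add: indicator_def)
      then show "(\<integral>\<^sup>+ p. ennreal (indicator D p *\<^sub>R sqrt (1 + (b p)\<^sup>2)) \<partial>lborel) < \<infinity>"
        using False by (simp add: less_top)
    qed (simp add: indicator_def)
    have bi: "set_integrable lborel D b" unfolding set_integrable_def
    proof (rule Bochner_Integration.integrable_bound[OF si[unfolded set_integrable_def]])
      show "(\<lambda>p. indicator D p *\<^sub>R b p) \<in> borel_measurable lborel" by measurable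
      have "\<bar>x\<bar> \<le> sqrt (1 + x\<^sup>2)" for x :: real by (rule real_le_rsqrt) simp
      then show "AE p in lborel. norm (indicator D p *\<^sub>R b p) \<le> norm (indicator D p *\<^sub>R sqrt (1 + (b p)\<^sup>2))"
        by (intro AE_I2) (simp add: indicator_def)
    qed
    interpret comparison tb g1 g2 f1 f2 G LG P LP u Lu v b
    proof (unfold_locales)
      show "box_law v b y y' t t'" if "y \<le> y'" "t \<le> t'" "{y..y'} \<times> {t..t'} \<subseteq> D" for y y' t t'
        by (rule box_law_of_B_rep[OF D_open admD(1)[OF v] b that(3,1,2)])
      show "box_law u mu y y' t t'" if "y \<le> y'" "t \<le> t'" "{y..y'} \<times> {t..t'} \<subseteq> D" for y y' t t'
        by (rule box_law_of_B_rep[OF D_open u_cont B_rep_u[OF uL] that(3,1,2)])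
    qed (use v bm bi in auto)
    let ?k = "\<lambda>p. N1 (slope (lab v p)) + N2 (slope (lab v p)) * b p"
    let ?s = "\<lambda>p. sqrt (1 + (b p)\<^sup>2)"
    have av': "area_H D v = ennreal (LINT p:D|lborel. ?s p)" unfolding av by (rule area_integral[OF si])
    have di: "integrable lborel (\<lambda>p. indicator D p *\<^sub>R (?s p - ?k p))"
      using set_integral_diff(1)[OF si calibration(2)] by (simp add: set_integrable_def)
    have nn: "0 \<le> indicator D p *\<^sub>R (?s p - ?k p)" for p using tangent_le[of "slope (lab v p)" "b p"] by (simp add: indicator_def)
    have eq: "(\<integral>p. indicator D p *\<^sub>R (?s p - ?k p) \<partial>lborel) = (LINT p:D|lborel. ?s p) - (LINT p:D|lborel. sqrt (1 + (mu p)\<^sup>2))"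
      using set_integral_diff(2)[OF si calibration(2)] unfolding calibration(1) by (simp only: set_lebesgue_integral_def)
    have ge: "0 \<le> (\<integral>p. indicator D p *\<^sub>R (?s p - ?k p) \<partial>lborel)" by (rule Bochner_Integration.integral_nonneg) (rule nn)
    have le: "area_H D u \<le> area_H D v" unfolding area_u(1)[OF uL] av' using ge unfolding eq by (intro ennreal_leI) simp
    have "\<forall>p\<in>D. v p = u p" if "area_H D u = area_H D v"
    proof -
      have nn0: "0 \<le> (LINT p:D|lborel. ?s p)" "0 \<le> (LINT p:D|lborel. sqrt (1 + (mu p)\<^sup>2))"
        unfolding set_lebesgue_integral_def by (rule Bochner_Integration.integral_nonneg; simp add: indicator_def)+
      have "(LINT p:D|lborel. sqrt (1 + (mu p)\<^sup>2)) = (LINT p:D|lborel. ?s p)"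
        using that nn0 unfolding area_u(1)[OF uL] av' by simp
      then have "(\<integral>p. indicator D p *\<^sub>R (?s p - ?k p) \<partial>lborel) = 0" unfolding eq by simp
      then have "AE p in lborel. indicator D p *\<^sub>R (?s p - ?k p) = 0"
        using integral_nonneg_eq_0_iff_AE[OF di] nn by simp
      then have "AE p in lborel. p \<in> D \<longrightarrow> b p = slope (lab v p)"
      proof eventually_elim
        case (elim p)
        then show ?case using tangent_eq[of "slope (lab v p)" "b p"] by auto
      qed
      then show ?thesis using rigidity by blast
    qed
    then show ?thesis using le by blast
  qed
  then show "area_H D u \<le> area_H D v" "area_H D u = area_H D v \<Longrightarrow> p \<in> D \<Longrightarrow> v p = u p" by blast+
qed

end

theorem theorem4p3:
  fixes tb :: real and g1 g2 :: "real \<Rightarrow> real" and \<phi> u v :: "real \<times> real \<Rightarrow> real"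
  defines "D \<equiv> domD tb g1 g2"
  assumes tb: "tb > 0"
    and g1_lip: "\<exists>L. L-lipschitz_on {0..tb} g1"
    and g2_lip: "\<exists>L. L-lipschitz_on {0..tb} g2"
    and g_sign: "\<forall>t\<in>{0<..<tb}. g1 t < 0 \<and> 0 < g2 t"
    and g_ends: "g1 0 = 0" "g1 tb = 0" "g2 0 = 0" "g2 tb = 0"
    and g1_convex: "convex_on {0..tb} g1"
    and g2_concave: "concave_on {0..tb} g2"
    and phi_cont: "continuous_on (frontier D) \<phi>"
    and phi1_lip: "\<exists>L. L-lipschitz_on {0..tb} (\<lambda>s. \<phi> (g1 s, s))"
    and phi2_lip: "\<exists>L. L-lipschitz_on {0..tb} (\<lambda>s. \<phi> (g2 s, s))"
    and zeta_small: "zeta tb g1 g2 \<phi> < (sqrt 721 - 25) / 48"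
    and u_lip: "\<exists>L. L-lipschitz_on (closure D) u"
    and u_bdry: "\<forall>p\<in>frontier D. u p = \<phi> p"
    and u_graph: "graph_S D u = R_phi tb g1 g2 \<phi>"
    and v_cont: "continuous_on (closure D) v"
    and v_bdry: "\<forall>p\<in>frontier D. v p = \<phi> p"
    and v_B: "B_Linfty_loc D v"
    and v_beta: "\<forall>y. {t \<in> {0<..<tb}. (y, t) \<in> D} \<noteq> {} \<longrightarrow>
                   strict_mono_on {t \<in> {0<..<tb}. (y, t) \<in> D} (\<lambda>t. t + 4 * y * v (y, t))"
  shows "area_H D u \<le> area_H D v \<and> (area_H D u = area_H D v \<longleftrightarrow> (\<forall>p\<in>D. u p = v p))"
proof -
  define f1 f2 where "f1 s = \<phi> (g1 s, s)" and "f2 s = \<phi> (g2 s, s)" for s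
  let ?I = "{0<..<tb}"
  define G LG P LP where "G = max (sup_norm ?I g1) (sup_norm ?I g2)" and "LG = max (lip_const ?I g1) (lip_const ?I g2)"
    and "P = max (sup_norm ?I f1) (sup_norm ?I f2)" and "LP = max (lip_const ?I f1) (lip_const ?I f2)"
  have fl: "\<exists>L. L-lipschitz_on {0..tb} f1" "\<exists>L. L-lipschitz_on {0..tb} f2"
    using phi1_lip phi2_lip by (simp_all add: f1_def[abs_def] f2_def[abs_def])
  have cont: "continuous_on {0..tb} f" if "\<exists>L. L-lipschitz_on {0..tb} f" for f :: "real \<Rightarrow> real"
    using that lipschitz_on_continuous_on by blast
  have lip: "\<bar>f s - f t\<bar> \<le> K * \<bar>s - t\<bar>"
    if "\<exists>L. L-lipschitz_on {0..tb} f" "lip_const ?I f \<le> K" "s \<in> {0..tb}" "t \<in> {0..tb}" for f :: "real \<Rightarrow> real" and K s t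
  proof -
    have "\<bar>f s - f t\<bar> \<le> lip_const ?I f * \<bar>s - t\<bar>"
      using lipschitz_onD[OF lip_const_lipschitz(2)[OF tb that(1)] that(3,4)] by (simp add: dist_real_def)
    also have "\<dots> \<le> K * \<bar>s - t\<bar>" by (rule mult_right_mono[OF that(2)]) simp
    finally show ?thesis .
  qed
  have sup: "\<bar>f s\<bar> \<le> K" if "\<exists>L. L-lipschitz_on {0..tb} f" "sup_norm ?I f \<le> K" "s \<in> {0..tb}" for f :: "real \<Rightarrow> real" and K s
    using sup_norm_bound[OF tb cont[OF that(1)] that(3)] that(2) by linarith
  \<comment> \<open>673/25 = 25 + 48/25, so the threshold is at most 1/25.\<close>
  have "sqrt 721 \<le> (673 / 25 :: real)" by (rule real_le_lsqrt) (simp_all add: power2_eq_square)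
  moreover have "zeta tb g1 g2 \<phi> = 4 * (G + LG) * (P + LP)"
    by (simp add: zeta_def Let_def G_def LG_def P_def LP_def f1_def[abs_def] f2_def[abs_def])
  ultimately have small: "4 * (G + LG) * (P + LP) \<le> 1 / 25" using zeta_small by simp
  interpret ruled_boundary tb g1 g2 f1 f2 G LG P LP
  proof
    show "0 \<le> LG" "0 \<le> LP"
      using lip_const_lipschitz(1)[OF tb g1_lip] lip_const_lipschitz(1)[OF tb fl(1)] by (simp_all add: LG_def LP_def le_max_iff_disj)
    fix s t assume st: "s \<in> {0..tb}" "t \<in> {0..tb}"
    show "\<bar>g1 s - g1 t\<bar> \<le> LG * \<bar>s - t\<bar>" by (rule lip[OF g1_lip _ st]) (simp add: LG_def)
    show "\<bar>g2 s - g2 t\<bar> \<le> LG * \<bar>s - t\<bar>" by (rule lip[OF g2_lip _ st]) (simp add: LG_def)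
    show "\<bar>f1 s - f1 t\<bar> \<le> LP * \<bar>s - t\<bar>" by (rule lip[OF fl(1) _ st]) (simp add: LP_def)
    show "\<bar>f2 s - f2 t\<bar> \<le> LP * \<bar>s - t\<bar>" by (rule lip[OF fl(2) _ st]) (simp add: LP_def)
  next
    fix s assume s: "s \<in> {0..tb}"
    show "\<bar>g1 s\<bar> \<le> G" by (rule sup[OF g1_lip _ s]) (simp add: G_def)
    show "\<bar>g2 s\<bar> \<le> G" by (rule sup[OF g2_lip _ s]) (simp add: G_def)
    show "\<bar>f1 s\<bar> \<le> P" by (rule sup[OF fl(1) _ s]) (simp add: P_def)
    show "\<bar>f2 s\<bar> \<le> P" by (rule sup[OF fl(2) _ s]) (simp add: P_def)
  qed (use tb small g_sign g_ends g1_convex g2_concave in auto)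
  define W where "W = closure D"
  have WD: "D \<subseteq> W" unfolding W_def by (rule closure_subset)
  have oD: "open D" and cD: "convex D" unfolding D_def by (rule D_open, rule D_convex)
  have D0: "(0, tb / 2) \<in> D" using tb g_sign by (auto simp: D_def domD_def)
  have W: "convex W" "closed W" "W \<noteq> {}" using convex_closure[OF cD] D0 WD by (auto simp: W_def)
  have front: "frontier D = W - D" using oD by (simp add: frontier_def W_def interior_open)
  obtain Lu where Lu: "Lu-lipschitz_on W u" using u_lip by (auto simp: W_def)
  \<comment> \<open>The closure is convex, so the nearest-point projection is nonexpansive and u
    extends to the plane with the same Lipschitz constant.\<close>
  define u' where "u' p = u (closest_point W p)" for p
  have u'W: "u' p = u p" if "p \<in> W" for p using closest_point_self[OF that] by (simp add: u'_def)
  have uL: "\<bar>u' p - u' q\<bar> \<le> Lu * dist p q" for p q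
  proof -
    have "dist (u' p) (u' q) \<le> Lu * dist (closest_point W p) (closest_point W q)"
      unfolding u'_def by (rule lipschitz_onD[OF Lu]) (use W closest_point_in_set in auto)
    also have "\<dots> \<le> Lu * dist p q"
      by (rule mult_left_mono[OF closest_point_lipschitz[OF W] lipschitz_on_nonneg[OF Lu]])
    finally show ?thesis by (simp add: dist_real_def)
  qed
  have uLip: "Lu-lipschitz_on UNIV u'"
    by (rule lipschitz_onI) (use uL lipschitz_on_nonneg[OF Lu] in \<open>auto simp: dist_real_def\<close>)
  have u'_cont: "continuous_on UNIV u'" by (rule lipschitz_on_continuous_on[OF uLip])
  have lam_eq: "Defs.lam tb g1 g2 \<phi> s = lam s" for s
  proof -
    have "pcurve g2 \<phi> r - pcurve g1 \<phi> s \<in> horiz (pcurve g1 \<phi> s) \<longleftrightarrow> F s r = s" for r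
      unfolding pcurve_def f1_def[symmetric] f2_def[symmetric]
      by (simp add: horiz_iff F_def algebra_simps)
    then show ?thesis unfolding Defs.lam_def lam_def by simp
  qed
  \<comment> \<open>The point of the ruling in graph coordinates, whose third entry is t + 2 y u;
    comparing it with a graph point determines y, u and then t.\<close>
  define pt where "pt h s = (U h s, Y h s, tt h s + 2 * Y h s * U h s)" for h s
  have point: "(1 - h) *\<^sub>R pcurve g1 \<phi> s + h *\<^sub>R pcurve g2 \<phi> (Defs.lam tb g1 g2 \<phi> s) = pt h s" if "s \<in> ?I" for h s
  proof -
    have "lam s + 2 * (g2 (lam s) - g1 s) * (f2 (lam s) + f1 s) = s" using lam(2)[of s] that by (simp add: F_def)
    then have l: "lam s = s - 2 * (g2 (lam s) - g1 s) * (f2 (lam s) + f1 s)" by linarith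
    have 3: "(1 - h) * (a + 2 * x * z) + h * (a - 2 * (y - x) * (k + z) + 2 * y * k)
      = (a - 4 * z * h * (y - x) - 2 * (k - z) * h\<^sup>2 * (y - x)) + 2 * (x + h * (y - x)) * (z + h * (k - z))" for a x y z k :: real
      by (simp add: algebra_simps power2_eq_square)
    have "(1 - h) * (s + 2 * g1 s * f1 s) + h * (lam s + 2 * g2 (lam s) * f2 (lam s)) = tt h s + 2 * Y h s * U h s"
      using 3[of s "g1 s" "f1 s" "g2 (lam s)" "f2 (lam s)"] l
      unfolding tt_def Y_def U_def wid_def rise_def by simp
    then show ?thesis unfolding lam_eq pcurve_def f1_def[symmetric] f2_def[symmetric] pt_def
      by (simp add: Y_def U_def wid_def rise_def algebra_simps)
  qed
  have R: "R_phi tb g1 g2 \<phi> = (\<lambda>(h, s). pt h s) ` ({0<..<1} \<times> ?I)"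
    unfolding R_phi_def by (rule image_cong) (use point in auto)
  have ruled: "(Y h s, tt h s) \<in> D \<and> u (Y h s, tt h s) = U h s" if "h \<in> {0<..<1}" "s \<in> ?I" for h s
  proof -
    have "pt h s \<in> graph_S D u" unfolding u_graph R using that by force
    then obtain y t where yt: "(y, t) \<in> D" "(u (y, t), y, t + 2 * y * u (y, t)) = pt h s" unfolding graph_S_def by force
    have e: "u (y, t) = U h s \<and> y = Y h s \<and> t + 2 * y * u (y, t) = tt h s + 2 * Y h s * U h s"
      using yt(2) unfolding pt_def prod.inject .
    then have "2 * y * u (y, t) = 2 * Y h s * U h s" by metis
    then have "t = tt h s" using e by linarith
    then show ?thesis using yt(1) e by metis
  qed
  interpret ruled_graph tb g1 g2 f1 f2 G LG P LP u' Lu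
  proof
    show "continuous_on UNIV u'" by (rule u'_cont)
    show "Lu-lipschitz_on (closure (domD tb g1 g2)) u'" by (rule lipschitz_on_subset[OF uLip]) simp
    fix h s :: real assume hs: "h \<in> {0<..<1}" "s \<in> ?I"
    show "(Y h s, tt h s) \<in> domD tb g1 g2" using ruled[OF hs] by (simp add: D_def)
    show "u' (Y h s, tt h s) = U h s" using ruled[OF hs] u'W WD by auto
  next
    fix p assume "p \<in> domD tb g1 g2"
    then obtain y t where p: "p = (y, t)" "(y, t) \<in> D" by (cases p) (simp add: D_def)
    have "(u (y, t), y, t + 2 * y * u (y, t)) \<in> graph_S D u" unfolding graph_S_def using p(2) by force
    then obtain h s where hs: "h \<in> {0<..<1}" "s \<in> ?I" "(u (y, t), y, t + 2 * y * u (y, t)) = pt h s" unfolding u_graph R by force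
    have e: "u (y, t) = U h s \<and> y = Y h s \<and> t + 2 * y * u (y, t) = tt h s + 2 * Y h s * U h s"
      using hs(3) unfolding pt_def prod.inject .
    then have "2 * y * u (y, t) = 2 * Y h s * U h s" by metis
    then have "t = tt h s" using e by linarith
    then have "p = (Y h s, tt h s)" using p(1) e by metis
    then show "\<exists>h\<in>{0<..<1}. \<exists>s\<in>{0<..<tb}. p = (Y h s, tt h s)" using hs(1,2) by blast
  qed
  \<comment> \<open>Both functions equal \<phi> on the frontier, so the two pieces fit together
    continuously.\<close>
  define v' where "v' p = (if p \<in> W then v p else u' p)" for p
  have off: "v' p = u' p" if "p \<notin> D" for p
    using that front u'W u_bdry v_bdry by (auto simp: v'_def)
  have v'D: "v' p = v p" if "p \<in> D" for p using that WD by (auto simp: v'_def)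
  have "continuous_on (W \<union> - D) v'" unfolding v'_def
  proof (rule continuous_on_cases)
    show "closed W" "closed (- D)" using W oD by auto
    show "continuous_on W v" using v_cont by (simp add: W_def)
    show "continuous_on (- D) u'" by (rule continuous_on_subset[OF u'_cont]) simp
    show "\<forall>x. x \<in> W \<and> x \<notin> W \<or> x \<in> - D \<and> x \<in> W \<longrightarrow> v x = u' x" using front u'W u_bdry v_bdry by auto
  qed
  moreover have "W \<union> - D = UNIV" using WD by auto
  ultimately have v'_cont: "continuous_on UNIV v'" by simp
  \<comment> \<open>Monotonicity is given on slices of D and wanted on slices of the closure. Either
    the open segment between the two points meets D, and then lies in it by convexity, or both
    points are off D, where v' = u' and u' is admissible.\<close>
  have "adm v'" unfolding adm_def
  proof (intro conjI allI impI v'_cont)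
    show "v' p = u' p" if "p \<notin> domD tb g1 g2" for p using off that by (simp add: D_def)
    fix y t t' assume c: "(y, t) \<in> closure (domD tb g1 g2)" "(y, t') \<in> closure (domD tb g1 g2)" "t < t'"
    let ?f = "\<lambda>t. t + 4 * y * v' (y, t)"
    have fc: "continuous_on X ?f" for X
      by (intro continuous_intros continuous_on_compose2[OF v'_cont]) auto
    have W1: "(y, t) \<in> W" "(y, t') \<in> W" using c by (simp_all add: W_def D_def)
    have seg: "(y, r) \<in> open_segment (y, a) (y, a')" if "a < r" "r < a'" for r a a' :: real
    proof -
      have "((1 - (r - a) / (a' - a)) *\<^sub>R (y, a) + ((r - a) / (a' - a)) *\<^sub>R (y, a')) = (y, r)"
        using convex_combination_point[of a a' r] that by (simp add: algebra_simps)
      then show ?thesis unfolding in_segment using that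
        by (intro conjI exI[of _ "(r - a) / (a' - a)"]) auto
    qed
    show "?f t < ?f t'"
    proof (cases "\<exists>r\<in>{t<..<t'}. (y, r) \<in> D")
      case True
      then obtain r where r: "t < r" "r < t'" "(y, r) \<in> D" by auto
      have rI: "(y, r) \<in> interior D" using r(3) oD by (simp add: interior_open)
      have inD: "(y, x) \<in> D" if x: "x \<in> {t<..<t'}" for x
      proof (cases x r rule: linorder_cases)
        case less
        then have "(y, x) \<in> open_segment (y, t) (y, r)" using seg x by auto
        then have "(y, x) \<in> open_segment (y, r) (y, t)" by (simp add: open_segment_commute)
        then show ?thesis using in_interior_closure_convex_segment[OF cD rI W1(1)[unfolded W_def]] interior_subset by blast
      next
        case equal
        then show ?thesis using r by simp
      next
        case greater
        then have "(y, x) \<in> open_segment (y, r) (y, t')" using seg x by auto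
        then show ?thesis using in_interior_closure_convex_segment[OF cD rI W1(2)[unfolded W_def]] interior_subset by blast
      qed
      have DI: "x \<in> {x \<in> ?I. (y, x) \<in> D}" if "x \<in> {t<..<t'}" for x
        using inD[OF that] by (auto simp: D_def domD_def)
      then have "{x \<in> ?I. (y, x) \<in> D} \<noteq> {}" using r by auto
      then have sm: "strict_mono_on {x \<in> ?I. (y, x) \<in> D} (\<lambda>t. t + 4 * y * v (y, t))" using v_beta by blast
      have mono: "?f a < ?f b" if "a \<in> {t<..<t'}" "b \<in> {t<..<t'}" "a < b" for a b
        using strict_mono_onD[OF sm DI[OF that(1)] DI[OF that(2)] that(3)] v'D inD that by simp
      \<comment> \<open>Dividing into thirds: continuity gives only weak inequalities on the outer
        thirds, and the middle one supplies the strict inequality.\<close>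
      define a b where "a = t + (t' - t) / 3" and "b = t + 2 * (t' - t) / 3"
      have ab: "t < a" "a < b" "b < t'" using c(3) by (auto simp: a_def b_def field_simps)
      have cl: "closure {t<..<a} = {t..a}" "closure {b<..<t'} = {b..t'}" using ab by (simp_all add: closure_greaterThanLessThan)
      have "?f t \<le> ?f a"
        by (rule continuous_le_on_closure[OF fc, of t "{t<..<a}"]) (use ab cl mono[of _ a] in \<open>auto intro: less_imp_le\<close>)
      moreover have "?f b \<le> ?f t'"
        by (rule continuous_ge_on_closure[OF fc, of t' "{b<..<t'}"]) (use ab cl mono[of b] in \<open>auto intro: less_imp_le\<close>)
      moreover have "?f a < ?f b" by (rule mono) (use ab in auto)
      ultimately show ?thesis by linarith
    next
      case False
      have nD: "(y, x) \<notin> D" if x: "x \<in> {t, t'}" for x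
      proof
        assume xD: "(y, x) \<in> D"
        then have xI: "(y, x) \<in> interior D" using oD by (simp add: interior_open)
        define m where "m = (t + t') / 2"
        have m: "t < m" "m < t'" using c(3) by (auto simp: m_def)
        define z where "z = (if x = t then t' else t)"
        have z: "(y, z) \<in> closure D" using W1 by (simp add: z_def W_def)
        have "(y, m) \<in> open_segment (y, t) (y, t')" by (rule seg[OF m])
        then have "(y, m) \<in> open_segment (y, x) (y, z)" using x c(3) by (auto simp: z_def open_segment_commute)
        then have "(y, m) \<in> D" using in_interior_closure_convex_segment[OF cD xI z] interior_subset by blast
        then show False using False m by auto
      qed
      then have "v' (y, t) = u' (y, t)" "v' (y, t') = u' (y, t')" using off by auto
      then show ?thesis using admD(3)[OF adm_u c] by simp
    qed
  qed
  note v'_adm = this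
  have B: "\<exists>w. B_rep D v' w" using v_B B_rep_cong[of D v' v, OF v'D] by (auto simp: B_Linfty_loc_def)
  have au: "area_H D u = area_H D u'" by (rule area_H_cong) (use u'W WD in auto)
  have avv: "area_H D v = area_H D v'" by (rule area_H_cong) (simp add: v'D)
  note cmp = area_comparison[OF uL v'_adm B[unfolded D_def], folded D_def]
  have "area_H D u \<le> area_H D v" unfolding au avv by (rule cmp(1))
  moreover have "u p = v p" if "area_H D u = area_H D v" "p \<in> D" for p
  proof -
    have "v' p = u' p" by (rule cmp(2)) (use that in \<open>simp_all add: au avv\<close>)
    moreover have "p \<in> W" using that(2) WD by blast
    ultimately show ?thesis using u'W[of p] v'D[OF that(2)] by simp
  qed
  moreover have "area_H D u = area_H D v" if "\<forall>p\<in>D. u p = v p"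
    by (rule area_H_cong) (use that in simp)
  ultimately show ?thesis by blast
qed

end
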